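(* Let $\mathcal{L}_m$ be a leaf of a holomorphic foliation $\mathcal{L}$ on a compact complex surface $X$ such that the holonomy group $\operatorname{hln}(\mathcal{L}_m,m)$ contains a hyperbolic element $\alpha$, and let $D$ be a Poincaré disc through $m$ with a coordinate $t$ in which $\alpha$ is multiplication by a complex number $\alpha$, $0<|\alpha|<1$. Suppose furthermore that the universal covering Poincaré domain $\tilde{\mathcal{P}}_D$ is Hausdorff and Rothstein. Then there exists a foliated domain $\tilde{\mathcal{P}}_{\mathbb{C}}$ over $\mathbb{C}$ such that: (i) $\tilde{\mathcal{P}}_D$ is a foliated subdomain of $\tilde{\mathcal{P}}_{\mathbb{C}}$, i.e. the projection $\tilde\pi:\tilde{\mathcal{P}}_D\to D$ extends to the projection $\tilde\pi:\tilde{\mathcal{P}}_{\mathbb{C}}\to\mathbb{C}$, and, moreover, $\tilde p:\tilde{\mathcal{P}}_D\to X$ also extends to $\tilde{\mathcal{P}}_{\mathbb{C}}$; (ii) $\tilde{\mathcal{P}}_{\mathbb{C}}$ is periodic, i.e. $\alpha$ lifts to a foliated, $\tilde p$-invariant biholomorphism $\tilde\alpha$ of $\tilde{\mathcal{P}}_{\mathbb{C}}$ (so $\tilde\pi\circ\tilde\alpha=\alpha\cdot\tilde\pi$ and $\tilde p\circ\tilde\alpha=\tilde p$).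
   Context: A (singular) holomorphic foliation $\mathcal{L}$ on a complex surface $X$ is given locally by holomorphic vector fields with isolated zeros, proportional up to nowhere vanishing holomorphic factors on overlaps; $\operatorname{Sing}\mathcal{L}$ is the set of their zeros. Leaves $\mathcal{L}_z$ are leaves of the nonsingular foliation on $X\setminus\operatorname{Sing}\mathcal{L}$. Poincaré disc: a smooth, locally closed holomorphic disc $D\subset X\setminus\operatorname{Sing}\mathcal{L}$ transversal to the leaves. The holonomy representation of $\pi_1(\mathcal{L}_m,m)$ takes values in the group of germs of biholomorphisms $\mathrm{Diff}(D,m)$ of $D$ fixing $m$; its image is the holonomy group $\operatorname{hln}(\mathcal{L}_m,m)$. An element is hyperbolic if the modulus of its derivative at $m$ is less than $1$. In that case the coordinate $t$ on (a sufficiently small) $D$, with $t(m)=0$, is chosen so that the element is multiplication by a number $\alpha$, $0<|\alpha|<1$; via $t$, $D$ is regarded as a disc centered at $0$ in $\mathbb{C}$. Universal covering Poincaré domain: $\tilde{\mathcal{P}}_D=\bigcup_{z\in D}\tilde{\mathcal{L}}_z$ is the quotient of the space of paths $\gamma_{z,w}$ that start at a point $z\in D$, end at $w\in\mathcal{L}_z$ and stay in $\mathcal{L}_z$ (with the topology of uniform convergence), by homotopy with fixed endpoints inside the leaf. Put $\tilde p(\gamma_{z,w})=w$ and $\tilde\pi(\gamma_{z,w})=z$. If the quotient topology is Hausdorff, $\tilde{\mathcal{P}}_D$ is a complex surface with $\tilde p:\tilde{\mathcal{P}}_D\to X$ locally biholomorphic and $\tilde\pi:\tilde{\mathcal{P}}_D\to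 D$ a holomorphic submersion whose fibers are the universal coverings $\tilde{\mathcal{L}}_z$ of the leaves $\mathcal{L}_z$, $z\in D$; $\tilde{\mathcal{L}}$ denotes the foliation of $\tilde{\mathcal{P}}_D$ by these fibers. Rothstein: let $\Delta_R$ be the disc of radius $R$ in $\mathbb{C}$ centered at $0$, $\Delta=\Delta_1$, and let $\mathcal{L}^{v}$ be the vertical foliation of $\Delta^2$ with leaves $\{z_1\}\times\Delta$. $(\tilde{\mathcal{P}}_D,\tilde{\mathcal{L}})$ is Rothstein if every holomorphic immersion $f:\Delta^2\to\tilde{\mathcal{P}}_D$ sending leaves of $\mathcal{L}^{v}$ to leaves of $\tilde{\mathcal{L}}$, and such that for every $z_1\in\Delta$ the restriction $f(z_1,\cdot)$ extends to a holomorphic immersion of $\Delta_R$, $R>1$, extends to a holomorphic immersion of $\Delta\times\Delta_R$ (jointly in both variables). Foliated domain over a complex curve $S$: a triple $(W,\pi,S)$ with $W$ a connected complex surface and $\pi:W\to S$ a holomorphic submersion with connected fibers. Foliated maps send fibers to fibers. *)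

theory Defs
  imports "HOL-Complex_Analysis.Complex_Analysis"
begin

section \<open>Complex vector spaces and holomorphic maps between them\<close>

class complex_normed = real_normed_vector +
  fixes scaleC :: "complex \<Rightarrow> 'a \<Rightarrow> 'a"  (infixr \<open>*\<^sub>C\<close> 75)
  assumes scaleC_add_right: "c *\<^sub>C (x + y) = c *\<^sub>C x + c *\<^sub>C y"
    and scaleC_add_left: "(b + c) *\<^sub>C x = b *\<^sub>C x + c *\<^sub>C x"
    and scaleC_scaleC: "b *\<^sub>C c *\<^sub>C x = (b * c) *\<^sub>C x"
    and scaleC_one: "1 *\<^sub>C x = x"
    and scaleC_of_real: "of_real r *\<^sub>C x = r *\<^sub>R x"
    and norm_scaleC: "norm (c *\<^sub>C x) = cmod c * norm x"

instantiation complex :: complex_normed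
begin
definition scaleC_complex_def: "scaleC = ((*) :: complex \<Rightarrow> complex \<Rightarrow> complex)"
instance
  by standard (auto simp: scaleC_complex_def algebra_simps norm_mult scaleR_conv_of_real)
end

instantiation prod :: (complex_normed, complex_normed) complex_normed
begin
definition scaleC_prod_def: "scaleC c z = (c *\<^sub>C fst z, c *\<^sub>C snd z)"
instance
proof
  fix c :: complex and x :: "'a \<times> 'b"
  have "(cmod c * norm (fst x))\<^sup>2 + (cmod c * norm (snd x))\<^sup>2
      = (cmod c)\<^sup>2 * ((norm (fst x))\<^sup>2 + (norm (snd x))\<^sup>2)"
    by (simp add: algebra_simps power_mult_distrib)
  then show "norm (c *\<^sub>C x) = cmod c * norm x"
    by (simp add: scaleC_prod_def norm_prod_def norm_scaleC real_sqrt_mult)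
qed (auto simp: scaleC_prod_def scaleC_add_right scaleC_add_left scaleC_scaleC scaleC_one
    scaleC_of_real prod_eq_iff)
end

text \<open>Complex differentiability at every point; meant for open sets \<^term>\<open>S\<close>.\<close>

definition holo_on :: "('a::complex_normed \<Rightarrow> 'b::complex_normed) \<Rightarrow> 'a set \<Rightarrow> bool" where
  "holo_on f S \<longleftrightarrow>
     (\<forall>p\<in>S. \<exists>L. (f has_derivative L) (at p) \<and> (\<forall>c v. L (c *\<^sub>C v) = c *\<^sub>C L v))"

lemma holo_on_complex_iff:
  fixes f :: "complex \<Rightarrow> complex"
  assumes "open S"
  shows "holo_on f S \<longleftrightarrow> f holomorphic_on S"
proof
  assume f: "holo_on f S"
  show "f holomorphic_on S"
  proof (unfold holomorphic_on_open[OF assms], intro ballI)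
    fix p assume "p \<in> S"
    then obtain L where L: "(f has_derivative L) (at p)" "\<And>c v. L (c *\<^sub>C v) = c *\<^sub>C L v"
      using f by (auto simp: holo_on_def)
    have "L = (*) (L 1)"
    proof
      fix v show "L v = L 1 * v"
        using L(2)[of v 1] by (simp add: scaleC_complex_def mult.commute)
    qed
    then show "\<exists>f'. (f has_field_derivative f') (at p)"
      using L(1) unfolding has_field_derivative_def by metis
  qed
next
  assume "f holomorphic_on S"
  then have "\<exists>c. (f has_derivative (*) c) (at p)" if "p \<in> S" for p
    using that unfolding holomorphic_on_open[OF assms] has_field_derivative_def by blast
  then show "holo_on f S"
    by (fastforce simp: holo_on_def scaleC_complex_def algebra_simps)
qed


section \<open>Complex manifolds\<close>

text \<open>A chart is a pair of a domain and a coordinate map; only the values of the coordinate map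
  on the domain matter.  The model space is the type \<^typ>\<open>'e\<close>: \<^typ>\<open>complex\<close> for curves,
  \<^typ>\<open>complex \<times> complex\<close> for surfaces.\<close>

record ('a, 'e) cmfd =
  mtop :: "'a topology"
  charts :: "('a set \<times> ('a \<Rightarrow> 'e)) set"

type_synonym 'a csurface = "('a, complex \<times> complex) cmfd"

definition compatible_chart ::
    "('a, 'e::complex_normed) cmfd \<Rightarrow> 'a set \<Rightarrow> ('a \<Rightarrow> 'e) \<Rightarrow> bool" where
  "compatible_chart M U \<phi> \<longleftrightarrow>
     openin (mtop M) U \<and> open (\<phi> ` U) \<and>
     homeomorphic_map (subtopology (mtop M) U) (top_of_set (\<phi> ` U)) \<phi> \<and>
     (\<forall>(V, \<psi>)\<in>charts M.
        holo_on (\<psi> \<circ> inv_into U \<phi>) (\<phi> ` (U \<inter> V)) \<and>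
        holo_on (\<phi> \<circ> inv_into V \<psi>) (\<psi> ` (U \<inter> V)))"

definition complex_manifold :: "('a, 'e::complex_normed) cmfd \<Rightarrow> bool" where
  "complex_manifold M \<longleftrightarrow>
     Hausdorff_space (mtop M) \<and> second_countable (mtop M) \<and>
     (\<Union>(U, \<phi>)\<in>charts M. U) = topspace (mtop M) \<and>
     (\<forall>(U, \<phi>)\<in>charts M. compatible_chart M U \<phi>)"

definition open_mfd :: "'e::complex_normed set \<Rightarrow> ('e, 'e) cmfd" where
  "open_mfd S = \<lparr>mtop = top_of_set S, charts = {(S, id)}\<rparr>"

definition open_submfd :: "('a, 'e::complex_normed) cmfd \<Rightarrow> 'a set \<Rightarrow> ('a, 'e) cmfd" where
  "open_submfd M S =
     \<lparr>mtop = subtopology (mtop M) S, charts = {(U \<inter> S, \<phi>) |U \<phi>. (U, \<phi>) \<in> charts M}\<rparr>"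

definition holo_map ::
    "('a, 'e::complex_normed) cmfd \<Rightarrow> ('b, 'f::complex_normed) cmfd \<Rightarrow> ('a \<Rightarrow> 'b) \<Rightarrow> bool" where
  "holo_map M N f \<longleftrightarrow>
     continuous_map (mtop M) (mtop N) f \<and>
     (\<forall>(U, \<phi>)\<in>charts M. \<forall>(V, \<psi>)\<in>charts N.
        holo_on (\<psi> \<circ> f \<circ> inv_into U \<phi>) (\<phi> ` {x\<in>U. f x \<in> V}))"

definition holo_immersion ::
    "('a, 'e::complex_normed) cmfd \<Rightarrow> ('b, 'f::complex_normed) cmfd \<Rightarrow> ('a \<Rightarrow> 'b) \<Rightarrow> bool" where
  "holo_immersion M N f \<longleftrightarrow>
     holo_map M N f \<and>
     (\<forall>(U, \<phi>)\<in>charts M. \<forall>(V, \<psi>)\<in>charts N. \<forall>x\<in>U. f x \<in> V \<longrightarrow>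
        inj (frechet_derivative (\<psi> \<circ> f \<circ> inv_into U \<phi>) (at (\<phi> x))))"

definition holo_submersion ::
    "('a, 'e::complex_normed) cmfd \<Rightarrow> ('b, 'f::complex_normed) cmfd \<Rightarrow> ('a \<Rightarrow> 'b) \<Rightarrow> bool" where
  "holo_submersion M N f \<longleftrightarrow>
     holo_map M N f \<and>
     (\<forall>(U, \<phi>)\<in>charts M. \<forall>(V, \<psi>)\<in>charts N. \<forall>x\<in>U. f x \<in> V \<longrightarrow>
        surj (frechet_derivative (\<psi> \<circ> f \<circ> inv_into U \<phi>) (at (\<phi> x))))"

definition biholomorphism ::
    "('a, 'e::complex_normed) cmfd \<Rightarrow> ('b, 'f::complex_normed) cmfd \<Rightarrow> ('a \<Rightarrow> 'b) \<Rightarrow> bool" where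
  "biholomorphism M N f \<longleftrightarrow>
     bij_betw f (topspace (mtop M)) (topspace (mtop N)) \<and>
     holo_map M N f \<and> holo_map N M (inv_into (topspace (mtop M)) f)"

definition locally_biholomorphic ::
    "('a, 'e::complex_normed) cmfd \<Rightarrow> ('b, 'f::complex_normed) cmfd \<Rightarrow> ('a \<Rightarrow> 'b) \<Rightarrow> bool" where
  "locally_biholomorphic M N f \<longleftrightarrow>
     (\<forall>x\<in>topspace (mtop M). \<exists>S. openin (mtop M) S \<and> x \<in> S \<and> openin (mtop N) (f ` S) \<and>
        biholomorphism (open_submfd M S) (open_submfd N (f ` S)) f)"

lemma complex_manifold_open_mfd:
  fixes S :: "'e::{complex_normed, second_countable_topology} set"
  assumes "open S"
  shows "complex_manifold (open_mfd S)"
proof -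
  have "second_countable (euclidean :: 'e topology)"
  proof -
    obtain B :: "'e set set" where "countable B" "topological_basis B"
      using ex_countable_basis by blast
    moreover have "\<exists>U\<in>B. x \<in> U \<and> U \<subseteq> V" if "open V" "x \<in> V" for V x
      using topological_basisE[OF \<open>topological_basis B\<close> that] by metis
    moreover have "open V" if "V \<in> B" for V
      using topological_basis_open \<open>topological_basis B\<close> that by blast
    ultimately show ?thesis
      using \<open>countable B\<close> unfolding second_countable_def by (metis open_openin)
  qed
  then have sc: "second_countable (top_of_set S)"
    by (rule second_countable_subtopology)
  have id: "holo_on (id \<circ> inv_into S id) S"
    unfolding holo_on_def
  proof (intro ballI exI conjI allI)
    fix p assume p: "p \<in> S"
    show "((id \<circ> inv_into S id) has_derivative id) (at p)"
      by (rule has_derivative_transform_within_open[of id id p UNIV S])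
        (use assms p in \<open>auto simp: id_def inv_into_f_f[of id S, simplified id_def]\<close>)
  qed auto
  have "compatible_chart (open_mfd S) S id"
    using id assms by (auto simp: compatible_chart_def open_mfd_def subtopology_subtopology)
  then show ?thesis
    using sc by (auto simp: complex_manifold_def open_mfd_def Hausdorff_space_subtopology)
qed


section \<open>Singular holomorphic foliations on a surface\<close>

text \<open>A generator \<^term>\<open>(U, \<phi>, v)\<close> is a holomorphic vector field on the open set \<^term>\<open>U\<close>,
  written as \<^term>\<open>v\<close> in the holomorphic coordinate \<^term>\<open>\<phi>\<close> on \<^term>\<open>U\<close>.\<close>

type_synonym 'a fol =
  "('a set \<times> ('a \<Rightarrow> complex \<times> complex) \<times> (complex \<times> complex \<Rightarrow> complex \<times> complex)) set"

definition foliation :: "'a csurface \<Rightarrow> 'a fol \<Rightarrow> bool" where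
  "foliation X F \<longleftrightarrow>
     (\<Union>(U, \<phi>, v)\<in>F. U) = topspace (mtop X) \<and>
     (\<forall>(U, \<phi>, v)\<in>F. compatible_chart X U \<phi> \<and> holo_on v (\<phi> ` U) \<and>
        (\<forall>p\<in>\<phi> ` U. \<not> p islimpt {q\<in>\<phi> ` U. v q = 0})) \<and>
     (\<forall>(U, \<phi>, v)\<in>F. \<forall>(U', \<phi>', v')\<in>F.
        \<exists>g :: complex \<times> complex \<Rightarrow> complex.
          holo_on g (\<phi> ` (U \<inter> U')) \<and>
          (\<forall>p\<in>\<phi> ` (U \<inter> U'). g p \<noteq> 0 \<and>
             v' ((\<phi>' \<circ> inv_into U \<phi>) p)
               = g p *\<^sub>C frechet_derivative (\<phi>' \<circ> inv_into U \<phi>) (at p) (v p)))"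

definition Sing :: "'a fol \<Rightarrow> 'a set" where
  "Sing F = {x. \<exists>(U, \<phi>, v)\<in>F. x \<in> U \<and> v (\<phi> x) = 0}"

definition tangent_at :: "'a fol \<Rightarrow> (complex \<Rightarrow> 'a) \<Rightarrow> complex \<Rightarrow> bool" where
  "tangent_at F c s \<longleftrightarrow>
     (\<forall>(U, \<phi>, v)\<in>F. c s \<in> U \<longrightarrow>
        (\<exists>k. ((\<phi> \<circ> c) has_derivative (\<lambda>h. (h * k) *\<^sub>C v (\<phi> (c s)))) (at s)))"

definition integral_disc :: "'a csurface \<Rightarrow> 'a fol \<Rightarrow> (complex \<Rightarrow> 'a) \<Rightarrow> bool" where
  "integral_disc X F c \<longleftrightarrow>
     holo_immersion (open_mfd (ball 0 1)) X c \<and>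
     (\<forall>s\<in>ball 0 1. c s \<notin> Sing F \<and> tangent_at F c s)"

text \<open>The leaf topology on the complement of the singular set is the topology for which the
  immersed integral discs are open; the leaves are its path components, each with the induced
  topology.\<close>

definition leaf_topology :: "'a csurface \<Rightarrow> 'a fol \<Rightarrow> 'a topology" where
  "leaf_topology X F = topology_generated_by {c ` ball 0 1 |c. integral_disc X F c}"

definition leaf :: "'a csurface \<Rightarrow> 'a fol \<Rightarrow> 'a \<Rightarrow> 'a set" where
  "leaf X F z = path_component_of_set (leaf_topology X F) z"

definition leaf_space :: "'a csurface \<Rightarrow> 'a fol \<Rightarrow> 'a \<Rightarrow> 'a topology" where
  "leaf_space X F z = subtopology (leaf_topology X F) (leaf X F z)"

definition leaf_path :: "'a csurface \<Rightarrow> 'a fol \<Rightarrow> (real \<Rightarrow> 'a) \<Rightarrow> bool" where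
  "leaf_path X F \<gamma> \<longleftrightarrow> pathin (leaf_space X F (\<gamma> 0)) \<gamma>"


section \<open>Poincare discs and holonomy\<close>

definition disc_embedding :: "'a csurface \<Rightarrow> 'a set \<Rightarrow> real \<Rightarrow> (complex \<Rightarrow> 'a) \<Rightarrow> bool" where
  "disc_embedding X D r u \<longleftrightarrow>
     holo_immersion (open_mfd (ball 0 r)) X u \<and>
     homeomorphic_map (top_of_set (ball 0 r)) (subtopology (mtop X) D) u"

definition poincare_disc :: "'a csurface \<Rightarrow> 'a fol \<Rightarrow> 'a set \<Rightarrow> bool" where
  "poincare_disc X F D \<longleftrightarrow>
     D \<subseteq> topspace (mtop X) - Sing F \<and>
     (\<exists>A C. openin (mtop X) A \<and> closedin (mtop X) C \<and> D = A \<inter> C) \<and>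
     (\<exists>u. disc_embedding X D 1 u \<and> (\<forall>s\<in>ball 0 1. \<not> tangent_at F u s))"

definition disc_coordinate ::
    "'a csurface \<Rightarrow> 'a set \<Rightarrow> 'a \<Rightarrow> real \<Rightarrow> ('a \<Rightarrow> complex) \<Rightarrow> bool" where
  "disc_coordinate X D m r t \<longleftrightarrow>
     r > 0 \<and> bij_betw t D (ball 0 r) \<and> t m = 0 \<and> disc_embedding X D r (inv_into D t)"

text \<open>The germ of \<^term>\<open>h\<close> at \<^term>\<open>m\<close>, as the set of all maps agreeing with \<^term>\<open>h\<close> near
  \<^term>\<open>m\<close>.\<close>

definition germ_at :: "'a topology \<Rightarrow> 'a \<Rightarrow> ('a \<Rightarrow> 'a) \<Rightarrow> ('a \<Rightarrow> 'a) set" where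
  "germ_at T m h = {h'. \<exists>N. openin T N \<and> m \<in> N \<and> (\<forall>z\<in>N. h' z = h z)}"

text \<open>\<^term>\<open>h\<close> is the holonomy map, defined on the neighbourhood \<^term>\<open>N\<close> of \<^term>\<open>m\<close> in
  \<^term>\<open>D\<close>, along the leafwise loop \<^term>\<open>\<gamma>\<close> at \<^term>\<open>m\<close>: the loop extends to a continuous
  family of leafwise paths leading from \<^term>\<open>z \<in> N\<close> to \<^term>\<open>h z \<in> D\<close>.\<close>

definition holonomy_along ::
    "'a csurface \<Rightarrow> 'a fol \<Rightarrow> 'a set \<Rightarrow> 'a \<Rightarrow> (real \<Rightarrow> 'a) \<Rightarrow> 'a set \<Rightarrow> ('a \<Rightarrow> 'a) \<Rightarrow> bool" where
  "holonomy_along X F D m \<gamma> N h \<longleftrightarrow>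
     leaf_path X F \<gamma> \<and> \<gamma> 0 = m \<and> \<gamma> 1 = m \<and>
     openin (subtopology (mtop X) D) N \<and> m \<in> N \<and> h ` N \<subseteq> D \<and>
     (\<exists>\<Gamma>. continuous_map (prod_topology (top_of_set {0..1}) (subtopology (mtop X) N)) (mtop X) \<Gamma> \<and>
        (\<forall>s\<in>{0..1}. \<Gamma> (s, m) = \<gamma> s) \<and>
        (\<forall>z\<in>N. leaf_path X F (\<lambda>s. \<Gamma> (s, z)) \<and> \<Gamma> (0, z) = z \<and> \<Gamma> (1, z) = h z))"

definition holonomy_group ::
    "'a csurface \<Rightarrow> 'a fol \<Rightarrow> 'a set \<Rightarrow> 'a \<Rightarrow> ('a \<Rightarrow> 'a) set set" where
  "holonomy_group X F D m =
     {germ_at (subtopology (mtop X) D) m h |h. \<exists>\<gamma> N. holonomy_along X F D m \<gamma> N h}"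

text \<open>The derivative at the fixed point \<^term>\<open>m\<close> does not depend on the coordinate \<^term>\<open>t\<close> nor
  on the representative of the germ.\<close>

definition hyperbolic_germ :: "'a set \<Rightarrow> ('a \<Rightarrow> complex) \<Rightarrow> 'a \<Rightarrow> ('a \<Rightarrow> 'a) set \<Rightarrow> bool" where
  "hyperbolic_germ D t m a \<longleftrightarrow>
     (\<forall>h\<in>a. cmod (deriv (t \<circ> h \<circ> inv_into D t) (t m)) < 1)"

text \<open>The germ \<^term>\<open>a\<close> is multiplication by \<^term>\<open>\<alpha>\<close> in the coordinate \<^term>\<open>t\<close>; the disc
  \<^term>\<open>D\<close> is small enough for a representative of \<^term>\<open>a\<close> to be a holonomy map on all of
  \<^term>\<open>D\<close>.\<close>

definition linear_in_coordinate ::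
    "'a csurface \<Rightarrow> 'a fol \<Rightarrow> 'a set \<Rightarrow> 'a \<Rightarrow> ('a \<Rightarrow> complex) \<Rightarrow> complex \<Rightarrow> ('a \<Rightarrow> 'a) set \<Rightarrow> bool" where
  "linear_in_coordinate X F D m t \<alpha> a \<longleftrightarrow>
     (\<exists>h\<in>a. (\<exists>\<gamma>. holonomy_along X F D m \<gamma> D h) \<and> (\<forall>z\<in>D. t (h z) = \<alpha> * t z))"


section \<open>The universal covering Poincare domain\<close>

definition quotient_topology :: "'a topology \<Rightarrow> ('a \<Rightarrow> 'b) \<Rightarrow> 'b topology" where
  "quotient_topology T q =
     topology (\<lambda>U. U \<subseteq> q ` topspace T \<and> openin T {x\<in>topspace T. q x \<in> U})"

lemma openin_quotient_topology:
  "openin (quotient_topology T q) U \<longleftrightarrow>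
     U \<subseteq> q ` topspace T \<and> openin T {x\<in>topspace T. q x \<in> U}"
proof -
  have "istopology (\<lambda>U. U \<subseteq> q ` topspace T \<and> openin T {x\<in>topspace T. q x \<in> U})"
    unfolding istopology_def
  proof (intro conjI allI impI)
    fix S S' assume *: "S \<subseteq> q ` topspace T \<and> openin T {x \<in> topspace T. q x \<in> S}"
      "S' \<subseteq> q ` topspace T \<and> openin T {x \<in> topspace T. q x \<in> S'}"
    show "S \<inter> S' \<subseteq> q ` topspace T" using * by blast
    have "{x \<in> topspace T. q x \<in> S \<inter> S'} = {x \<in> topspace T. q x \<in> S} \<inter> {x \<in> topspace T. q x \<in> S'}"
      by blast
    then show "openin T {x \<in> topspace T. q x \<in> S \<inter> S'}" using * by auto
  next
    fix \<K> assume *: "\<forall>K\<in>\<K>. K \<subseteq> q ` topspace T \<and> openin T {x \<in> topspace T. q x \<in> K}"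
    show "\<Union>\<K> \<subseteq> q ` topspace T" using * by blast
    have "{x \<in> topspace T. q x \<in> \<Union>\<K>} = (\<Union>K\<in>\<K>. {x \<in> topspace T. q x \<in> K})"
      by blast
    then show "openin T {x \<in> topspace T. q x \<in> \<Union>\<K>}" using * by auto
  qed
  then show ?thesis
    by (simp add: quotient_topology_def)
qed

lemma topspace_quotient_topology: "topspace (quotient_topology T q) = q ` topspace T"
proof (rule antisym)
  show "topspace (quotient_topology T q) \<subseteq> q ` topspace T"
    using openin_quotient_topology[of T q "topspace (quotient_topology T q)"] by simp
  have "{x \<in> topspace T. q x \<in> q ` topspace T} = topspace T" by blast
  then have "openin (quotient_topology T q) (q ` topspace T)"
    by (simp add: openin_quotient_topology)
  then show "q ` topspace T \<subseteq> topspace (quotient_topology T q)"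
    by (rule openin_subset)
qed

lemma quotient_map_quotient_topology: "quotient_map T (quotient_topology T q) q"
  by (auto simp: quotient_map_def topspace_quotient_topology openin_quotient_topology)

definition leaf_paths_from :: "'a csurface \<Rightarrow> 'a fol \<Rightarrow> 'a set \<Rightarrow> (real \<Rightarrow> 'a) set" where
  "leaf_paths_from X F D = {\<gamma> \<in> extensional {0..1}. \<gamma> 0 \<in> D \<and> leaf_path X F \<gamma>}"

text \<open>Uniform convergence with respect to a metric \<^term>\<open>d\<close> on \<^term>\<open>X\<close>.  For compact
  \<^term>\<open>X\<close> the resulting topology is the same for all metrics inducing the topology of
  \<^term>\<open>X\<close>.\<close>

definition path_space :: "'a csurface \<Rightarrow> 'a fol \<Rightarrow> 'a metric \<Rightarrow> 'a set \<Rightarrow> (real \<Rightarrow> 'a) topology" where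
  "path_space X F d D =
     subtopology (mtopology_of (cfunspace (top_of_set {0..1}) d)) (leaf_paths_from X F D)"

definition leaf_homotopic :: "'a csurface \<Rightarrow> 'a fol \<Rightarrow> (real \<Rightarrow> 'a) \<Rightarrow> (real \<Rightarrow> 'a) \<Rightarrow> bool" where
  "leaf_homotopic X F \<gamma> \<gamma>' \<longleftrightarrow>
     homotopic_with (\<lambda>\<eta>. \<eta> 0 = \<gamma> 0 \<and> \<eta> 1 = \<gamma> 1) (top_of_set {0..1}) (leaf_space X F (\<gamma> 0)) \<gamma> \<gamma>'"

definition path_class ::
    "'a csurface \<Rightarrow> 'a fol \<Rightarrow> 'a set \<Rightarrow> (real \<Rightarrow> 'a) \<Rightarrow> (real \<Rightarrow> 'a) set" where
  "path_class X F D \<gamma> = {\<gamma>' \<in> leaf_paths_from X F D. leaf_homotopic X F \<gamma> \<gamma>'}"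

definition class_start :: "(real \<Rightarrow> 'a) set \<Rightarrow> 'a" where
  "class_start c = (SOME \<gamma>. \<gamma> \<in> c) 0"

definition class_end :: "(real \<Rightarrow> 'a) set \<Rightarrow> 'a" where
  "class_end c = (SOME \<gamma>. \<gamma> \<in> c) 1"

text \<open>The complex structure making \<^term>\<open>p\<close> locally biholomorphic: the charts are the charts of
  \<^term>\<open>M\<close> composed with \<^term>\<open>p\<close>, on the open sets which \<^term>\<open>p\<close> maps homeomorphically onto
  open sets.\<close>

definition pullback_mfd ::
    "'b topology \<Rightarrow> ('b \<Rightarrow> 'a) \<Rightarrow> ('a, 'e::complex_normed) cmfd \<Rightarrow> ('b, 'e) cmfd" where
  "pullback_mfd T p M =
     \<lparr>mtop = T,
      charts = {(W, \<phi> \<circ> p) |W U \<phi>. (U, \<phi>) \<in> charts M \<and> openin T W \<and> p ` W \<subseteq> U \<and>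
        openin (mtop M) (p ` W) \<and>
        homeomorphic_map (subtopology T W) (subtopology (mtop M) (p ` W)) p}\<rparr>"

definition poincare_domain ::
    "'a csurface \<Rightarrow> 'a fol \<Rightarrow> 'a metric \<Rightarrow> 'a set \<Rightarrow> (real \<Rightarrow> 'a) set csurface" where
  "poincare_domain X F d D =
     pullback_mfd (quotient_topology (path_space X F d D) (path_class X F D)) class_end X"

text \<open>The leaves of the foliation of \<^term>\<open>P\<close> are the fibres of \<^term>\<open>\<pi>\<close>.\<close>

definition rothstein :: "'a csurface \<Rightarrow> ('a \<Rightarrow> 'b) \<Rightarrow> bool" where
  "rothstein P \<pi> \<longleftrightarrow>
     (\<forall>R>1. \<forall>f :: complex \<times> complex \<Rightarrow> 'a.
        holo_immersion (open_mfd (ball 0 1 \<times> ball 0 1)) P f \<and>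
        (\<forall>z\<in>ball 0 1. \<exists>s. \<forall>w\<in>ball 0 1. \<pi> (f (z, w)) = s) \<and>
        (\<forall>z\<in>ball 0 1. \<exists>g :: complex \<Rightarrow> 'a. holo_immersion (open_mfd (ball 0 R)) P g \<and>
           (\<forall>w\<in>ball 0 1. g w = f (z, w))) \<longrightarrow>
        (\<exists>G :: complex \<times> complex \<Rightarrow> 'a. holo_immersion (open_mfd (ball 0 1 \<times> ball 0 R)) P G \<and>
           (\<forall>z\<in>ball 0 1. \<forall>w\<in>ball 0 1. G (z, w) = f (z, w))))"


section \<open>Foliated domains over a complex curve\<close>

definition foliated_domain ::
    "'a csurface \<Rightarrow> ('a \<Rightarrow> 's) \<Rightarrow> ('s, complex) cmfd \<Rightarrow> bool" where
  "foliated_domain W \<pi> S \<longleftrightarrow>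
     complex_manifold W \<and> connected_space (mtop W) \<and> complex_manifold S \<and>
     holo_submersion W S \<pi> \<and> \<pi> ` topspace (mtop W) = topspace (mtop S) \<and>
     (\<forall>s\<in>topspace (mtop S). connectedin (mtop W) {x\<in>topspace (mtop W). \<pi> x = s})"

text \<open>\<^term>\<open>\<iota>\<close> identifies the foliated domain \<^term>\<open>P\<close> over an open part \<^term>\<open>S\<close> of the curve
  \<^term>\<open>S'\<close> with an open subset of the foliated domain \<^term>\<open>W\<close> over \<^term>\<open>S'\<close>, compatibly
  with the projections.\<close>

definition foliated_subdomain ::
    "'a csurface \<Rightarrow> ('a \<Rightarrow> 's) \<Rightarrow> 's set \<Rightarrow> 'b csurface \<Rightarrow> ('b \<Rightarrow> 's) \<Rightarrow> ('s, complex) cmfd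
      \<Rightarrow> ('a \<Rightarrow> 'b) \<Rightarrow> bool" where
  "foliated_subdomain P \<pi> S W \<pi>' S' \<iota> \<longleftrightarrow>
     openin (mtop S') S \<and>
     foliated_domain P \<pi> (open_submfd S' S) \<and> foliated_domain W \<pi>' S' \<and>
     openin (mtop W) (\<iota> ` topspace (mtop P)) \<and>
     biholomorphism P (open_submfd W (\<iota> ` topspace (mtop P))) \<iota> \<and>
     (\<forall>x\<in>topspace (mtop P). \<pi>' (\<iota> x) = \<pi> x)"

end

theory Submission
  imports Defs
begin

text \<open>Let \<open>h\<close> be the holonomy map with \<open>t \<circ> h = \<alpha> \<cdot> t\<close> on the whole disc and let \<open>\<Gamma>\<^sub>z\<close> be the leaf
  path from \<open>z\<close> to \<open>h z\<close>.  Prefixing a path that starts at \<open>z\<close> with the reversal of \<open>\<Gamma>\<^sub>z\<close> leaves its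
  end point unchanged and respects homotopy, so it induces an injective self-map \<open>e\<close> of the covering
  Poincare domain over \<open>X\<close> with \<open>t \<circ> class_start \<circ> e = \<alpha> \<cdot> (t \<circ> class_start)\<close>.  The direct limit of
  the iterates of \<open>e\<close> is again etale over \<open>X\<close>, it contains the domain as the part lying over the disc, and
  \<open>e\<close> becomes invertible on it.  Since \<open>0 < \<bar>\<alpha>\<bar> < 1\<close>, the projection \<open>\<alpha>\<^sup>-\<^sup>n t\<close> maps it onto the whole plane.

  That the domain is etale over \<open>X\<close> comes from transporting leaf paths: the holomorphic dependence of
  solutions of ordinary differential equations on initial values gives charts straightening the
  foliation, and a leaf path is covered by finitely many of them.\<close>

subsection \<open>Holomorphic maps in two variables and flows\<close>

text \<open>The obstacle is that the quotient carries uniform convergence in X, while homotopies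
  must stay inside leaves. Transversality bridges the two. A leaf path from D uniformly close to
  \<open>\<gamma>\<close> runs through the same chain of flow boxes, its first plaque meets D near
  \<open>\<gamma> 0\<close> only once, and sliding inside convex plaques deforms it, with fixed
  ends, to a path determined by its end point alone. So near each class the end point is a local
  coordinate. The analysis ends there: a continuous map between spaces etale over X that commutes
  with the projections to X is automatically holomorphic, because in pulled-back charts it is a
  coordinate change of X. The family \<open>\<Gamma>\<close> is run backwards so that the new path
  starts at h z: the start coordinate is then multiplied by \<alpha> and stays in the disc, whereas
  dividing could leave it. The larger space is built as a limit of abstract copies since no ambient
  space is given. Compactness of X makes it second countable: finite nets code the leaf paths by
  countably many finite words at each scale.\<close>

lemma holo_on_subset: "holo_on f S \<Longrightarrow> T \<subseteq> S \<Longrightarrow> holo_on f T"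
  by (auto simp: holo_on_def)

lemma holo_onE:
  assumes "holo_on f S" "p \<in> S"
  obtains L where "(f has_derivative L) (at p)" "\<And>c v. L (c *\<^sub>C v) = c *\<^sub>C L v"
  using assms unfolding holo_on_def by blast

lemma holo_on_imp_continuous_on: "holo_on f S \<Longrightarrow> continuous_on S f"
  by (meson continuous_at_imp_continuous_on has_derivative_continuous holo_onE)

lemma holo_on_compose:
  assumes f: "holo_on f S" and g: "holo_on g T" and "f ` S \<subseteq> T"
  shows "holo_on (g \<circ> f) S"
  unfolding holo_on_def
proof
  fix p assume p: "p \<in> S"
  obtain L where L: "(f has_derivative L) (at p)" "\<And>c v. L (c *\<^sub>C v) = c *\<^sub>C L v"
    using holo_onE[OF f p] by blast
  have "f p \<in> T" using assms p by blast
  then obtain M where M: "(g has_derivative M) (at (f p))" "\<And>c v. M (c *\<^sub>C v) = c *\<^sub>C M v"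
    using holo_onE[OF g] by blast
  show "\<exists>K. (g \<circ> f has_derivative K) (at p) \<and> (\<forall>c v. K (c *\<^sub>C v) = c *\<^sub>C K v)"
    using diff_chain_at[OF L(1) M(1)] L(2) M(2) by (intro exI[of _ "M \<circ> L"]) auto
qed

lemma holo_on_cong_open:
  assumes "open S" "holo_on f S" "\<And>x. x \<in> S \<Longrightarrow> g x = f x"
  shows "holo_on g S"
  unfolding holo_on_def
proof
  fix p assume p: "p \<in> S"
  obtain L where L: "(f has_derivative L) (at p)" "\<And>c v. L (c *\<^sub>C v) = c *\<^sub>C L v"
    using holo_onE[OF assms(2) p] by blast
  have "(g has_derivative L) (at p)"
    using has_derivative_transform_within_open[OF L(1) \<open>open S\<close> p] assms(3) by simp
  with L(2) show "\<exists>L. (g has_derivative L) (at p) \<and> (\<forall>c v. L (c *\<^sub>C v) = c *\<^sub>C L v)" by blast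
qed

lemma holo_on_locally:
  assumes "\<And>x. x \<in> S \<Longrightarrow> \<exists>T. x \<in> T \<and> holo_on f T"
  shows "holo_on f S"
  using assms unfolding holo_on_def by blast

lemma holo_on_linear:
  assumes "bounded_linear f" "\<And>c v. f (c *\<^sub>C v) = c *\<^sub>C f v"
  shows "holo_on f S"
  using assms bounded_linear_imp_has_derivative unfolding holo_on_def by blast

lemma holo_on_id [simp]: "holo_on id S" "holo_on (\<lambda>x. x) S"
  by (auto intro!: holo_on_linear simp: id_def)

lemma holo_on_fst: "holo_on fst S" and holo_on_snd: "holo_on snd S"
  by (auto intro!: holo_on_linear bounded_linear_fst bounded_linear_snd simp: scaleC_prod_def)

lemma scaleC_zero_right [simp]: "c *\<^sub>C (0::'a::complex_normed) = 0"
  by (metis add_cancel_left_left scaleC_add_right)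


lemma scaleC_zero_left [simp]: "0 *\<^sub>C (x::'a::complex_normed) = 0"
  by (metis add_cancel_left_left scaleC_add_left)

lemma scaleC_eq_0_iff [simp]: "c *\<^sub>C (x::'a::complex_normed) = 0 \<longleftrightarrow> c = 0 \<or> x = 0"
  by (metis mult_eq_0_iff norm_eq_zero norm_scaleC)

lemma holo_on_const [simp]: "holo_on (\<lambda>x. c) S"
  unfolding holo_on_def by (intro ballI exI[of _ "\<lambda>x. 0"]) auto

lemma holo_on_Pair:
  assumes f: "holo_on f S" and g: "holo_on g S"
  shows "holo_on (\<lambda>x. (f x, g x)) S"
  unfolding holo_on_def
proof
  fix p assume p: "p \<in> S"
  obtain L where L: "(f has_derivative L) (at p)" "\<And>c v. L (c *\<^sub>C v) = c *\<^sub>C L v"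
    using holo_onE[OF f p] by blast
  obtain M where M: "(g has_derivative M) (at p)" "\<And>c v. M (c *\<^sub>C v) = c *\<^sub>C M v"
    using holo_onE[OF g p] by blast
  show "\<exists>K. ((\<lambda>x. (f x, g x)) has_derivative K) (at p) \<and> (\<forall>c v. K (c *\<^sub>C v) = c *\<^sub>C K v)"
    using has_derivative_Pair[OF L(1) M(1)] L(2) M(2)
    by (intro exI[of _ "\<lambda>h. (L h, M h)"]) (auto simp: scaleC_prod_def)
qed

lemma holo_on_add:
  assumes f: "holo_on f S" and g: "holo_on g S"
  shows "holo_on (\<lambda>x. f x + g x) S"
  unfolding holo_on_def
proof
  fix p assume p: "p \<in> S"
  obtain L where L: "(f has_derivative L) (at p)" "\<And>c v. L (c *\<^sub>C v) = c *\<^sub>C L v"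
    using holo_onE[OF f p] by blast
  obtain M where M: "(g has_derivative M) (at p)" "\<And>c v. M (c *\<^sub>C v) = c *\<^sub>C M v"
    using holo_onE[OF g p] by blast
  show "\<exists>K. ((\<lambda>x. f x + g x) has_derivative K) (at p) \<and> (\<forall>c v. K (c *\<^sub>C v) = c *\<^sub>C K v)"
    using has_derivative_add[OF L(1) M(1)] L(2) M(2)
    by (intro exI[of _ "\<lambda>h. L h + M h"]) (auto simp: scaleC_add_right)
qed

lemma holo_on_mult:
  fixes f g :: "'a::complex_normed \<Rightarrow> complex"
  assumes f: "holo_on f S" and g: "holo_on g S"
  shows "holo_on (\<lambda>x. f x * g x) S"
  unfolding holo_on_def
proof
  fix p assume p: "p \<in> S"
  obtain L where L: "(f has_derivative L) (at p)" "\<And>c v. L (c *\<^sub>C v) = c *\<^sub>C L v"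
    using holo_onE[OF f p] by blast
  obtain M where M: "(g has_derivative M) (at p)" "\<And>c v. M (c *\<^sub>C v) = c *\<^sub>C M v"
    using holo_onE[OF g p] by blast
  show "\<exists>K. ((\<lambda>x. f x * g x) has_derivative K) (at p) \<and> (\<forall>c v. K (c *\<^sub>C v) = c *\<^sub>C K v)"
    using has_derivative_mult[OF L(1) M(1)] L(2) M(2)
    by (intro exI[of _ "\<lambda>h. f p * M h + L h * g p"]) (auto simp: scaleC_complex_def algebra_simps)
qed

lemma holo_on_holomorphic_compose:
  assumes f: "holo_on f S" and g: "g holomorphic_on T" and "open T" "f ` S \<subseteq> T"
  shows "holo_on (\<lambda>x. g (f x)) S"
  using holo_on_compose[OF f _ assms(4)] g holo_on_complex_iff[OF \<open>open T\<close>] by (auto simp: o_def)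

lemma holo_on_divide:
  fixes f g :: "'a::complex_normed \<Rightarrow> complex"
  assumes f: "holo_on f S" and g: "holo_on g S" and "\<And>x. x \<in> S \<Longrightarrow> g x \<noteq> 0"
  shows "holo_on (\<lambda>x. f x / g x) S"
proof -
  have "holo_on (\<lambda>x. inverse (g x)) S"
    by (rule holo_on_holomorphic_compose[OF g, of inverse "- {0}"])
       (use assms in \<open>auto intro!: holomorphic_intros\<close>)
  from holo_on_mult[OF f this] show ?thesis by (simp add: divide_inverse)
qed

lemma clinear_complex_field_derivative:
  assumes "(f has_derivative L) (at x)" "\<And>c v. L (c *\<^sub>C v) = c *\<^sub>C L v"
  shows "(f has_field_derivative L 1) (at (x::complex))"
proof -
  have "L = (*) (L 1)"
  proof
    show "L v = L 1 * v" for v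
      using assms(2)[of v 1] by (simp add: scaleC_complex_def mult.commute)
  qed
  then show ?thesis
    using assms(1) unfolding has_field_derivative_def by metis
qed

lemma holo_on_slices:
  fixes f :: "complex \<times> complex \<Rightarrow> complex"
  assumes "holo_on f S" "p \<in> S"
  shows "(\<lambda>z. f (z, snd p)) field_differentiable at (fst p)"
    and "(\<lambda>w. f (fst p, w)) field_differentiable at (snd p)"
proof -
  have "holo_on (f \<circ> (\<lambda>z. (z, snd p))) {fst p}" "holo_on (f \<circ> (\<lambda>w. (fst p, w))) {snd p}"
    by (rule holo_on_compose[OF _ assms(1)]; use assms in \<open>auto intro!: holo_on_Pair\<close>)+
  then show "(\<lambda>z. f (z, snd p)) field_differentiable at (fst p)"
    and "(\<lambda>w. f (fst p, w)) field_differentiable at (snd p)"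
    unfolding field_differentiable_def o_def
    by (fastforce simp: holo_on_def intro: clinear_complex_field_derivative)+
qed

lemma open_slices:
  assumes "open (S :: ('a::topological_space \<times> 'b::topological_space) set)"
  shows "open {z. (z, y) \<in> S}" "open {w. (x, w) \<in> S}"
proof -
  have "open ((\<lambda>z. (z, y)) -` S)" "open ((\<lambda>w. (x, w)) -` S)"
    by (auto intro!: open_vimage assms continuous_intros)
  then show "open {z. (z, y) \<in> S}" "open {w. (x, w) \<in> S}" by (auto simp: vimage_def)
qed

lemma open_contains_cball_times:
  assumes "open (S :: ('a::metric_space \<times> 'b::metric_space) set)" "(a, b) \<in> S"
  obtains r where "r > 0" "cball a r \<times> cball b r \<subseteq> S"
proof -
  obtain A B where AB: "open A" "open B" "a \<in> A" "b \<in> B" "A \<times> B \<subseteq> S"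
    using open_prod_elim[OF assms] by (metis SigmaE2)
  obtain r1 where r1: "r1 > 0" "cball a r1 \<subseteq> A" using AB open_contains_cball by metis
  obtain r2 where r2: "r2 > 0" "cball b r2 \<subseteq> B" using AB open_contains_cball by metis
  have "cball a (min r1 r2) \<subseteq> A" "cball b (min r1 r2) \<subseteq> B" using r1 r2 by auto
  then have "cball a (min r1 r2) \<times> cball b (min r1 r2) \<subseteq> S" using AB(5) by blast
  with r1(1) r2(1) show ?thesis by (intro that[of "min r1 r2"]) auto
qed

section \<open>Separate holomorphy and integrals with a holomorphic parameter\<close>

text \<open>The derivative at y of f (x, .) - f (a, .) is bounded by Cauchy's inequality, since that
  difference is uniformly small on a compact polydisc; the remaining change, in y with a fixed, is
  continuity of a derivative in one variable.\<close>

lemma continuous_on_partial_deriv: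
  fixes f :: "complex \<times> complex \<Rightarrow> complex"
  assumes S: "open S" and cont: "continuous_on S f"
    and diff: "\<And>p. p \<in> S \<Longrightarrow> (\<lambda>w. f (fst p, w)) field_differentiable at (snd p)"
  shows "continuous_on S (\<lambda>p. deriv (\<lambda>w. f (fst p, w)) (snd p))"
proof (rule continuous_at_imp_continuous_on, rule ballI)
  fix p assume p: "p \<in> S"
  obtain a b where ab: "p = (a, b)" by fastforce
  obtain R where R: "R > 0" "cball a R \<times> cball b R \<subseteq> S"
    using open_contains_cball_times[OF S] p ab by metis
  \<comment> \<open>Half of R, so that a disc of radius r around any y within r of b still lies in
    the polydisc.\<close>
  define r where "r = R / 2"
  have r: "r > 0" "2 * r = R" using R by (auto simp: r_def)
  define K where "K = cball a R \<times> cball b R"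
  have K: "compact K" "K \<subseteq> S" unfolding K_def using R by (auto intro: compact_Times)
  have ucont: "uniformly_continuous_on K f"
    by (rule compact_uniformly_continuous[OF continuous_on_subset[OF cont K(2)] K(1)])
  have hol: "(\<lambda>w. f (x, w)) holomorphic_on {w. (x, w) \<in> S}" for x
    unfolding holomorphic_on_def
  proof
    fix w assume "w \<in> {w. (x, w) \<in> S}"
    then show "(\<lambda>w. f (x, w)) field_differentiable at w within {w. (x, w) \<in> S}"
      using diff[of "(x, w)"] by (simp add: field_differentiable_at_within)
  qed
  let ?g = "\<lambda>p. deriv (\<lambda>w. f (fst p, w)) (snd p)"
  show "isCont ?g p"
    unfolding continuous_at_eps_delta
  proof (intro allI impI)
    fix e :: real assume e: "e > 0"
    have "continuous_on {w. (a, w) \<in> S} (deriv (\<lambda>w. f (a, w)))"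
      using holomorphic_deriv[OF hol open_slices(2)[OF S]] holomorphic_on_imp_continuous_on by blast
    then have "isCont (deriv (\<lambda>w. f (a, w))) b"
      using continuous_on_eq_continuous_at[OF open_slices(2)[OF S]] p ab by blast
    then obtain d1 where d1: "d1 > 0"
      "\<And>y. dist y b < d1 \<Longrightarrow> dist (deriv (\<lambda>w. f (a, w)) y) (deriv (\<lambda>w. f (a, w)) b) < e / 2"
      unfolding continuous_at_eps_delta using e by (meson half_gt_zero)
    \<comment> \<open>Cauchy's inequality divides by r, so a tolerance e * r / 2 for f becomes e / 2
      for the derivative; the other e / 2 comes from d1.\<close>
    obtain d2 where d2: "d2 > 0"
      "\<And>q q'. q \<in> K \<Longrightarrow> q' \<in> K \<Longrightarrow> dist q' q < d2 \<Longrightarrow> dist (f q') (f q) < e * r / 2"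
      using ucont e r unfolding uniformly_continuous_on_def by (metis half_gt_zero mult_pos_pos)
    define d where "d = min (min d1 d2) r"
    have "dist (?g q) (?g p) < e" if q: "dist q p < d" for q
    proof -
      obtain x y where xy: "q = (x, y)" by fastforce
      have dx: "dist x a < d" and dy: "dist y b < d"
        using q dist_fst_le[of q p] dist_snd_le[of q p] by (auto simp: xy ab)
      have inK: "(x, w) \<in> K" "(a, w) \<in> K" if "w \<in> cball y r" for w
      proof -
        have "dist b w \<le> dist b y + dist y w" by (rule dist_triangle)
        then have "dist b w \<le> R" using that dy r by (auto simp: d_def dist_commute)
        then show "(x, w) \<in> K" "(a, w) \<in> K"
          using dx r by (auto simp: K_def d_def dist_commute)
      qed
      define h where "h = (\<lambda>w. f (x, w) - f (a, w))"
      have bnd: "norm (h w) \<le> e * r / 2" if "w \<in> cball y r" for w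
      proof -
        have "dist (x, w) (a, w) < d2" using dx by (simp add: dist_Pair_Pair d_def)
        then show ?thesis using d2(2) inK[OF that] by (fastforce simp: h_def dist_norm)
      qed
      have sub: "cball y r \<subseteq> {w. (x, w) \<in> S} \<inter> {w. (a, w) \<in> S}" using inK K(2) by blast
      have hh: "h holomorphic_on {w. (x, w) \<in> S} \<inter> {w. (a, w) \<in> S}"
        unfolding h_def by (intro holomorphic_intros holomorphic_on_subset[OF hol]) auto
      have "norm ((deriv ^^ 1) h y) \<le> fact 1 * (e * r / 2) / r ^ 1"
      proof (rule Cauchy_inequality)
        show "h holomorphic_on ball y r"
          using holomorphic_on_subset[OF hh] sub ball_subset_cball by blast
        show "continuous_on (cball y r) h"
          using holomorphic_on_imp_continuous_on[OF holomorphic_on_subset[OF hh sub]] .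
      qed (use r bnd in \<open>auto simp: dist_norm\<close>)
      moreover have "deriv h y = deriv (\<lambda>w. f (x, w)) y - deriv (\<lambda>w. f (a, w)) y"
        unfolding h_def
        by (rule deriv_diff) (use diff[of "(x,y)"] diff[of "(a,y)"] inK[of y] K(2) r in auto)
      ultimately have "dist (deriv (\<lambda>w. f (x, w)) y) (deriv (\<lambda>w. f (a, w)) y) \<le> e / 2"
        using r(1) by (simp add: dist_norm)
      moreover have "dist (deriv (\<lambda>w. f (a, w)) y) (deriv (\<lambda>w. f (a, w)) b) < e / 2"
        using d1 dy by (simp add: d_def)
      ultimately have "dist (deriv (\<lambda>w. f (x, w)) y) (deriv (\<lambda>w. f (a, w)) b) < e"
        using dist_triangle[of "deriv (\<lambda>w. f (x, w)) y" "deriv (\<lambda>w. f (a, w)) b"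
            "deriv (\<lambda>w. f (a, w)) y"] by linarith
      then show ?thesis by (simp add: xy ab)
    qed
    moreover have "d > 0" using d1 d2 r by (simp add: d_def)
    ultimately show "\<exists>d>0. \<forall>x'. dist x' p < d \<longrightarrow> dist (?g x') (?g p) < e" by blast
  qed
qed

text \<open>Osgood's lemma. A total derivative exists as soon as one partial derivative exists at
  the point and the other is continuous nearby; the previous lemma supplies that continuity, and the
  resulting linear map is visibly complex linear.\<close>

lemma separately_holomorphic_imp_holo_on:
  fixes f :: "complex \<times> complex \<Rightarrow> complex"
  assumes S: "open S" and cont: "continuous_on S f"
    and diff1: "\<And>p. p \<in> S \<Longrightarrow> (\<lambda>z. f (z, snd p)) field_differentiable at (fst p)"
    and diff2: "\<And>p. p \<in> S \<Longrightarrow> (\<lambda>w. f (fst p, w)) field_differentiable at (snd p)"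
  shows "holo_on f S"
  unfolding holo_on_def
proof
  fix p assume p: "p \<in> S"
  obtain a b where ab: "p = (a, b)" by fastforce
  obtain R where R: "R > 0" "cball a R \<times> cball b R \<subseteq> S"
    using open_contains_cball_times[OF S] p ab by metis
  define A where "A = ball a R" define B where "B = ball b R"
  have AB: "open A" "open B" "a \<in> A" "b \<in> B" "A \<times> B \<subseteq> S" "convex B"
    using R ball_subset_cball by (auto simp: A_def B_def)
  let ?f1 = "deriv (\<lambda>z. f (z, b)) a"
  let ?g = "\<lambda>p. deriv (\<lambda>w. f (fst p, w)) (snd p)"
  have "((\<lambda>(x, y). f (x, y)) has_derivative
      (\<lambda>(tx, ty). ?f1 * tx + blinfun_mult_right (?g (a, b)) ty)) (at (a, b) within A \<times> B)"
  proof (rule has_derivative_partialsI[where f="\<lambda>x y. f (x, y)" and fy="\<lambda>x y. blinfun_mult_right (?g (x, y))"])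
    show "((\<lambda>x. f (x, b)) has_derivative (*) ?f1) (at a within A)"
      using diff1[OF p] ab
      by (metis field_differentiable_derivI fst_conv snd_conv has_field_derivative_def
          has_derivative_at_withinI)
    show "((\<lambda>y. f (x, y)) has_derivative blinfun_apply (blinfun_mult_right (?g (x, y)))) (at y within B)"
      if "x \<in> A" "y \<in> B" for x y
    proof -
      have "(\<lambda>w. f (x, w)) field_differentiable at y" using diff2[of "(x,y)"] that AB by auto
      then have "((\<lambda>w. f (x, w)) has_field_derivative ?g (x, y)) (at y)"
        by (simp add: field_differentiable_derivI)
      then show ?thesis
        by (auto simp: has_field_derivative_def intro: has_derivative_at_withinI)
    qed
    have "continuous_on (A \<times> B) (\<lambda>p. blinfun_mult_right (?g p))"
      using continuous_on_subset[OF continuous_on_partial_deriv[OF S cont diff2] AB(5)]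
      by (rule bounded_linear.continuous_on[OF bounded_linear_blinfun_mult_right])
    then show "continuous (at (a, b) within A \<times> B) (\<lambda>(x, y). blinfun_mult_right (?g (x, y)))"
      unfolding case_prod_beta' using AB by (simp add: continuous_on_eq_continuous_within)
  qed (use AB in auto)
  then have "(f has_derivative (\<lambda>t. ?f1 * fst t + ?g (a, b) * snd t)) (at p)"
    using at_within_open[of "(a,b)" "A \<times> B"] AB ab by (simp add: open_Times case_prod_beta')
  then show "\<exists>L. (f has_derivative L) (at p) \<and> (\<forall>c v. L (c *\<^sub>C v) = c *\<^sub>C L v)"
    by (intro exI conjI) (auto simp: scaleC_prod_def scaleC_complex_def algebra_simps)
qed

lemma holo_on_slice_holomorphic:
  fixes f :: "complex \<times> complex \<Rightarrow> complex"
  assumes "holo_on f S" "\<And>w. w \<in> B \<Longrightarrow> (x, w) \<in> S"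
  shows "(\<lambda>w. f (x, w)) holomorphic_on B"
  unfolding holomorphic_on_def
proof
  fix w assume "w \<in> B"
  then show "(\<lambda>w. f (x, w)) field_differentiable at w within B"
    using holo_on_slices(2)[OF assms(1), of "(x, w)"] assms(2) field_differentiable_at_within by auto
qed

lemma contour_integral_linepath_integral:
  "contour_integral (linepath a x) f = integral (cbox 0 1) (\<lambda>t. f (linepath a x t) * (x - a))"
  by (simp add: contour_integral_integral)

lemma linepath_in_convex: "convex S \<Longrightarrow> a \<in> S \<Longrightarrow> x \<in> S \<Longrightarrow> t \<in> {0..1} \<Longrightarrow> linepath a x t \<in> S"
  unfolding linepath_def by (simp add: convex_alt)

text \<open>This is the integral operator of Picard iteration. On a convex base the integral along
  the segment from a is a primitive, which settles the first variable; the second is settled by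
  differentiating under the integral sign.\<close>

lemma holo_on_integral:
  fixes g :: "complex \<times> complex \<Rightarrow> complex"
  assumes A: "open A" "convex A" "a \<in> A" and B: "open B" "convex B" and g: "holo_on g (A \<times> B)"
  defines "J \<equiv> \<lambda>p. contour_integral (linepath a (fst p)) (\<lambda>\<zeta>. g (\<zeta>, snd p))"
  shows "\<And>x w. x \<in> A \<Longrightarrow> w \<in> B \<Longrightarrow> ((\<lambda>x. J (x, w)) has_field_derivative g (x, w)) (at x)"
    and "holo_on J (A \<times> B)"
proof -
  have AB: "open (A \<times> B)" using A B by (simp add: open_Times)
  have cg: "continuous_on (A \<times> B) g" by (rule holo_on_imp_continuous_on[OF g])
  show *: "((\<lambda>x. J (x, w)) has_field_derivative g (x, w)) (at x)" if xw: "x \<in> A" "w \<in> B" for x w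
  proof -
    have "(\<lambda>\<zeta>. g (\<zeta>, w)) holomorphic_on A"
      unfolding holomorphic_on_def
      using holo_on_slices(1)[OF g, of "(_, w)"] xw by (simp add: field_differentiable_at_within)
    then obtain G where G: "\<And>z. z \<in> A \<Longrightarrow> (G has_field_derivative g (z, w)) (at z within A)"
      using holomorphic_convex_primitive'[OF A(2,1)] by blast
    have J: "J (z, w) = G z - G a" if "z \<in> A" for z
    proof -
      have "((\<lambda>\<zeta>. g (\<zeta>, w)) has_contour_integral (G z - G a)) (linepath a z)"
        using contour_integral_primitive[OF G, of "linepath a z"] A that
        by (simp add: closed_segment_subset)
      then show ?thesis by (simp add: J_def contour_integral_unique)
    qed
    have "((\<lambda>z. G z - G a) has_field_derivative g (x, w)) (at x)"
      using G[OF xw(1)] at_within_open[OF xw(1) A(1)] by (auto intro!: derivative_eq_intros)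
    then show ?thesis
      by (rule has_field_derivative_transform_within_open[OF _ A(1) xw(1)]) (simp add: J)
  qed
  have J: "J p = integral (cbox 0 1) (\<lambda>t. g (linepath a (fst p) t, snd p) * (fst p - a))" for p
    by (simp add: J_def contour_integral_linepath_integral)
  show "holo_on J (A \<times> B)"
  proof (rule separately_holomorphic_imp_holo_on[OF AB])
    have "continuous_on ((A \<times> B) \<times> cbox 0 1)
        (\<lambda>(p, t). g (linepath a (fst p) t, snd p) * (fst p - a))"
      unfolding case_prod_beta' linepath_def
      by (intro continuous_intros continuous_on_compose2[OF cg])
         (use A in \<open>auto simp: convex_alt\<close>)
    from integral_continuous_on_param[OF this] show "continuous_on (A \<times> B) J"
      by (simp add: J)
  next
    fix p assume p: "p \<in> A \<times> B"
    show "(\<lambda>z. J (z, snd p)) field_differentiable at (fst p)"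
      using *[of "fst p" "snd p"] p unfolding field_differentiable_def by auto
    have lp: "linepath a (fst p) t \<in> A" if "t \<in> cbox 0 1" for t
      using linepath_in_convex[OF A(2,3)] p that by auto
    have "(\<lambda>w. integral (cbox 0 1) (\<lambda>t. g (linepath a (fst p) t, w) * (fst p - a))) holomorphic_on B"
    proof (rule leibniz_rule_holomorphic[where
          fx="\<lambda>w t. deriv (\<lambda>w. g (linepath a (fst p) t, w)) w * (fst p - a)", OF _ _ _ B(2)])
      fix w t assume w: "w \<in> B" and t: "t \<in> cbox (0::real) 1"
      have "(\<lambda>w. g (linepath a (fst p) t, w)) field_differentiable at w"
        using holo_on_slices(2)[OF g, of "(linepath a (fst p) t, w)"] lp[OF t] w by simp
      then have "((\<lambda>w. g (linepath a (fst p) t, w)) has_field_derivative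
          deriv (\<lambda>w. g (linepath a (fst p) t, w)) w) (at w within B)"
        by (simp add: field_differentiable_derivI has_field_derivative_at_within)
      then show "((\<lambda>w. g (linepath a (fst p) t, w) * (fst p - a)) has_field_derivative
          deriv (\<lambda>w. g (linepath a (fst p) t, w)) w * (fst p - a)) (at w within B)"
        by (rule DERIV_cmult_right)
    next
      fix w assume w: "w \<in> B"
      have "continuous_on (cbox 0 1) (\<lambda>t. g (linepath a (fst p) t, w) * (fst p - a))"
        by (intro continuous_intros continuous_on_compose2[OF cg] continuous_on_linepath)
          (use lp w in auto)
      then show "(\<lambda>t. g (linepath a (fst p) t, w) * (fst p - a)) integrable_on cbox 0 1"
        by (rule integrable_continuous)
    next
      have cd: "continuous_on (A \<times> B) (\<lambda>p. deriv (\<lambda>w. g (fst p, w)) (snd p))"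
        by (rule continuous_on_partial_deriv[OF AB cg]) (rule holo_on_slices(2)[OF g])
      have "continuous_on (B \<times> cbox 0 1)
          (\<lambda>q. (\<lambda>p. deriv (\<lambda>w. g (fst p, w)) (snd p)) (linepath a (fst p) (snd q), fst q))"
        by (rule continuous_on_compose2[OF cd])
          (use lp in \<open>auto intro!: continuous_intros continuous_on_compose2[OF continuous_on_linepath]\<close>)
      then show "continuous_on (B \<times> cbox 0 1)
          (\<lambda>(w, t). deriv (\<lambda>w. g (linepath a (fst p) t, w)) w * (fst p - a))"
        unfolding case_prod_beta' by (intro continuous_intros) simp
    qed
    then have "(\<lambda>w. J (fst p, w)) holomorphic_on B" by (simp add: J)
    then show "(\<lambda>w. J (fst p, w)) field_differentiable at (snd p)"
      using holomorphic_on_imp_differentiable_at B(1) p by auto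
  qed
qed

section \<open>Holomorphic dependence of solutions on initial values\<close>

text \<open>One estimate with three uses in the iteration: against the zero function to stay in the
  domain, between consecutive iterates for convergence, and between two initial values for
  injectivity.\<close>

lemma contour_integral_linepath_diff_bound:
  assumes "continuous_on (ball a \<rho>) f" "continuous_on (ball a \<rho>) g" "x \<in> ball a \<rho>"
    and "\<And>z. z \<in> ball a \<rho> \<Longrightarrow> cmod (f z - g z) \<le> B" "B \<ge> 0"
  shows "cmod (contour_integral (linepath a x) f - contour_integral (linepath a x) g) \<le> B * \<rho>"
proof -
  have seg: "closed_segment a x \<subseteq> ball a \<rho>"
    using assms(3) by (intro closed_segment_subset) (auto intro: le_less_trans[OF zero_le_dist])
  have int: "f contour_integrable_on linepath a x" "g contour_integrable_on linepath a x"
    using seg assms(1,2)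
    by (auto intro!: contour_integrable_continuous_linepath intro: continuous_on_subset)
  have "cmod (contour_integral (linepath a x) (\<lambda>z. f z - g z)) \<le> B * cmod (x - a)"
    using int assms(4,5) seg
    by (intro contour_integral_bound_linepath contour_integrable_diff) auto
  also have "\<dots> \<le> B * \<rho>"
    using assms(3,5) by (intro mult_left_mono) (auto simp: dist_norm norm_minus_commute)
  finally show ?thesis using int by (simp add: contour_integral_diff)
qed

text \<open>Circles of radius s < r around points of the inner disc stay in the doubled disc, so
  Cauchy's inequality bounds the derivative by M / s; letting s tend to r gives M / r.\<close>

lemma bounded_holomorphic_lipschitz:
  assumes f: "f holomorphic_on ball b (2 * r)"
    and M: "\<And>z. z \<in> ball b (2 * r) \<Longrightarrow> cmod (f z) \<le> M"
    and y: "y \<in> ball b r" "y' \<in> ball b r"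
  shows "cmod (f y - f y') \<le> M / r * cmod (y - y')"
proof (rule field_differentiable_bound[OF convex_ball, where f'="deriv f"])
  fix z assume z: "z \<in> ball b r"
  have r: "r > 0" using z by (auto intro: le_less_trans[OF zero_le_dist])
  have "z \<in> ball b (2 * r)" using z r by auto
  then show "(f has_field_derivative deriv f z) (at z within ball b r)"
    using f holomorphic_derivI by blast
  have sub: "ball z s \<subseteq> ball b (2 * r)" if "s \<le> r" for s
  proof
    fix w assume "w \<in> ball z s"
    with z that show "w \<in> ball b (2 * r)" using dist_triangle[of b w z] by auto
  qed
  have "cmod (deriv f z) \<le> M / s" if s: "0 < s" "s < r" for s
  proof -
    have cs: "cball z s \<subseteq> ball b (2 * r)"
    proof -
      have "cball z s \<subseteq> ball z r" using s by auto
      then show ?thesis using sub[of r] by blast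
    qed
    have "norm ((deriv ^^ 1) f z) \<le> fact 1 * M / s ^ 1"
    proof (rule Cauchy_inequality)
      show "f holomorphic_on ball z s" using holomorphic_on_subset[OF f] sub[of s] s by auto
      show "continuous_on (cball z s) f"
        using holomorphic_on_imp_continuous_on[OF holomorphic_on_subset[OF f cs]] .
      show "cmod (f x) \<le> M" if "cmod (z - x) = s" for x
        using that cs by (intro M) (auto simp: dist_norm)
    qed (use s in auto)
    then show ?thesis by simp
  qed
  then have "\<forall>\<^sub>F s in at_left r. cmod (deriv f z) \<le> M / s"
    using eventually_at_left_real[OF r] by (auto elim: eventually_mono)
  moreover have "((\<lambda>s. M / s) \<longlongrightarrow> M / r) (at_left r)"
    using r by (auto intro!: tendsto_intros)
  ultimately show "cmod (deriv f z) \<le> M / r"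
    by (intro tendsto_lowerbound[of "\<lambda>s. M / s"]) auto
qed (use y in auto)

text \<open>Picard iteration for y' = f (x, y) with y = w at x = a, over complex x. Every iterate is
  holomorphic in (x, w) and they converge uniformly, so the limit is holomorphic in each variable
  and jointly continuous, and Osgood's lemma applies.\<close>

lemma holomorphic_flow:
  fixes f :: "complex \<times> complex \<Rightarrow> complex"
  assumes S: "open S" and f: "holo_on f S" and ab: "(a, b) \<in> S"
  obtains \<rho> Y where "\<rho> > 0" "holo_on Y (ball a \<rho> \<times> ball b \<rho>)"
    "\<And>w. Y (a, w) = w"
    "\<And>x w. x \<in> ball a \<rho> \<Longrightarrow> w \<in> ball b \<rho> \<Longrightarrow> (x, Y (x, w)) \<in> S"
    "\<And>x w. x \<in> ball a \<rho> \<Longrightarrow> w \<in> ball b \<rho> \<Longrightarrow>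
       ((\<lambda>x. Y (x, w)) has_field_derivative f (x, Y (x, w))) (at x)"
    "\<And>x. x \<in> ball a \<rho> \<Longrightarrow> inj_on (\<lambda>w. Y (x, w)) (ball b \<rho>)"
proof -
  obtain R where R: "R > 0" "cball a R \<times> cball b R \<subseteq> S"
    using open_contains_cball_times[OF S ab] by metis
  define r where "r = R / 2"
  have r: "r > 0" "R = 2 * r" using R by (auto simp: r_def)
  have cf: "continuous_on S f" by (rule holo_on_imp_continuous_on[OF f])
  have "compact (f ` (cball a R \<times> cball b R))"
    by (intro compact_continuous_image continuous_on_subset[OF cf R(2)] compact_Times compact_cball)
  then obtain M0 where M0: "\<And>p. p \<in> cball a R \<times> cball b R \<Longrightarrow> cmod (f p) \<le> M0"
    using compact_imp_bounded bounded_iff by (metis imageI)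
  \<comment> \<open>M at least 1 ensures \<rho> \<le> r / 4 below.\<close>
  define M where "M = max 1 M0"
  have M: "M \<ge> 1" "\<And>p. p \<in> cball a R \<times> cball b R \<Longrightarrow> cmod (f p) \<le> M"
    using M0 by (auto simp: M_def le_max_iff_disj)
  \<comment> \<open>Chosen so that an integral of f over a segment of length below \<rho> is at most
    r / 4, and so that the integral operator contracts with factor M / r * \<rho> = 1 / 4.\<close>
  define \<rho> where "\<rho> = r / (4 * M)"
  have \<rho>: "\<rho> > 0" "M * \<rho> = r / 4" "M / r * \<rho> = 1 / 4" "\<rho> \<le> r / 4"
    using r M by (auto simp: \<rho>_def field_simps)
  define Q where "Q = ball a \<rho> \<times> ball b \<rho>"
  have Q: "open Q" by (simp add: Q_def open_Times)
  have lip: "cmod (f (x, y) - f (x, y')) \<le> M / r * cmod (y - y')"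
    if "x \<in> ball a \<rho>" "y \<in> ball b r" "y' \<in> ball b r" for x y y'
  proof (rule bounded_holomorphic_lipschitz[where f="\<lambda>w. f (x, w)", OF _ _ that(2,3)])
    have xR: "x \<in> cball a R" using that(1) \<rho> r by auto
    have inS: "(x, w) \<in> S" if "w \<in> ball b (2 * r)" for w
      using R(2) xR that r(2) by auto
    show "(\<lambda>w. f (x, w)) holomorphic_on ball b (2 * r)"
      by (rule holo_on_slice_holomorphic[OF f inS])
    show "cmod (f (x, z)) \<le> M" if "z \<in> ball b (2 * r)" for z
      using M(2)[of "(x, z)"] xR that r(2) by auto
  qed
  define Y where "Y = rec_nat snd
    (\<lambda>n Yn p. snd p + contour_integral (linepath a (fst p)) (\<lambda>\<zeta>. f (\<zeta>, Yn (\<zeta>, snd p))))"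
  have Y0: "Y 0 = snd" by (simp add: Y_def)
  have YS: "Y (Suc n) = (\<lambda>p. snd p + contour_integral (linepath a (fst p)) (\<lambda>\<zeta>. f (\<zeta>, Y n (\<zeta>, snd p))))" for n
    by (simp add: Y_def)
  define g where "g n p = f (fst p, Y n p)" for n p
  have inS: "(x, y) \<in> S" "cmod (f (x, y)) \<le> M" if "x \<in> ball a \<rho>" "y \<in> ball b r" for x y
  proof -
    have "(x, y) \<in> cball a R \<times> cball b R" using that \<rho> r by auto
    then show "(x, y) \<in> S" "cmod (f (x, y)) \<le> M" using R M by auto
  qed
  \<comment> \<open>A deviation of at most r / 4 from w, with w within \<rho> \<le> r / 4 of b,
    keeps the iterates inside the disc of radius r where f is bounded and Lipschitz.\<close>
  have inv: "holo_on (Y n) Q \<and> (\<forall>p\<in>Q. cmod (Y n p - snd p) \<le> r / 4)" for n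
  proof (induction n)
    case 0
    show ?case using r by (simp add: Y0 holo_on_snd)
  next
    case (Suc n)
    have ball: "Y n p \<in> ball b r" if "p \<in> Q" for p
    proof -
      have "cmod (Y n p - snd p) \<le> r / 4" "dist b (snd p) < \<rho>" using Suc that by (auto simp: Q_def)
      moreover from this(2) have "dist b (snd p) < r / 4" using \<rho>(4) by linarith
      ultimately show ?thesis using dist_triangle[of b "Y n p" "snd p"] r
        by (simp add: dist_norm norm_minus_commute)
    qed
    have "holo_on (f \<circ> (\<lambda>p. (fst p, Y n p))) Q"
      by (rule holo_on_compose[OF _ f]) (use Suc ball inS in \<open>auto intro!: holo_on_Pair holo_on_fst simp: Q_def\<close>)
    then have hg: "holo_on (g n) Q" by (simp add: g_def[abs_def] o_def)
    have YS': "Y (Suc n) = (\<lambda>p. snd p + contour_integral (linepath a (fst p)) (\<lambda>\<zeta>. g n (\<zeta>, snd p)))"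
      by (simp add: YS g_def)
    have "holo_on (Y (Suc n)) Q"
      unfolding YS' Q_def using \<rho>(1)
      by (intro holo_on_add holo_on_snd holo_on_integral(2)) (use hg in \<open>auto simp: Q_def\<close>)
    moreover have "cmod (Y (Suc n) p - snd p) \<le> r / 4" if p: "p \<in> Q" for p
    proof -
      have "continuous_on (ball a \<rho>) (\<lambda>\<zeta>. g n (\<zeta>, snd p))"
        by (rule continuous_on_compose2[OF holo_on_imp_continuous_on[OF hg]])
          (use p in \<open>auto intro!: continuous_intros simp: Q_def\<close>)
      moreover have "cmod (g n (\<zeta>, snd p)) \<le> M" if "\<zeta> \<in> ball a \<rho>" for \<zeta>
        using inS(2)[OF that] ball p that by (auto simp: g_def Q_def)
      ultimately have "cmod (contour_integral (linepath a (fst p)) (\<lambda>\<zeta>. g n (\<zeta>, snd p))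
          - contour_integral (linepath a (fst p)) (\<lambda>\<zeta>. 0)) \<le> M * \<rho>"
        using p M by (intro contour_integral_linepath_diff_bound) (auto simp: Q_def)
      then show ?thesis using \<rho>(2) by (simp add: YS')
    qed
    ultimately show ?case by blast
  qed
  have Ybd: "cmod (Y n p - b) \<le> r / 2" if "p \<in> Q" for n p
  proof -
    have "cmod (Y n p - snd p) \<le> r / 4" "cmod (snd p - b) < \<rho>"
      using inv[of n] that by (auto simp: Q_def dist_norm norm_minus_commute)
    moreover from this(2) have "cmod (snd p - b) < r / 4" using \<rho>(4) by linarith
    ultimately show ?thesis using norm_triangle_ineq[of "Y n p - snd p" "snd p - b"] by simp
  qed
  have ball: "Y n p \<in> ball b r" if "p \<in> Q" for n p
    using Ybd[OF that, of n] r by (simp add: dist_norm norm_minus_commute)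
  have hg: "holo_on (g n) Q" for n
  proof -
    have "holo_on (f \<circ> (\<lambda>p. (fst p, Y n p))) Q"
      by (rule holo_on_compose[OF _ f]) (use inv[of n] ball inS in \<open>auto intro!: holo_on_Pair holo_on_fst simp: Q_def\<close>)
    then show ?thesis by (simp add: g_def[abs_def] o_def)
  qed
  have cg: "continuous_on (ball a \<rho>) (\<lambda>\<zeta>. g n (\<zeta>, w))" if "w \<in> ball b \<rho>" for n w
    by (rule continuous_on_compose2[OF holo_on_imp_continuous_on[OF hg]])
      (use that in \<open>auto intro!: continuous_intros simp: Q_def\<close>)
  have YS': "Y (Suc n) p = snd p + contour_integral (linepath a (fst p)) (\<lambda>\<zeta>. g n (\<zeta>, snd p))" for n p
    by (simp add: YS g_def)
  have dY: "((\<lambda>x. Y (Suc n) (x, w)) has_field_derivative g n (x, w)) (at x)"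
    if "x \<in> ball a \<rho>" "w \<in> ball b \<rho>" for n x w
    unfolding YS' using \<rho>(1) that
    by (auto intro!: derivative_eq_intros holo_on_integral(1)[where A="ball a \<rho>" and B="ball b \<rho>", simplified]
        simp: hg[unfolded Q_def])
  have diff: "\<forall>p\<in>Q. cmod (Y (Suc n) p - Y n p) \<le> (1/4) ^ n * (r / 4)" for n
  proof (induction n)
    case 0
    then show ?case using inv[of "Suc 0"] by (simp add: Y0)
  next
    case (Suc n)
    show ?case
    proof
      fix p assume p: "p \<in> Q"
      have "cmod (g (Suc n) (z, snd p) - g n (z, snd p)) \<le> M / r * ((1/4) ^ n * (r / 4))"
        if z: "z \<in> ball a \<rho>" for z
      proof -
        have q: "(z, snd p) \<in> Q" using z p by (auto simp: Q_def)
        have "cmod (g (Suc n) (z, snd p) - g n (z, snd p)) \<le>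
            M / r * cmod (Y (Suc n) (z, snd p) - Y n (z, snd p))"
          using lip[OF z ball ball] q by (simp add: g_def)
        also have "\<dots> \<le> M / r * ((1/4) ^ n * (r / 4))"
          using Suc q M r by (intro mult_left_mono) auto
        finally show ?thesis .
      qed
      then have "cmod (contour_integral (linepath a (fst p)) (\<lambda>\<zeta>. g (Suc n) (\<zeta>, snd p))
          - contour_integral (linepath a (fst p)) (\<lambda>\<zeta>. g n (\<zeta>, snd p))) \<le> (M / r * ((1/4) ^ n * (r / 4))) * \<rho>"
        using p M r by (intro contour_integral_linepath_diff_bound cg) (auto simp: Q_def)
      also have "\<dots> = (M / r * \<rho>) * ((1/4) ^ n * (r / 4))" by (simp only: ac_simps)
      also have "\<dots> = (1/4) ^ Suc n * (r / 4)" by (simp only: \<rho>(3) power_Suc mult.assoc)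
      finally show "cmod (Y (Suc (Suc n)) p - Y (Suc n) p) \<le> (1/4) ^ Suc n * (r / 4)"
        by (simp only: YS' add_diff_add) simp
    qed
  qed
  \<comment> \<open>Each iterate differs from the identity in w by a map with Lipschitz constant 1 /
    2. The bound reproduces itself: the iterate is then (3/2)-Lipschitz, and the operator
    contributes 1/4 * 3/2 \<le> 1/2. In the limit it yields injectivity in w.\<close>
  have lipw: "\<forall>x\<in>ball a \<rho>. \<forall>w\<in>ball b \<rho>. \<forall>w'\<in>ball b \<rho>.
      cmod ((Y n (x, w) - Y n (x, w')) - (w - w')) \<le> 1/2 * cmod (w - w')" for n
  proof (induction n)
    case 0
    then show ?case by (simp add: Y0)
  next
    case (Suc n)
    show ?case
    proof (intro ballI)
      fix x w w' assume x: "x \<in> ball a \<rho>" and w: "w \<in> ball b \<rho>" and w': "w' \<in> ball b \<rho>"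
      have "cmod (g n (z, w) - g n (z, w')) \<le> M / r * (3/2 * cmod (w - w'))"
        if z: "z \<in> ball a \<rho>" for z
      proof -
        have q: "(z, w) \<in> Q" "(z, w') \<in> Q" using z w w' by (auto simp: Q_def)
        have "cmod (Y n (z, w) - Y n (z, w')) \<le> 3/2 * cmod (w - w')"
        proof -
          have "cmod ((Y n (z, w) - Y n (z, w')) - (w - w')) \<le> 1/2 * cmod (w - w')"
            using Suc z w w' by blast
          then show ?thesis
            using norm_triangle_sub[of "Y n (z, w) - Y n (z, w')" "w - w'"] by linarith
        qed
        moreover have "cmod (g n (z, w) - g n (z, w')) \<le> M / r * cmod (Y n (z, w) - Y n (z, w'))"
          using lip[OF z ball ball] q by (simp add: g_def)
        moreover have "M / r \<ge> 0" using M r by simp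
        ultimately show ?thesis by (meson mult_left_mono order_trans)
      qed
      then have "cmod (contour_integral (linepath a x) (\<lambda>\<zeta>. g n (\<zeta>, w))
          - contour_integral (linepath a x) (\<lambda>\<zeta>. g n (\<zeta>, w'))) \<le> (M / r * (3/2 * cmod (w - w'))) * \<rho>"
        using x w w' M r by (intro contour_integral_linepath_diff_bound cg) auto
      also have "\<dots> = (M / r * \<rho>) * (3/2 * cmod (w - w'))" by (simp only: ac_simps)
      also have "\<dots> \<le> 1/2 * cmod (w - w')" unfolding \<rho>(3) by simp
      finally show "cmod ((Y (Suc n) (x, w) - Y (Suc n) (x, w')) - (w - w')) \<le> 1/2 * cmod (w - w')"
        by (simp add: YS' algebra_simps)
    qed
  qed
  \<comment> \<open>The limit is written as a telescoping series in order to use the geometric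
    bounds in the Weierstrass test.\<close>
  define Z where "Z p = snd p + (\<Sum>i. Y (Suc i) p - Y i p)" for p
  have "uniform_limit Q (\<lambda>n p. \<Sum>i<n. Y (Suc i) p - Y i p) (\<lambda>p. \<Sum>i. Y (Suc i) p - Y i p) sequentially"
    by (rule Weierstrass_m_test[of _ _ "\<lambda>n. (1/4) ^ n * (r / 4)"])
       (use diff in \<open>auto intro!: summable_mult2 summable_geometric\<close>)
  then have wm: "uniform_limit Q (\<lambda>n p. Y n p - Y 0 p) (\<lambda>p. \<Sum>i. Y (Suc i) p - Y i p) sequentially"
    by (simp add: sum_lessThan_telescope[of "\<lambda>i. Y i _"])
  have "uniform_limit Q (\<lambda>n p. snd p + (Y n p - Y 0 p)) Z sequentially"
    unfolding Z_def by (intro uniform_limit_intros wm)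
  then have ul: "uniform_limit Q Y Z sequentially" by (simp add: Y0)
  have lim: "(\<lambda>n. Y n p) \<longlonglongrightarrow> Z p" if "p \<in> Q" for p
    by (rule tendsto_uniform_limitI[OF ul that])
  have Zball: "Z p \<in> ball b r" if p: "p \<in> Q" for p
  proof -
    have "(\<lambda>n. cmod (Y n p - b)) \<longlonglongrightarrow> cmod (Z p - b)" by (intro tendsto_intros lim p)
    then have "cmod (Z p - b) \<le> r / 2"
      by (rule LIMSEQ_le_const2) (use Ybd[OF p] in auto)
    then show ?thesis using r by (simp add: dist_norm norm_minus_commute)
  qed
  have cZ: "continuous_on Q Z"
    by (rule uniform_limit_theorem[OF _ ul])
      (use inv in \<open>auto intro!: always_eventually holo_on_imp_continuous_on\<close>)
  have dZ: "((\<lambda>x. Z (x, w)) has_field_derivative f (x, Z (x, w))) (at x)"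
    if x: "x \<in> ball a \<rho>" and w: "w \<in> ball b \<rho>" for x w
  proof -
    \<comment> \<open>Locally uniform limits of holomorphic functions may be differentiated
      termwise, and the derivatives of the iterates converge to f along the limit; so the limit
      solves the equation.\<close>
    have "\<exists>g'. \<forall>x\<in>ball a \<rho>. ((\<lambda>x. Z (x, w)) has_field_derivative g' x) (at x) \<and>
        (\<lambda>n. g n (x, w)) \<longlonglongrightarrow> g' x"
    proof (rule has_complex_derivative_uniform_sequence[where f="\<lambda>n x. Y (Suc n) (x, w)"])
      fix x assume x: "x \<in> ball a \<rho>"
      obtain d where d: "d > 0" "cball x d \<subseteq> ball a \<rho>"
        using x open_contains_cball open_ball by metis
      have "uniform_limit Q (\<lambda>n. Y (Suc n)) Z sequentially"
        using ul filterlim_compose[OF _ filterlim_Suc] by blast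
      then have "uniform_limit (cball x d) (\<lambda>n x. Y (Suc n) (x, w)) (\<lambda>x. Z (x, w)) sequentially"
        by (rule uniform_limit_compose'[where h="\<lambda>x. (x, w)"]) (use d w in \<open>auto simp: Q_def\<close>)
      with d show "\<exists>d>0. cball x d \<subseteq> ball a \<rho> \<and>
          uniform_limit (cball x d) (\<lambda>n x. Y (Suc n) (x, w)) (\<lambda>x. Z (x, w)) sequentially" by blast
    qed (use dY w in auto)
    then obtain g' where g': "((\<lambda>x. Z (x, w)) has_field_derivative g' x) (at x)"
      "(\<lambda>n. g n (x, w)) \<longlonglongrightarrow> g' x" using x by blast
    have "(\<lambda>n. f (x, Y n (x, w))) \<longlonglongrightarrow> f (x, Z (x, w))"
    proof (rule isCont_tendsto_compose[where g=f])
      have "(x, Z (x, w)) \<in> S" using inS(1)[OF x Zball] x w by (auto simp: Q_def)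
      then show "isCont f (x, Z (x, w))" using cf S by (simp add: continuous_on_eq_continuous_at)
      show "(\<lambda>n. (x, Y n (x, w))) \<longlonglongrightarrow> (x, Z (x, w))"
        using x w by (intro tendsto_intros lim) (auto simp: Q_def)
    qed
    then have "g' x = f (x, Z (x, w))"
      using g'(2) LIMSEQ_unique by (simp add: g_def)
    with g'(1) show ?thesis by simp
  qed
  have hZ: "holo_on Z Q"
  proof (rule separately_holomorphic_imp_holo_on[OF Q cZ])
    fix p assume p: "p \<in> Q"
    show "(\<lambda>z. Z (z, snd p)) field_differentiable at (fst p)"
      using dZ[of "fst p" "snd p"] p unfolding field_differentiable_def Q_def by auto
    have "(\<lambda>w. Z (fst p, w)) holomorphic_on ball b \<rho>"
    proof (rule holomorphic_uniform_sequence[where f="\<lambda>n w. Y n (fst p, w)"])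
      show "(\<lambda>w. Y n (fst p, w)) holomorphic_on ball b \<rho>" for n
        by (rule holo_on_slice_holomorphic[of _ Q]) (use inv p in \<open>auto simp: Q_def\<close>)
      fix y assume y: "y \<in> ball b \<rho>"
      obtain d where d: "d > 0" "cball y d \<subseteq> ball b \<rho>"
        using y open_contains_cball open_ball by metis
      have "uniform_limit (cball y d) (\<lambda>n w. Y n (fst p, w)) (\<lambda>w. Z (fst p, w)) sequentially"
        by (rule uniform_limit_compose'[OF ul, where h="\<lambda>w. (fst p, w)"]) (use d p in \<open>auto simp: Q_def\<close>)
      with d show "\<exists>d>0. cball y d \<subseteq> ball b \<rho> \<and>
          uniform_limit (cball y d) (\<lambda>n w. Y n (fst p, w)) (\<lambda>w. Z (fst p, w)) sequentially" by blast
    qed auto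
    then show "(\<lambda>w. Z (fst p, w)) field_differentiable at (snd p)"
      using holomorphic_on_imp_differentiable_at p by (auto simp: Q_def)
  qed
  have Za: "Z (a, w) = w" for w
  proof -
    have "Y n (a, w) = w" for n by (cases n) (auto simp: Y0 YS)
    then show ?thesis by (simp add: Z_def)
  qed
  have injZ: "inj_on (\<lambda>w. Z (x, w)) (ball b \<rho>)" if x: "x \<in> ball a \<rho>" for x
  proof (rule inj_onI)
    fix w w' assume w: "w \<in> ball b \<rho>" and w': "w' \<in> ball b \<rho>" and eq: "Z (x, w) = Z (x, w')"
    have "(\<lambda>n. cmod ((Y n (x, w) - Y n (x, w')) - (w - w'))) \<longlonglongrightarrow> cmod ((Z (x, w) - Z (x, w')) - (w - w'))"
      using x w w' by (intro tendsto_intros lim) (auto simp: Q_def)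
    then have "cmod ((Z (x, w) - Z (x, w')) - (w - w')) \<le> 1/2 * cmod (w - w')"
      by (rule LIMSEQ_le_const2) (use lipw x w w' in auto)
    then show "w = w'" using eq by (simp add: norm_minus_commute)
  qed
  show ?thesis
  proof (rule that[of \<rho> Z])
    show "(x, Z (x, w)) \<in> S" if "x \<in> ball a \<rho>" "w \<in> ball b \<rho>" for x w
      using inS(1)[OF that(1) Zball] that by (auto simp: Q_def)
  qed (use \<rho> hZ Za dZ injZ in \<open>auto simp: Q_def\<close>)
qed

section \<open>Straightening a nonvanishing vector field\<close>

text \<open>The inverse function theorem gives the inverse derivative; it commutes with complex
  scalars because the derivative it inverts does.\<close>

lemma holo_on_inverse:
  fixes \<Psi> :: "complex \<times> complex \<Rightarrow> complex \<times> complex"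
  assumes S: "open S" and h: "holo_on \<Psi> S" and inv: "\<And>q. q \<in> S \<Longrightarrow> \<Theta> (\<Psi> q) = q"
    and nd: "\<And>q L. q \<in> S \<Longrightarrow> (\<Psi> has_derivative L) (at q) \<Longrightarrow> inj L"
  shows "holo_on \<Theta> (\<Psi> ` S)"
  unfolding holo_on_def
proof
  fix p assume "p \<in> \<Psi> ` S"
  then obtain q where q: "q \<in> S" and p: "p = \<Psi> q" by blast
  obtain L where L: "(\<Psi> has_derivative L) (at q)" "\<And>c v. L (c *\<^sub>C v) = c *\<^sub>C L v"
    using holo_onE[OF h q] by blast
  have lin: "linear L" using L(1) has_derivative_linear by blast
  have "inj L" using nd[OF q L(1)] .
  then obtain M where M: "linear M" "M \<circ> L = id" "L \<circ> M = id"
    using linear_injective_isomorphism[OF lin] by (auto simp: fun_eq_iff)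
  have "(\<Theta> has_derivative M) (at p)"
    unfolding p by (rule has_derivative_inverse_strong[OF S q holo_on_imp_continuous_on[OF h] inv L(1) M(3)])
  moreover have "M (c *\<^sub>C v) = c *\<^sub>C M v" for c v
    using L(2)[of c "M v"] M(2,3) by (metis comp_apply id_apply)
  ultimately show "\<exists>L. (\<Theta> has_derivative L) (at p) \<and> (\<forall>c v. L (c *\<^sub>C v) = c *\<^sub>C L v)" by blast
qed

text \<open>Where the first component of v does not vanish, the integral curves are graphs of
  solutions of y' = v2 / v1. The map (x, w) to (x, Y (x, w)) straightens them; its derivative is
  triangular with diagonal 1 and dY/dw.\<close>

lemma flow_normal_form_aux:
  fixes v :: "complex \<times> complex \<Rightarrow> complex \<times> complex"
  assumes S: "open S" and v: "holo_on v S" and p: "p \<in> S" and nz: "fst (v p) \<noteq> 0"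
  obtains a b :: complex and \<rho> \<Psi> \<Theta> where "\<rho> > 0" "open (\<Psi> ` (ball a \<rho> \<times> ball b \<rho>))"
    "\<Psi> ` (ball a \<rho> \<times> ball b \<rho>) \<subseteq> S" "p \<in> \<Psi> ` (ball a \<rho> \<times> ball b \<rho>)"
    "holo_on \<Psi> (ball a \<rho> \<times> ball b \<rho>)" "holo_on \<Theta> (\<Psi> ` (ball a \<rho> \<times> ball b \<rho>))"
    "\<And>q. q \<in> ball a \<rho> \<times> ball b \<rho> \<Longrightarrow> \<Theta> (\<Psi> q) = q"
    "\<And>q. q \<in> ball a \<rho> \<times> ball b \<rho> \<Longrightarrow> v (\<Psi> q) \<noteq> 0 \<and>
       (\<exists>k. k \<noteq> 0 \<and> ((\<lambda>x. \<Psi> (x, snd q)) has_derivative (\<lambda>h. (h * k) *\<^sub>C v (\<Psi> q))) (at (fst q)))"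
proof -
  obtain a b where ab: "p = (a, b)" by fastforce
  define S' where "S' = S \<inter> {q. fst (v q) \<noteq> 0}"
  have cv: "continuous_on S v" by (rule holo_on_imp_continuous_on[OF v])
  have "open (S \<inter> (fst \<circ> v) -` (- {0}))"
    by (rule continuous_open_preimage[OF _ S]) (auto simp: o_def intro!: continuous_intros cv)
  moreover have "S' = S \<inter> (fst \<circ> v) -` (- {0})" by (auto simp: S'_def)
  ultimately have S': "open S'" "S' \<subseteq> S" by (simp_all add: S'_def)
  have vS': "holo_on v S'" using holo_on_subset[OF v S'(2)] .
  have v1: "holo_on (\<lambda>q. fst (v q)) S'" "holo_on (\<lambda>q. snd (v q)) S'"
    using holo_on_compose[OF vS' holo_on_fst[of UNIV]] holo_on_compose[OF vS' holo_on_snd[of UNIV]] by (simp_all add: o_def)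
  define f where "f q = snd (v q) / fst (v q)" for q
  have f: "holo_on f S'"
    unfolding f_def by (rule holo_on_divide[OF v1(2,1)]) (simp add: S'_def)
  have "(a, b) \<in> S'" using p nz ab by (simp add: S'_def)
  obtain \<rho> Y where Y: "\<rho> > 0" "holo_on Y (ball a \<rho> \<times> ball b \<rho>)"
    "\<And>w. Y (a, w) = w"
    "\<And>x w. x \<in> ball a \<rho> \<Longrightarrow> w \<in> ball b \<rho> \<Longrightarrow> (x, Y (x, w)) \<in> S'"
    "\<And>x w. x \<in> ball a \<rho> \<Longrightarrow> w \<in> ball b \<rho> \<Longrightarrow>
       ((\<lambda>x. Y (x, w)) has_field_derivative f (x, Y (x, w))) (at x)"
    "\<And>x. x \<in> ball a \<rho> \<Longrightarrow> inj_on (\<lambda>w. Y (x, w)) (ball b \<rho>)"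
    by (rule holomorphic_flow[OF S'(1) f \<open>(a, b) \<in> S'\<close>]) (rule that)
  define Q where "Q = ball a \<rho> \<times> ball b \<rho>"
  have Q: "open Q" by (simp add: Q_def open_Times)
  define \<Psi> where "\<Psi> q = (fst q, Y q)" for q
  have inj: "inj_on \<Psi> Q"
  proof (rule inj_onI)
    fix q q' assume "q \<in> Q" "q' \<in> Q" "\<Psi> q = \<Psi> q'"
    then show "q = q'" using inj_onD[OF Y(6), of "fst q" "snd q" "snd q'"]
      by (cases q; cases q') (auto simp: Q_def \<Psi>_def)
  qed
  define \<Theta> where "\<Theta> = inv_into Q \<Psi>"
  have \<Theta>: "\<Theta> (\<Psi> q) = q" if "q \<in> Q" for q
    unfolding \<Theta>_def using inv_into_f_f[OF inj that] .
  have h\<Psi>: "holo_on \<Psi> Q"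
    unfolding \<Psi>_def[abs_def] Q_def by (intro holo_on_Pair holo_on_fst Y(2))
  have op: "open (\<Psi> ` Q)"
    by (rule invariance_of_domain[OF holo_on_imp_continuous_on[OF h\<Psi>] Q inj])
  have h\<Theta>: "holo_on \<Theta> (\<Psi> ` Q)"
  proof (rule holo_on_inverse[OF Q h\<Psi> \<Theta>])
    fix q L assume q: "q \<in> Q" and L: "(\<Psi> has_derivative L) (at q)"
    obtain x y where xy: "q = (x, y)" "x \<in> ball a \<rho>" "y \<in> ball b \<rho>" using q by (auto simp: Q_def)
    obtain M where M: "(\<Psi> has_derivative M) (at q)" "\<And>c v. M (c *\<^sub>C v) = c *\<^sub>C M v"
      using holo_onE[OF h\<Psi> q] by blast
    have LM: "L = M" using has_derivative_unique[OF L M(1)] .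
    have d1: "((\<lambda>p. fst (\<Psi> p)) has_derivative (\<lambda>h. fst (L h))) (at q)"
      by (rule has_derivative_fst[OF L])
    have "((\<lambda>p. fst (\<Psi> p)) has_derivative fst) (at q)"
      by (simp add: \<Psi>_def) (rule bounded_linear_imp_has_derivative[OF bounded_linear_fst])
    then have fstL: "fst (L h) = fst h" for h
      using has_derivative_unique[OF d1] by (metis)
    have "((\<lambda>w. Y (x, w)) has_derivative (\<lambda>h. snd (L (0, h)))) (at y)"
    proof -
      have "((\<lambda>w. (x, w)) has_derivative (\<lambda>h. (0, h))) (at y)"
        by (auto intro!: derivative_eq_intros)
      from has_derivative_snd[OF has_derivative_compose[OF this, of \<Psi> L]] L
      show ?thesis by (simp add: xy \<Psi>_def)
    qed
    then have "((\<lambda>w. Y (x, w)) has_field_derivative snd (L (0, 1))) (at y)"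
      by (rule clinear_complex_field_derivative)
        (use M(2)[of _ "(0,_)"] in \<open>auto simp: LM scaleC_prod_def\<close>)
    \<comment> \<open>An injective holomorphic function of one variable has no critical points, so
      injectivity of the flow already gives regularity.\<close>
    moreover have "deriv (\<lambda>w. Y (x, w)) y \<noteq> 0"
    proof (rule holomorphic_injective_imp_regular[OF _ _ Y(6)[OF xy(2)] xy(3)])
      show "(\<lambda>w. Y (x, w)) holomorphic_on ball b \<rho>"
        by (rule holo_on_slice_holomorphic[OF Y(2)]) (use xy(2) in auto)
    qed simp
    ultimately have c: "snd (L (0, 1)) \<noteq> 0" using DERIV_imp_deriv by metis
    have "linear L" using L has_derivative_linear by blast
    moreover have "h = 0" if "L h = 0" for h
    proof -
      obtain h1 h2 where h: "h = (h1, h2)" by fastforce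
      have "h1 = 0" using fstL[of h] that h by simp
      then have "L h = h2 *\<^sub>C L (0, 1)"
        using M(2)[of h2 "(0, 1)"] by (simp add: h LM scaleC_prod_def scaleC_complex_def)
      then have "h2 *\<^sub>C snd (L (0, 1)) = 0" using that by (simp add: scaleC_prod_def prod_eq_iff)
      then show "h = 0" using c h \<open>h1 = 0\<close> by (simp add: scaleC_complex_def zero_prod_def)
    qed
    ultimately show "inj L" by (simp add: linear_injective_0)
  qed
  have sub: "\<Psi> ` Q \<subseteq> S" using Y(4) S'(2) by (auto simp: Q_def \<Psi>_def)
  have pQ: "p \<in> \<Psi> ` Q"
  proof -
    have "\<Psi> (a, b) = p" by (simp add: \<Psi>_def ab Y(3))
    then show ?thesis using Y(1) by (intro image_eqI[of _ _ "(a, b)"]) (auto simp: Q_def)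
  qed
  have d: "v (\<Psi> q) \<noteq> 0 \<and>
       (\<exists>k. k \<noteq> 0 \<and> ((\<lambda>x. \<Psi> (x, snd q)) has_derivative (\<lambda>h. (h * k) *\<^sub>C v (\<Psi> q))) (at (fst q)))"
    if q: "q \<in> Q" for q
  proof -
    obtain x y where xy: "q = (x, y)" "x \<in> ball a \<rho>" "y \<in> ball b \<rho>" using q by (auto simp: Q_def)
    have nz: "fst (v (\<Psi> q)) \<noteq> 0" using Y(4)[OF xy(2,3)] by (simp add: S'_def \<Psi>_def xy)
    have "((\<lambda>x. Y (x, y)) has_derivative (\<lambda>h. f (\<Psi> q) * h)) (at x)"
      using Y(5)[OF xy(2,3)] by (simp add: has_field_derivative_def \<Psi>_def xy)
    then have "((\<lambda>x. \<Psi> (x, y)) has_derivative (\<lambda>h. (h, f (\<Psi> q) * h))) (at x)"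
      unfolding \<Psi>_def by (auto intro!: has_derivative_Pair)
    \<comment> \<open>The graph is parametrized by x, so its velocity is v rescaled to first
      component 1; this is where k = 1 / fst v comes from.\<close>
    moreover have "(\<lambda>h. (h, f (\<Psi> q) * h)) = (\<lambda>h. (h * (1 / fst (v (\<Psi> q)))) *\<^sub>C v (\<Psi> q))"
      using nz by (auto simp: fun_eq_iff scaleC_prod_def scaleC_complex_def f_def)
    ultimately show ?thesis
      using nz by (intro conjI exI[of _ "1 / fst (v (\<Psi> q))"]) (auto simp: xy)
  qed
  show ?thesis
    using that[OF Y(1), of \<Psi> a b \<Theta>] sub pQ d \<Theta> h\<Psi> op h\<Theta> unfolding Q_def by blast
qed

text \<open>If the first component vanishes at p the second does not, and exchanging the two
  coordinates, an involution that commutes with complex scalars, reduces to the case already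
  treated.\<close>

lemma flow_normal_form:
  fixes v :: "complex \<times> complex \<Rightarrow> complex \<times> complex"
  assumes S: "open S" and v: "holo_on v S" and p: "p \<in> S" and nz: "v p \<noteq> 0"
  obtains a b :: complex and \<rho> \<Psi> \<Theta> where "\<rho> > 0" "open (\<Psi> ` (ball a \<rho> \<times> ball b \<rho>))"
    "\<Psi> ` (ball a \<rho> \<times> ball b \<rho>) \<subseteq> S" "p \<in> \<Psi> ` (ball a \<rho> \<times> ball b \<rho>)"
    "holo_on \<Psi> (ball a \<rho> \<times> ball b \<rho>)" "holo_on \<Theta> (\<Psi> ` (ball a \<rho> \<times> ball b \<rho>))"
    "\<And>q. q \<in> ball a \<rho> \<times> ball b \<rho> \<Longrightarrow> \<Theta> (\<Psi> q) = q"
    "\<And>q. q \<in> ball a \<rho> \<times> ball b \<rho> \<Longrightarrow> v (\<Psi> q) \<noteq> 0 \<and>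
       (\<exists>k. k \<noteq> 0 \<and> ((\<lambda>x. \<Psi> (x, snd q)) has_derivative (\<lambda>h. (h * k) *\<^sub>C v (\<Psi> q))) (at (fst q)))"
proof (cases "fst (v p) = 0")
  case False
  show ?thesis
  proof (rule flow_normal_form_aux[OF S v p False], goal_cases)
    case (1 a b \<rho> \<Psi> \<Theta>)
    then show ?case using that[of \<rho> \<Psi> a b \<Theta>] by blast
  qed
next
  case True
  define sw :: "complex \<times> complex \<Rightarrow> complex \<times> complex" where "sw = prod.swap"
  have sw: "sw (sw q) = q" for q by (simp add: sw_def)
  have bl: "bounded_linear sw"
    unfolding sw_def prod.swap_def
    by (intro bounded_linear_Pair bounded_linear_fst bounded_linear_snd)
  have swC: "sw (c *\<^sub>C q) = c *\<^sub>C sw q" for c q by (simp add: sw_def scaleC_prod_def)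
  have hsw: "holo_on sw T" for T by (rule holo_on_linear[OF bl swC])
  have cont_sw: "continuous_on UNIV sw" using linear_continuous_on[OF bl] .
  have im: "sw ` T = sw -` T" for T using sw by (auto simp: image_iff) metis
  have osw: "open (sw ` T)" if "open T" for T
    unfolding im using continuous_on_open_vimage[of UNIV sw] cont_sw that by auto
  have hv: "holo_on (sw \<circ> (v \<circ> sw)) (sw ` S)"
  proof -
    have "holo_on (v \<circ> sw) (sw ` S)"
      by (rule holo_on_compose[OF hsw v]) (simp add: image_image sw)
    then show ?thesis by (rule holo_on_compose[OF _ hsw[of UNIV] subset_UNIV])
  qed
  have swp: "sw p \<in> sw ` S" using p by blast
  have "fst ((sw \<circ> (v \<circ> sw)) (sw p)) \<noteq> 0"
    using True nz by (simp add: sw) (simp add: sw_def prod_eq_iff)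
  then obtain a b :: complex and \<rho> \<Psi> \<Theta> where *: "\<rho> > 0" "open (\<Psi> ` (ball a \<rho> \<times> ball b \<rho>))"
    "\<Psi> ` (ball a \<rho> \<times> ball b \<rho>) \<subseteq> sw ` S" "sw p \<in> \<Psi> ` (ball a \<rho> \<times> ball b \<rho>)"
    "holo_on \<Psi> (ball a \<rho> \<times> ball b \<rho>)" "holo_on \<Theta> (\<Psi> ` (ball a \<rho> \<times> ball b \<rho>))"
    "\<And>q. q \<in> ball a \<rho> \<times> ball b \<rho> \<Longrightarrow> \<Theta> (\<Psi> q) = q"
    "\<And>q. q \<in> ball a \<rho> \<times> ball b \<rho> \<Longrightarrow> (sw \<circ> (v \<circ> sw)) (\<Psi> q) \<noteq> 0 \<and>
       (\<exists>k. k \<noteq> 0 \<and> ((\<lambda>x. \<Psi> (x, snd q)) has_derivative (\<lambda>h. (h * k) *\<^sub>C (sw \<circ> (v \<circ> sw)) (\<Psi> q))) (at (fst q)))"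
    by (rule flow_normal_form_aux[OF osw[OF S] hv swp]) (rule that)
  show ?thesis
  proof (rule that[of \<rho> "sw \<circ> \<Psi>" a b "\<Theta> \<circ> sw", OF *(1)])
    show "open ((sw \<circ> \<Psi>) ` (ball a \<rho> \<times> ball b \<rho>))" using osw[OF *(2)] by (simp add: image_comp)
    show "(sw \<circ> \<Psi>) ` (ball a \<rho> \<times> ball b \<rho>) \<subseteq> S" using image_mono[OF *(3), of sw] by (simp add: image_image sw)
    show "p \<in> (sw \<circ> \<Psi>) ` (ball a \<rho> \<times> ball b \<rho>)" using imageI[OF *(4), of sw] by (simp add: image_comp sw)
    show "holo_on (sw \<circ> \<Psi>) (ball a \<rho> \<times> ball b \<rho>)"
      by (rule holo_on_compose[OF *(5) hsw[of UNIV]]) simp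
    show "holo_on (\<Theta> \<circ> sw) ((sw \<circ> \<Psi>) ` (ball a \<rho> \<times> ball b \<rho>))"
      by (rule holo_on_compose[OF hsw *(6)]) (simp add: image_image sw)
    fix q assume q: "q \<in> ball a \<rho> \<times> ball b \<rho>"
    show "(\<Theta> \<circ> sw) ((sw \<circ> \<Psi>) q) = q" using *(7)[OF q] sw by simp
    have nz: "v (sw (\<Psi> q)) \<noteq> 0" using *(8)[OF q] by (auto simp: sw_def prod_eq_iff)
    obtain k where k: "k \<noteq> 0"
      "((\<lambda>x. \<Psi> (x, snd q)) has_derivative (\<lambda>h. (h * k) *\<^sub>C (sw \<circ> (v \<circ> sw)) (\<Psi> q))) (at (fst q))"
      using *(8)[OF q] by blast
    have "((\<lambda>x. sw (\<Psi> (x, snd q))) has_derivative (\<lambda>h. sw ((h * k) *\<^sub>C (sw \<circ> (v \<circ> sw)) (\<Psi> q)))) (at (fst q))"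
      by (rule bounded_linear.has_derivative[OF bl k(2)])
    then have "((\<lambda>x. (sw \<circ> \<Psi>) (x, snd q)) has_derivative (\<lambda>h. (h * k) *\<^sub>C v ((sw \<circ> \<Psi>) q))) (at (fst q))"
      by (simp add: swC sw)
    with k(1) nz show "v ((sw \<circ> \<Psi>) q) \<noteq> 0 \<and>
       (\<exists>k. k \<noteq> 0 \<and> ((\<lambda>x. (sw \<circ> \<Psi>) (x, snd q)) has_derivative (\<lambda>h. (h * k) *\<^sub>C v ((sw \<circ> \<Psi>) q))) (at (fst q)))"
      by auto
  qed
qed

subsection \<open>Charts and etale maps\<close>

lemma compatible_chartD:
  assumes "compatible_chart M U \<phi>"
  shows "openin (mtop M) U" "open (\<phi> ` U)" "inj_on \<phi> U"
    "homeomorphic_map (subtopology (mtop M) U) (top_of_set (\<phi> ` U)) \<phi>"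
    "\<And>x. x \<in> U \<Longrightarrow> inv_into U \<phi> (\<phi> x) = x"
proof -
  show *: "openin (mtop M) U" "open (\<phi> ` U)"
    "homeomorphic_map (subtopology (mtop M) U) (top_of_set (\<phi> ` U)) \<phi>"
    using assms by (auto simp: compatible_chart_def)
  have "topspace (subtopology (mtop M) U) = U" using openin_subset[OF *(1)] by auto
  then show inj: "inj_on \<phi> U" using homeomorphic_imp_injective_map[OF *(3)] by simp
  show "inv_into U \<phi> (\<phi> x) = x" if "x \<in> U" for x using inv_into_f_f[OF inj that] .
qed

lemma chart_topspace: "compatible_chart M U \<phi> \<Longrightarrow> U \<subseteq> topspace (mtop M)"
  using compatible_chartD(1) openin_subset by blast

lemma chart_open_image:
  assumes "compatible_chart M U \<phi>" "openin (mtop M) W" "W \<subseteq> U"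
  shows "open (\<phi> ` W)"
proof -
  have "openin (subtopology (mtop M) U) W"
    using assms(2,3) by (simp add: openin_subtopology_alt) blast
  then have "openin (top_of_set (\<phi> ` U)) (\<phi> ` W)"
    using homeomorphic_imp_open_map[OF compatible_chartD(4)[OF assms(1)]] by (simp add: open_map_def)
  then show ?thesis using compatible_chartD(2)[OF assms(1)] by (simp add: openin_open_eq)
qed

lemma chart_continuous:
  assumes "compatible_chart M U \<phi>"
  shows "continuous_map (subtopology (mtop M) U) euclidean \<phi>"
  using homeomorphic_imp_continuous_map[OF compatible_chartD(4)[OF assms]] continuous_map_in_subtopology by blast

lemma chart_openin_preimage:
  assumes "compatible_chart M U \<phi>" "open Q"
  shows "openin (mtop M) {x \<in> U. \<phi> x \<in> Q}"
proof -
  have "openin (subtopology (mtop M) U) {x \<in> topspace (subtopology (mtop M) U). \<phi> x \<in> Q}"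
    using openin_continuous_map_preimage[OF chart_continuous[OF assms(1)]] assms(2) by auto
  moreover have "{x \<in> topspace (subtopology (mtop M) U). \<phi> x \<in> Q} = {x \<in> U. \<phi> x \<in> Q}"
    using chart_topspace[OF assms(1)] by auto
  ultimately show ?thesis
    using openin_trans_full compatible_chartD(1)[OF assms(1)] by metis
qed

lemma chart_inv_continuous:
  assumes "compatible_chart M U \<phi>"
  shows "continuous_map (top_of_set (\<phi> ` U)) (mtop M) (inv_into U \<phi>)"
proof -
  obtain g where g: "homeomorphic_maps (subtopology (mtop M) U) (top_of_set (\<phi> ` U)) \<phi> g"
    using compatible_chartD(4)[OF assms] homeomorphic_map_maps by blast
  have "continuous_map (top_of_set (\<phi> ` U)) (mtop M) g"
    using g continuous_map_into_fulltopology by (auto simp: homeomorphic_maps_def)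
  then show ?thesis
    by (rule continuous_map_eq)
      (use g chart_topspace[OF assms] compatible_chartD(5)[OF assms] in \<open>auto simp: homeomorphic_maps_def\<close>)
qed

lemma atlas_chart:
  assumes "complex_manifold M" "(U, \<phi>) \<in> charts M"
  shows "compatible_chart M U \<phi>"
  using assms by (auto simp: complex_manifold_def)

lemma atlas_covers:
  assumes "complex_manifold M" "x \<in> topspace (mtop M)"
  obtains U \<phi> where "(U, \<phi>) \<in> charts M" "x \<in> U"
proof -
  have "x \<in> (\<Union>(U, \<phi>)\<in>charts M. U)" using assms by (simp add: complex_manifold_def)
  then show ?thesis using that by auto
qed

text \<open>Compatibility is only required against the charts of the atlas; between two compatible
  charts the coordinate change factors, near each point, through an atlas chart around that
  point.\<close>

lemma chart_transition:
  assumes M: "complex_manifold M" and U: "compatible_chart M U \<phi>" and V: "compatible_chart M V \<psi>"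
  shows "holo_on (\<psi> \<circ> inv_into U \<phi>) (\<phi> ` (U \<inter> V))"
proof (rule holo_on_locally)
  fix q assume "q \<in> \<phi> ` (U \<inter> V)"
  then obtain x where x: "x \<in> U" "x \<in> V" "q = \<phi> x" by auto
  obtain W \<eta> where W: "(W, \<eta>) \<in> charts M" "x \<in> W"
    using atlas_covers[OF M] chart_topspace[OF U] x(1) by blast
  note cW = atlas_chart[OF M W(1)]
  let ?A = "U \<inter> V \<inter> W"
  have A: "openin (mtop M) ?A"
    using compatible_chartD(1)[OF U] compatible_chartD(1)[OF V] compatible_chartD(1)[OF cW] by blast
  have op: "open (\<phi> ` ?A)" using chart_open_image[OF U A] by blast
  have "holo_on (\<eta> \<circ> inv_into U \<phi>) (\<phi> ` (U \<inter> W))"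
    using U W(1) by (auto simp: compatible_chart_def)
  then have h1: "holo_on (\<eta> \<circ> inv_into U \<phi>) (\<phi> ` ?A)"
    by (rule holo_on_subset) auto
  have h2: "holo_on (\<psi> \<circ> inv_into W \<eta>) (\<eta> ` (V \<inter> W))"
    using V W(1) by (auto simp: compatible_chart_def)
  have "holo_on ((\<psi> \<circ> inv_into W \<eta>) \<circ> (\<eta> \<circ> inv_into U \<phi>)) (\<phi> ` ?A)"
    by (rule holo_on_compose[OF h1 h2]) (auto simp: compatible_chartD(5)[OF U])
  then have "holo_on (\<psi> \<circ> inv_into U \<phi>) (\<phi> ` ?A)"
    by (rule holo_on_cong_open[OF op])
      (auto simp: compatible_chartD(5)[OF U] compatible_chartD(5)[OF cW])
  then show "\<exists>T. q \<in> T \<and> holo_on (\<psi> \<circ> inv_into U \<phi>) T"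
    using x W(2) by (intro exI[of _ "\<phi> ` ?A"] conjI) auto
qed

lemma compatible_chartI:
  assumes "openin (mtop M) U" "open (\<phi> ` U)"
    and "homeomorphic_map (subtopology (mtop M) U) (top_of_set (\<phi> ` U)) \<phi>"
    and "\<And>V \<psi>. (V, \<psi>) \<in> charts M \<Longrightarrow> holo_on (\<psi> \<circ> inv_into U \<phi>) (\<phi> ` (U \<inter> V))"
    and "\<And>V \<psi>. (V, \<psi>) \<in> charts M \<Longrightarrow> holo_on (\<phi> \<circ> inv_into V \<psi>) (\<psi> ` (U \<inter> V))"
  shows "compatible_chart M U \<phi>"
  unfolding compatible_chart_def using assms by blast

text \<open>This turns the straightening map of a vector field into a chart of the surface: a chart
  followed by a local biholomorphism of the model, with inverse \<Psi>, is again compatible.\<close>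

lemma compatible_chart_compose:
  assumes M: "complex_manifold M" and U: "compatible_chart M U \<phi>"
    and W: "openin (mtop M) W" "W \<subseteq> U"
    and \<Theta>: "holo_on \<Theta> (\<phi> ` W)" and \<Psi>: "holo_on \<Psi> (\<Theta> ` \<phi> ` W)"
    and inv: "\<And>q. q \<in> \<phi> ` W \<Longrightarrow> \<Psi> (\<Theta> q) = q" and op: "open (\<Theta> ` \<phi> ` W)"
  shows "compatible_chart M W (\<Theta> \<circ> \<phi>)"
proof (rule compatible_chartI[OF W(1)])
  note inU = compatible_chartD(5)[OF U]
  have opW: "open (\<phi> ` W)" using chart_open_image[OF U W] .
  have tW: "topspace (subtopology (mtop M) W) = W" using openin_subset[OF W(1)] by auto
  show opim: "open ((\<Theta> \<circ> \<phi>) ` W)" using op by (simp add: image_comp)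
  have "homeomorphic_maps (subtopology (mtop M) W) (top_of_set ((\<Theta> \<circ> \<phi>) ` W)) (\<Theta> \<circ> \<phi>) (inv_into U \<phi> \<circ> \<Psi>)"
    unfolding homeomorphic_maps_def
  proof (intro conjI ballI)
    have "continuous_map (subtopology (mtop M) W) (top_of_set (\<phi> ` W)) \<phi>"
      using continuous_map_from_subtopology_mono[OF chart_continuous[OF U] W(2)] tW
      by (auto simp: continuous_map_in_subtopology)
    moreover have "continuous_map (top_of_set (\<phi> ` W)) euclidean \<Theta>"
      using holo_on_imp_continuous_on[OF \<Theta>] by simp
    ultimately have "continuous_map (subtopology (mtop M) W) euclidean (\<Theta> \<circ> \<phi>)"
      by (rule continuous_map_compose)
    then show "continuous_map (subtopology (mtop M) W) (top_of_set ((\<Theta> \<circ> \<phi>) ` W)) (\<Theta> \<circ> \<phi>)"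
      using tW by (auto simp: continuous_map_in_subtopology)
    have "continuous_map (top_of_set (\<Theta> ` \<phi> ` W)) (top_of_set (\<phi> ` U)) \<Psi>"
      using holo_on_imp_continuous_on[OF \<Psi>] inv W(2) by (auto simp: continuous_map_in_subtopology)
    from continuous_map_compose[OF this chart_inv_continuous[OF U]]
    show "continuous_map (top_of_set ((\<Theta> \<circ> \<phi>) ` W)) (subtopology (mtop M) W) (inv_into U \<phi> \<circ> \<Psi>)"
      using inv inU W(2) by (auto simp: continuous_map_in_subtopology image_comp)
  qed (use inv inU W(2) tW in auto)
  then show "homeomorphic_map (subtopology (mtop M) W) (top_of_set ((\<Theta> \<circ> \<phi>) ` W)) (\<Theta> \<circ> \<phi>)"
    using homeomorphic_map_maps by blast
  have injW: "inj_on (\<Theta> \<circ> \<phi>) W"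
    using inv inU W(2) by (intro inj_on_inverseI[where g="inv_into U \<phi> \<circ> \<Psi>"]) auto
  fix V \<psi> assume V: "(V, \<psi>) \<in> charts M"
  note cV = atlas_chart[OF M V]
  have WV: "openin (mtop M) (W \<inter> V)" using W compatible_chartD(1)[OF cV] by blast
  have opWV: "open (\<phi> ` (W \<inter> V))" using chart_open_image[OF U WV] W(2) by blast
  have "open ((\<Theta> \<circ> \<phi>) ` (W \<inter> V))"
  proof -
    have "continuous_on (\<Theta> ` \<phi> ` W) \<Psi>" by (rule holo_on_imp_continuous_on[OF \<Psi>])
    then have "open (\<Theta> ` \<phi> ` W \<inter> \<Psi> -` (\<phi> ` (W \<inter> V)))"
      by (rule continuous_open_preimage[OF _ op opWV])
    moreover have "\<Theta> ` \<phi> ` W \<inter> \<Psi> -` (\<phi> ` (W \<inter> V)) = (\<Theta> \<circ> \<phi>) ` (W \<inter> V)"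
      using inv inj_on_eq_iff[OF compatible_chartD(3)[OF U]] W(2) by fastforce
    ultimately show ?thesis by simp
  qed
  moreover have "holo_on ((\<psi> \<circ> inv_into U \<phi>) \<circ> \<Psi>) ((\<Theta> \<circ> \<phi>) ` (W \<inter> V))"
    by (rule holo_on_compose[OF holo_on_subset[OF \<Psi>] chart_transition[OF M U cV]])
      (use inv W(2) in auto)
  ultimately show "holo_on (\<psi> \<circ> inv_into W (\<Theta> \<circ> \<phi>)) ((\<Theta> \<circ> \<phi>) ` (W \<inter> V))"
    by (rule holo_on_cong_open) (use inv inU W(2) inv_into_f_f[OF injW] in auto)
  have "open (\<psi> ` (W \<inter> V))" using chart_open_image[OF cV WV] by blast
  moreover have "holo_on (\<Theta> \<circ> (\<phi> \<circ> inv_into V \<psi>)) (\<psi> ` (W \<inter> V))"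
    by (rule holo_on_compose[OF holo_on_subset[OF chart_transition[OF M cV U]] \<Theta>])
      (use compatible_chartD(5)[OF cV] W(2) in auto)
  ultimately show "holo_on (\<Theta> \<circ> \<phi> \<circ> inv_into V \<psi>) (\<psi> ` (W \<inter> V))"
    by (simp add: comp_assoc)
qed

text \<open>The two coordinate changes compose to the identity near the point, so by the chain rule
  their derivatives are mutually inverse.\<close>

lemma chart_transition_derivative:
  assumes M: "complex_manifold M" and U: "compatible_chart M U \<phi>" and V: "compatible_chart M V \<psi>"
    and x: "x \<in> U" "x \<in> V"
  obtains K K' where "((\<psi> \<circ> inv_into U \<phi>) has_derivative K) (at (\<phi> x))"
    "\<And>c v. K (c *\<^sub>C v) = c *\<^sub>C K v" "K \<circ> K' = id" "K' \<circ> K = id"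
proof -
  obtain K where K: "((\<psi> \<circ> inv_into U \<phi>) has_derivative K) (at (\<phi> x))"
    "\<And>c v. K (c *\<^sub>C v) = c *\<^sub>C K v"
    using holo_onE[OF chart_transition[OF M U V], of "\<phi> x"] x by blast
  obtain K' where K': "((\<phi> \<circ> inv_into V \<psi>) has_derivative K') (at (\<psi> x))"
    using holo_onE[OF chart_transition[OF M V U], of "\<psi> x"] x by blast
  have UV: "openin (mtop M) (U \<inter> V)"
    using compatible_chartD(1)[OF U] compatible_chartD(1)[OF V] by blast
  have op: "open (\<phi> ` (U \<inter> V))" "open (\<psi> ` (U \<inter> V))"
    using chart_open_image[OF U UV] chart_open_image[OF V UV] by blast+
  note inv = compatible_chartD(5)[OF U] compatible_chartD(5)[OF V]
  have "((\<phi> \<circ> inv_into V \<psi>) \<circ> (\<psi> \<circ> inv_into U \<phi>) has_derivative K' \<circ> K) (at (\<phi> x))"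
    by (rule diff_chain_at[OF K(1)]) (use K' x inv in auto)
  then have "(id has_derivative K' \<circ> K) (at (\<phi> x))"
    by (rule has_derivative_transform_within_open[OF _ op(1)]) (use x inv in auto)
  then have 1: "K' \<circ> K = id" using has_derivative_unique[OF has_derivative_id] by (metis id_def)
  have "((\<psi> \<circ> inv_into U \<phi>) \<circ> (\<phi> \<circ> inv_into V \<psi>) has_derivative K \<circ> K') (at (\<psi> x))"
    by (rule diff_chain_at[OF K']) (use K x inv in auto)
  then have "(id has_derivative K \<circ> K') (at (\<psi> x))"
    by (rule has_derivative_transform_within_open[OF _ op(2)]) (use x inv in auto)
  then have 2: "K \<circ> K' = id" using has_derivative_unique[OF has_derivative_id] by (metis id_def)
  show ?thesis by (rule that[OF K 2 1])
qed

text \<open>One compatible chart is enough, so that a flow box, which need not belong to the atlas,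
  can serve as witness; the next lemma moves the condition to every other chart.\<close>

definition submersive_at :: "('a, 'e::complex_normed) cmfd \<Rightarrow> ('a \<Rightarrow> complex) \<Rightarrow> 'a \<Rightarrow> bool" where
  "submersive_at M q x \<longleftrightarrow> (\<exists>B \<psi> L. compatible_chart M B \<psi> \<and> x \<in> B \<and>
     ((q \<circ> inv_into B \<psi>) has_derivative L) (at (\<psi> x)) \<and> (\<forall>c v. L (c *\<^sub>C v) = c *\<^sub>C L v) \<and> surj L)"

lemma submersive_at_chart:
  assumes M: "complex_manifold M" and q: "submersive_at M q x"
    and U: "compatible_chart M U \<phi>" "x \<in> U"
  obtains L where "((q \<circ> inv_into U \<phi>) has_derivative L) (at (\<phi> x))"
    "\<And>c v. L (c *\<^sub>C v) = c *\<^sub>C L v" "surj L"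
proof -
  obtain B \<psi> L where B: "compatible_chart M B \<psi>" "x \<in> B"
    and L: "((q \<circ> inv_into B \<psi>) has_derivative L) (at (\<psi> x))" "\<And>c v. L (c *\<^sub>C v) = c *\<^sub>C L v" "surj L"
    using q by (auto simp: submersive_at_def)
  obtain K K' where K: "((\<psi> \<circ> inv_into U \<phi>) has_derivative K) (at (\<phi> x))"
    "\<And>c v. K (c *\<^sub>C v) = c *\<^sub>C K v" "K \<circ> K' = id" "K' \<circ> K = id"
    by (rule chart_transition_derivative[OF M U(1) B(1) U(2) B(2)]) (rule that)
  note inv = compatible_chartD(5)[OF U(1)] compatible_chartD(5)[OF B(1)]
  have UB: "openin (mtop M) (U \<inter> B)"
    using compatible_chartD(1)[OF U(1)] compatible_chartD(1)[OF B(1)] by blast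
  have op: "open (\<phi> ` (U \<inter> B))" using chart_open_image[OF U(1) UB] by blast
  have "((q \<circ> inv_into B \<psi>) \<circ> (\<psi> \<circ> inv_into U \<phi>) has_derivative L \<circ> K) (at (\<phi> x))"
    by (rule diff_chain_at[OF K(1)]) (use L U B inv in auto)
  then have "((q \<circ> inv_into U \<phi>) has_derivative L \<circ> K) (at (\<phi> x))"
    by (rule has_derivative_transform_within_open[OF _ op]) (use U B inv in auto)
  moreover have "surj K" by (rule surjI[of K K']) (use K(3) in \<open>simp add: fun_eq_iff\<close>)
  then have "surj (L \<circ> K)" by (rule comp_surj[OF _ L(3)])
  ultimately show ?thesis using that[of "L \<circ> K"] L(2) K(2) by simp
qed


section \<open>Complex structures pulled back along local homeomorphisms\<close>

text \<open>A local homeomorphism, split into three conditions that can be verified separately for a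
  quotient space and for a direct limit.\<close>

definition etale :: "'b topology \<Rightarrow> ('b \<Rightarrow> 'a) \<Rightarrow> ('a, 'e::complex_normed) cmfd \<Rightarrow> bool" where
  "etale T p M \<longleftrightarrow> continuous_map T (mtop M) p \<and> open_map T (mtop M) p \<and>
     (\<forall>x\<in>topspace T. \<exists>W. openin T W \<and> x \<in> W \<and> inj_on p W)"

lemma etale_homeomorphic:
  assumes e: "etale T p M" and W: "openin T W" "inj_on p W"
  shows "openin (mtop M) (p ` W)"
    "homeomorphic_map (subtopology T W) (subtopology (mtop M) (p ` W)) p"
proof -
  show op: "openin (mtop M) (p ` W)" using e W by (auto simp: etale_def open_map_def)
  have tW: "topspace (subtopology T W) = W" using openin_subset[OF W(1)] by auto
  show "homeomorphic_map (subtopology T W) (subtopology (mtop M) (p ` W)) p"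
  proof (rule bijective_open_imp_homeomorphic_map)
    show "continuous_map (subtopology T W) (subtopology (mtop M) (p ` W)) p"
      using e tW by (auto simp: etale_def continuous_map_in_subtopology continuous_map_from_subtopology)
    show "open_map (subtopology T W) (subtopology (mtop M) (p ` W)) p"
      unfolding open_map_def
    proof (intro allI impI)
      fix V assume V: "openin (subtopology T W) V"
      then have "openin T V" using W(1) openin_trans_full by blast
      then have "openin (mtop M) (p ` V)" using e by (auto simp: etale_def open_map_def)
      moreover have "V \<subseteq> W" using openin_subset[OF V] by simp
      ultimately show "openin (subtopology (mtop M) (p ` W)) (p ` V)"
        by (simp add: openin_subtopology_alt) blast
    qed
    show "p ` topspace (subtopology T W) = topspace (subtopology (mtop M) (p ` W))"
      using tW openin_subset[OF op] by auto
    show "inj_on p (topspace (subtopology T W))" using tW W by simp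
  qed
qed

text \<open>For an etale map, injectivity on an open set already gives the open image and the
  homeomorphism that the pulled-back atlas asks for.\<close>

lemma pullback_charts:
  assumes e: "etale T p M"
  shows "(W, \<eta>) \<in> charts (pullback_mfd T p M) \<longleftrightarrow>
    (\<exists>U \<phi>. \<eta> = \<phi> \<circ> p \<and> (U, \<phi>) \<in> charts M \<and> openin T W \<and> p ` W \<subseteq> U \<and> inj_on p W)"
proof
  assume "(W, \<eta>) \<in> charts (pullback_mfd T p M)"
  then obtain U \<phi> where *: "\<eta> = \<phi> \<circ> p" "(U, \<phi>) \<in> charts M" "openin T W" "p ` W \<subseteq> U"
    "homeomorphic_map (subtopology T W) (subtopology (mtop M) (p ` W)) p"
    by (auto simp: pullback_mfd_def)
  have "inj_on p W"
    using homeomorphic_imp_injective_map[OF *(5)] openin_subset[OF *(3)] by (simp add: Int_absorb1)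
  with * show "\<exists>U \<phi>. \<eta> = \<phi> \<circ> p \<and> (U, \<phi>) \<in> charts M \<and> openin T W \<and> p ` W \<subseteq> U \<and> inj_on p W"
    by blast
next
  assume "\<exists>U \<phi>. \<eta> = \<phi> \<circ> p \<and> (U, \<phi>) \<in> charts M \<and> openin T W \<and> p ` W \<subseteq> U \<and> inj_on p W"
  then show "(W, \<eta>) \<in> charts (pullback_mfd T p M)"
    using etale_homeomorphic[OF e] unfolding pullback_mfd_def by fastforce
qed

lemma mtop_pullback [simp]: "mtop (pullback_mfd T p M) = T"
  by (simp add: pullback_mfd_def)

lemma etale_small:
  assumes e: "etale T p M" and x: "x \<in> topspace T" and A: "openin (mtop M) A" "p x \<in> A"
  obtains W where "openin T W" "x \<in> W" "inj_on p W" "p ` W \<subseteq> A"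
proof -
  obtain W where W: "openin T W" "x \<in> W" "inj_on p W" using e x by (auto simp: etale_def)
  have "openin T {y \<in> topspace T. p y \<in> A}"
    using e A openin_continuous_map_preimage by (auto simp: etale_def)
  then have "openin T (W \<inter> {y \<in> topspace T. p y \<in> A})" using W(1) by blast
  then show ?thesis
    by (rule that) (use W x A in \<open>auto intro: inj_on_subset\<close>)
qed

lemma etale_subtopology:
  assumes e: "etale T p M" and S: "openin T S"
  shows "etale (subtopology T S) p M"
  unfolding etale_def
proof (intro conjI ballI)
  show "continuous_map (subtopology T S) (mtop M) p"
    using e by (auto simp: etale_def continuous_map_from_subtopology)
  show "open_map (subtopology T S) (mtop M) p"
    using e S openin_trans_full unfolding etale_def open_map_def by blast
  fix x assume x: "x \<in> topspace (subtopology T S)"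
  then obtain W where W: "openin T W" "x \<in> W" "inj_on p W" using e by (auto simp: etale_def)
  have "openin (subtopology T S) (W \<inter> S)" using W(1) by (auto simp: openin_subtopology)
  then show "\<exists>W. openin (subtopology T S) W \<and> x \<in> W \<and> inj_on p W"
    using W x by (intro exI[of _ "W \<inter> S"]) (auto intro: inj_on_subset)
qed

lemma etale_id:
  assumes S: "openin (mtop M) S"
  shows "etale (subtopology (mtop M) S) id M"
  unfolding etale_def open_map_def
  using S openin_trans_full by (auto intro!: exI[of _ "topspace (mtop M) \<inter> S"]
      continuous_map_from_subtopology simp: openin_subtopology)

text \<open>In pulled-back charts g is a coordinate change of M, because it commutes with the
  projections; continuity therefore suffices. The atlases are only required to be contained in the
  pulled-back ones so that open submanifolds, with their restricted charts, are covered too.\<close>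

lemma holo_map_over:
  assumes M: "complex_manifold M" and e: "etale T p M" and e': "etale T' p' M"
    and g: "continuous_map T T' g" and eq: "\<And>x. x \<in> topspace T \<Longrightarrow> p' (g x) = p x"
    and A: "mtop A = T" "charts A \<subseteq> charts (pullback_mfd T p M)"
    and B: "mtop B = T'" "charts B \<subseteq> charts (pullback_mfd T' p' M)"
  shows "holo_map A B g"
proof -
  have "holo_on (\<eta>' \<circ> g \<circ> inv_into W \<eta>) (\<eta> ` {x \<in> W. g x \<in> V})"
    if WA: "(W, \<eta>) \<in> charts A" and VB: "(V, \<eta>') \<in> charts B" for W \<eta> V \<eta>'
  proof -
    obtain U \<phi> where W: "\<eta> = \<phi> \<circ> p" "(U, \<phi>) \<in> charts M" "openin T W" "p ` W \<subseteq> U" "inj_on p W"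
      using pullback_charts[OF e, THEN iffD1, OF subsetD[OF A(2) WA]] by blast
    obtain U' \<phi>' where V: "\<eta>' = \<phi>' \<circ> p'" "(U', \<phi>') \<in> charts M" "openin T' V" "p' ` V \<subseteq> U'"
      using pullback_charts[OF e', THEN iffD1, OF subsetD[OF B(2) VB]] by blast
    note c = atlas_chart[OF M W(2)] and c' = atlas_chart[OF M V(2)]
    define N where "N = {x \<in> W. g x \<in> V}"
    have WT: "W \<subseteq> topspace T" using openin_subset[OF W(3)] .
    have "openin T {x \<in> topspace T. g x \<in> V}" using openin_continuous_map_preimage[OF g V(3)] .
    moreover have "N = W \<inter> {x \<in> topspace T. g x \<in> V}" using WT by (auto simp: N_def)
    ultimately have N: "openin T N" using openin_Int[OF W(3)] by metis
    then have pN: "openin (mtop M) (p ` N)" using e by (auto simp: etale_def open_map_def)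
    have sub: "p ` N \<subseteq> U \<inter> U'"
    proof clarify
      fix x assume "x \<in> N"
      then have x: "x \<in> W" "g x \<in> V" "x \<in> topspace T" using WT by (auto simp: N_def)
      have "p x = p' (g x)" using eq x by simp
      then show "p x \<in> U \<inter> U'" using x W(4) V(4) by auto
    qed
    have op: "open (\<phi> ` p ` N)" using chart_open_image[OF c pN] sub by blast
    have inj: "inj_on (\<phi> \<circ> p) W"
      using comp_inj_on[OF W(5) inj_on_subset[OF compatible_chartD(3)[OF c] W(4)]] .
    have "holo_on (\<phi>' \<circ> inv_into U \<phi>) (\<phi> ` p ` N)"
      by (rule holo_on_subset[OF chart_transition[OF M c c']]) (use sub in auto)
    then have "holo_on (\<eta>' \<circ> g \<circ> inv_into W \<eta>) (\<phi> ` p ` N)"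
    proof (rule holo_on_cong_open[OF op])
      fix z assume "z \<in> \<phi> ` p ` N"
      then obtain x where x: "x \<in> N" "z = \<phi> (p x)" by blast
      have xW: "x \<in> W" using x by (simp add: N_def)
      have "inv_into W \<eta> z = x" using inv_into_f_f[OF inj xW] by (simp add: x W(1))
      moreover have "inv_into U \<phi> z = p x"
        using compatible_chartD(5)[OF c] x sub by auto
      ultimately show "(\<eta>' \<circ> g \<circ> inv_into W \<eta>) z = (\<phi>' \<circ> inv_into U \<phi>) z"
        using eq xW WT by (auto simp: V(1))
    qed
    then show ?thesis by (simp add: W(1) N_def image_comp)
  qed
  then show ?thesis using g A B by (auto simp: holo_map_def)
qed

lemma biholomorphism_over:
  assumes M: "complex_manifold M" and e: "etale T p M" and e': "etale T' p' M"
    and g: "homeomorphic_map T T' g" and eq: "\<And>x. x \<in> topspace T \<Longrightarrow> p' (g x) = p x"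
    and A: "mtop A = T" "charts A \<subseteq> charts (pullback_mfd T p M)"
    and B: "mtop B = T'" "charts B \<subseteq> charts (pullback_mfd T' p' M)"
  shows "biholomorphism A B g"
proof -
  have inj: "inj_on g (topspace T)" and im: "g ` topspace T = topspace T'"
    using g homeomorphic_imp_injective_map homeomorphic_imp_surjective_map by blast+
  obtain h where h: "homeomorphic_maps T T' g h" using g homeomorphic_map_maps by blast
  have ch: "continuous_map T' T h" using h by (simp add: homeomorphic_maps_def)
  have "h y = inv_into (topspace T) g y" if "y \<in> topspace T'" for y
  proof -
    have "h y \<in> topspace T" using ch that by (auto simp: continuous_map_def)
    then show ?thesis using h that inv_into_f_f[OF inj] by (fastforce simp: homeomorphic_maps_def)
  qed
  then have ci: "continuous_map T' T (inv_into (topspace T) g)"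
    using continuous_map_eq[OF ch] by blast
  have "p (inv_into (topspace T) g y) = p' y" if "y \<in> topspace T'" for y
    using eq[of "inv_into (topspace T) g y"] that im by (metis f_inv_into_f inv_into_into)
  then show ?thesis
    unfolding biholomorphism_def A(1) B(1)
    using inj im holo_map_over[OF M e e' homeomorphic_imp_continuous_map[OF g] eq A B]
      holo_map_over[OF M e' e ci _ B A] by (auto simp: bij_betw_def)
qed

lemma charts_open_submfd_pullback:
  assumes e: "etale T p M" and S: "openin T S"
  shows "charts (open_submfd (pullback_mfd T p M) S) \<subseteq> charts (pullback_mfd (subtopology T S) p M)"
proof clarify
  fix W \<eta> assume "(W, \<eta>) \<in> charts (open_submfd (pullback_mfd T p M) S)"
  then obtain W' where W': "W = W' \<inter> S" "(W', \<eta>) \<in> charts (pullback_mfd T p M)"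
    by (auto simp: open_submfd_def)
  then obtain U \<phi> where *: "\<eta> = \<phi> \<circ> p" "(U, \<phi>) \<in> charts M" "openin T W'" "p ` W' \<subseteq> U" "inj_on p W'"
    using pullback_charts[OF e, THEN iffD1, OF W'(2)] by blast
  have "openin (subtopology T S) W" using *(3) W'(1) by (auto simp: openin_subtopology)
  then show "(W, \<eta>) \<in> charts (pullback_mfd (subtopology T S) p M)"
    unfolding pullback_charts[OF etale_subtopology[OF e S]] using * W'(1)
    by (intro exI[of _ U] exI[of _ \<phi>]) (auto intro: inj_on_subset)
qed

text \<open>An open part of M is regarded as etale over M by the identity, so that the projection p
  itself becomes a map over M.\<close>

lemma charts_open_submfd_id:
  assumes M: "complex_manifold M" and S: "openin (mtop M) S"
  shows "charts (open_submfd M S) \<subseteq> charts (pullback_mfd (subtopology (mtop M) S) id M)"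
proof clarify
  fix W \<eta> assume "(W, \<eta>) \<in> charts (open_submfd M S)"
  then obtain U where U: "W = U \<inter> S" "(U, \<eta>) \<in> charts M" by (auto simp: open_submfd_def)
  have "openin (subtopology (mtop M) S) W"
    using compatible_chartD(1)[OF atlas_chart[OF M U(2)]] U(1) by (auto simp: openin_subtopology)
  then show "(W, \<eta>) \<in> charts (pullback_mfd (subtopology (mtop M) S) id M)"
    unfolding pullback_charts[OF etale_id[OF S]] using U
    by (intro exI[of _ U] exI[of _ \<eta>]) auto
qed

lemma locally_biholomorphic_pullback:
  assumes M: "complex_manifold M" and e: "etale T p M"
  shows "locally_biholomorphic (pullback_mfd T p M) M p"
  unfolding locally_biholomorphic_def
proof
  fix x assume "x \<in> topspace (mtop (pullback_mfd T p M))"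
  then obtain W where W: "openin T W" "x \<in> W" "inj_on p W" using e by (auto simp: etale_def)
  note h = etale_homeomorphic[OF e W(1,3)]
  have "biholomorphism (open_submfd (pullback_mfd T p M) W) (open_submfd M (p ` W)) p"
    by (rule biholomorphism_over[OF M etale_subtopology[OF e W(1)] etale_id[OF h(1)] h(2) _ _
          charts_open_submfd_pullback[OF e W(1)] _ charts_open_submfd_id[OF M h(1)]])
       (auto simp: open_submfd_def)
  with W h(1) show "\<exists>S. openin (mtop (pullback_mfd T p M)) S \<and> x \<in> S \<and> openin (mtop M) (p ` S) \<and>
      biholomorphism (open_submfd (pullback_mfd T p M) S) (open_submfd M (p ` S)) p" by auto
qed

lemma complex_manifold_pullback:
  assumes M: "complex_manifold M" and e: "etale T p M"
    and "Hausdorff_space T" "second_countable T"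
  shows "complex_manifold (pullback_mfd T p M)"
  unfolding complex_manifold_def
proof (intro conjI)
  show "(\<Union>(U, \<phi>)\<in>charts (pullback_mfd T p M). U) = topspace (mtop (pullback_mfd T p M))"
  proof
    show "(\<Union>(U, \<phi>)\<in>charts (pullback_mfd T p M). U) \<subseteq> topspace (mtop (pullback_mfd T p M))"
    proof clarify
      fix x W \<eta> assume W: "(W, \<eta>) \<in> charts (pullback_mfd T p M)" and x: "x \<in> W"
      have "openin T W" using pullback_charts[OF e, THEN iffD1, OF W] by blast
      then show "x \<in> topspace (mtop (pullback_mfd T p M))" using x openin_subset by fastforce
    qed
    show "topspace (mtop (pullback_mfd T p M)) \<subseteq> (\<Union>(U, \<phi>)\<in>charts (pullback_mfd T p M). U)"
    proof
      fix x assume "x \<in> topspace (mtop (pullback_mfd T p M))"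
      then have x: "x \<in> topspace T" by simp
      then have "p x \<in> topspace (mtop M)" using e by (auto simp: etale_def continuous_map_def)
      then obtain U \<phi> where U: "(U, \<phi>) \<in> charts M" "p x \<in> U" using atlas_covers[OF M] by blast
      obtain W where "openin T W" "x \<in> W" "inj_on p W" "p ` W \<subseteq> U"
        using etale_small[OF e x compatible_chartD(1)[OF atlas_chart[OF M U(1)]] U(2)] by blast
      then have "(W, \<phi> \<circ> p) \<in> charts (pullback_mfd T p M)" "x \<in> W"
        unfolding pullback_charts[OF e] using U(1) by blast+
      then show "x \<in> (\<Union>(U, \<phi>)\<in>charts (pullback_mfd T p M). U)" by blast
    qed
  qed
  have id: "continuous_map T T id" by simp
  \<comment> \<open>Coordinate changes of the pulled-back atlas are the local expressions of the
    identity, which is a map over M.\<close>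
  have tr: "holo_on (\<eta>' \<circ> inv_into W \<eta>) (\<eta> ` (W \<inter> V))"
    if "(W, \<eta>) \<in> charts (pullback_mfd T p M)" "(V, \<eta>') \<in> charts (pullback_mfd T p M)" for W \<eta> V \<eta>'
  proof -
    have "holo_map (pullback_mfd T p M) (pullback_mfd T p M) id"
      by (rule holo_map_over[OF M e e id]) auto
    then have "holo_on (\<eta>' \<circ> id \<circ> inv_into W \<eta>) (\<eta> ` {x \<in> W. id x \<in> V})"
      using that unfolding holo_map_def by blast
    moreover have "{x \<in> W. id x \<in> V} = W \<inter> V" by auto
    ultimately show ?thesis by simp
  qed
  have "compatible_chart (pullback_mfd T p M) W \<eta>"
    if W: "(W, \<eta>) \<in> charts (pullback_mfd T p M)" for W \<eta>
  proof (rule compatible_chartI)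
    obtain U \<phi> where *: "\<eta> = \<phi> \<circ> p" "(U, \<phi>) \<in> charts M" "openin T W" "p ` W \<subseteq> U" "inj_on p W"
      using pullback_charts[OF e, THEN iffD1, OF W] by blast
    note h = etale_homeomorphic[OF e *(3,5)] and c = atlas_chart[OF M *(2)]
    show "openin (mtop (pullback_mfd T p M)) W" using * by simp
    show "open (\<eta> ` W)" using chart_open_image[OF c h(1) *(4)] by (simp add: *(1) image_comp)
    have "homeomorphic_map (subtopology (mtop M) (p ` W)) (top_of_set (\<phi> ` p ` W)) \<phi>"
      using homeomorphic_map_subtopologies[OF compatible_chartD(4)[OF c], of "p ` W" "\<phi> ` p ` W"]
        *(4) chart_topspace[OF c] by (simp add: subtopology_subtopology Int_absorb1 image_mono) 
    from homeomorphic_map_compose[OF h(2) this]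
    show "homeomorphic_map (subtopology (mtop (pullback_mfd T p M)) W) (top_of_set (\<eta> ` W)) \<eta>"
      by (simp add: *(1) image_comp)
  next
    fix V \<psi> assume V: "(V, \<psi>) \<in> charts (pullback_mfd T p M)"
    show "holo_on (\<psi> \<circ> inv_into W \<eta>) (\<eta> ` (W \<inter> V))" using tr[OF W V] .
    show "holo_on (\<eta> \<circ> inv_into V \<psi>) (\<psi> ` (W \<inter> V))" using tr[OF V W] by (simp add: Int_commute)
  qed
  then show "\<forall>(U, \<phi>)\<in>charts (pullback_mfd T p M). compatible_chart (pullback_mfd T p M) U \<phi>" by blast
qed (use assms in auto)

text \<open>Locally \<pi> factors as q after p with q submersive on M, and in pulled-back charts p
  is the identity; so \<pi> and q have the same derivative there.\<close>

lemma holo_submersion_pullback: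
  assumes M: "complex_manifold M" and e: "etale T p M"
    and S: "mtop S = top_of_set Q" "charts S = {(Q, id)}"
    and c: "continuous_map T (top_of_set Q) \<pi>"
    and loc: "\<And>x. x \<in> topspace T \<Longrightarrow> \<exists>N q. openin T N \<and> x \<in> N \<and> (\<forall>y\<in>N. \<pi> y = q (p y)) \<and> submersive_at M q (p x)"
  shows "holo_submersion (pullback_mfd T p M) S \<pi>"
proof -
  have *: "\<exists>L. ((\<pi> \<circ> inv_into W \<eta>) has_derivative L) (at (\<eta> x)) \<and> (\<forall>c v. L (c *\<^sub>C v) = c *\<^sub>C L v) \<and> surj L"
    if W: "(W, \<eta>) \<in> charts (pullback_mfd T p M)" "x \<in> W" for W \<eta> x
  proof -
    obtain U \<phi> where *: "\<eta> = \<phi> \<circ> p" "(U, \<phi>) \<in> charts M" "openin T W" "p ` W \<subseteq> U" "inj_on p W"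
      using pullback_charts[OF e, THEN iffD1, OF W(1)] by blast
    note h = etale_homeomorphic[OF e *(3,5)] and c = atlas_chart[OF M *(2)]
    have x: "x \<in> topspace T" using W(2) openin_subset[OF *(3)] by blast
    obtain N q where N: "openin T N" "x \<in> N" "\<And>y. y \<in> N \<Longrightarrow> \<pi> y = q (p y)" "submersive_at M q (p x)"
      using loc[OF x] by blast
    have pxU: "p x \<in> U" using *(4) W(2) by blast
    obtain L where L: "((q \<circ> inv_into U \<phi>) has_derivative L) (at (\<phi> (p x)))"
      "\<And>c v. L (c *\<^sub>C v) = c *\<^sub>C L v" "surj L"
      by (rule submersive_at_chart[OF M N(4) c pxU]) (rule that)
    have "openin (mtop M) (p ` (N \<inter> W))"
      using e N(1) *(3) by (auto simp: etale_def open_map_def)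
    then have op: "open (\<phi> ` p ` (N \<inter> W))" using chart_open_image[OF c] *(4) by blast
    have inj: "inj_on (\<phi> \<circ> p) W"
      using comp_inj_on[OF *(5) inj_on_subset[OF compatible_chartD(3)[OF c] *(4)]] .
    have "((\<pi> \<circ> inv_into W \<eta>) has_derivative L) (at (\<phi> (p x)))"
    proof (rule has_derivative_transform_within_open[OF L(1) op])
      show "\<phi> (p x) \<in> \<phi> ` p ` (N \<inter> W)" using N(2) W(2) by blast
      fix z assume "z \<in> \<phi> ` p ` (N \<inter> W)"
      then obtain y where y: "y \<in> N" "y \<in> W" "z = \<phi> (p y)" by blast
      have "inv_into W \<eta> z = y" using inv_into_f_f[OF inj y(2)] by (simp add: y *(1))
      moreover have "inv_into U \<phi> z = p y" using compatible_chartD(5)[OF c] y *(4) by auto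
      ultimately show "(q \<circ> inv_into U \<phi>) z = (\<pi> \<circ> inv_into W \<eta>) z" using N(3) y by simp
    qed
    then show ?thesis using L(2,3) *(1) by auto
  qed
  have "holo_map (pullback_mfd T p M) S \<pi>"
    unfolding holo_map_def S mtop_pullback
  proof (intro conjI c ballI)
    fix x assume x: "x \<in> charts (pullback_mfd T p M)"
    obtain W \<eta> where W: "x = (W, \<eta>)" by fastforce
    show "case x of (U, \<phi>) \<Rightarrow> \<forall>(V, \<psi>)\<in>{(Q, id)}. holo_on (\<psi> \<circ> \<pi> \<circ> inv_into U \<phi>) (\<phi> ` {x \<in> U. \<pi> x \<in> V})"
      using *[of W \<eta>] x unfolding W by (fastforce simp: holo_on_def)
  qed
  moreover have "surj (frechet_derivative (\<pi> \<circ> inv_into W \<eta>) (at (\<eta> x)))"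
    if "(W, \<eta>) \<in> charts (pullback_mfd T p M)" "x \<in> W" for W \<eta> x
    using *[OF that] frechet_derivative_at by metis
  ultimately show ?thesis
    unfolding holo_submersion_def S by auto
qed

lemma second_countable_countable_cover:
  assumes "countable \<O>" "\<And>V. V \<in> \<O> \<Longrightarrow> openin T V" "\<And>V. V \<in> \<O> \<Longrightarrow> second_countable (subtopology T V)"
    and cover: "topspace T \<subseteq> \<Union>\<O>"
  shows "second_countable T"
proof -
  have "\<exists>B. countable B \<and> (\<forall>W\<in>B. openin (subtopology T V) W) \<and>
      (\<forall>U x. openin (subtopology T V) U \<and> x \<in> U \<longrightarrow> (\<exists>W\<in>B. x \<in> W \<and> W \<subseteq> U))" if "V \<in> \<O>" for V
    using assms(3)[OF that] unfolding second_countable_def by blast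
  then obtain B where B: "\<And>V. V \<in> \<O> \<Longrightarrow> countable (B V)"
    "\<And>V W. V \<in> \<O> \<Longrightarrow> W \<in> B V \<Longrightarrow> openin (subtopology T V) W"
    "\<And>V U x. V \<in> \<O> \<Longrightarrow> openin (subtopology T V) U \<Longrightarrow> x \<in> U \<Longrightarrow> \<exists>W\<in>B V. x \<in> W \<and> W \<subseteq> U"
    by metis
  show ?thesis
    unfolding second_countable_def
  proof (intro exI[of _ "\<Union>V\<in>\<O>. B V"] conjI allI impI ballI)
    show "countable (\<Union>V\<in>\<O>. B V)" using assms(1) B(1) by blast
    show "openin T W" if "W \<in> (\<Union>V\<in>\<O>. B V)" for W
      using that B(2) assms(2) openin_trans_full by blast
    fix U x assume U: "openin T U \<and> x \<in> U"
    then obtain V where V: "V \<in> \<O>" "x \<in> V" using cover openin_subset by blast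
    have "openin (subtopology T V) (U \<inter> V)" using U by (auto simp: openin_subtopology)
    then obtain W where "W \<in> B V" "x \<in> W" "W \<subseteq> U \<inter> V" using B(3)[OF V(1)] U V(2) by blast
    then show "\<exists>W\<in>\<Union>V\<in>\<O>. B V. x \<in> W \<and> W \<subseteq> U" using V by blast
  qed
qed

subsection \<open>Flow boxes and the leaf topology\<close>

lemma open_nbhd_chart_preimage:
  assumes U: "openin (mtop X) U" and N: "open N" "s \<in> N" and c: "continuous_map (top_of_set N) (mtop X) c"
    and s: "c s \<in> U"
  shows "open {z \<in> N. c z \<in> U}" "s \<in> {z \<in> N. c z \<in> U}"
proof -
  have "openin (top_of_set N) {z \<in> topspace (top_of_set N). c z \<in> U}"
    by (rule openin_continuous_map_preimage[OF c U])
  then show "open {z \<in> N. c z \<in> U}" using N(1) openin_open_eq by auto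
  show "s \<in> {z \<in> N. c z \<in> U}" using N s by simp
qed

lemma chart_change_derivative:
  assumes M: "complex_manifold M" and U: "compatible_chart M U \<phi>" and V: "compatible_chart M V \<psi>"
    and N: "open N" "s \<in> N" and c: "continuous_map (top_of_set N) (mtop M) c"
    and s: "c s \<in> U" "c s \<in> V" and L: "((\<phi> \<circ> c) has_derivative L) (at s)"
    and K: "((\<psi> \<circ> inv_into U \<phi>) has_derivative K) (at (\<phi> (c s)))"
  shows "((\<psi> \<circ> c) has_derivative (K \<circ> L)) (at s)"
proof -
  have op: "openin (mtop M) (U \<inter> V)" using compatible_chartD(1)[OF U] compatible_chartD(1)[OF V] by blast
  have "((\<psi> \<circ> inv_into U \<phi>) \<circ> (\<phi> \<circ> c) has_derivative K \<circ> L) (at s)"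
    by (rule diff_chain_at[OF L]) (use K in simp)
  then show ?thesis
    by (rule has_derivative_transform_within_open[OF _ open_nbhd_chart_preimage[OF op N c]])
      (use s compatible_chartD(5)[OF U] in auto)
qed

abbreviation unitT :: "real topology" where "unitT \<equiv> top_of_set {0..1}"

locale foliated_surface =
  fixes X :: "'x csurface" and F :: "'x fol"
  assumes X: "complex_manifold X" and F: "foliation X F"
begin

lemma generator:
  assumes "(U, \<phi>, v) \<in> F"
  shows "compatible_chart X U \<phi>" "holo_on v (\<phi> ` U)"
  using F assms by (auto simp: foliation_def)

lemma generator_change:
  assumes 1: "(U, \<phi>, v) \<in> F" and 2: "(U', \<phi>', v') \<in> F" and x: "x \<in> U" "x \<in> U'"
  obtains K g where "((\<phi>' \<circ> inv_into U \<phi>) has_derivative K) (at (\<phi> x))"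
    "\<And>c v. K (c *\<^sub>C v) = c *\<^sub>C K v" "inj K" "g \<noteq> 0" "v' (\<phi>' x) = g *\<^sub>C K (v (\<phi> x))"
proof -
  obtain K K' where K: "((\<phi>' \<circ> inv_into U \<phi>) has_derivative K) (at (\<phi> x))"
    "\<And>c v. K (c *\<^sub>C v) = c *\<^sub>C K v" "K \<circ> K' = id" "K' \<circ> K = id"
    by (rule chart_transition_derivative[OF X generator(1)[OF 1] generator(1)[OF 2] x]) (rule that)
  have "\<forall>(U, \<phi>, v)\<in>F. \<forall>(U', \<phi>', v')\<in>F. \<exists>g :: complex \<times> complex \<Rightarrow> complex.
          holo_on g (\<phi> ` (U \<inter> U')) \<and>
          (\<forall>p\<in>\<phi> ` (U \<inter> U'). g p \<noteq> 0 \<and> v' ((\<phi>' \<circ> inv_into U \<phi>) p)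
               = g p *\<^sub>C frechet_derivative (\<phi>' \<circ> inv_into U \<phi>) (at p) (v p))"
    using F unfolding foliation_def by (elim conjE)
  from bspec[OF bspec[OF this 1, unfolded split_conv] 2, unfolded split_conv]
  obtain g :: "complex \<times> complex \<Rightarrow> complex" where
    g: "\<And>p. p \<in> \<phi> ` (U \<inter> U') \<Longrightarrow> g p \<noteq> 0 \<and> v' ((\<phi>' \<circ> inv_into U \<phi>) p)
               = g p *\<^sub>C frechet_derivative (\<phi>' \<circ> inv_into U \<phi>) (at p) (v p)" by blast
  have "inj K" using K(4) by (metis comp_apply id_apply injI)
  moreover have "frechet_derivative (\<phi>' \<circ> inv_into U \<phi>) (at (\<phi> x)) = K"
    using frechet_derivative_at[OF K(1)] by simp
  ultimately show ?thesis
    using that[OF K(1,2) _ _, of "g (\<phi> x)"] g[of "\<phi> x"] x compatible_chartD(5)[OF generator(1)[OF 1]] by auto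
qed

text \<open>Two generators differ by a nonzero factor and an injective derivative, so they vanish at
  the same points.\<close>

lemma Sing_iff:
  assumes 1: "(U, \<phi>, v) \<in> F" and x: "x \<in> U"
  shows "x \<in> Sing F \<longleftrightarrow> v (\<phi> x) = 0"
proof
  show "v (\<phi> x) = 0 \<Longrightarrow> x \<in> Sing F" using 1 x by (auto simp: Sing_def)
  assume "x \<in> Sing F"
  then obtain U' \<phi>' v' where 2: "(U', \<phi>', v') \<in> F" "x \<in> U'" "v' (\<phi>' x) = 0" by (auto simp: Sing_def)
  obtain K g where K: "((\<phi>' \<circ> inv_into U \<phi>) has_derivative K) (at (\<phi> x))"
    "\<And>c v. K (c *\<^sub>C v) = c *\<^sub>C K v" "inj K" "g \<noteq> 0" "v' (\<phi>' x) = g *\<^sub>C K (v (\<phi> x))"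
    by (rule generator_change[OF 1 2(1) x 2(2)]) (rule that)
  have "K (v (\<phi> x)) = 0" using K(4,5) 2(3) by simp
  moreover have "K 0 = 0" using K(2)[of 0 0] by simp
  ultimately show "v (\<phi> x) = 0" using injD[OF K(3)] by metis
qed

text \<open>Tangency passes between generators because one field is g times the image of the other;
  the factor k is replaced by k / g.\<close>

lemma tangent_at_generator:
  assumes 1: "(U, \<phi>, v) \<in> F" and N: "open N" "s \<in> N" and c: "continuous_map (top_of_set N) (mtop X) c"
    and s: "c s \<in> U"
  shows "tangent_at F c s \<longleftrightarrow> (\<exists>k. ((\<phi> \<circ> c) has_derivative (\<lambda>h. (h * k) *\<^sub>C v (\<phi> (c s)))) (at s))"
proof
  show "tangent_at F c s \<Longrightarrow> \<exists>k. ((\<phi> \<circ> c) has_derivative (\<lambda>h. (h * k) *\<^sub>C v (\<phi> (c s)))) (at s)"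
    using 1 s unfolding tangent_at_def by blast
  assume "\<exists>k. ((\<phi> \<circ> c) has_derivative (\<lambda>h. (h * k) *\<^sub>C v (\<phi> (c s)))) (at s)"
  then obtain k where k: "((\<phi> \<circ> c) has_derivative (\<lambda>h. (h * k) *\<^sub>C v (\<phi> (c s)))) (at s)" ..
  have "\<exists>k'. ((\<phi>' \<circ> c) has_derivative (\<lambda>h. (h * k') *\<^sub>C v' (\<phi>' (c s)))) (at s)"
    if 2: "(U', \<phi>', v') \<in> F" "c s \<in> U'" for U' \<phi>' v'
  proof -
    obtain K g where K: "((\<phi>' \<circ> inv_into U \<phi>) has_derivative K) (at (\<phi> (c s)))"
      "\<And>c v. K (c *\<^sub>C v) = c *\<^sub>C K v" "inj K" "g \<noteq> 0" "v' (\<phi>' (c s)) = g *\<^sub>C K (v (\<phi> (c s)))"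
      by (rule generator_change[OF 1 2(1) s 2(2)]) (rule that)
    have "((\<phi>' \<circ> c) has_derivative (K \<circ> (\<lambda>h. (h * k) *\<^sub>C v (\<phi> (c s))))) (at s)"
      by (rule chart_change_derivative[OF X generator(1)[OF 1] generator(1)[OF 2(1)] N c s 2(2) k K(1)])
    moreover have "K \<circ> (\<lambda>h. (h * k) *\<^sub>C v (\<phi> (c s))) = (\<lambda>h. (h * (k / g)) *\<^sub>C v' (\<phi>' (c s)))"
      by (simp add: fun_eq_iff K(2,4,5) scaleC_scaleC)
    ultimately show ?thesis by metis
  qed
  then show "tangent_at F c s" unfolding tangent_at_def by blast
qed

text \<open>A chart straightening the foliation: the leaves are the level sets of the second coordinate.\<close>

definition flow_box :: "'x set \<Rightarrow> ('x \<Rightarrow> complex \<times> complex) \<Rightarrow> complex \<Rightarrow> complex \<Rightarrow> real \<Rightarrow> bool" where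
  "flow_box B \<psi> a b \<rho> \<longleftrightarrow>
     compatible_chart X B \<psi> \<and> \<rho> > 0 \<and> \<psi> ` B = ball a \<rho> \<times> ball b \<rho> \<and> B \<inter> Sing F = {} \<and>
     (\<forall>N c s. open N \<longrightarrow> s \<in> N \<longrightarrow> continuous_map (top_of_set N) (mtop X) c \<longrightarrow> c s \<in> B \<longrightarrow>
        (tangent_at F c s \<longleftrightarrow> (\<exists>k. ((\<psi> \<circ> c) has_derivative (\<lambda>h. (h * k, 0))) (at s))))"

text \<open>The box coordinate is \<Theta> \<circ> \<phi>, with \<Theta> the inverse of the
  straightening map \<Psi>. The equivalence in the notion of a flow box needs both maps: the
  derivative of \<Theta> makes multiples of v horizontal, and that of \<Psi> turns horizontal
  vectors back into multiples of v.\<close>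

lemma flow_box_exists:
  assumes x: "x \<in> topspace (mtop X)" "x \<notin> Sing F"
  obtains B \<psi> a b \<rho> where "flow_box B \<psi> a b \<rho>" "x \<in> B"
proof -
  have "x \<in> (\<Union>(U, \<phi>, v)\<in>F. U)" using F x(1) by (simp add: foliation_def)
  then obtain U \<phi> v where G: "(U, \<phi>, v) \<in> F" "x \<in> U" by auto
  note U = generator(1)[OF G(1)] and v = generator(2)[OF G(1)]
  have nz: "v (\<phi> x) \<noteq> 0" using Sing_iff[OF G] x(2) by simp
  have \<phi>x: "\<phi> x \<in> \<phi> ` U" using G(2) by blast
  obtain a b :: complex and \<rho> \<Psi> \<Theta> where *: "\<rho> > 0" "open (\<Psi> ` (ball a \<rho> \<times> ball b \<rho>))"
    "\<Psi> ` (ball a \<rho> \<times> ball b \<rho>) \<subseteq> \<phi> ` U" "\<phi> x \<in> \<Psi> ` (ball a \<rho> \<times> ball b \<rho>)"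
    "holo_on \<Psi> (ball a \<rho> \<times> ball b \<rho>)" "holo_on \<Theta> (\<Psi> ` (ball a \<rho> \<times> ball b \<rho>))"
    "\<And>q. q \<in> ball a \<rho> \<times> ball b \<rho> \<Longrightarrow> \<Theta> (\<Psi> q) = q"
    "\<And>q. q \<in> ball a \<rho> \<times> ball b \<rho> \<Longrightarrow> v (\<Psi> q) \<noteq> 0 \<and>
       (\<exists>k. k \<noteq> 0 \<and> ((\<lambda>x. \<Psi> (x, snd q)) has_derivative (\<lambda>h. (h * k) *\<^sub>C v (\<Psi> q))) (at (fst q)))"
    by (rule flow_normal_form[OF compatible_chartD(2)[OF U] v \<phi>x nz]) (rule that)
  define Q where "Q = ball a \<rho> \<times> ball b \<rho>"
  note * = *[folded Q_def]
  have Q: "open Q" by (simp add: Q_def open_Times)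
  define B where "B = {y \<in> U. \<phi> y \<in> \<Psi> ` Q}"
  have B: "openin (mtop X) B" "B \<subseteq> U"
    using chart_openin_preimage[OF U *(2)] by (auto simp: B_def)
  have \<phi>B: "\<phi> ` B = \<Psi> ` Q"
  proof
    show "\<Psi> ` Q \<subseteq> \<phi> ` B"
    proof
      fix z assume z: "z \<in> \<Psi> ` Q"
      then obtain y where y: "y \<in> U" "z = \<phi> y" using *(3) by blast
      then have "y \<in> B" using z by (simp add: B_def)
      then show "z \<in> \<phi> ` B" using y(2) by blast
    qed
  qed (auto simp: B_def)
  have \<Theta>Q: "\<Theta> ` \<Psi> ` Q = Q" using *(7) by force
  define \<psi> where "\<psi> = \<Theta> \<circ> \<phi>"
  have cB: "compatible_chart X B \<psi>"
    unfolding \<psi>_def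
    by (rule compatible_chart_compose[OF X U B]) (use * Q \<phi>B \<Theta>Q in auto)
  have \<psi>B: "\<psi> ` B = Q" unfolding \<psi>_def image_comp[symmetric] \<phi>B \<Theta>Q ..
  have \<Psi>\<psi>: "\<Psi> (\<psi> y) = \<phi> y" "\<psi> y \<in> Q" if "y \<in> B" for y
    using that *(7) by (auto simp: B_def \<psi>_def)
  have "B \<inter> Sing F = {}"
  proof -
    have "v (\<phi> y) \<noteq> 0" if "y \<in> B" for y
      using *(8)[OF \<Psi>\<psi>(2)[OF that]] \<Psi>\<psi>(1)[OF that] by simp
    then show ?thesis using Sing_iff[OF G(1)] B(2) by blast
  qed
  moreover have "tangent_at F c s \<longleftrightarrow> (\<exists>k. ((\<psi> \<circ> c) has_derivative (\<lambda>h. (h * k, 0))) (at s))"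
    if N: "open N" "s \<in> N" and c: "continuous_map (top_of_set N) (mtop X) c" and s: "c s \<in> B" for N c s
  proof -
    have sU: "c s \<in> U" using s B(2) by blast
    let ?q = "\<psi> (c s)"
    have q: "?q \<in> Q" "\<Psi> ?q = \<phi> (c s)" using \<Psi>\<psi>[OF s] by auto
    obtain k0 where k0: "k0 \<noteq> 0"
      "((\<lambda>x. \<Psi> (x, snd ?q)) has_derivative (\<lambda>h. (h * k0) *\<^sub>C v (\<phi> (c s)))) (at (fst ?q))"
      using *(8)[OF q(1)] q(2) by auto
    have q': "\<phi> (c s) \<in> \<Psi> ` Q" using q by (metis image_eqI)
    obtain M where M: "(\<Theta> has_derivative M) (at (\<phi> (c s)))" "\<And>c v. M (c *\<^sub>C v) = c *\<^sub>C M v"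
      by (rule holo_onE[OF *(6) q']) (rule that)
    obtain P where P: "(\<Psi> has_derivative P) (at ?q)"
      using *(5) q(1) unfolding holo_on_def by meson
    have pair: "((\<lambda>x. (x, snd ?q)) has_derivative (\<lambda>h. (h, 0))) (at (fst ?q))"
      by (auto intro!: derivative_eq_intros)
    have "((\<lambda>x. \<Psi> (x, snd ?q)) has_derivative (\<lambda>h. P (h, 0))) (at (fst ?q))"
      using has_derivative_compose[OF pair, of \<Psi> P] P by simp
    then have P0: "P (h, 0) = (h * k0) *\<^sub>C v (\<phi> (c s))" for h
      using has_derivative_unique[OF k0(2)] by metis
    \<comment> \<open>Obtained by differentiating \<Theta> \<circ> \<Psi> = id along the first
      coordinate, in which \<Psi> moves with velocity k0 times v.\<close>
    have Mv: "M ((h * k0) *\<^sub>C v (\<phi> (c s))) = (h, 0)" for h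
    proof -
      have "((\<lambda>x. \<Theta> (\<Psi> (x, snd ?q))) has_derivative (\<lambda>h. M ((h * k0) *\<^sub>C v (\<phi> (c s))))) (at (fst ?q))"
        using has_derivative_compose[OF k0(2), of \<Theta> M] M(1) q(2) by simp
      moreover have "((\<lambda>x. \<Theta> (\<Psi> (x, snd ?q))) has_derivative (\<lambda>h. (h, 0))) (at (fst ?q))"
        by (rule has_derivative_transform_within_open[OF pair, of "ball a \<rho>"])
          (use q(1) *(7) in \<open>auto simp: Q_def\<close>)
      ultimately show ?thesis using has_derivative_unique by metis
    qed
    have "(\<exists>k. ((\<phi> \<circ> c) has_derivative (\<lambda>h. (h * k) *\<^sub>C v (\<phi> (c s)))) (at s)) \<longleftrightarrow>
      (\<exists>k. ((\<psi> \<circ> c) has_derivative (\<lambda>h. (h * k, 0))) (at s))"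
    proof
      assume "\<exists>k. ((\<phi> \<circ> c) has_derivative (\<lambda>h. (h * k) *\<^sub>C v (\<phi> (c s)))) (at s)"
      then obtain k where k: "((\<phi> \<circ> c) has_derivative (\<lambda>h. (h * k) *\<^sub>C v (\<phi> (c s)))) (at s)" ..
      have "(\<Theta> \<circ> (\<phi> \<circ> c) has_derivative (M \<circ> (\<lambda>h. (h * k) *\<^sub>C v (\<phi> (c s))))) (at s)"
        by (rule diff_chain_at[OF k]) (use M in simp)
      moreover have "M \<circ> (\<lambda>h. (h * k) *\<^sub>C v (\<phi> (c s))) = (\<lambda>h. (h * (k / k0), 0))"
        using Mv[of "_ * (k / k0)"] k0(1) by (auto simp: fun_eq_iff)
      ultimately show "\<exists>k. ((\<psi> \<circ> c) has_derivative (\<lambda>h. (h * k, 0))) (at s)"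
        unfolding \<psi>_def comp_assoc by metis
    next
      assume "\<exists>k. ((\<psi> \<circ> c) has_derivative (\<lambda>h. (h * k, 0))) (at s)"
      then obtain k where k: "((\<psi> \<circ> c) has_derivative (\<lambda>h. (h * k, 0))) (at s)" ..
      have "(\<Psi> \<circ> (\<psi> \<circ> c) has_derivative (P \<circ> (\<lambda>h. (h * k, 0)))) (at s)"
        by (rule diff_chain_at[OF k]) (use P in simp)
      then have "((\<phi> \<circ> c) has_derivative (P \<circ> (\<lambda>h. (h * k, 0)))) (at s)"
        by (rule has_derivative_transform_within_open[OF _ open_nbhd_chart_preimage[OF B(1) N c s]])
          (use \<Psi>\<psi> in auto)
      moreover have "P \<circ> (\<lambda>h. (h * k, 0)) = (\<lambda>h. (h * (k * k0)) *\<^sub>C v (\<phi> (c s)))"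
        using P0 by (auto simp: mult.assoc)
      ultimately show "\<exists>k. ((\<phi> \<circ> c) has_derivative (\<lambda>h. (h * k) *\<^sub>C v (\<phi> (c s)))) (at s)" by metis
    qed
    then show ?thesis using tangent_at_generator[OF G(1) N c sU] by simp
  qed
  ultimately have "flow_box B \<psi> a b \<rho>"
    unfolding flow_box_def using cB *(1) \<psi>B by (auto simp: Q_def)
  moreover have "x \<in> B" using G(2) *(4) by (simp add: B_def)
  ultimately show ?thesis by (rule that)
qed

section \<open>The leaf topology in flow-box coordinates\<close>

abbreviation leafT :: "'x topology" where "leafT \<equiv> leaf_topology X F"

lemma flow_boxD:
  assumes "flow_box B \<psi> a b \<rho>"
  shows "compatible_chart X B \<psi>" "\<rho> > 0" "\<psi> ` B = ball a \<rho> \<times> ball b \<rho>" "B \<inter> Sing F = {}"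
    "openin (mtop X) B" "inj_on \<psi> B" "\<And>x. x \<in> B \<Longrightarrow> inv_into B \<psi> (\<psi> x) = x"
    "\<And>x y. x \<in> ball a \<rho> \<Longrightarrow> y \<in> ball b \<rho> \<Longrightarrow> inv_into B \<psi> (x, y) \<in> B \<and> \<psi> (inv_into B \<psi> (x, y)) = (x, y)"
    "\<And>x. x \<in> B \<Longrightarrow> fst (\<psi> x) \<in> ball a \<rho> \<and> snd (\<psi> x) \<in> ball b \<rho>"
proof -
  have fb: "compatible_chart X B \<psi> \<and> \<rho> > 0 \<and> \<psi> ` B = ball a \<rho> \<times> ball b \<rho> \<and> B \<inter> Sing F = {}"
    using assms unfolding flow_box_def by (elim conjE) (intro conjI)
  show *: "compatible_chart X B \<psi>" "\<rho> > 0" "\<psi> ` B = ball a \<rho> \<times> ball b \<rho>" "B \<inter> Sing F = {}"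
    using fb by simp_all
  show "openin (mtop X) B" "inj_on \<psi> B" "\<And>x. x \<in> B \<Longrightarrow> inv_into B \<psi> (\<psi> x) = x"
    using compatible_chartD[OF *(1)] by blast+
  show "inv_into B \<psi> (x, y) \<in> B \<and> \<psi> (inv_into B \<psi> (x, y)) = (x, y)"
    if "x \<in> ball a \<rho>" "y \<in> ball b \<rho>" for x y
  proof -
    have "(x, y) \<in> \<psi> ` B" using *(3) that by simp
    then show ?thesis using inv_into_into f_inv_into_f by metis
  qed
  show "fst (\<psi> x) \<in> ball a \<rho> \<and> snd (\<psi> x) \<in> ball b \<rho>" if "x \<in> B" for x
  proof -
    have "\<psi> x \<in> ball a \<rho> \<times> ball b \<rho>" using *(3) that by blast
    then show ?thesis by auto
  qed
qed

lemma flow_box_tangent: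
  assumes "flow_box B \<psi> a b \<rho>"
    and "open N" "s \<in> N" "continuous_map (top_of_set N) (mtop X) c" "c s \<in> B"
  shows "tangent_at F c s \<longleftrightarrow> (\<exists>k. ((\<psi> \<circ> c) has_derivative (\<lambda>h. (h * k, 0))) (at s))"
proof -
  have "\<forall>N c s. open N \<longrightarrow> s \<in> N \<longrightarrow> continuous_map (top_of_set N) (mtop X) c \<longrightarrow> c s \<in> B \<longrightarrow>
        (tangent_at F c s \<longleftrightarrow> (\<exists>k. ((\<psi> \<circ> c) has_derivative (\<lambda>h. (h * k, 0))) (at s)))"
    using assms(1) unfolding flow_box_def by (elim conjE)
  then show ?thesis using assms(2-5) by blast
qed


text \<open>Horizontal discs in a box are the model integral discs; the scaling by \<delta> is there
  because integral discs are parametrized by the unit disc.\<close>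

lemma plaque_integral_disc:
  assumes fb: "flow_box B \<psi> a b \<rho>" and xy: "ball x \<delta> \<subseteq> ball a \<rho>" "\<delta> > 0" "y \<in> ball b \<rho>"
  shows "integral_disc X F (\<lambda>s. inv_into B \<psi> (x + of_real \<delta> * s, y))"
    "\<And>s. s \<in> ball 0 1 \<Longrightarrow> x + of_real \<delta> * s \<in> ball a \<rho>"
proof -
  note B = flow_boxD[OF fb]
  let ?l = "\<lambda>s::complex. (x + of_real \<delta> * s, y)" let ?c = "\<lambda>s. inv_into B \<psi> (?l s)"
  show l: "x + of_real \<delta> * s \<in> ball a \<rho>" if "s \<in> ball 0 1" for s
  proof -
    have "x + of_real \<delta> * s \<in> ball x \<delta>" using that xy(2) by (auto simp: dist_norm norm_mult)
    then show ?thesis using xy(1) by blast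
  qed
  have c: "?c s \<in> B" "\<psi> (?c s) = ?l s" if "s \<in> ball 0 1" for s
    using B(8)[OF l[OF that] xy(3)] by auto
  have dl: "(?l has_derivative (\<lambda>h. (h * of_real \<delta>, 0))) (at s)" for s
    by (auto intro!: derivative_eq_intros)
  have cont: "continuous_map (top_of_set (ball 0 1)) (mtop X) ?c"
  proof -
    have "continuous_map (top_of_set (ball 0 1)) (top_of_set (\<psi> ` B)) ?l"
      unfolding B(3) using l xy(3) by (auto simp: continuous_map_in_subtopology intro!: continuous_intros)
    from continuous_map_compose[OF this chart_inv_continuous[OF B(1)]] show ?thesis by (simp add: o_def)
  qed
  have d: "((\<psi> \<circ> ?c) has_derivative (\<lambda>h. (h * of_real \<delta>, 0))) (at s)" if "s \<in> ball 0 1" for s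
    by (rule has_derivative_transform_within_open[OF dl, of "ball 0 1"]) (use that c in auto)
  have chart: "\<exists>L. ((\<eta> \<circ> ?c) has_derivative L) (at s) \<and> (\<forall>c v. L (c *\<^sub>C v) = c *\<^sub>C L v) \<and> inj L"
    if s: "s \<in> ball 0 1" "?c s \<in> V" and V: "(V, \<eta>) \<in> charts X" for s V \<eta>
  proof -
    note cV = atlas_chart[OF X V]
    obtain K K' where K: "((\<eta> \<circ> inv_into B \<psi>) has_derivative K) (at (\<psi> (?c s)))"
      "\<And>c v. K (c *\<^sub>C v) = c *\<^sub>C K v" "K \<circ> K' = id" "K' \<circ> K = id"
      by (rule chart_transition_derivative[OF X B(1) cV c(1)[OF s(1)] s(2)]) (rule that)
    have "((\<eta> \<circ> ?c) has_derivative K \<circ> (\<lambda>h. (h * of_real \<delta>, 0))) (at s)"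
      by (rule chart_change_derivative[OF X B(1) cV open_ball s(1) cont c(1)[OF s(1)] s(2) d[OF s(1)] K(1)])
    moreover have "inj (K \<circ> (\<lambda>h. (h * of_real \<delta>, 0)))"
    proof (rule inj_compose)
      show "inj K" using K(4) by (metis comp_apply id_apply injI)
      show "inj (\<lambda>h. (h * complex_of_real \<delta>, 0::complex))" using xy(2) by (auto intro: injI)
    qed
    moreover have "(K \<circ> (\<lambda>h. (h * of_real \<delta>, 0))) (c *\<^sub>C v) = c *\<^sub>C (K \<circ> (\<lambda>h. (h * of_real \<delta>, 0))) v" for c v
      using K(2)[of c "(v * of_real \<delta>, 0)"] by (simp add: scaleC_prod_def scaleC_complex_def mult.assoc)
    ultimately show ?thesis by blast
  qed
  have "holo_map (open_mfd (ball 0 1)) X ?c"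
    unfolding holo_map_def
  proof (intro conjI ballI)
    show "continuous_map (mtop (open_mfd (ball 0 1))) (mtop X) ?c" using cont by (simp add: open_mfd_def)
    fix c1 assume c1: "c1 \<in> charts (open_mfd (ball (0::complex) 1))"
    have "holo_on (\<eta> \<circ> ?c \<circ> inv_into (ball 0 1) id) (id ` {s \<in> ball 0 1. ?c s \<in> V})"
      if V: "(V, \<eta>) \<in> charts X" for V \<eta>
    proof -
      have op: "openin (mtop X) V" using compatible_chartD(1)[OF atlas_chart[OF X V]] .
      have "open {s \<in> ball 0 1. ?c s \<in> V}"
      proof -
        have "openin (top_of_set (ball 0 1)) {s \<in> topspace (top_of_set (ball 0 1)). ?c s \<in> V}"
          by (rule openin_continuous_map_preimage[OF cont op])
        then show ?thesis using openin_open_eq[OF open_ball] by auto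
      qed
      moreover have "holo_on (\<eta> \<circ> ?c) {s \<in> ball 0 1. ?c s \<in> V}"
        unfolding holo_on_def using chart[OF _ _ V] by blast
      ultimately have "holo_on (\<eta> \<circ> ?c \<circ> inv_into (ball 0 1) id) {s \<in> ball 0 1. ?c s \<in> V}"
        by (rule holo_on_cong_open) simp
      then show ?thesis by simp
    qed
    then show "case c1 of (U, \<phi>) \<Rightarrow> \<forall>(V, \<psi>')\<in>charts X.
          holo_on (\<psi>' \<circ> ?c \<circ> inv_into U \<phi>) (\<phi> ` {s \<in> U. ?c s \<in> V})"
      using c1 unfolding open_mfd_def by auto
  qed
  moreover have "inj (frechet_derivative (\<eta> \<circ> ?c \<circ> inv_into (ball 0 1) id) (at (id s)))"
    if s: "s \<in> ball 0 1" "?c s \<in> V" and V: "(V, \<eta>) \<in> charts X" for s V \<eta>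
  proof -
    obtain L where L: "((\<eta> \<circ> ?c) has_derivative L) (at s)" "inj L"
      using chart[OF s V] by blast
    have "((\<eta> \<circ> ?c \<circ> inv_into (ball 0 1) id) has_derivative L) (at s)"
      by (rule has_derivative_transform_within_open[OF L(1), of "ball 0 1"]) (use s in auto)
    then show ?thesis using frechet_derivative_at L(2) by (metis id_apply)
  qed
  ultimately have "holo_immersion (open_mfd (ball 0 1)) X ?c"
    unfolding holo_immersion_def by (auto simp: open_mfd_def)
  moreover have "?c s \<notin> Sing F" "tangent_at F ?c s" if "s \<in> ball 0 1" for s
    using c(1)[OF that] B(4) d[OF that] flow_box_tangent[OF fb open_ball that cont] by blast+
  ultimately show "integral_disc X F ?c" unfolding integral_disc_def by blast
qed

lemma integral_discD:
  assumes "integral_disc X F c"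
  shows "continuous_map (top_of_set (ball 0 1)) (mtop X) c"
    "\<And>s. s \<in> ball 0 1 \<Longrightarrow> c s \<notin> Sing F" "\<And>s. s \<in> ball 0 1 \<Longrightarrow> c s \<in> topspace (mtop X)"
proof -
  show *: "continuous_map (top_of_set (ball 0 1)) (mtop X) c"
    using assms by (auto simp: integral_disc_def holo_immersion_def holo_map_def open_mfd_def)
  show "c s \<notin> Sing F" if "s \<in> ball 0 1" for s using assms that by (auto simp: integral_disc_def)
  show "c s \<in> topspace (mtop X)" if "s \<in> ball 0 1" for s
    using continuous_map_image_subset_topspace[OF *] that by auto
qed

lemma immersed_disc_chart_derivative:
  assumes c: "holo_immersion (open_mfd (ball 0 r)) X c" and s: "s \<in> ball 0 r" "c s \<in> B"
    and B: "compatible_chart X B \<psi>"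
  obtains L where "((\<psi> \<circ> c) has_derivative L) (at s)" "\<And>c v. L (c *\<^sub>C v) = c *\<^sub>C L v" "inj L"
proof -
  have hm: "holo_map (open_mfd (ball 0 r)) X c" using c by (simp add: holo_immersion_def)
  have cont: "continuous_map (top_of_set (ball 0 r)) (mtop X) c"
    using hm by (simp add: holo_map_def open_mfd_def)
  obtain V \<eta> where V: "(V, \<eta>) \<in> charts X" "c s \<in> V"
    using atlas_covers[OF X, of "c s"] chart_topspace[OF B] s(2) by blast
  note cV = atlas_chart[OF X V(1)]
  have "holo_on (\<eta> \<circ> c \<circ> inv_into (ball 0 r) id) (id ` {s \<in> ball 0 r. c s \<in> V})"
    using hm V(1) unfolding holo_map_def open_mfd_def by auto
  then obtain L where L: "((\<eta> \<circ> c \<circ> inv_into (ball 0 r) id) has_derivative L) (at s)"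
    "\<And>c v. L (c *\<^sub>C v) = c *\<^sub>C L v"
    using holo_onE[of _ _ s] s V(2) by (metis (mono_tags, lifting) id_apply image_iff mem_Collect_eq)
  have "inj (frechet_derivative (\<eta> \<circ> c \<circ> inv_into (ball 0 r) id) (at (id s)))"
    using c V s unfolding holo_immersion_def open_mfd_def by auto
  then have inj: "inj L" using frechet_derivative_at[OF L(1)] by simp
  have L1: "((\<eta> \<circ> c) has_derivative L) (at s)"
    by (rule has_derivative_transform_within_open[OF L(1), of "ball 0 r"]) (use s in auto)
  obtain K K' where K: "((\<psi> \<circ> inv_into V \<eta>) has_derivative K) (at (\<eta> (c s)))"
    "\<And>c v. K (c *\<^sub>C v) = c *\<^sub>C K v" "K \<circ> K' = id" "K' \<circ> K = id"
    by (rule chart_transition_derivative[OF X cV B V(2) s(2)]) (rule that)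
  have "((\<psi> \<circ> c) has_derivative (K \<circ> L)) (at s)"
    by (rule chart_change_derivative[OF X cV B open_ball s(1) cont V(2) s(2) L1 K(1)])
  moreover have "inj K" using K(4) by (metis comp_apply id_apply injI)
  then have "inj (K \<circ> L)" using inj by (rule inj_compose)
  moreover have "(K \<circ> L) (c *\<^sub>C v) = c *\<^sub>C (K \<circ> L) v" for c v by (simp add: K(2) L(2))
  ultimately show ?thesis using that[of "K \<circ> L"] by metis
qed

text \<open>Tangency makes the velocity horizontal, and the immersion property makes it
  nonzero.\<close>

lemma integral_disc_flow_box:
  assumes c: "integral_disc X F c" and fb: "flow_box B \<psi> a b \<rho>" and s: "s \<in> ball 0 1" "c s \<in> B"
  obtains k where "k \<noteq> 0" "((\<psi> \<circ> c) has_derivative (\<lambda>h. (h * k, 0))) (at s)"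
proof -
  note B = flow_boxD[OF fb] and cont = integral_discD(1)[OF c]
  have "tangent_at F c s" using c s(1) by (auto simp: integral_disc_def)
  then obtain k where k: "((\<psi> \<circ> c) has_derivative (\<lambda>h. (h * k, 0))) (at s)"
    using flow_box_tangent[OF fb open_ball s(1) cont s(2)] by blast
  have im: "holo_immersion (open_mfd (ball 0 1)) X c" using c by (simp add: integral_disc_def)
  obtain L where L: "((\<psi> \<circ> c) has_derivative L) (at s)" "\<And>c v. L (c *\<^sub>C v) = c *\<^sub>C L v" "inj L"
    by (rule immersed_disc_chart_derivative[OF im s B(1)]) (rule that)
  have "L = (\<lambda>h. (h * k, 0))" using has_derivative_unique[OF L(1) k] .
  then have "k \<noteq> 0" using injD[OF L(3), of 0 1] by auto
  with k show ?thesis by (rule that[rotated])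
qed

lemma topspace_leafT: "topspace leafT = topspace (mtop X) - Sing F"
proof -
  have "topspace leafT = (\<Union>{c ` ball 0 1 |c. integral_disc X F c})"
    by (simp add: leaf_topology_def topology_generated_by_topspace)
  also have "\<dots> = topspace (mtop X) - Sing F"
  proof
    show "(\<Union>{c ` ball 0 1 |c. integral_disc X F c}) \<subseteq> topspace (mtop X) - Sing F"
      using integral_discD by blast
    show "topspace (mtop X) - Sing F \<subseteq> (\<Union>{c ` ball 0 1 |c. integral_disc X F c})"
    proof
      fix x assume "x \<in> topspace (mtop X) - Sing F"
      then obtain B \<psi> a b \<rho> where fb: "flow_box B \<psi> a b \<rho>" and x: "x \<in> B"
        using flow_box_exists[of x] by blast
      note B = flow_boxD[OF fb]
      obtain \<delta> where \<delta>: "\<delta> > 0" "ball (fst (\<psi> x)) \<delta> \<subseteq> ball a \<rho>"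
        using B(9)[OF x] open_contains_ball open_ball by metis
      note c = plaque_integral_disc(1)[OF fb \<delta>(2,1) conjunct2[OF B(9)[OF x]]]
      have "x \<in> (\<lambda>s. inv_into B \<psi> (fst (\<psi> x) + of_real \<delta> * s, snd (\<psi> x))) ` ball 0 1"
        using B(7)[OF x] by (intro image_eqI[of _ _ 0]) auto
      with c show "x \<in> (\<Union>{c ` ball 0 1 |c. integral_disc X F c})" by blast
    qed
  qed
  finally show ?thesis .
qed

lemma openin_leafT_disc: "integral_disc X F c \<Longrightarrow> openin leafT (c ` ball 0 1)"
  unfolding leaf_topology_def by (rule topology_generated_by_Basis) blast

text \<open>Around each point a small horizontal disc of a box is an integral disc, hence open for
  the leaves, and it fits into the given set.\<close>

lemma leafT_openI:
  assumes "\<And>x. x \<in> A \<Longrightarrow> \<exists>B \<psi> a b \<rho> \<delta>. flow_box B \<psi> a b \<rho> \<and> x \<in> B \<and> \<delta> > 0 \<and>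
      (\<forall>z\<in>B. dist (fst (\<psi> x)) (fst (\<psi> z)) < \<delta> \<and> snd (\<psi> z) = snd (\<psi> x) \<longrightarrow> z \<in> A)"
  shows "openin leafT A"
proof (subst openin_subopen, rule ballI)
  fix x assume "x \<in> A"
  then obtain B \<psi> a b \<rho> \<delta> where fb: "flow_box B \<psi> a b \<rho>" and x: "x \<in> B" and \<delta>: "\<delta> > 0"
    "\<And>z. z \<in> B \<Longrightarrow> dist (fst (\<psi> x)) (fst (\<psi> z)) < \<delta> \<Longrightarrow> snd (\<psi> z) = snd (\<psi> x) \<Longrightarrow> z \<in> A"
    using assms by metis
  note B = flow_boxD[OF fb]
  obtain \<delta>' where \<delta>': "\<delta>' > 0" "ball (fst (\<psi> x)) \<delta>' \<subseteq> ball a \<rho>"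
    using B(9)[OF x] open_contains_ball open_ball by metis
  \<comment> \<open>The given \<delta> may reach beyond the box; \<delta>' keeps the disc inside its
    first factor.\<close>
  define d where "d = min \<delta> \<delta>'"
  have d: "d > 0" "ball (fst (\<psi> x)) d \<subseteq> ball a \<rho>" using \<delta> \<delta>' by (auto simp: d_def)
  note c = plaque_integral_disc[OF fb d(2,1) conjunct2[OF B(9)[OF x]]]
  let ?c = "\<lambda>s. inv_into B \<psi> (fst (\<psi> x) + of_real d * s, snd (\<psi> x))"
  have "x \<in> ?c ` ball 0 1" using B(7)[OF x] by (intro image_eqI[of _ _ 0]) auto
  moreover have "?c ` ball 0 1 \<subseteq> A"
  proof clarify
    fix s :: complex assume s: "s \<in> ball 0 1"
    have z: "?c s \<in> B" "\<psi> (?c s) = (fst (\<psi> x) + of_real d * s, snd (\<psi> x))"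
      using B(8)[OF c(2)[OF s] conjunct2[OF B(9)[OF x]]] by auto
    have "dist (fst (\<psi> x)) (fst (\<psi> x) + of_real d * s) = d * cmod s" using d(1) by (simp add: dist_norm norm_mult)
    also have "\<dots> < d" using s d(1) by simp
    also have "\<dots> \<le> \<delta>" by (simp add: d_def)
    finally show "?c s \<in> A" using \<delta>(2)[OF z(1)] z(2) by simp
  qed
  ultimately show "\<exists>T. openin leafT T \<and> x \<in> T \<and> T \<subseteq> A" using openin_leafT_disc[OF c(1)] by blast
qed

text \<open>The leaf topology is finer than that of X: an open set of X contains, in box
  coordinates, a ball around each of its points and so a piece of the plaque.\<close>

lemma continuous_map_leafT: "continuous_map leafT (mtop X) (\<lambda>x. x)"
  unfolding continuous_map
proof (intro conjI allI impI)
  show "(\<lambda>x. x) ` topspace leafT \<subseteq> topspace (mtop X)" using topspace_leafT by auto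
  fix U assume U: "openin (mtop X) U"
  have "openin leafT (topspace leafT \<inter> U)"
  proof (rule leafT_openI)
    fix x assume "x \<in> topspace leafT \<inter> U"
    then obtain B \<psi> a b \<rho> where fb: "flow_box B \<psi> a b \<rho>" and x: "x \<in> B" "x \<in> U"
      using flow_box_exists[of x] topspace_leafT by blast
    note B = flow_boxD[OF fb]
    have "openin (mtop X) (B \<inter> U)" using B(5) U by blast
    then have "open (\<psi> ` (B \<inter> U))" using chart_open_image[OF B(1)] by blast
    then obtain \<delta> where \<delta>: "\<delta> > 0" "ball (\<psi> x) \<delta> \<subseteq> \<psi> ` (B \<inter> U)"
      using x open_contains_ball by (metis IntI imageI)
    have "z \<in> topspace leafT \<inter> U"
      if z: "z \<in> B" "dist (fst (\<psi> x)) (fst (\<psi> z)) < \<delta>" "snd (\<psi> z) = snd (\<psi> x)" for z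
    proof -
      have "\<psi> z \<in> ball (\<psi> x) \<delta>" using z(2,3) by (simp add: dist_prod_def)
      then obtain z' where z': "z' \<in> B \<inter> U" "\<psi> z = \<psi> z'" using \<delta>(2) by auto
      then have "z = z'" using inj_onD[OF B(6)] z(1) by blast
      then show ?thesis using z' B(4) openin_subset[OF B(5)] topspace_leafT by auto
    qed
    with fb x(1) \<delta>(1) show "\<exists>B \<psi> a b \<rho> \<delta>. flow_box B \<psi> a b \<rho> \<and> x \<in> B \<and> \<delta> > 0 \<and>
      (\<forall>z\<in>B. dist (fst (\<psi> x)) (fst (\<psi> z)) < \<delta> \<and> snd (\<psi> z) = snd (\<psi> x) \<longrightarrow> z \<in> topspace leafT \<inter> U)"
      by blast
  qed
  then show "openin leafT {x \<in> topspace leafT. x \<in> U}" by (simp add: Collect_conj_eq Int_commute inf_commute)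
qed

lemma leafT_continuous_imp_continuous:
  "continuous_map Z leafT g \<Longrightarrow> continuous_map Z (mtop X) g"
  using continuous_map_compose[OF _ continuous_map_leafT] by (simp add: o_def)

lemma flow_box_subset_leafT: "flow_box B \<psi> a b \<rho> \<Longrightarrow> B \<subseteq> topspace leafT"
  using flow_boxD(4) openin_subset[OF flow_boxD(5)] topspace_leafT by blast

text \<open>Any union of plaques of a box is open for the leaves, which is why the second coordinate
  is continuous even into the discrete topology.\<close>

lemma leafT_continuous_locally_constant:
  assumes fb: "flow_box B \<psi> a b \<rho>" and g: "continuous_map Z leafT g" "g ` topspace Z \<subseteq> B"
  shows "continuous_map Z (discrete_topology UNIV) (\<lambda>z. snd (\<psi> (g z)))"
  unfolding continuous_map
proof (intro conjI allI impI)
  fix U :: "complex set"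
  have "openin leafT {x \<in> B. snd (\<psi> x) \<in> U}"
  proof (rule leafT_openI)
    fix x assume "x \<in> {x \<in> B. snd (\<psi> x) \<in> U}"
    then show "\<exists>B' \<psi>' a b \<rho> \<delta>. flow_box B' \<psi>' a b \<rho> \<and> x \<in> B' \<and> \<delta> > 0 \<and> (\<forall>z\<in>B'.
        dist (fst (\<psi>' x)) (fst (\<psi>' z)) < \<delta> \<and> snd (\<psi>' z) = snd (\<psi>' x) \<longrightarrow> z \<in> {x \<in> B. snd (\<psi> x) \<in> U})"
      using fb by (intro exI[of _ B] exI[of _ \<psi>] exI[of _ a] exI[of _ b] exI[of _ \<rho>] exI[of _ 1]) auto
  qed
  from openin_continuous_map_preimage[OF g(1) this]
  have "openin Z {z \<in> topspace Z. g z \<in> {x \<in> B. snd (\<psi> x) \<in> U}}" .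
  moreover have "{z \<in> topspace Z. g z \<in> {x \<in> B. snd (\<psi> x) \<in> U}} = {z \<in> topspace Z. snd (\<psi> (g z)) \<in> U}"
    using g(2) by auto
  ultimately show "openin Z {x \<in> topspace Z. snd (\<psi> (g x)) \<in> U}" by simp
qed auto

text \<open>The converse of the preceding facts. Since the topology is generated by arbitrary
  integral discs and not only by plaques, it must be seen that an integral disc contains a piece of
  the plaque around each of its points in the box.\<close>

lemma leafT_continuousI:
  assumes fb: "flow_box B \<psi> a b \<rho>" and g: "g ` topspace Z \<subseteq> B"
    and f1: "continuous_map Z euclidean (\<lambda>z. fst (\<psi> (g z)))"
    and f2: "continuous_map Z (discrete_topology UNIV) (\<lambda>z. snd (\<psi> (g z)))"
  shows "continuous_map Z leafT g"
  unfolding leaf_topology_def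
proof (rule continuous_on_generated_topo)
  note B = flow_boxD[OF fb]
  show "g ` topspace Z \<subseteq> (\<Union>{c ` ball 0 1 |c. integral_disc X F c})"
    using g flow_box_subset_leafT[OF fb] by (simp add: leaf_topology_def topology_generated_by_topspace)
  fix U assume "U \<in> {c ` ball 0 1 |c. integral_disc X F c}"
  then obtain c where c: "integral_disc X F c" "U = c ` ball 0 1" by blast
  show "openin Z (g -` U \<inter> topspace Z)"
  proof (subst openin_subopen, rule ballI)
    fix z0 assume "z0 \<in> g -` U \<inter> topspace Z"
    then obtain s0 where s0: "s0 \<in> ball 0 1" "g z0 = c s0" "z0 \<in> topspace Z" using c(2) by auto
    have cB: "c s0 \<in> B" using s0 g by auto
    have op: "open {s \<in> ball 0 1. c s \<in> B}" "s0 \<in> {s \<in> ball 0 1. c s \<in> B}"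
      using open_nbhd_chart_preimage[OF B(5) open_ball s0(1) integral_discD(1)[OF c(1)] cB] by blast+
    obtain \<delta> where \<delta>: "\<delta> > 0" "ball s0 \<delta> \<subseteq> {s \<in> ball 0 1. c s \<in> B}"
      using op open_contains_ball by metis
    have d: "\<exists>k. k \<noteq> 0 \<and> ((\<lambda>s. fst (\<psi> (c s))) has_field_derivative k) (at s) \<and>
        ((\<lambda>s. snd (\<psi> (c s))) has_field_derivative 0) (at s)" if s: "s \<in> ball s0 \<delta>" for s
    proof -
      have s1: "s \<in> ball 0 1" "c s \<in> B" using s \<delta>(2) by auto
      obtain k where k: "k \<noteq> 0" "((\<psi> \<circ> c) has_derivative (\<lambda>h. (h * k, 0))) (at s)"
        by (rule integral_disc_flow_box[OF c(1) fb s1]) (rule that)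
      have "((\<lambda>s. fst (\<psi> (c s))) has_derivative (\<lambda>h. k * h)) (at s)"
        "((\<lambda>s. snd (\<psi> (c s))) has_derivative (\<lambda>h. 0 * h)) (at s)"
        using has_derivative_fst[OF k(2)] has_derivative_snd[OF k(2)] by (simp_all add: mult.commute)
      then show ?thesis
        using k(1) by (intro exI[of _ k]) (simp add: has_field_derivative_def lambda_zero[symmetric])
    qed
    \<comment> \<open>The derivative of the second coordinate along an integral disc is zero, so the
      disc stays in one plaque.\<close>
    have const: "snd (\<psi> (c s)) = snd (\<psi> (c s0))" if s: "s \<in> ball s0 \<delta>" for s
    proof -
      have "\<exists>y. \<forall>s\<in>ball s0 \<delta>. snd (\<psi> (c s)) = y"
        by (rule has_field_derivative_zero_constant[OF convex_ball])
          (use d in \<open>blast intro: has_field_derivative_at_within\<close>)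
      then show ?thesis using s \<delta>(1) centre_in_ball by metis
    qed
    let ?f = "\<lambda>s. fst (\<psi> (c s))"
    have hol: "?f holomorphic_on ball s0 \<delta>"
      unfolding holomorphic_on_open[OF open_ball] using d by blast
    \<comment> \<open>Needed for the open mapping theorem: the first coordinate then covers an open
      piece of the plaque.\<close>
    have "\<not> ?f constant_on ball s0 \<delta>"
    proof
      assume "?f constant_on ball s0 \<delta>"
      then obtain y where y: "\<And>s. s \<in> ball s0 \<delta> \<Longrightarrow> ?f s = y" by (auto simp: constant_on_def)
      obtain k where k: "k \<noteq> 0" "(?f has_field_derivative k) (at s0)" using d[of s0] \<delta>(1) by auto
      have "((\<lambda>s. y) has_field_derivative k) (at s0)"
        by (rule has_field_derivative_transform_within_open[OF k(2) open_ball]) (use \<delta>(1) y in auto)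
      then show False using k(1) DERIV_unique DERIV_const by metis
    qed
    then have A: "open (?f ` ball s0 \<delta>)"
      using open_mapping_thm[OF hol open_ball connected_ball open_ball subset_refl] by blast
    define T where "T = {z \<in> topspace Z. fst (\<psi> (g z)) \<in> ?f ` ball s0 \<delta>} \<inter>
        {z \<in> topspace Z. snd (\<psi> (g z)) \<in> {snd (\<psi> (c s0))}}"
    have "openin Z T"
      unfolding T_def
      by (intro openin_Int openin_continuous_map_preimage[OF f1] openin_continuous_map_preimage[OF f2])
        (use A in auto)
    moreover have "z0 \<in> T" using s0 \<delta>(1) by (auto simp: T_def)
    moreover have "T \<subseteq> g -` U \<inter> topspace Z"
    proof
      fix z assume z: "z \<in> T"
      then obtain s where s: "s \<in> ball s0 \<delta>" "fst (\<psi> (g z)) = ?f s" by (auto simp: T_def)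
      have "\<psi> (g z) = \<psi> (c s)" using s z const[OF s(1)] by (auto simp: T_def prod_eq_iff)
      moreover have "g z \<in> B" "c s \<in> B" "s \<in> ball 0 1" using z g \<delta>(2) s by (auto simp: T_def)
      ultimately have "g z = c s" using inj_onD[OF B(6)] by blast
      then show "z \<in> g -` U \<inter> topspace Z" using c(2) \<open>s \<in> ball 0 1\<close> z by (auto simp: T_def)
    qed
    ultimately show "\<exists>T. openin Z T \<and> z0 \<in> T \<and> T \<subseteq> g -` U \<inter> topspace Z" by blast
  qed
qed

text \<open>A connected image in the discrete space of second coordinates is a single point.\<close>

lemma pathin_flow_box_plaque:
  assumes fb: "flow_box B \<psi> a b \<rho>" and g: "continuous_map (top_of_set S) leafT g" "g ` S \<subseteq> B"
    and S: "connected S" "s \<in> S" "s' \<in> S"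
  shows "snd (\<psi> (g s)) = snd (\<psi> (g s'))"
proof -
  have c: "continuous_map (top_of_set S) (discrete_topology UNIV) (\<lambda>z. snd (\<psi> (g z)))"
    by (rule leafT_continuous_locally_constant[OF fb g(1)]) (use g(2) in auto)
  have "connectedin (top_of_set S) S" using S(1) connectedin_subtopology connectedin_iff_connected by blast
  from connectedin_continuous_map_image[OF c this]
  have "connectedin (discrete_topology UNIV) ((\<lambda>z. snd (\<psi> (g z))) ` S)" .
  then obtain y where "(\<lambda>z. snd (\<psi> (g z))) ` S \<subseteq> {y}" using connectedin_discrete_topology by metis
  then show ?thesis using S by auto
qed

lemma pathin_leafT_image: "pathin leafT \<gamma> \<Longrightarrow> s \<in> {0..1} \<Longrightarrow> \<gamma> s \<in> topspace leafT"
  using continuous_map_image_subset_topspace unfolding pathin_def by fastforce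

text \<open>A path continuous for the leaf topology cannot leave its path component, so restricting
  the target to a leaf is no extra condition.\<close>

lemma leaf_path_iff: "leaf_path X F \<gamma> \<longleftrightarrow> pathin leafT \<gamma>"
proof
  assume "leaf_path X F \<gamma>"
  then show "pathin leafT \<gamma>"
    by (simp add: leaf_path_def leaf_space_def pathin_def continuous_map_in_subtopology)
next
  assume g: "pathin leafT \<gamma>"
  have "\<gamma> ` {0..1} \<subseteq> leaf X F (\<gamma> 0)"
    unfolding leaf_def
    by (rule path_component_of_maximal[OF path_connectedin_path_image[OF g]]) auto
  with g show "leaf_path X F \<gamma>"
    by (auto simp: leaf_path_def leaf_space_def pathin_def continuous_map_in_subtopology)
qed

text \<open>The same for homotopies: the square is path connected, so its image lies in the leaf of
  the corner.\<close>

lemma leaf_homotopic_iff: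
  "leaf_homotopic X F \<gamma> \<gamma>' \<longleftrightarrow> homotopic_with (\<lambda>\<eta>. \<eta> 0 = \<gamma> 0 \<and> \<eta> 1 = \<gamma> 1) unitT leafT \<gamma> \<gamma>'"
proof
  assume "leaf_homotopic X F \<gamma> \<gamma>'"
  then show "homotopic_with (\<lambda>\<eta>. \<eta> 0 = \<gamma> 0 \<and> \<eta> 1 = \<gamma> 1) unitT leafT \<gamma> \<gamma>'"
    unfolding leaf_homotopic_def leaf_space_def homotopic_with_def
    by (auto simp: continuous_map_in_subtopology)
next
  assume "homotopic_with (\<lambda>\<eta>. \<eta> 0 = \<gamma> 0 \<and> \<eta> 1 = \<gamma> 1) unitT leafT \<gamma> \<gamma>'"
  then obtain h where h: "continuous_map (prod_topology unitT unitT) leafT h"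
    "\<forall>x. h (0, x) = \<gamma> x" "\<forall>x. h (1, x) = \<gamma>' x" "\<forall>t\<in>{0..1}. h (t, 0) = \<gamma> 0 \<and> h (t, 1) = \<gamma> 1"
    unfolding homotopic_with_def by auto
  have "path_connected_space (prod_topology unitT unitT)"
    by (simp add: convex_Times convex_imp_path_connected)
  then have "path_connectedin leafT (h ` topspace (prod_topology unitT unitT))"
    using path_connectedin_continuous_map_image[OF h(1)] path_connectedin_topspace by blast
  moreover have "\<gamma> 0 \<in> h ` topspace (prod_topology unitT unitT)"
    by (rule image_eqI[of _ _ "(0, 0)"]) (use h(2) in auto)
  ultimately have "h ` topspace (prod_topology unitT unitT) \<subseteq> leaf X F (\<gamma> 0)"
    unfolding leaf_def by (rule path_component_of_maximal)
  then have "continuous_map (prod_topology unitT unitT) (subtopology leafT (leaf X F (\<gamma> 0))) h"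
    using h(1) by (auto simp: continuous_map_in_subtopology)
  with h(2-4) show "leaf_homotopic X F \<gamma> \<gamma>'"
    unfolding leaf_homotopic_def leaf_space_def homotopic_with_def by auto
qed

end

subsection \<open>Transport of leaf paths\<close>

locale foliated_disc = foliated_surface +
  fixes d :: "'a metric" and D :: "'a set" and m :: 'a and t :: "'a \<Rightarrow> complex" and r :: real
  assumes cpt: "compact_space (mtop X)" and d: "mtopology_of d = mtop X"
    and pd: "poincare_disc X F D" and mD: "m \<in> D" and dc: "disc_coordinate X D m r t"
begin

lemma D_sub: "D \<subseteq> topspace leafT" "D \<subseteq> topspace (mtop X)"
  using pd topspace_leafT by (auto simp: poincare_disc_def)

lemma disc_coordinateD:
  shows "r > 0" "bij_betw t D (ball 0 r)" "t m = 0"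
    "holo_immersion (open_mfd (ball 0 r)) X (inv_into D t)"
    "homeomorphic_map (top_of_set (ball 0 r)) (subtopology (mtop X) D) (inv_into D t)"
    "\<And>z. z \<in> D \<Longrightarrow> t z \<in> ball 0 r \<and> inv_into D t (t z) = z"
    "\<And>s. s \<in> ball 0 r \<Longrightarrow> inv_into D t s \<in> D \<and> t (inv_into D t s) = s"
proof -
  show *: "r > 0" "bij_betw t D (ball 0 r)" "t m = 0"
    "holo_immersion (open_mfd (ball 0 r)) X (inv_into D t)"
    "homeomorphic_map (top_of_set (ball 0 r)) (subtopology (mtop X) D) (inv_into D t)"
    using dc by (auto simp: disc_coordinate_def disc_embedding_def)
  show "t z \<in> ball 0 r \<and> inv_into D t (t z) = z" if "z \<in> D" for z
    using *(2) that inv_into_f_f[of t D z] by (auto simp: bij_betw_def)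
  show "inv_into D t s \<in> D \<and> t (inv_into D t s) = s" if "s \<in> ball 0 r" for s
    using *(2) that inv_into_into[of s t D] f_inv_into_f[of s t D] by (auto simp: bij_betw_def)
qed


lemma coordinate_continuous: "continuous_map (subtopology (mtop X) D) (top_of_set (ball 0 r)) t"
proof -
  obtain g where g: "homeomorphic_maps (top_of_set (ball 0 r)) (subtopology (mtop X) D) (inv_into D t) g"
    using disc_coordinateD(5) homeomorphic_map_maps by blast
  have tD: "topspace (subtopology (mtop X) D) = D" using D_sub by auto
  have "continuous_map (subtopology (mtop X) D) (top_of_set (ball 0 r)) g"
    using g by (simp add: homeomorphic_maps_def)
  moreover have "g z = t z" if z: "z \<in> D" for z
  proof -
    have "t z \<in> topspace (top_of_set (ball 0 r))" using disc_coordinateD(6)[OF z] by simp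
    then have "g (inv_into D t (t z)) = t z" using g unfolding homeomorphic_maps_def by blast
    then show ?thesis using conjunct2[OF disc_coordinateD(6)[OF z]] by metis
  qed
  ultimately show ?thesis using continuous_map_eq tD by metis
qed

text \<open>Transversality is given in a parametrization u of D that need not be related to the
  coordinate t. It is recorded here as a property of the set D, so that it can be reused with
  t.\<close>

lemma transversal_second_coordinate_injective:
  assumes fb: "flow_box B \<psi> a b \<rho>" and z: "z \<in> D" "z \<in> B"
  obtains N where "openin (subtopology (mtop X) D) N" "z \<in> N" "N \<subseteq> B" "inj_on (\<lambda>x. snd (\<psi> x)) N"
proof -
  note B = flow_boxD[OF fb]
  obtain u where u: "disc_embedding X D 1 u" "\<And>s. s \<in> ball 0 1 \<Longrightarrow> \<not> tangent_at F u s"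
    using pd by (auto simp: poincare_disc_def)
  have im: "holo_immersion (open_mfd (ball 0 1)) X u"
    and hom: "homeomorphic_map (top_of_set (ball 0 1)) (subtopology (mtop X) D) u"
    using u(1) by (auto simp: disc_embedding_def)
  have tD: "topspace (subtopology (mtop X) D) = D" using D_sub by auto
  have "u ` ball 0 1 = D" using homeomorphic_imp_surjective_map[OF hom] tD by simp
  then obtain s where s: "s \<in> ball 0 1" "u s = z" using z(1) by auto
  have cont: "continuous_map (top_of_set (ball 0 1)) (mtop X) u"
    using homeomorphic_imp_continuous_map[OF hom] continuous_map_in_subtopology by blast
  have usB: "u s \<in> B" using s z by simp
  note op = open_nbhd_chart_preimage[OF B(5) open_ball s(1) cont usB]
  define A where "A = {x \<in> ball 0 1. u x \<in> B}"
  note op = op[folded A_def]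
  let ?f = "\<lambda>x. snd (\<psi> (u x))"
  have df: "\<exists>L. ((\<psi> \<circ> u) has_derivative L) (at x) \<and> (\<forall>c v. L (c *\<^sub>C v) = c *\<^sub>C L v) \<and>
      (?f has_field_derivative snd (L 1)) (at x)" if x: "x \<in> A" for x
  proof -
    have x1: "x \<in> ball 0 1" "u x \<in> B" using x by (auto simp: A_def)
    obtain L where L: "((\<psi> \<circ> u) has_derivative L) (at x)" "\<And>c v. L (c *\<^sub>C v) = c *\<^sub>C L v" "inj L"
      by (rule immersed_disc_chart_derivative[OF im x1 B(1)]) (rule that)
    have "(?f has_derivative (\<lambda>h. snd (L h))) (at x)" using has_derivative_snd[OF L(1)] by simp
    then have "(?f has_field_derivative snd (L 1)) (at x)"
      by (rule clinear_complex_field_derivative) (simp add: L(2) scaleC_prod_def)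
    with L(1,2) show ?thesis by blast
  qed
  have hol: "?f holomorphic_on A"
    unfolding holomorphic_on_open[OF op(1)]
  proof
    fix x assume "x \<in> A"
    from df[OF this] show "\<exists>f'. (?f has_field_derivative f') (at x)" by blast
  qed
  obtain L where L: "((\<psi> \<circ> u) has_derivative L) (at s)" "\<And>c v. L (c *\<^sub>C v) = c *\<^sub>C L v"
    "(?f has_field_derivative snd (L 1)) (at s)" using df[OF op(2)] by blast
  \<comment> \<open>Otherwise the derivative of u would be horizontal, that is, u would be tangent
    to the foliation.\<close>
  have "snd (L 1) \<noteq> 0"
  proof
    assume "snd (L 1) = 0"
    then have "L h = (h * fst (L 1), 0)" for h
      using L(2)[of h 1] by (simp add: scaleC_complex_def scaleC_prod_def)
    then have "L = (\<lambda>h. (h * fst (L 1), 0))" by blast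
    then have "tangent_at F u s"
      using flow_box_tangent[OF fb open_ball s(1) cont usB] L(1) by metis
    then show False using u(2)[OF s(1)] by blast
  qed
  then have "deriv ?f s \<noteq> 0" using DERIV_imp_deriv[OF L(3)] by simp
  then obtain e where e: "e > 0" "ball s e \<subseteq> A" "inj_on ?f (ball s e)"
    using has_complex_derivative_locally_injective[OF hol op(2,1)] by metis
  have sub: "ball s e \<subseteq> ball 0 1" using e(2) by (auto simp: A_def)
  have "openin (top_of_set (ball 0 1)) (ball s e)" using sub by (simp add: openin_open_eq)
  then have "openin (subtopology (mtop X) D) (u ` ball s e)"
    using homeomorphic_imp_open_map[OF hom] by (simp add: open_map_def)
  moreover have "z \<in> u ` ball s e" using s e(1) by auto
  moreover have "u ` ball s e \<subseteq> B" using e(2) by (auto simp: A_def)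
  moreover have "inj_on (\<lambda>x. snd (\<psi> x)) (u ` ball s e)"
    using e(3) by (auto simp: inj_on_def)
  ultimately show ?thesis by (rule that)
qed

text \<open>Near z the disc is a graph over the second box coordinate: \<xi> y is its one point on
  the plaque y. It comes from inverting the injective holomorphic function taking s to the second
  coordinate of the point with coordinate s, so the inverse t \<circ> \<xi> has nonzero
  derivative.\<close>

lemma transversal_section:
  assumes fb: "flow_box B \<psi> a b \<rho>" and z: "z \<in> D" "z \<in> B"
  obtains \<delta> \<xi> N where "\<delta> > 0" "ball (snd (\<psi> z)) \<delta> \<subseteq> ball b \<rho>"
    "\<And>y. y \<in> ball (snd (\<psi> z)) \<delta> \<Longrightarrow> \<xi> y \<in> D \<and> \<xi> y \<in> B \<and> snd (\<psi> (\<xi> y)) = y"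
    "continuous_on (ball (snd (\<psi> z)) \<delta>) (\<lambda>y. fst (\<psi> (\<xi> y)))"
    "\<And>y. y \<in> ball (snd (\<psi> z)) \<delta> \<Longrightarrow> \<exists>k. k \<noteq> 0 \<and> ((\<lambda>y. t (\<xi> y)) has_field_derivative k) (at y)"
    "openin (mtop X) N" "z \<in> N" "\<And>x. x \<in> D \<Longrightarrow> x \<in> N \<Longrightarrow> x \<in> B \<and> snd (\<psi> x) \<in> ball (snd (\<psi> z)) \<delta> \<and> \<xi> (snd (\<psi> x)) = x"
proof -
  note B = flow_boxD[OF fb] and T = disc_coordinateD
  obtain N where N: "openin (subtopology (mtop X) D) N" "z \<in> N" "N \<subseteq> B" "inj_on (\<lambda>x. snd (\<psi> x)) N"
    by (rule transversal_second_coordinate_injective[OF fb z]) (rule that)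
  let ?\<tau> = "inv_into D t"
  have tD: "topspace (subtopology (mtop X) D) = D" using D_sub by auto
  have ND: "N \<subseteq> D" using openin_subset[OF N(1)] tD by simp
  define A where "A = {s \<in> ball 0 r. ?\<tau> s \<in> N}"
  have "openin (top_of_set (ball 0 r)) {s \<in> topspace (top_of_set (ball 0 r)). ?\<tau> s \<in> N}"
    by (rule openin_continuous_map_preimage[OF homeomorphic_imp_continuous_map[OF T(5)] N(1)])
  then have A: "open A" using openin_open_eq[OF open_ball] by (auto simp: A_def)
  have AD: "?\<tau> s \<in> N" "s \<in> ball 0 r" "?\<tau> s \<in> B" "t (?\<tau> s) = s" if "s \<in> A" for s
    using that N(3) T(7) by (auto simp: A_def)
  have tzA: "t z \<in> A" using T(6)[OF z(1)] N(2) by (simp add: A_def)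
  let ?f = "\<lambda>s. snd (\<psi> (?\<tau> s))"
  have d\<tau>: "\<exists>L. ((\<psi> \<circ> ?\<tau>) has_derivative L) (at x) \<and> (?f has_field_derivative snd (L 1)) (at x)" if x: "x \<in> A" for x
  proof -
    obtain L where L: "((\<psi> \<circ> ?\<tau>) has_derivative L) (at x)" "\<And>c v. L (c *\<^sub>C v) = c *\<^sub>C L v" "inj L"
      by (rule immersed_disc_chart_derivative[OF T(4) AD(2,3)[OF x] B(1)]) (rule that)
    have "(?f has_derivative (\<lambda>h. snd (L h))) (at x)" using has_derivative_snd[OF L(1)] by simp
    then have "(?f has_field_derivative snd (L 1)) (at x)"
      by (rule clinear_complex_field_derivative) (simp add: L(2) scaleC_prod_def)
    with L(1) show ?thesis by blast
  qed
  have hol: "?f holomorphic_on A" unfolding holomorphic_on_open[OF A] using d\<tau> by blast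
  have inj: "inj_on ?f A"
  proof (rule inj_onI)
    fix s s' assume s: "s \<in> A" "s' \<in> A" "?f s = ?f s'"
    have "?\<tau> s = ?\<tau> s'" using inj_onD[OF N(4) s(3)] AD(1) s by blast
    then show "s = s'" using AD(4) s by metis
  qed
  obtain g where g: "g holomorphic_on (?f ` A)" "\<And>s. s \<in> A \<Longrightarrow> deriv ?f s * deriv g (?f s) = 1"
    "\<And>s. s \<in> A \<Longrightarrow> g (?f s) = s"
    by (rule holomorphic_has_inverse[OF hol A inj]) (rule that)
  have fA: "open (?f ` A)" by (rule open_mapping_thm3[OF hol A inj])
  let ?y = "snd (\<psi> z)"
  have "?y \<in> ?f ` A" using tzA T(6)[OF z(1)] by (intro image_eqI[of _ _ "t z"]) auto
  then obtain \<delta> where \<delta>: "\<delta> > 0" "ball ?y \<delta> \<subseteq> ?f ` A" using fA open_contains_ball by metis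
  define \<xi> where "\<xi> y = ?\<tau> (g y)" for y
  have gy: "g y \<in> A \<and> ?f (g y) = y" if y: "y \<in> ball ?y \<delta>" for y
  proof -
    obtain s where "s \<in> A" "y = ?f s" using subsetD[OF \<delta>(2) y] by blast
    then show ?thesis using g(3) by auto
  qed
  have c\<tau>: "continuous_on A (\<lambda>s. fst (\<psi> (?\<tau> s)))"
  proof (rule continuous_at_imp_continuous_on, rule ballI)
    fix s assume "s \<in> A"
    then obtain L where "((\<psi> \<circ> ?\<tau>) has_derivative L) (at s)" using d\<tau> by blast
    then have "isCont (\<psi> \<circ> ?\<tau>) s" by (rule has_derivative_continuous)
    then show "isCont (\<lambda>s. fst (\<psi> (?\<tau> s))) s" using isCont_fst by fastforce
  qed
  have cg: "continuous_on (ball ?y \<delta>) g"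
    using holomorphic_on_imp_continuous_on[OF holomorphic_on_subset[OF g(1) \<delta>(2)]] .
  \<comment> \<open>Open in D and therefore the trace on D of an open set N' of X; this is how
    nearness in X of a point of D is turned into membership in the graph.\<close>
  define S where "S = {x \<in> topspace (subtopology (mtop X) D). t x \<in> A \<inter> ?f -` ball ?y \<delta>}"
  have "open (A \<inter> ?f -` ball ?y \<delta>)"
    by (rule continuous_open_preimage[OF holomorphic_on_imp_continuous_on[OF hol] A open_ball])
  then have "openin (top_of_set (ball 0 r)) (A \<inter> ?f -` ball ?y \<delta>)"
    using AD(2) by (auto simp: openin_open_eq)
  then have "openin (subtopology (mtop X) D) S"
    unfolding S_def by (rule openin_continuous_map_preimage[OF coordinate_continuous])
  then obtain N' where N': "openin (mtop X) N'" "S = N' \<inter> D" by (auto simp: openin_subtopology)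
  show ?thesis
  proof (rule that[of \<delta> \<xi> N'])
    show "\<delta> > 0" by fact
    show "ball ?y \<delta> \<subseteq> ball b \<rho>"
    proof
      fix y assume "y \<in> ball ?y \<delta>"
      from gy[OF this] have "g y \<in> A" "y = ?f (g y)" by auto
      then show "y \<in> ball b \<rho>" using B(9) AD(3) by metis
    qed
    show "\<xi> y \<in> D \<and> \<xi> y \<in> B \<and> snd (\<psi> (\<xi> y)) = y" if "y \<in> ball ?y \<delta>" for y
      using gy[OF that] AD ND unfolding \<xi>_def by blast
    show "continuous_on (ball ?y \<delta>) (\<lambda>y. fst (\<psi> (\<xi> y)))"
      unfolding \<xi>_def by (rule continuous_on_compose2[OF c\<tau> cg]) (use gy in blast)
    show "\<exists>k. k \<noteq> 0 \<and> ((\<lambda>y. t (\<xi> y)) has_field_derivative k) (at y)" if y: "y \<in> ball ?y \<delta>" for y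
    proof -
      have "(g has_field_derivative deriv g y) (at y)"
        using g(1) fA \<delta>(2) y holomorphic_derivI by blast
      then have "((\<lambda>y. t (\<xi> y)) has_field_derivative deriv g y) (at y)"
        by (rule has_field_derivative_transform_within_open[OF _ open_ball y])
          (use gy AD(4) in \<open>simp add: \<xi>_def\<close>)
      moreover have "deriv g y \<noteq> 0" using g(2)[of "g y"] gy[OF y] by auto
      ultimately show ?thesis by blast
    qed
    show "openin (mtop X) N'" by fact
    have "z \<in> S" using z tzA T(6)[OF z(1)] \<delta>(1) tD by (auto simp: S_def)
    then show "z \<in> N'" using N'(2) by blast
    show "x \<in> B \<and> snd (\<psi> x) \<in> ball ?y \<delta> \<and> \<xi> (snd (\<psi> x)) = x" if x: "x \<in> D" "x \<in> N'" for x
    proof -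
      have "x \<in> S" using x N'(2) by blast
      then have tx: "t x \<in> A" "?f (t x) \<in> ball ?y \<delta>" by (auto simp: S_def)
      have "?\<tau> (t x) = x" using T(6)[OF x(1)] by simp
      then show ?thesis using tx AD(3)[OF tx(1)] g(3)[OF tx(1)] by (simp add: \<xi>_def)
    qed
  qed
qed

text \<open>Locally D meets each plaque once, so D is discrete for the leaf topology and a connected
  family inside it is constant. This fixes the starting points of homotopies built by
  transport.\<close>

lemma leaf_path_in_transversal_constant:
  assumes g: "continuous_map (top_of_set S) leafT g" "g ` S \<subseteq> D" and S: "connected S" "s \<in> S" "s' \<in> S"
  shows "g s = g s'"
proof (rule connected_equivalence_relation[OF S, of "\<lambda>s s'. g s = g s'"])
  fix u assume u: "u \<in> S"
  have gu: "g u \<in> D" using g(2) u by blast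
  obtain B \<psi> a b \<rho> where fb: "flow_box B \<psi> a b \<rho>" and uB: "g u \<in> B"
    using flow_box_exists[of "g u"] D_sub gu topspace_leafT by blast
  note B = flow_boxD[OF fb]
  obtain \<delta> \<xi> N where N: "openin (mtop X) N" "g u \<in> N"
    "\<And>x. x \<in> D \<Longrightarrow> x \<in> N \<Longrightarrow> x \<in> B \<and> snd (\<psi> x) \<in> ball (snd (\<psi> (g u))) \<delta> \<and> \<xi> (snd (\<psi> x)) = x"
    by (rule transversal_section[OF fb gu uB]) metis
  define T0 where "T0 = {x \<in> topspace (top_of_set S). g x \<in> N}"
  have T0: "openin (top_of_set S) T0"
    unfolding T0_def by (rule openin_continuous_map_preimage[OF leafT_continuous_imp_continuous[OF g(1)] N(1)])
  have c0: "continuous_map (top_of_set T0) leafT g"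
    using continuous_map_from_subtopology_mono[OF g(1), of T0] by (auto simp: T0_def subset_iff)
  have T0B: "g ` T0 \<subseteq> B" using N(3) g(2) by (auto simp: T0_def)
  have "continuous_map (top_of_set T0) (discrete_topology UNIV) (\<lambda>z. snd (\<psi> (g z)))"
    by (rule leafT_continuous_locally_constant[OF fb c0]) (use T0B in auto)
  then have "openin (top_of_set T0) {x \<in> topspace (top_of_set T0). snd (\<psi> (g x)) \<in> {snd (\<psi> (g u))}}"
    by (rule openin_continuous_map_preimage) auto
  then have "openin (top_of_set S) {x \<in> T0. snd (\<psi> (g x)) = snd (\<psi> (g u))}"
    using T0 openin_trans by auto
  moreover have "g u = g x" if "x \<in> {x \<in> T0. snd (\<psi> (g x)) = snd (\<psi> (g u))}" for x
  proof -
    have "x \<in> S" "g x \<in> N" "g x \<in> D" using that g(2) by (auto simp: T0_def)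
    then have "\<xi> (snd (\<psi> (g x))) = g x" using N(3) by blast
    moreover have "\<xi> (snd (\<psi> (g u))) = g u" using N(3)[OF gu N(2)] by blast
    moreover have "snd (\<psi> (g x)) = snd (\<psi> (g u))" using that by blast
    ultimately show ?thesis by metis
  qed
  moreover have "u \<in> {x \<in> T0. snd (\<psi> (g x)) = snd (\<psi> (g u))}" using u N(2) by (simp add: T0_def)
  ultimately show "\<exists>T. openin (top_of_set S) T \<and> u \<in> T \<and> (\<forall>x\<in>T. g u = g x)" by blast
qed auto

end

section \<open>Families of points in a box and relative homotopies\<close>

context foliated_surface
begin

lemma flow_box_point_continuous:
  assumes fb: "flow_box B \<psi> a b \<rho>"
    and k: "continuous_map Z euclidean k1" "continuous_map Z euclidean k2"
    and im: "\<And>z. z \<in> topspace Z \<Longrightarrow> k1 z \<in> ball a \<rho>" "\<And>z. z \<in> topspace Z \<Longrightarrow> k2 z \<in> ball b \<rho>"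
  shows "continuous_map Z (mtop X) (\<lambda>z. inv_into B \<psi> (k1 z, k2 z))"
proof -
  note B = flow_boxD[OF fb]
  have "continuous_map Z euclidean (\<lambda>z. (k1 z, k2 z))"
    using k continuous_map_paired[of Z euclidean euclidean k1 k2] by (simp add: prod_topology_euclidean)
  then have "continuous_map Z (top_of_set (\<psi> ` B)) (\<lambda>z. (k1 z, k2 z))"
    using im by (auto simp: continuous_map_in_subtopology B(3))
  from continuous_map_compose[OF this chart_inv_continuous[OF B(1)]] show ?thesis by (simp add: o_def)
qed

lemma flow_box_point_leafT_continuous:
  assumes fb: "flow_box B \<psi> a b \<rho>"
    and k: "continuous_map Z euclidean k1" "continuous_map Z (discrete_topology UNIV) k2"
    and im: "\<And>z. z \<in> topspace Z \<Longrightarrow> k1 z \<in> ball a \<rho>" "\<And>z. z \<in> topspace Z \<Longrightarrow> k2 z \<in> ball b \<rho>"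
  shows "continuous_map Z leafT (\<lambda>z. inv_into B \<psi> (k1 z, k2 z))"
proof (rule leafT_continuousI[OF fb])
  note B = flow_boxD[OF fb]
  have *: "inv_into B \<psi> (k1 z, k2 z) \<in> B" "\<psi> (inv_into B \<psi> (k1 z, k2 z)) = (k1 z, k2 z)" if "z \<in> topspace Z" for z
    using B(8)[OF im(1)[OF that] im(2)[OF that]] by auto
  show "(\<lambda>z. inv_into B \<psi> (k1 z, k2 z)) ` topspace Z \<subseteq> B" using * by blast
  show "continuous_map Z euclidean (\<lambda>z. fst (\<psi> (inv_into B \<psi> (k1 z, k2 z))))"
    by (rule continuous_map_eq[OF k(1)]) (simp add: *)
  show "continuous_map Z (discrete_topology UNIV) (\<lambda>z. snd (\<psi> (inv_into B \<psi> (k1 z, k2 z))))"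
    by (rule continuous_map_eq[OF k(2)]) (simp add: *)
qed

lemma flow_box_coordinates_continuous:
  assumes fb: "flow_box B \<psi> a b \<rho>" and g: "continuous_map Z (mtop X) g" "g ` topspace Z \<subseteq> B"
  shows "continuous_map Z euclidean (\<lambda>z. fst (\<psi> (g z)))" "continuous_map Z euclidean (\<lambda>z. snd (\<psi> (g z)))"
proof -
  have "continuous_map Z (subtopology (mtop X) B) g" using g by (auto simp: continuous_map_in_subtopology)
  from continuous_map_compose[OF this chart_continuous[OF flow_boxD(1)[OF fb]]]
  have *: "continuous_map Z euclidean (\<lambda>z. \<psi> (g z))" by (simp add: o_def)
  then have "continuous_map Z (prod_topology euclidean euclidean) (\<lambda>z. \<psi> (g z))" by (simp add: prod_topology_euclidean)
  then show "continuous_map Z euclidean (\<lambda>z. fst (\<psi> (g z)))" "continuous_map Z euclidean (\<lambda>z. snd (\<psi> (g z)))"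
    unfolding continuous_map_pairwise by (simp_all add: o_def)
qed

lemma continuous_map_prod_leafT:
  assumes "continuous_map (prod_topology (subtopology (mtop X) V) T) Y f"
  shows "continuous_map (prod_topology (subtopology leafT V) T) Y f"
proof -
  have "continuous_map (subtopology leafT V) (subtopology (mtop X) V) (\<lambda>x. x)"
    using continuous_map_leafT by (auto simp: continuous_map_in_subtopology continuous_map_from_subtopology)
  then have "continuous_map (prod_topology (subtopology leafT V) T) (prod_topology (subtopology (mtop X) V) T)
      (\<lambda>(x, y). (x, y))"
    by (subst continuous_map_prod_top) auto
  from continuous_map_compose[OF this assms] show ?thesis by (simp add: o_def case_prod_beta')
qed

text \<open>Both topologies are needed: that of X for families of paths running across leaves, and
  the leaf topology for homotopies inside one leaf.\<close>

lemma flow_box_family_continuous: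
  assumes fb: "flow_box B \<psi> a b \<rho>" and V: "V \<subseteq> B"
    and k: "continuous_map (prod_topology (subtopology (mtop X) V) T) euclidean k"
    and im: "\<And>w u. w \<in> V \<Longrightarrow> u \<in> topspace T \<Longrightarrow> k (w, u) \<in> ball a \<rho>"
  shows "continuous_map (prod_topology (subtopology (mtop X) V) T) (mtop X) (\<lambda>p. inv_into B \<psi> (k p, snd (\<psi> (fst p))))"
    and "continuous_map (prod_topology (subtopology leafT V) T) leafT (\<lambda>p. inv_into B \<psi> (k p, snd (\<psi> (fst p))))"
proof -
  note B = flow_boxD[OF fb]
  let ?Z = "prod_topology (subtopology (mtop X) V) T" and ?Z' = "prod_topology (subtopology leafT V) T"
  have fst: "continuous_map ?Z (mtop X) fst" "continuous_map ?Z' leafT fst"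
    using continuous_map_fst continuous_map_into_fulltopology by blast+
  have im1: "k p \<in> ball a \<rho>" "fst p \<in> B" "snd (\<psi> (fst p)) \<in> ball b \<rho>" if "p \<in> topspace ?Z \<union> topspace ?Z'" for p
  proof -
    have p: "fst p \<in> V" "snd p \<in> topspace T" using that by auto
    show "k p \<in> ball a \<rho>" using im[OF p] by simp
    show "fst p \<in> B" using p V by blast
    then show "snd (\<psi> (fst p)) \<in> ball b \<rho>" using B(9) by blast
  qed
  show "continuous_map ?Z (mtop X) (\<lambda>p. inv_into B \<psi> (k p, snd (\<psi> (fst p))))"
    by (rule flow_box_point_continuous[OF fb k flow_box_coordinates_continuous(2)[OF fb fst(1)]])
      (use im1 in blast)+
  show "continuous_map ?Z' leafT (\<lambda>p. inv_into B \<psi> (k p, snd (\<psi> (fst p))))"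
    by (rule flow_box_point_leafT_continuous[OF fb continuous_map_prod_leafT[OF k]
          leafT_continuous_locally_constant[OF fb fst(2)]])
      (use im1 in blast)+
qed

text \<open>Homotopy relative to A in the leaf topology. For A = {0, 1} it is the relation of the
  covering domain; transport up to time s uses A = {0} with [s, 1], on which the partial paths are
  constant, so that further segments can be attached.\<close>

definition leaf_hom :: "real set \<Rightarrow> (real \<Rightarrow> 'x) \<Rightarrow> (real \<Rightarrow> 'x) \<Rightarrow> bool" where
  "leaf_hom A f g \<longleftrightarrow> homotopic_with (\<lambda>\<kappa>. \<forall>u\<in>A. \<kappa> u = f u) unitT leafT f g"

lemma leaf_homI:
  assumes A: "A \<subseteq> {0..1}" and h: "continuous_map (prod_topology unitT unitT) leafT h"
    and "\<And>u. u \<in> {0..1} \<Longrightarrow> h (0, u) = f u" "\<And>u. u \<in> {0..1} \<Longrightarrow> h (1, u) = g u"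
    and "\<And>\<tau> u. \<tau> \<in> {0..1} \<Longrightarrow> u \<in> A \<Longrightarrow> h (\<tau>, u) = f u"
  shows "leaf_hom A f g"
  unfolding leaf_hom_def
proof (subst homotopic_with)
  fix h k :: "real \<Rightarrow> 'x" assume *: "\<And>x. x \<in> topspace unitT \<Longrightarrow> h x = k x"
  have "h u = k u" if "u \<in> A" for u using *[of u] A that by auto
  then show "(\<forall>u\<in>A. h u = f u) = (\<forall>u\<in>A. k u = f u)" by simp
next
  show "\<exists>h. continuous_map (prod_topology unitT unitT) leafT h \<and> (\<forall>x\<in>topspace unitT. h (0, x) = f x) \<and>
      (\<forall>x\<in>topspace unitT. h (1, x) = g x) \<and> (\<forall>t\<in>{0..1}. \<forall>u\<in>A. h (t, u) = f u)"
    using assms by (intro exI[of _ h]) auto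
qed

lemma leaf_homE:
  assumes "leaf_hom A f g"
  obtains h where "continuous_map (prod_topology unitT unitT) leafT h" "\<And>u. h (0, u) = f u"
    "\<And>u. h (1, u) = g u" "\<And>\<tau> u. \<tau> \<in> {0..1} \<Longrightarrow> u \<in> A \<Longrightarrow> h (\<tau>, u) = f u"
  using assms unfolding leaf_hom_def homotopic_with_def by auto

lemma leaf_hom_eq_on: "leaf_hom A f g \<Longrightarrow> u \<in> A \<Longrightarrow> g u = f u"
  by (auto elim!: leaf_homE dest: spec[of _ 1])

lemma leaf_hom_trans:
  assumes "leaf_hom A f g" "leaf_hom A g h"
  shows "leaf_hom A f h"
proof -
  have eq: "(\<lambda>\<kappa>. \<forall>u\<in>A. \<kappa> u = g u) = (\<lambda>\<kappa>. \<forall>u\<in>A. \<kappa> u = f u)"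
    using leaf_hom_eq_on[OF assms(1)] by (auto simp: fun_eq_iff)
  show ?thesis
    unfolding leaf_hom_def
    by (rule homotopic_with_trans[OF assms(1)[unfolded leaf_hom_def] assms(2)[unfolded leaf_hom_def eq]])
qed

lemma leaf_hom_sym:
  assumes "leaf_hom A f g" shows "leaf_hom A g f"
proof -
  have eq: "(\<lambda>\<kappa>. \<forall>u\<in>A. \<kappa> u = g u) = (\<lambda>\<kappa>. \<forall>u\<in>A. \<kappa> u = f u)"
    using leaf_hom_eq_on[OF assms] by (auto simp: fun_eq_iff)
  show ?thesis
    using assms unfolding leaf_hom_def eq by (simp only: homotopic_with_sym)
qed

lemma leaf_hom_refl: "pathin leafT f \<Longrightarrow> leaf_hom A f f"
  unfolding leaf_hom_def by (simp add: pathin_def)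

lemma leaf_hom_cong:
  assumes A: "A \<subseteq> {0..1}" and "leaf_hom A f g"
    and "\<And>u. u \<in> {0..1} \<Longrightarrow> f' u = f u" "\<And>u. u \<in> {0..1} \<Longrightarrow> g' u = g u"
  shows "leaf_hom A f' g'"
proof -
  obtain h where h: "continuous_map (prod_topology unitT unitT) leafT h" "\<And>u. h (0, u) = f u"
    "\<And>u. h (1, u) = g u" "\<And>\<tau> u. \<tau> \<in> {0..1} \<Longrightarrow> u \<in> A \<Longrightarrow> h (\<tau>, u) = f u"
    using leaf_homE[OF assms(2)] by metis
  show ?thesis by (rule leaf_homI[OF A h(1)]) (use h assms A in auto)
qed

text \<open>A plaque is a convex disc in box coordinates, so two paths in it are joined by the
  straight-line homotopy, which rests wherever they agree.\<close>

lemma leaf_hom_plaque: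
  assumes A: "A \<subseteq> {0..1}" and fb: "flow_box B \<psi> a b \<rho>" and y: "y \<in> ball b \<rho>"
    and p: "continuous_map unitT euclidean p" "\<And>u. u \<in> {0..1} \<Longrightarrow> p u \<in> ball a \<rho>"
    and q: "continuous_map unitT euclidean q" "\<And>u. u \<in> {0..1} \<Longrightarrow> q u \<in> ball a \<rho>"
    and eq: "\<And>u. u \<in> A \<Longrightarrow> p u = q u"
  shows "continuous_map (prod_topology unitT unitT) leafT
      (\<lambda>z. inv_into B \<psi> ((1 - of_real (fst z)) * p (snd z) + of_real (fst z) * q (snd z), y))"
    and "leaf_hom A (\<lambda>u. inv_into B \<psi> (p u, y)) (\<lambda>u. inv_into B \<psi> (q u, y))"
proof -
  let ?Z = "prod_topology unitT unitT"
  have fst: "continuous_map ?Z euclidean fst" "continuous_map ?Z unitT snd"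
    using continuous_map_fst continuous_map_snd continuous_map_into_fulltopology by blast+
  have of: "continuous_map euclideanreal euclidean (complex_of_real)"
    by (simp add: continuous_intros)
  have c: "continuous_map ?Z euclidean (\<lambda>z. complex_of_real (fst z))"
    "continuous_map ?Z euclidean (\<lambda>z. p (snd z))" "continuous_map ?Z euclidean (\<lambda>z. q (snd z))"
    using continuous_map_compose[OF fst(1) of] continuous_map_compose[OF fst(2) p(1)]
      continuous_map_compose[OF fst(2) q(1)] by (simp_all add: o_def)
  show *: "continuous_map ?Z leafT
      (\<lambda>z. inv_into B \<psi> ((1 - of_real (fst z)) * p (snd z) + of_real (fst z) * q (snd z), y))"
  proof (rule flow_box_point_leafT_continuous[OF fb])
    show "continuous_map ?Z euclidean (\<lambda>z. (1 - of_real (fst z)) * p (snd z) + of_real (fst z) * q (snd z))"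
      using c by (simp add: continuous_intros)
    show "(1 - of_real (fst z)) * p (snd z) + of_real (fst z) * q (snd z) \<in> ball a \<rho>" if "z \<in> topspace ?Z" for z
    proof -
      have z: "fst z \<in> {0..1}" "snd z \<in> {0..1}" using that by auto
      have "(1 - fst z) *\<^sub>R p (snd z) + fst z *\<^sub>R q (snd z) \<in> ball a \<rho>"
        using convex_ball[of a \<rho>] p(2)[OF z(2)] q(2)[OF z(2)] z(1) unfolding convex_alt by auto
      then show ?thesis by (simp add: scaleR_conv_of_real)
    qed
  qed (use y in auto)
  show "leaf_hom A (\<lambda>u. inv_into B \<psi> (p u, y)) (\<lambda>u. inv_into B \<psi> (q u, y))"
    by (rule leaf_homI[OF A *]) (use eq in \<open>auto simp: algebra_simps\<close>)
qed

end

section \<open>Transport along a chain of flow boxes\<close>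

context foliated_disc
begin

text \<open>A Lebesgue number of the one-element cover of the compact piece of path.\<close>

lemma compact_path_tube:
  assumes \<gamma>: "continuous_map unitT (mtop X) \<gamma>" and lh: "{l..h} \<subseteq> {0..1}" and B: "openin (mtop X) B" "\<gamma> ` {l..h} \<subseteq> B"
  obtains \<epsilon> where "\<epsilon> > 0" "\<And>u x. u \<in> {l..h} \<Longrightarrow> x \<in> topspace (mtop X) \<Longrightarrow> mdist d x (\<gamma> u) < \<epsilon> \<Longrightarrow> x \<in> B"
proof -
  interpret Md: Metric_space "mspace d" "mdist d" by simp
  have top: "Md.mtopology = mtop X" using d by (simp add: mtopology_of_def)
  have ts: "topspace (mtop X) = mspace d" using top Md.topspace_mtopology by metis
  have "compactin unitT {l..h}" using lh by (simp add: compactin_subtopology)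
  then have "compactin Md.mtopology (\<gamma> ` {l..h})" unfolding top using image_compactin \<gamma> by blast
  from Md.lebesgue_number[OF this, of "{B}"] obtain \<epsilon> where e: "\<epsilon> > 0" "\<And>x. x \<in> \<gamma> ` {l..h} \<Longrightarrow> Md.mball x \<epsilon> \<subseteq> B"
    using B top by auto
  show ?thesis
  proof (rule that[OF e(1)])
    fix u x assume u: "u \<in> {l..h}" and x: "x \<in> topspace (mtop X)" "mdist d x (\<gamma> u) < \<epsilon>"
    have "\<gamma> u \<in> topspace (mtop X)" using continuous_map_image_subset_topspace[OF \<gamma>] lh u by auto
    then have "x \<in> Md.mball (\<gamma> u) \<epsilon>" using x ts by (simp add: Md.commute)
    then show "x \<in> B" using e(2) u by blast
  qed
qed

text \<open>Transport of the path \<^term>\<open>\<gamma>\<close> from \<^term>\<open>D\<close>, restricted to \<^term>\<open>{0..s}\<close>: a continuous family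
  \<^term>\<open>G\<close> of leaf paths from \<^term>\<open>D\<close> to the points of a neighbourhood of \<^term>\<open>\<gamma> s\<close>.  Paths on
  \<^term>\<open>{0..s}\<close> are extended to \<^term>\<open>{0..1}\<close> by their constant end value.\<close>

definition transport :: "(real \<Rightarrow> 'a) \<Rightarrow> real \<Rightarrow> 'a set \<Rightarrow> ('a \<times> real \<Rightarrow> 'a) \<Rightarrow> bool" where
  "transport \<gamma> s V G \<longleftrightarrow>
     0 < s \<and> s \<le> 1 \<and> openin (mtop X) V \<and> V \<inter> Sing F = {} \<and> \<gamma> s \<in> V \<and>
     continuous_map (prod_topology (subtopology (mtop X) V) unitT) (mtop X) G \<and>
     continuous_map (prod_topology (subtopology leafT V) unitT) leafT G \<and>
     (\<forall>w\<in>V. G (w, 0) \<in> D \<and> (\<forall>u\<in>{s..1}. G (w, u) = w)) \<and>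
     (\<forall>u\<in>{0..s}. G (\<gamma> s, u) = \<gamma> u) \<and>
     (\<forall>w\<in>V. submersive_at X (\<lambda>w. t (G (w, 0))) w) \<and>
     (\<exists>\<epsilon>>0. \<forall>\<eta>. pathin leafT \<eta> \<and> \<eta> 0 \<in> D \<and> (\<forall>u\<in>{0..s}. mdist d (\<eta> u) (\<gamma> u) < \<epsilon>) \<longrightarrow>
        \<eta> s \<in> V \<and> leaf_hom (insert 0 {s..1}) (\<lambda>u. \<eta> (min u s)) (\<lambda>u. G (\<eta> s, u)))"

lemma transportI:
  assumes "0 < s" "s \<le> 1" "openin (mtop X) V" "V \<inter> Sing F = {}" "\<gamma> s \<in> V"
    "continuous_map (prod_topology (subtopology (mtop X) V) unitT) (mtop X) G"
    "continuous_map (prod_topology (subtopology leafT V) unitT) leafT G"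
    "\<And>w. w \<in> V \<Longrightarrow> G (w, 0) \<in> D" "\<And>w u. w \<in> V \<Longrightarrow> u \<in> {s..1} \<Longrightarrow> G (w, u) = w"
    "\<And>u. u \<in> {0..s} \<Longrightarrow> G (\<gamma> s, u) = \<gamma> u"
    "\<And>w. w \<in> V \<Longrightarrow> submersive_at X (\<lambda>w. t (G (w, 0))) w"
    "\<epsilon> > 0" "\<And>\<eta>. pathin leafT \<eta> \<Longrightarrow> \<eta> 0 \<in> D \<Longrightarrow> (\<And>u. u \<in> {0..s} \<Longrightarrow> mdist d (\<eta> u) (\<gamma> u) < \<epsilon>) \<Longrightarrow>
        \<eta> s \<in> V \<and> leaf_hom (insert 0 {s..1}) (\<lambda>u. \<eta> (min u s)) (\<lambda>u. G (\<eta> s, u))"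
  shows "transport \<gamma> s V G"
  unfolding transport_def
  by (intro conjI ballI exI[of _ \<epsilon>] allI impI) (use assms in blast)+

lemma transportD:
  assumes "transport \<gamma> s V G"
  shows "0 < s" "s \<le> 1" "openin (mtop X) V" "V \<inter> Sing F = {}" "\<gamma> s \<in> V"
    "continuous_map (prod_topology (subtopology (mtop X) V) unitT) (mtop X) G"
    "continuous_map (prod_topology (subtopology leafT V) unitT) leafT G"
    "\<And>w. w \<in> V \<Longrightarrow> G (w, 0) \<in> D" "\<And>w u. w \<in> V \<Longrightarrow> u \<in> {s..1} \<Longrightarrow> G (w, u) = w"
    "\<And>u. u \<in> {0..s} \<Longrightarrow> G (\<gamma> s, u) = \<gamma> u"
    "\<And>w. w \<in> V \<Longrightarrow> submersive_at X (\<lambda>w. t (G (w, 0))) w"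
    "\<exists>\<epsilon>>0. \<forall>\<eta>. pathin leafT \<eta> \<and> \<eta> 0 \<in> D \<and> (\<forall>u\<in>{0..s}. mdist d (\<eta> u) (\<gamma> u) < \<epsilon>) \<longrightarrow>
        \<eta> s \<in> V \<and> leaf_hom (insert 0 {s..1}) (\<lambda>u. \<eta> (min u s)) (\<lambda>u. G (\<eta> s, u))"
  using assms unfolding transport_def by (elim conjE; blast)+

end

lemma continuous_map_mult_complex:
  fixes f g :: "'a \<Rightarrow> complex"
  assumes "continuous_map Z euclidean f" "continuous_map Z euclidean g"
  shows "continuous_map Z euclidean (\<lambda>z. f z * g z)"
proof -
  have "continuous_map Z (euclidean :: (complex \<times> complex) topology) (\<lambda>z. (f z, g z))"
    using assms continuous_map_paired[of Z euclidean euclidean f g] by (simp add: prod_topology_euclidean)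
  moreover have "continuous_map (euclidean :: (complex \<times> complex) topology) euclidean (\<lambda>p. fst p * snd p)"
    by (auto intro!: continuous_intros)
  ultimately have "continuous_map Z euclidean ((\<lambda>p. fst p * snd p) \<circ> (\<lambda>z. (f z, g z)))"
    by (rule continuous_map_compose)
  then show ?thesis by (simp add: o_def)
qed

context foliated_disc
begin

lemma path_ball_tube:
  assumes x: "continuous_map unitT euclidean (x :: real \<Rightarrow> complex)" and im: "\<And>u. u \<in> {0..1} \<Longrightarrow> x u \<in> ball a \<rho>"
  obtains \<mu> where "\<mu> > 0" "\<And>u z. u \<in> {0..1} \<Longrightarrow> z \<in> ball 0 \<mu> \<Longrightarrow> x u + z \<in> ball a \<rho>"
proof -
  have "compact (x ` {0..1})" using x by (intro compact_continuous_image) auto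
  moreover have "x ` {0..1} \<subseteq> ball a \<rho>" using im by blast
  ultimately obtain e where e: "e > 0" "(\<Union>z\<in>x ` {0..1}. ball z e) \<subseteq> ball a \<rho>"
    using compact_subset_open_imp_ball_epsilon_subset open_ball by metis
  show ?thesis
  proof (rule that[OF e(1)])
    fix u :: real and z :: complex assume u: "u \<in> {0..1}" and z: "z \<in> ball 0 e"
    have "x u + z \<in> ball (x u) e" using z by (simp add: dist_norm)
    then show "x u + z \<in> ball a \<rho>" using e(2) u by blast
  qed
qed

text \<open>While \<open>\<gamma>\<close> stays in one box, the transported path of w runs in the
  plaque of w. Its first coordinate is that of \<open>\<gamma>\<close> plus an error interpolated
  linearly in time, from the one that places it on D at time 0 to the one that places it at w at
  time s.\<close>

lemma transport_base:
  assumes \<gamma>: "pathin leafT \<gamma>" "\<gamma> 0 \<in> D" and s: "0 < s" "s \<le> 1"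
    and fb: "flow_box B \<psi> a b \<rho>" and \<gamma>B: "\<gamma> ` {0..s} \<subseteq> B"
  shows "\<exists>V G. transport \<gamma> s V G"
proof -
  note B = flow_boxD[OF fb]
  have clip: "continuous_map unitT unitT (\<lambda>u. min u s)" using s by (auto simp: continuous_map_in_subtopology intro!: continuous_intros)
  have c\<gamma>: "continuous_map unitT leafT \<gamma>" using \<gamma>(1) by (simp add: pathin_def)
  have clipped: "continuous_map unitT euclidean (\<lambda>u. fst (\<psi> (\<eta> (min u s))))"
    if "pathin leafT \<eta>" "\<eta> ` {0..s} \<subseteq> B" for \<eta>
  proof (rule flow_box_coordinates_continuous(1)[OF fb])
    have "continuous_map unitT (mtop X) \<eta>" using that(1) leafT_continuous_imp_continuous by (simp add: pathin_def)
    from continuous_map_compose[OF clip this] show "continuous_map unitT (mtop X) (\<lambda>u. \<eta> (min u s))" by (simp add: o_def)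
    show "(\<lambda>u. \<eta> (min u s)) ` topspace unitT \<subseteq> B" using that(2) s by auto
  qed
  have plaque: "snd (\<psi> (\<eta> u)) = snd (\<psi> (\<eta> u'))"
    if "pathin leafT \<eta>" "\<eta> ` {0..s} \<subseteq> B" "u \<in> {0..s}" "u' \<in> {0..s}" for \<eta> u u'
  proof (rule pathin_flow_box_plaque[OF fb _ that(2) _ that(3,4)])
    show "continuous_map (top_of_set {0..s}) leafT \<eta>"
      using that(1) s continuous_map_from_subtopology_mono[of euclideanreal "{0..1}" leafT \<eta> "{0..s}"] by (auto simp: pathin_def)
  qed simp
  define x where "x u = fst (\<psi> (\<gamma> (min u s)))" for u
  define y0 where "y0 = snd (\<psi> (\<gamma> 0))"
  have x: "continuous_map unitT euclidean x" unfolding x_def[abs_def] by (rule clipped[OF \<gamma>(1) \<gamma>B])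
  have \<gamma>inB: "\<gamma> u \<in> B" if "u \<in> {0..s}" for u using \<gamma>B that by blast
  have \<gamma>u: "\<psi> (\<gamma> u) = (x u, y0)" if "u \<in> {0..s}" for u
    using plaque[OF \<gamma>(1) \<gamma>B that, of 0] that s by (simp add: x_def y0_def prod_eq_iff min_def)
  have xball: "x u \<in> ball a \<rho>" if "u \<in> {0..1}" for u
    unfolding x_def using B(9)[OF \<gamma>inB] that s by auto
  obtain \<mu> where \<mu>: "\<mu> > 0" "\<And>u z. u \<in> {0..1} \<Longrightarrow> z \<in> ball 0 \<mu> \<Longrightarrow> x u + z \<in> ball a \<rho>"
    using path_ball_tube[OF x xball] by metis
  have \<gamma>0B: "\<gamma> 0 \<in> B" using \<gamma>inB s by simp
  obtain \<delta> \<xi> N where \<delta>: "\<delta> > 0" and \<xi>: "ball y0 \<delta> \<subseteq> ball b \<rho>"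
    "\<And>y. y \<in> ball y0 \<delta> \<Longrightarrow> \<xi> y \<in> D \<and> \<xi> y \<in> B \<and> snd (\<psi> (\<xi> y)) = y"
    "continuous_on (ball y0 \<delta>) (\<lambda>y. fst (\<psi> (\<xi> y)))"
    "\<And>y. y \<in> ball y0 \<delta> \<Longrightarrow> \<exists>k. k \<noteq> 0 \<and> ((\<lambda>y. t (\<xi> y)) has_field_derivative k) (at y)"
    and N: "openin (mtop X) N" "\<gamma> 0 \<in> N" "\<And>x. x \<in> D \<Longrightarrow> x \<in> N \<Longrightarrow> x \<in> B \<and> snd (\<psi> x) \<in> ball y0 \<delta> \<and> \<xi> (snd (\<psi> x)) = x"
    by (rule transversal_section[OF fb \<gamma>(2) \<gamma>0B, folded y0_def]) (rule that)
  define X1 where "X1 y = fst (\<psi> (\<xi> y))" for y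
  have \<psi>\<xi>: "\<psi> (\<xi> y) = (X1 y, y)" if "y \<in> ball y0 \<delta>" for y using \<xi>(2)[OF that] by (simp add: X1_def prod_eq_iff)
  have "\<xi> y0 = \<gamma> 0" using N(3)[OF \<gamma>(2) N(2)] by (simp add: y0_def)
  then have X10: "X1 y0 = x 0" using s by (simp add: X1_def x_def)
  have cX1: "continuous_on (ball y0 \<delta>) X1" using \<xi>(3) by (simp add: X1_def[abs_def])
  \<comment> \<open>\<mu> is the margin by which the first coordinate of the path can be moved
    inside its disc; \<delta>' keeps the error at time 0 below it.\<close>
  obtain \<delta>' where \<delta>': "\<delta>' > 0" "\<delta>' \<le> \<delta>" "\<And>y. y \<in> ball y0 \<delta>' \<Longrightarrow> X1 y - x 0 \<in> ball 0 \<mu>"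
  proof -
    have "isCont X1 y0" using cX1 \<delta> continuous_on_eq_continuous_at[OF open_ball] by (metis centre_in_ball)
    then obtain e where e: "e > 0" "\<And>y. dist y y0 < e \<Longrightarrow> dist (X1 y) (X1 y0) < \<mu>"
      using \<mu>(1) unfolding continuous_at_eps_delta by metis
    show ?thesis
      by (rule that[of "min e \<delta>"]) (use e \<delta> X10 in \<open>auto simp: dist_commute dist_norm norm_minus_commute\<close>)
  qed
  have \<delta>sub: "ball y0 \<delta>' \<subseteq> ball y0 \<delta>" using \<delta>'(2) by auto
  \<comment> \<open>The second factor controls the error at time 0 and the first factor the error at
    time s; convexity of the disc of radius \<mu> controls everything between.\<close>
  define V where "V = {w \<in> B. \<psi> w \<in> ball (x s) \<mu> \<times> ball y0 \<delta>'}"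
  have V: "openin (mtop X) V" "V \<subseteq> B"
    using chart_openin_preimage[OF B(1), of "ball (x s) \<mu> \<times> ball y0 \<delta>'"] by (auto simp: V_def open_Times)
  have Vw: "fst (\<psi> w) - x s \<in> ball 0 \<mu>" "snd (\<psi> w) \<in> ball y0 \<delta>'" "snd (\<psi> w) \<in> ball y0 \<delta>" "w \<in> B" if "w \<in> V" for w
    using that \<delta>sub by (auto simp: V_def dist_norm norm_minus_commute mem_Times_iff)
  have \<gamma>sV: "\<gamma> s \<in> V" using \<gamma>u[of s] \<gamma>inB[of s] s \<mu> \<delta>' by (simp add: V_def)
  define l where "l u = complex_of_real (min u s / s)" for u
  define k where "k = (\<lambda>p. x (snd p) + ((1 - l (snd p)) * (X1 (snd (\<psi> (fst p))) - x 0) + l (snd p) * (fst (\<psi> (fst p)) - x s)))"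
  have k0: "k (w, 0) = X1 (snd (\<psi> w))" for w
    using s by (simp add: k_def l_def x_def min_def)
  have ks: "k (w, u) = fst (\<psi> w)" if "u \<in> {s..1}" for w u
  proof -
    have "min u s = s" using that by simp
    then show ?thesis using s by (simp add: k_def l_def x_def)
  qed
  have kball: "k (w, u) \<in> ball a \<rho>" if w: "w \<in> V" and u: "u \<in> {0..1}" for w u
  proof -
    have "(1 - min u s / s) *\<^sub>R (X1 (snd (\<psi> w)) - x 0) + (min u s / s) *\<^sub>R (fst (\<psi> w) - x s) \<in> ball 0 \<mu>"
      by (rule convexD_alt[OF convex_ball \<delta>'(3)[OF Vw(2)[OF w]] Vw(1)[OF w]]) (use u s in auto)
    then show ?thesis using \<mu>(2)[OF u] by (simp add: k_def l_def scaleR_conv_of_real)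
  qed
  let ?Z = "prod_topology (subtopology (mtop X) V) unitT"
  have kcont: "continuous_map ?Z euclidean k"
  proof -
    have s1: "continuous_map ?Z unitT snd" and f1: "continuous_map ?Z (subtopology (mtop X) V) fst"
      using continuous_map_snd continuous_map_fst by blast+
    have cf: "continuous_map ?Z (mtop X) fst" using f1 continuous_map_into_fulltopology by blast
    have fB: "fst ` topspace ?Z \<subseteq> B" using V(2) by auto
    note cc = flow_box_coordinates_continuous[OF fb cf fB]
    have "continuous_map ?Z (top_of_set (ball y0 \<delta>)) (\<lambda>p. snd (\<psi> (fst p)))"
      using cc(2) Vw(3) by (auto simp: continuous_map_in_subtopology)
    from continuous_map_compose[OF this, of euclidean X1] cX1
    have c1: "continuous_map ?Z euclidean (\<lambda>p. X1 (snd (\<psi> (fst p))))" by (simp add: o_def)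
    have c2: "continuous_map ?Z euclidean (\<lambda>p. x (snd p))" using continuous_map_compose[OF s1 x] by (simp add: o_def)
    have "continuous_map unitT euclidean l" unfolding l_def[abs_def] using s by (auto intro!: continuous_intros)
    from continuous_map_compose[OF s1 this] have c3: "continuous_map ?Z euclidean (\<lambda>p. l (snd p))" by (simp add: o_def)
    show ?thesis unfolding k_def
      by (intro continuous_map_add continuous_map_diff continuous_map_mult_complex c1 c2 c3 cc(1)) simp_all
  qed
  define G where "G = (\<lambda>p. inv_into B \<psi> (k p, snd (\<psi> (fst p))))"
  have kball': "k (w, u) \<in> ball a \<rho>" if "w \<in> V" "u \<in> topspace unitT" for w u using kball that by simp
  note Gc = flow_box_family_continuous[OF fb V(2) kcont kball', folded G_def]
  have G0: "G (w, 0) = \<xi> (snd (\<psi> w))" if "w \<in> V" for w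
  proof -
    have "\<psi> (\<xi> (snd (\<psi> w))) = (k (w, 0), snd (\<psi> w))" using \<psi>\<xi>[OF Vw(3)[OF that]] k0 by simp
    moreover have "\<xi> (snd (\<psi> w)) \<in> B" using \<xi>(2)[OF Vw(3)[OF that]] by blast
    ultimately show ?thesis using B(7) by (simp add: G_def) metis
  qed
  \<comment> \<open>Three tolerances for a nearby path: \<epsilon>1 keeps it in the box, \<epsilon>2
    puts its end in V, and \<epsilon>3 puts its start in the part of D that is a graph.\<close>
  obtain \<epsilon>1 where \<epsilon>1: "\<epsilon>1 > 0" "\<And>u x. u \<in> {0..s} \<Longrightarrow> x \<in> topspace (mtop X) \<Longrightarrow> mdist d x (\<gamma> u) < \<epsilon>1 \<Longrightarrow> x \<in> B"
    using compact_path_tube[OF leafT_continuous_imp_continuous[OF c\<gamma>], of 0 s B] s B(5) \<gamma>B by auto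
  obtain \<epsilon>2 where \<epsilon>2: "\<epsilon>2 > 0" "\<And>u x. u \<in> {s..s} \<Longrightarrow> x \<in> topspace (mtop X) \<Longrightarrow> mdist d x (\<gamma> u) < \<epsilon>2 \<Longrightarrow> x \<in> V"
    using compact_path_tube[OF leafT_continuous_imp_continuous[OF c\<gamma>], of s s V] s V \<gamma>sV by auto
  obtain \<epsilon>3 where \<epsilon>3: "\<epsilon>3 > 0" "\<And>u x. u \<in> {0..0} \<Longrightarrow> x \<in> topspace (mtop X) \<Longrightarrow> mdist d x (\<gamma> u) < \<epsilon>3 \<Longrightarrow> x \<in> N"
    using compact_path_tube[OF leafT_continuous_imp_continuous[OF c\<gamma>], of 0 0 N] N by auto
  have "transport \<gamma> s V G"
  proof (rule transportI[where \<epsilon>="min \<epsilon>1 (min \<epsilon>2 \<epsilon>3)"])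
    show "V \<inter> Sing F = {}" using V(2) B(4) by blast
    show "continuous_map ?Z (mtop X) G" "continuous_map (prod_topology (subtopology leafT V) unitT) leafT G"
      using Gc by auto
    show "G (w, 0) \<in> D" if "w \<in> V" for w using G0[OF that] \<xi>(2)[OF Vw(3)[OF that]] by simp
    show "G (w, u) = w" if "w \<in> V" "u \<in> {s..1}" for w u
      using ks[OF that(2)] B(7) Vw(4)[OF that(1)] by (simp add: G_def)
    show "G (\<gamma> s, u) = \<gamma> u" if u: "u \<in> {0..s}" for u
    proof -
      have "\<psi> (\<gamma> s) = (x s, y0)" using \<gamma>u[of s] s by simp
      then have "k (\<gamma> s, u) = x u" by (simp add: k_def X10)
      then have "G (\<gamma> s, u) = inv_into B \<psi> (\<psi> (\<gamma> u))" using \<gamma>u[OF u] \<open>\<psi> (\<gamma> s) = (x s, y0)\<close> by (simp add: G_def)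
      then show ?thesis using B(7)[OF \<gamma>inB[OF u]] by simp
    qed
    show "submersive_at X (\<lambda>w. t (G (w, 0))) w" if w: "w \<in> V" for w
    proof -
      obtain k where k: "k \<noteq> 0" "((\<lambda>y. t (\<xi> y)) has_field_derivative k) (at (snd (\<psi> w)))"
        using \<xi>(4)[OF Vw(3)[OF w]] by blast
      have "((\<lambda>p. t (\<xi> (snd p))) has_derivative (\<lambda>h. k * snd h)) (at (\<psi> w))"
        using has_derivative_compose[OF bounded_linear_imp_has_derivative[OF bounded_linear_snd], of "\<lambda>y. t (\<xi> y)" "(*) k" "\<psi> w" UNIV]
          k(2) by (simp add: has_field_derivative_def)
      then have "((\<lambda>w. t (G (w, 0))) \<circ> inv_into B \<psi> has_derivative (\<lambda>h. k * snd h)) (at (\<psi> w))"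
        by (rule has_derivative_transform_within_open[OF _ chart_open_image[OF B(1) V]])
          (use w G0 V(2) B(7) in \<open>auto simp: subset_iff\<close>)
      moreover have "surj (\<lambda>h::complex \<times> complex. k * snd h)"
        by (rule surjI[of _ "\<lambda>z. (0, z / k)"]) (use k(1) in simp)
      ultimately show ?thesis unfolding submersive_at_def using B(1) Vw(4)[OF w]
        by (intro exI[of _ B] exI[of _ \<psi>] exI[of _ "\<lambda>h. k * snd h"]) (simp add: scaleC_prod_def scaleC_complex_def)
    qed
    fix \<eta> assume \<eta>: "pathin leafT \<eta>" "\<eta> 0 \<in> D" and close: "\<And>u. u \<in> {0..s} \<Longrightarrow> mdist d (\<eta> u) (\<gamma> u) < min \<epsilon>1 (min \<epsilon>2 \<epsilon>3)"
    have \<eta>X: "\<eta> u \<in> topspace (mtop X)" if "u \<in> {0..1}" for u using pathin_leafT_image[OF \<eta>(1) that] topspace_leafT by blast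
    have \<eta>inB: "\<eta> u \<in> B" if "u \<in> {0..s}" for u using \<epsilon>1(2)[OF that \<eta>X] close[OF that] that s by auto
    then have \<eta>B: "\<eta> ` {0..s} \<subseteq> B" by blast
    have \<eta>s: "\<eta> s \<in> V" using \<epsilon>2(2)[of s "\<eta> s"] \<eta>X[of s] close[of s] s by auto
    have \<eta>0: "\<eta> 0 \<in> N" using \<epsilon>3(2)[of 0 "\<eta> 0"] \<eta>X[of 0] close[of 0] s by auto
    define y where "y = snd (\<psi> (\<eta> s))"
    have yu: "snd (\<psi> (\<eta> u)) = y" if "u \<in> {0..s}" for u unfolding y_def using plaque[OF \<eta>(1) \<eta>B that, of s] s by simp
    \<comment> \<open>Here transversality enters: the nearby path starts at the only point of this
      part of D on its plaque, which is also where the transported path starts.\<close>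
    have \<xi>y: "\<xi> y = \<eta> 0" using N(3)[OF \<eta>(2) \<eta>0] yu[of 0] s by simp
    have kc: "continuous_map unitT euclidean (\<lambda>u. k (\<eta> s, u))"
    proof -
      have "continuous_map unitT ?Z (\<lambda>u. (\<eta> s, u))"
        using \<eta>s openin_subset[OF V(1)] by (auto simp: continuous_map_pairwise o_def)
      from continuous_map_compose[OF this kcont] show ?thesis by (simp add: o_def)
    qed
    have "leaf_hom (insert 0 {s..1}) (\<lambda>u. inv_into B \<psi> (fst (\<psi> (\<eta> (min u s))), y)) (\<lambda>u. inv_into B \<psi> (k (\<eta> s, u), y))"
    proof (rule leaf_hom_plaque(2)[OF _ fb _ clipped[OF \<eta>(1) \<eta>B] _ kc])
      show "insert 0 {s..1} \<subseteq> {0..1}" using s by auto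
      show "y \<in> ball b \<rho>" unfolding y_def using B(9)[OF Vw(4)[OF \<eta>s]] by simp
      show "fst (\<psi> (\<eta> (min u s))) \<in> ball a \<rho>" if "u \<in> {0..1}" for u using B(9)[OF \<eta>inB] that s by auto
      show "k (\<eta> s, u) \<in> ball a \<rho>" if "u \<in> {0..1}" for u using kball[OF \<eta>s that] .
      show "fst (\<psi> (\<eta> (min u s))) = k (\<eta> s, u)" if "u \<in> insert 0 {s..1}" for u
      proof (cases "u = 0")
        case True
        then show ?thesis using k0 \<xi>y s by (simp add: X1_def y_def[symmetric])
      next
        case False
        then have "u \<in> {s..1}" "min u s = s" using that by auto
        then show ?thesis using ks[of u "\<eta> s"] by simp
      qed
    qed
    then have "leaf_hom (insert 0 {s..1}) (\<lambda>u. \<eta> (min u s)) (\<lambda>u. G (\<eta> s, u))"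
    proof (rule leaf_hom_cong[rotated])
      show "\<eta> (min u s) = inv_into B \<psi> (fst (\<psi> (\<eta> (min u s))), y)" if "u \<in> {0..1}" for u
      proof -
        have u: "min u s \<in> {0..s}" using that s by auto
        have "\<psi> (\<eta> (min u s)) = (fst (\<psi> (\<eta> (min u s))), y)" using yu[OF u] by (simp add: prod_eq_iff)
        then show ?thesis using B(7)[OF \<eta>inB[OF u]] by metis
      qed
    qed (use s in \<open>auto simp: G_def y_def\<close>)
    with \<eta>s show "\<eta> s \<in> V \<and> leaf_hom (insert 0 {s..1}) (\<lambda>u. \<eta> (min u s)) (\<lambda>u. G (\<eta> s, u))" by blast
  qed (use s V \<gamma>sV \<epsilon>1 \<epsilon>2 \<epsilon>3 in auto)
  then show ?thesis by blast
qed


text \<open>A point w near \<open>\<gamma> s'\<close> is slid back along its plaque to a point of V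
  near \<open>\<gamma> s\<close>, and the earlier transport takes over. The homotopy to a nearby
  path \<open>\<eta>\<close> has two stages: first the part up to s is replaced by the transported
  path, then the junction at time s slides along the plaque.\<close>

lemma transport_step:
  assumes \<gamma>: "pathin leafT \<gamma>" and tr: "transport \<gamma> s V G" and s': "s < s'" "s' \<le> 1"
    and fb: "flow_box B \<psi> a b \<rho>" and \<gamma>B: "\<gamma> ` {s..s'} \<subseteq> B"
  shows "\<exists>V' G'. transport \<gamma> s' V' G'"
proof -
  note B = flow_boxD[OF fb] and T = transportD[OF tr]
  have s: "0 < s" "s \<le> 1" by fact+
  have c\<gamma>: "continuous_map unitT leafT \<gamma>" using \<gamma> by (simp add: pathin_def)
  \<comment> \<open>Clamping time to [s, s'] makes the box coordinates of the path meaningful on the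
    whole unit interval.\<close>
  define cl where "cl u = max s (min u s')" for u :: real
  have cl: "continuous_map unitT unitT cl" "\<And>u. cl u \<in> {s..s'}" "cl s = s" "cl s' = s'"
      "\<And>u. u \<ge> s' \<Longrightarrow> cl u = s'" "\<And>u. u \<ge> s \<Longrightarrow> cl u = min u s'"
    using s s' by (auto simp: continuous_map_in_subtopology cl_def[abs_def] intro!: continuous_intros)
  have clipped: "continuous_map unitT euclidean (\<lambda>u. fst (\<psi> (\<eta> (cl u))))"
    if "pathin leafT \<eta>" "\<eta> ` {s..s'} \<subseteq> B" for \<eta>
  proof (rule flow_box_coordinates_continuous(1)[OF fb])
    have "continuous_map unitT (mtop X) \<eta>" using that(1) leafT_continuous_imp_continuous by (simp add: pathin_def)
    from continuous_map_compose[OF cl(1) this] show "continuous_map unitT (mtop X) (\<lambda>u. \<eta> (cl u))" by (simp add: o_def)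
    show "(\<lambda>u. \<eta> (cl u)) ` topspace unitT \<subseteq> B" using that(2) cl(2) by blast
  qed
  have plaque: "snd (\<psi> (\<eta> u)) = snd (\<psi> (\<eta> u'))"
    if "pathin leafT \<eta>" "\<eta> ` {s..s'} \<subseteq> B" "u \<in> {s..s'}" "u' \<in> {s..s'}" for \<eta> u u'
  proof (rule pathin_flow_box_plaque[OF fb _ that(2) _ that(3,4)])
    show "continuous_map (top_of_set {s..s'}) leafT \<eta>"
      using that(1) s s' continuous_map_from_subtopology_mono[of euclideanreal "{0..1}" leafT \<eta> "{s..s'}"] by (auto simp: pathin_def)
  qed simp
  define x where "x u = fst (\<psi> (\<gamma> (cl u)))" for u
  define y0 where "y0 = snd (\<psi> (\<gamma> s))"
  have x: "continuous_map unitT euclidean x" unfolding x_def[abs_def] by (rule clipped[OF \<gamma> \<gamma>B])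
  have \<gamma>inB: "\<gamma> u \<in> B" if "u \<in> {s..s'}" for u using \<gamma>B that by blast
  have \<gamma>u: "\<psi> (\<gamma> u) = (x u, y0)" if "u \<in> {s..s'}" for u
  proof -
    have "cl u = u" using that by (simp add: cl_def)
    then show ?thesis using plaque[OF \<gamma> \<gamma>B that, of s] s' by (simp add: x_def y0_def prod_eq_iff)
  qed
  have xball: "x u \<in> ball a \<rho>" for u
    unfolding x_def using B(9)[OF \<gamma>inB[OF cl(2)]] by simp
  obtain \<mu> where \<mu>: "\<mu> > 0" "\<And>u z. u \<in> {0..1} \<Longrightarrow> z \<in> ball 0 \<mu> \<Longrightarrow> x u + z \<in> ball a \<rho>"
    using path_ball_tube[OF x xball] by metis
  have \<gamma>s: "\<psi> (\<gamma> s) = (x s, y0)" "\<psi> (\<gamma> s') = (x s', y0)" "\<gamma> s \<in> B" "\<gamma> s' \<in> B"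
    using \<gamma>u \<gamma>inB s' by auto
  have "open (\<psi> ` (V \<inter> B))" using chart_open_image[OF B(1)] T(3) B(5) by blast
  moreover have "(x s, y0) \<in> \<psi> ` (V \<inter> B)" using \<gamma>s T(5) by (metis IntI imageI)
  ultimately obtain \<delta>0 where \<delta>0: "\<delta>0 > 0" "cball (x s) \<delta>0 \<times> cball y0 \<delta>0 \<subseteq> \<psi> ` (V \<inter> B)"
    using open_contains_cball_times by metis
  \<comment> \<open>One size for two boxes: the one around \<open>\<gamma> s\<close> must fit into
    V, which \<delta>0 ensures, and the displacement at \<open>\<gamma> s'\<close> must not exceed
    the margin \<mu>.\<close>
  define \<delta> where "\<delta> = min \<mu> \<delta>0"
  have \<delta>: "\<delta> > 0" "\<delta> \<le> \<mu>" "\<delta> \<le> \<delta>0" using \<mu> \<delta>0 by (auto simp: \<delta>_def)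
  define V0 where "V0 = {w \<in> B. \<psi> w \<in> ball (x s) \<delta> \<times> ball y0 \<delta>}"
  define V' where "V' = {w \<in> B. \<psi> w \<in> ball (x s') \<delta> \<times> ball y0 \<delta>}"
  have V0: "openin (mtop X) V0" and V': "openin (mtop X) V'" "V' \<subseteq> B"
    using chart_openin_preimage[OF B(1), of "ball (x s) \<delta> \<times> ball y0 \<delta>"]
      chart_openin_preimage[OF B(1), of "ball (x s') \<delta> \<times> ball y0 \<delta>"] by (auto simp: V0_def V'_def open_Times)
  have box: "inv_into B \<psi> p \<in> V0 \<and> inv_into B \<psi> p \<in> V \<and> \<psi> (inv_into B \<psi> p) = p" if p: "p \<in> ball (x s) \<delta> \<times> ball y0 \<delta>" for p
  proof -
    have "p \<in> cball (x s) \<delta>0 \<times> cball y0 \<delta>0" using p \<delta>(3) by (auto simp: mem_Times_iff)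
    then obtain w where w: "w \<in> V" "w \<in> B" "p = \<psi> w" using \<delta>0(2) by blast
    then have "inv_into B \<psi> p = w" using B(7) by simp
    then show ?thesis using w p by (simp add: V0_def)
  qed
  have V'w: "fst (\<psi> w) - x s' \<in> ball 0 \<delta>" "fst (\<psi> w) - x s' \<in> ball 0 \<mu>" "snd (\<psi> w) \<in> ball y0 \<delta>" "w \<in> B" if "w \<in> V'" for w
    using that \<delta>(2) by (auto simp: V'_def dist_norm norm_minus_commute mem_Times_iff)
  \<comment> \<open>Unlike in the base case the displacement is constant in time: no prescribed set
    has to be hit at time s, only V, and a translation maps the box around
    \<open>\<gamma> s'\<close> onto the one around \<open>\<gamma> s\<close>.\<close>
  define k where "k = (\<lambda>p. x (snd p) + (fst (\<psi> (fst p)) - x s'))"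
  have kball: "k (w, u) \<in> ball a \<rho>" if w: "w \<in> V'" and u: "u \<in> topspace unitT" for w u
    using \<mu>(2)[OF _ V'w(2)[OF w]] u by (simp add: k_def)
  let ?Z = "prod_topology (subtopology (mtop X) V') unitT" and ?Z' = "prod_topology (subtopology leafT V') unitT"
  have kcont: "continuous_map ?Z euclidean k"
  proof -
    have s1: "continuous_map ?Z unitT snd" and f1: "continuous_map ?Z (subtopology (mtop X) V') fst"
      using continuous_map_snd continuous_map_fst by blast+
    have cf: "continuous_map ?Z (mtop X) fst" using f1 continuous_map_into_fulltopology by blast
    have fB: "fst ` topspace ?Z \<subseteq> B" using V'(2) by auto
    have c2: "continuous_map ?Z euclidean (\<lambda>p. x (snd p))" using continuous_map_compose[OF s1 x] by (simp add: o_def)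
    show ?thesis unfolding k_def
      by (intro continuous_map_add continuous_map_diff c2 flow_box_coordinates_continuous(1)[OF fb cf fB]) simp
  qed
  define H where "H = (\<lambda>p. inv_into B \<psi> (k p, snd (\<psi> (fst p))))"
  note Hc = flow_box_family_continuous[OF fb V'(2) kcont kball, folded H_def]
  define \<sigma> where "\<sigma> w = H (w, s)" for w
  have \<sigma>eq: "\<sigma> w = inv_into B \<psi> (x s + (fst (\<psi> w) - x s'), snd (\<psi> w))" for w by (simp add: \<sigma>_def H_def k_def)
  have shift: "(x s + (fst (\<psi> w) - x s'), snd (\<psi> w)) \<in> ball (x s) \<delta> \<times> ball y0 \<delta>" if "w \<in> V'" for w
  proof -
    have "dist (x s) (x s + (fst (\<psi> w) - x s')) < \<delta>" using V'w(1)[OF that] by (simp add: dist_norm)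
    then show ?thesis using V'w(3)[OF that] by simp
  qed
  have \<sigma>: "\<sigma> w \<in> V" "\<psi> (\<sigma> w) = (x s + (fst (\<psi> w) - x s'), snd (\<psi> w))" if "w \<in> V'" for w
    using box[OF shift[OF that]] by (simp_all add: \<sigma>eq)
  have sT: "s \<in> topspace unitT" using s by simp
  have \<sigma>c: "continuous_map (subtopology (mtop X) V') (subtopology (mtop X) V) \<sigma>"
    "continuous_map (subtopology leafT V') (subtopology leafT V) \<sigma>"
  proof -
    have "continuous_map (subtopology (mtop X) V') ?Z (\<lambda>w. (w, s))" "continuous_map (subtopology leafT V') ?Z' (\<lambda>w. (w, s))"
      using sT by (simp_all add: continuous_map_pairwise o_def)
    from continuous_map_compose[OF this(1) Hc(1)] continuous_map_compose[OF this(2) Hc(2)]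
    have "continuous_map (subtopology (mtop X) V') (mtop X) \<sigma>" "continuous_map (subtopology leafT V') leafT \<sigma>"
      by (simp_all add: o_def \<sigma>_def[abs_def])
    then show "continuous_map (subtopology (mtop X) V') (subtopology (mtop X) V) \<sigma>"
      "continuous_map (subtopology leafT V') (subtopology leafT V) \<sigma>"
      using \<sigma>(1) by (auto simp: continuous_map_in_subtopology)
  qed
  define G' where "G' = (\<lambda>p. if snd p \<le> s then G (\<sigma> (fst p), snd p) else H p)"
  have Hs: "G (\<sigma> w, s) = H (w, s)" if "w \<in> V'" for w
    using T(9)[OF \<sigma>(1)[OF that], of s] s by (simp add: \<sigma>_def)
  have clipZ: "continuous_map (prod_topology S unitT) euclideanreal snd" for S :: "'a topology"
    using continuous_map_snd continuous_map_into_fulltopology by blast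
  have G'c: "continuous_map ?Z (mtop X) G'"
    unfolding G'_def
  proof (rule continuous_map_cases_le[OF clipZ])
    have "continuous_map ?Z (prod_topology (subtopology (mtop X) V) unitT) (\<lambda>p. (\<sigma> (fst p), snd p))"
      using continuous_map_compose[OF continuous_map_fst \<sigma>c(1)] continuous_map_snd by (auto simp: continuous_map_pairwise o_def)
    from continuous_map_compose[OF this T(6)]
    show "continuous_map (subtopology ?Z {z \<in> topspace ?Z. snd z \<le> s}) (mtop X) (\<lambda>p. G (\<sigma> (fst p), snd p))"
      by (intro continuous_map_from_subtopology) (simp add: o_def)
    show "continuous_map (subtopology ?Z {z \<in> topspace ?Z. s \<le> snd z}) (mtop X) H"
      by (rule continuous_map_from_subtopology[OF Hc(1)])
    show "G (\<sigma> (fst p), snd p) = H p" if "p \<in> topspace ?Z" "snd p = s" for p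
      using Hs[of "fst p"] that by (cases p) auto
  qed simp
  have G'l: "continuous_map ?Z' leafT G'"
    unfolding G'_def
  proof (rule continuous_map_cases_le[OF clipZ])
    have "continuous_map ?Z' (prod_topology (subtopology leafT V) unitT) (\<lambda>p. (\<sigma> (fst p), snd p))"
      using continuous_map_compose[OF continuous_map_fst \<sigma>c(2)] continuous_map_snd by (auto simp: continuous_map_pairwise o_def)
    from continuous_map_compose[OF this T(7)]
    show "continuous_map (subtopology ?Z' {z \<in> topspace ?Z'. snd z \<le> s}) leafT (\<lambda>p. G (\<sigma> (fst p), snd p))"
      by (intro continuous_map_from_subtopology) (simp add: o_def)
    show "continuous_map (subtopology ?Z' {z \<in> topspace ?Z'. s \<le> snd z}) leafT H"
      by (rule continuous_map_from_subtopology[OF Hc(2)])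
    show "G (\<sigma> (fst p), snd p) = H p" if "p \<in> topspace ?Z'" "snd p = s" for p
      using Hs[of "fst p"] that by (cases p) auto
  qed simp
  obtain \<epsilon>0 where \<epsilon>0: "\<epsilon>0 > 0" "\<And>\<eta>. pathin leafT \<eta> \<Longrightarrow> \<eta> 0 \<in> D \<Longrightarrow> (\<And>u. u \<in> {0..s} \<Longrightarrow> mdist d (\<eta> u) (\<gamma> u) < \<epsilon>0) \<Longrightarrow>
        \<eta> s \<in> V \<and> leaf_hom (insert 0 {s..1}) (\<lambda>u. \<eta> (min u s)) (\<lambda>u. G (\<eta> s, u))"
    using T(12) by blast
  note tube = compact_path_tube[OF leafT_continuous_imp_continuous[OF c\<gamma>]]
  have \<gamma>V: "\<gamma> s \<in> V0" "\<gamma> s' \<in> V'" using \<gamma>s \<delta> by (auto simp: V0_def V'_def)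
  obtain \<epsilon>1 where \<epsilon>1: "\<epsilon>1 > 0" "\<And>u x. u \<in> {s..s'} \<Longrightarrow> x \<in> topspace (mtop X) \<Longrightarrow> mdist d x (\<gamma> u) < \<epsilon>1 \<Longrightarrow> x \<in> B"
    using tube[of s s' B] s s' B(5) \<gamma>B by auto
  obtain \<epsilon>2 where \<epsilon>2: "\<epsilon>2 > 0" "\<And>u x. u \<in> {s..s} \<Longrightarrow> x \<in> topspace (mtop X) \<Longrightarrow> mdist d x (\<gamma> u) < \<epsilon>2 \<Longrightarrow> x \<in> V0"
    using tube[of s s V0] s V0 \<gamma>V by auto
  obtain \<epsilon>3 where \<epsilon>3: "\<epsilon>3 > 0" "\<And>u x. u \<in> {s'..s'} \<Longrightarrow> x \<in> topspace (mtop X) \<Longrightarrow> mdist d x (\<gamma> u) < \<epsilon>3 \<Longrightarrow> x \<in> V'"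
    using tube[of s' s' V'] s s' V' \<gamma>V by auto
  have "transport \<gamma> s' V' G'"
  proof (rule transportI[where \<epsilon>="min (min \<epsilon>0 \<epsilon>1) (min \<epsilon>2 \<epsilon>3)"])
    show "V' \<inter> Sing F = {}" using V'(2) B(4) by blast
    show "G' (w, 0) \<in> D" if "w \<in> V'" for w using T(8)[OF \<sigma>(1)[OF that]] s by (simp add: G'_def)
    show "G' (w, u) = w" if "w \<in> V'" "u \<in> {s'..1}" for w u
    proof -
      have "x u = x s'" using that(2) cl(5)[of u] cl(4) by (simp add: x_def)
      then have "k (w, u) = fst (\<psi> w)" by (simp add: k_def)
      then show ?thesis using B(7)[OF V'w(4)[OF that(1)]] that(2) s' by (simp add: G'_def H_def)
    qed
    show "G' (\<gamma> s', u) = \<gamma> u" if u: "u \<in> {0..s'}" for u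
    proof (cases "u \<le> s")
      case True
      have "\<sigma> (\<gamma> s') = inv_into B \<psi> (\<psi> (\<gamma> s))" unfolding \<sigma>eq using \<gamma>s by simp
      then have "\<sigma> (\<gamma> s') = \<gamma> s" using B(7)[OF \<gamma>s(3)] by simp
      then show ?thesis using True T(10)[of u] u by (simp add: G'_def)
    next
      case False
      then have u': "u \<in> {s..s'}" using u by simp
      have "H (\<gamma> s', u) = inv_into B \<psi> (\<psi> (\<gamma> u))" using \<gamma>u[OF u'] \<gamma>s by (simp add: H_def k_def)
      then show ?thesis using False B(7)[OF \<gamma>inB[OF u']] by (simp add: G'_def)
    qed
    show "submersive_at X (\<lambda>w. t (G' (w, 0))) w" if w: "w \<in> V'" for w
    proof -
      have \<sigma>wB: "\<sigma> w \<in> B" using box[OF shift[OF w]] by (simp add: \<sigma>eq V0_def)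
      obtain L where L: "((\<lambda>w. t (G (w, 0))) \<circ> inv_into B \<psi> has_derivative L) (at (\<psi> (\<sigma> w)))"
        "\<And>c v. L (c *\<^sub>C v) = c *\<^sub>C L v" "surj L"
        by (rule submersive_at_chart[OF X T(11)[OF \<sigma>(1)[OF w]] B(1) \<sigma>wB]) (rule that)
      let ?s = "\<lambda>p::complex \<times> complex. (x s + (fst p - x s'), snd p)"
      have "(?s has_derivative (\<lambda>h. h)) (at (\<psi> w))"
        by (auto intro!: derivative_eq_intros)
      from has_derivative_compose[OF this, of "(\<lambda>w. t (G (w, 0))) \<circ> inv_into B \<psi>" L] L(1) \<sigma>(2)[OF w]
      have "((\<lambda>p. ((\<lambda>w. t (G (w, 0))) \<circ> inv_into B \<psi>) (?s p)) has_derivative L) (at (\<psi> w))" by simp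
      then have "((\<lambda>w. t (G' (w, 0))) \<circ> inv_into B \<psi> has_derivative L) (at (\<psi> w))"
        by (rule has_derivative_transform_within_open[OF _ chart_open_image[OF B(1) V']])
          (use w s V'(2) B(7) in \<open>auto simp: G'_def \<sigma>eq subset_iff\<close>)
      then show ?thesis unfolding submersive_at_def using B(1) V'w(4)[OF w] L(2,3) by blast
    qed
    fix \<eta> assume \<eta>: "pathin leafT \<eta>" "\<eta> 0 \<in> D"
      and close: "\<And>u. u \<in> {0..s'} \<Longrightarrow> mdist d (\<eta> u) (\<gamma> u) < min (min \<epsilon>0 \<epsilon>1) (min \<epsilon>2 \<epsilon>3)"
    have c\<eta>: "continuous_map unitT leafT \<eta>" using \<eta>(1) by (simp add: pathin_def)
    have \<eta>X: "\<eta> u \<in> topspace (mtop X)" if "u \<in> {0..1}" for u using pathin_leafT_image[OF \<eta>(1) that] topspace_leafT by blast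
    have \<eta>inB: "\<eta> u \<in> B" if "u \<in> {s..s'}" for u using \<epsilon>1(2)[OF that \<eta>X] close[of u] that s s' by auto
    then have \<eta>B: "\<eta> ` {s..s'} \<subseteq> B" by blast
    have \<eta>s: "\<eta> s \<in> V0" using \<epsilon>2(2)[of s "\<eta> s"] \<eta>X[of s] close[of s] s s' by auto
    have \<eta>s': "\<eta> s' \<in> V'" using \<epsilon>3(2)[of s' "\<eta> s'"] \<eta>X[of s'] close[of s'] s s' by auto
    have h1: "\<eta> s \<in> V" "leaf_hom (insert 0 {s..1}) (\<lambda>u. \<eta> (min u s)) (\<lambda>u. G (\<eta> s, u))"
      using \<epsilon>0(2)[OF \<eta>] close s' by auto
    obtain K where K: "continuous_map (prod_topology unitT unitT) leafT K" "\<And>u. K (0, u) = \<eta> (min u s)"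
      "\<And>u. K (1, u) = G (\<eta> s, u)" "\<And>\<tau> u. \<tau> \<in> {0..1} \<Longrightarrow> u \<in> insert 0 {s..1} \<Longrightarrow> K (\<tau>, u) = \<eta> (min u s)"
      by (rule leaf_homE[OF h1(2)]) (rule that)
    let ?A = "insert 0 {s'..1}"
    have A: "?A \<subseteq> {0..1}" using s s' by auto
    \<comment> \<open>The path between the two stages: transported up to \<open>\<eta> s\<close>,
      then \<open>\<eta>\<close> itself.\<close>
    define f1 where "f1 u = (if u \<le> s then G (\<eta> s, u) else \<eta> (min u s'))" for u
    have clipU: "continuous_map (prod_topology unitT unitT) euclideanreal snd"
      "continuous_map (prod_topology unitT unitT) unitT snd" "continuous_map (prod_topology unitT unitT) unitT fst"
      using continuous_map_snd continuous_map_fst continuous_map_into_fulltopology by blast+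
    let ?U = "prod_topology unitT unitT"
    have "leaf_hom ?A (\<lambda>u. \<eta> (min u s')) f1"
    proof (rule leaf_homI[OF A, where h="\<lambda>p. if snd p \<le> s then K p else \<eta> (min (snd p) s')"])
      show "continuous_map ?U leafT (\<lambda>p. if snd p \<le> s then K p else \<eta> (min (snd p) s'))"
      proof (rule continuous_map_cases_le[OF clipU(1)])
        have "continuous_map unitT unitT (\<lambda>u. min u s')"
          using s s' by (auto simp: continuous_map_in_subtopology intro!: continuous_intros)
        from continuous_map_compose[OF clipU(2) continuous_map_compose[OF this c\<eta>]]
        have "continuous_map ?U leafT (\<lambda>p. \<eta> (min (snd p) s'))" by (simp add: o_def)
        then show "continuous_map (subtopology ?U {z \<in> topspace ?U. s \<le> snd z}) leafT (\<lambda>p. \<eta> (min (snd p) s'))"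
          by (rule continuous_map_from_subtopology)
        show "continuous_map (subtopology ?U {z \<in> topspace ?U. snd z \<le> s}) leafT K"
          by (rule continuous_map_from_subtopology[OF K(1)])
        show "K p = \<eta> (min (snd p) s')" if "p \<in> topspace ?U" "snd p = s" for p
        proof -
          have "K p = K (fst p, s)" using that by (metis prod.collapse)
          also have "\<dots> = \<eta> (min s s)" using K(4)[of "fst p" s] that s by auto
          finally show ?thesis using that s' by simp
        qed
      qed simp
      show "(if snd (0::real, u) \<le> s then K (0, u) else \<eta> (min (snd (0::real, u)) s')) = \<eta> (min u s')" for u
        using K(2)[of u] s' by (cases "u \<le> s") simp_all
      show "(if snd (1::real, u) \<le> s then K (1, u) else \<eta> (min (snd (1::real, u)) s')) = f1 u" for u
        using K(3)[of u] by (simp add: f1_def)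
      show "(if snd (\<tau>, u) \<le> s then K (\<tau>, u) else \<eta> (min (snd (\<tau>, u)) s')) = \<eta> (min u s')"
        if "\<tau> \<in> {0..(1::real)}" "u \<in> ?A" for \<tau> u
      proof (cases "u = 0")
        case True
        then show ?thesis using K(4)[of \<tau> 0] that(1) s s' by simp
      next
        case False
        then have "\<not> u \<le> s" using that(2) s' by auto
        then show ?thesis by simp
      qed
    qed
    moreover have "leaf_hom ?A f1 (\<lambda>u. G' (\<eta> s', u))"
    proof -
      define y where "y = snd (\<psi> (\<eta> s'))"
      have yu: "snd (\<psi> (\<eta> u)) = y" if "u \<in> {s..s'}" for u unfolding y_def using plaque[OF \<eta>(1) \<eta>B that, of s'] s' by simp
      define p where "p u = fst (\<psi> (\<eta> (cl u)))" for u
      define q where "q u = k (\<eta> s', u)" for u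
      have pc: "continuous_map unitT euclidean p" unfolding p_def[abs_def] by (rule clipped[OF \<eta>(1) \<eta>B])
      have qc: "continuous_map unitT euclidean q"
      proof -
        have "continuous_map unitT ?Z (\<lambda>u. (\<eta> s', u))"
          using \<eta>s' openin_subset[OF V'(1)] by (auto simp: continuous_map_pairwise o_def)
        from continuous_map_compose[OF this kcont] show ?thesis by (simp add: o_def q_def[abs_def])
      qed
      have yb: "y \<in> ball b \<rho>" unfolding y_def using B(9)[OF V'w(4)[OF \<eta>s']] by simp
      have pb: "p u \<in> ball a \<rho>" for u using B(9)[OF \<eta>inB[OF cl(2)]] by (simp add: p_def)
      have qb: "q u \<in> ball a \<rho>" if "u \<in> {0..1}" for u using kball[OF \<eta>s'] that by (simp add: q_def)
      define J where "J = (\<lambda>z. inv_into B \<psi> ((1 - of_real (fst z)) * p (snd z) + of_real (fst z) * q (snd z), y))"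
      have Jc: "continuous_map ?U leafT J"
        unfolding J_def by (rule leaf_hom_plaque(1)[where A="{}", OF _ fb yb pc pb qc qb]) auto
      \<comment> \<open>The moving junction, from \<open>\<eta> s\<close> to the slid-back point of
        \<open>\<eta> s'\<close>; it stays in V because the box around \<open>\<gamma> s\<close> is
        convex in coordinates.\<close>
      define c where "c \<tau> = J (\<tau>, s)" for \<tau>
      have \<eta>cl: "inv_into B \<psi> (p u, y) = \<eta> (cl u)" for u
      proof -
        have "\<psi> (\<eta> (cl u)) = (p u, y)" using yu[OF cl(2)] by (simp add: p_def prod_eq_iff)
        then show ?thesis using B(7)[OF \<eta>inB[OF cl(2)]] by metis
      qed
      have cV: "c \<tau> \<in> V" if \<tau>: "\<tau> \<in> {0..1}" for \<tau>
      proof -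
        have ps: "p s \<in> ball (x s) \<delta>" using \<eta>s cl by (simp add: V0_def p_def mem_Times_iff)
        have qs: "q s \<in> ball (x s) \<delta>" using shift[OF \<eta>s'] by (simp add: q_def k_def)
        have "(1 - \<tau>) *\<^sub>R p s + \<tau> *\<^sub>R q s \<in> ball (x s) \<delta>"
          by (rule convexD_alt[OF convex_ball ps qs]) (use \<tau> in auto)
        moreover have "y \<in> ball y0 \<delta>" using V'w(3)[OF \<eta>s'] by (simp add: y_def)
        ultimately have "((1 - of_real \<tau>) * p s + of_real \<tau> * q s, y) \<in> ball (x s) \<delta> \<times> ball y0 \<delta>"
          by (simp add: scaleR_conv_of_real)
        from box[OF this] show ?thesis by (simp add: c_def J_def)
      qed
      have cc: "continuous_map unitT (subtopology leafT V) c"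
      proof -
        have "continuous_map unitT ?U (\<lambda>\<tau>. (\<tau>, s))" using sT by (auto simp: continuous_map_pairwise o_def intro!: continuous_intros)
        from continuous_map_compose[OF this Jc] have "continuous_map unitT leafT c" by (simp add: o_def c_def[abs_def])
        then show ?thesis using cV by (auto simp: continuous_map_in_subtopology)
      qed
      have Gcc: "continuous_map ?U leafT (\<lambda>z. G (c (fst z), snd z))"
      proof -
        have "continuous_map ?U (prod_topology (subtopology leafT V) unitT) (\<lambda>z. (c (fst z), snd z))"
          using continuous_map_compose[OF clipU(3) cc] clipU(2) by (auto simp: continuous_map_pairwise o_def)
        from continuous_map_compose[OF this T(7)] show ?thesis by (simp add: o_def)
      qed
      have c0: "c 0 = \<eta> s" using \<eta>cl[of s] cl by (simp add: c_def J_def)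
      have c1: "c 1 = \<sigma> (\<eta> s')" by (simp add: c_def J_def \<sigma>_def H_def q_def y_def)
      \<comment> \<open>While the junction slides, the starting point moves continuously in a leaf
        and inside D, hence not at all. Without this the homotopy would not fix its start.\<close>
      have start: "G (c \<tau>, 0) = G (c 0, 0)" if \<tau>: "\<tau> \<in> {0..1}" for \<tau>
      proof (rule leaf_path_in_transversal_constant[of "{0..1}" "\<lambda>\<tau>. G (c \<tau>, 0)"])
        have "continuous_map unitT ?U (\<lambda>\<tau>. (\<tau>, 0))" by (auto simp: continuous_map_pairwise o_def intro!: continuous_intros)
        from continuous_map_compose[OF this Gcc] show "continuous_map unitT leafT (\<lambda>\<tau>. G (c \<tau>, 0))" by (simp add: o_def)
        show "(\<lambda>\<tau>. G (c \<tau>, 0)) ` {0..1} \<subseteq> D" using T(8)[OF cV] by blast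
      qed (use \<tau> in auto)
      show ?thesis
      proof (rule leaf_homI[OF A, where h="\<lambda>z. if snd z \<le> s then G (c (fst z), snd z) else J z"])
        show "continuous_map ?U leafT (\<lambda>z. if snd z \<le> s then G (c (fst z), snd z) else J z)"
        proof (rule continuous_map_cases_le[OF clipU(1)])
          show "G (c (fst z), snd z) = J z" if "z \<in> topspace ?U" "snd z = s" for z
          proof -
            have "G (c (fst z), s) = c (fst z)" using T(9)[OF cV, of "fst z" s] that s by auto
            then show ?thesis using that by (cases z) (simp add: c_def)
          qed
        qed (use Gcc Jc in \<open>auto intro: continuous_map_from_subtopology\<close>)
        show "(if snd (0::real, u) \<le> s then G (c (fst (0::real, u)), snd (0::real, u)) else J (0, u)) = f1 u" for u
          using \<eta>cl[of u] cl(6)[of u] c0 by (simp add: f1_def J_def)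
        show "(if snd (1::real, u) \<le> s then G (c (fst (1::real, u)), snd (1::real, u)) else J (1, u)) = G' (\<eta> s', u)" for u
          using c1 by (simp add: G'_def J_def H_def q_def y_def)
        fix \<tau> u assume \<tau>: "\<tau> \<in> {0..(1::real)}" and u: "u \<in> ?A"
        show "(if snd (\<tau>, u) \<le> s then G (c (fst (\<tau>, u)), snd (\<tau>, u)) else J (\<tau>, u)) = f1 u"
        proof (cases "u = 0")
          case True
          then show ?thesis using start[OF \<tau>] c0 s by (simp add: f1_def)
        next
          case False
          then have u': "u \<ge> s'" using u by simp
          then have "p u = fst (\<psi> (\<eta> s'))" "q u = fst (\<psi> (\<eta> s'))" "\<not> u \<le> s"
            using cl(5)[of u] cl(4) s' by (auto simp: p_def q_def k_def x_def)
          moreover have "inv_into B \<psi> (fst (\<psi> (\<eta> s')), y) = \<eta> s'" using \<eta>cl[of s'] cl(4) by (simp add: p_def)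
          ultimately show ?thesis using u' by (simp add: J_def f1_def algebra_simps)
        qed
      qed
    qed
    ultimately show "\<eta> s' \<in> V' \<and> leaf_hom ?A (\<lambda>u. \<eta> (min u s')) (\<lambda>u. G' (\<eta> s', u))"
      using \<eta>s' leaf_hom_trans by blast
  qed (use s s' V' \<gamma>V G'c G'l \<epsilon>0 \<epsilon>1 \<epsilon>2 \<epsilon>3 in auto)
  then show ?thesis by blast
qed

text \<open>Bisection: by continuity every time has a neighbourhood mapped into one flow box, so
  transport can be extended across it.\<close>

lemma transport_exists:
  assumes \<gamma>: "pathin leafT \<gamma>" "\<gamma> 0 \<in> D"
  shows "\<exists>V G. transport \<gamma> 1 V G"
proof -
  have c\<gamma>: "continuous_map unitT (mtop X) \<gamma>" using \<gamma>(1) leafT_continuous_imp_continuous by (simp add: pathin_def)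
  define Q where "Q u \<longleftrightarrow> u = 0 \<or> (\<exists>V G. transport \<gamma> u V G)" for u
  have "(0::real) \<le> 1" by simp
  then have "0 \<le> (0::real) \<longrightarrow> (1::real) \<le> 1 \<longrightarrow> Q 0 \<longrightarrow> Q 1"
  proof (induction rule: Bolzano[where P="\<lambda>u v. 0 \<le> u \<longrightarrow> v \<le> 1 \<longrightarrow> Q u \<longrightarrow> Q v"])
    case (trans a b c)
    then show ?case by auto
  next
    case (local x)
    have "\<gamma> x \<in> topspace leafT" using pathin_leafT_image[OF \<gamma>(1)] local by simp
    then obtain B \<psi> a b \<rho> where fb: "flow_box B \<psi> a b \<rho>" and x: "\<gamma> x \<in> B"
      using flow_box_exists[of "\<gamma> x"] topspace_leafT by blast
    have "openin unitT {u \<in> topspace unitT. \<gamma> u \<in> B}"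
      by (rule openin_continuous_map_preimage[OF c\<gamma> flow_boxD(5)[OF fb]])
    moreover have "x \<in> {u \<in> topspace unitT. \<gamma> u \<in> B}" using local x by simp
    ultimately obtain e where e: "e > 0" "ball x e \<inter> {0..1} \<subseteq> {u \<in> topspace unitT. \<gamma> u \<in> B}"
      unfolding openin_contains_ball by blast
    show ?case
    proof (intro exI[of _ e] conjI e(1) allI impI)
      fix u v assume uv: "u \<le> x \<and> x \<le> v \<and> v - u < e" "0 \<le> u" "v \<le> 1" "Q u"
      have B: "\<gamma> ` {u..v} \<subseteq> B"
      proof clarify
        fix z assume "z \<in> {u..v}"
        then have "z \<in> ball x e \<inter> {0..1}" using uv by (auto simp: dist_real_def)
        then show "\<gamma> z \<in> B" using e(2) by auto
      qed
      show "Q v"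
      proof (cases "u = v")
        case False
        then have lt: "u < v" using uv by simp
        show ?thesis
        proof (cases "u = 0")
          case True
          then show ?thesis using transport_base[OF \<gamma> _ uv(3) fb] B lt by (simp add: Q_def)
        next
          case False
          then obtain V G where "transport \<gamma> u V G" using uv(4) by (auto simp: Q_def)
          from transport_step[OF \<gamma>(1) this lt uv(3) fb B] show ?thesis by (simp add: Q_def)
        qed
      qed (use uv in simp)
    qed
  qed
  then show ?thesis by (auto simp: Q_def)
qed


subsection \<open>The space of leaf paths and its quotient\<close>

abbreviation paths :: "(real \<Rightarrow> 'a) set" where "paths \<equiv> leaf_paths_from X F D"

abbreviation pathsT :: "(real \<Rightarrow> 'a) topology" where "pathsT \<equiv> path_space X F d D"

abbreviation cls :: "(real \<Rightarrow> 'a) \<Rightarrow> (real \<Rightarrow> 'a) set" where "cls \<equiv> path_class X F D"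

abbreviation classT :: "(real \<Rightarrow> 'a) set topology" where "classT \<equiv> quotient_topology pathsT cls"

lemma paths_iff: "\<gamma> \<in> paths \<longleftrightarrow> \<gamma> \<in> extensional {0..1} \<and> \<gamma> 0 \<in> D \<and> pathin leafT \<gamma>"
  by (simp add: leaf_paths_from_def leaf_path_iff)

lemma mspace_d: "mspace d = topspace (mtop X)"
proof -
  interpret Md: Metric_space "mspace d" "mdist d" by simp
  have "Md.mtopology = mtop X" using d by (simp add: mtopology_of_def)
  then show ?thesis using Md.topspace_mtopology by metis
qed

lemma restrict_paths:
  assumes "pathin leafT \<gamma>" "\<gamma> 0 \<in> D"
  shows "restrict \<gamma> {0..1} \<in> paths"
proof -
  have "pathin leafT (restrict \<gamma> {0..1})"
    using assms(1) unfolding pathin_def by (rule continuous_map_eq) auto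
  then show ?thesis using assms(2) by (simp add: paths_iff)
qed

lemma pathsD:
  assumes "\<gamma> \<in> paths"
  shows "pathin leafT \<gamma>" "\<gamma> 0 \<in> D" "continuous_map unitT leafT \<gamma>" "continuous_map unitT (mtop X) \<gamma>"
    "\<And>u. u \<in> {0..1} \<Longrightarrow> \<gamma> u \<in> topspace (mtop X)" "\<gamma> \<in> mspace (cfunspace unitT d)" "restrict \<gamma> {0..1} = \<gamma>"
proof -
  show *: "pathin leafT \<gamma>" "\<gamma> 0 \<in> D" "continuous_map unitT leafT \<gamma>" using assms by (auto simp: paths_iff pathin_def)
  then show c: "continuous_map unitT (mtop X) \<gamma>" using leafT_continuous_imp_continuous by blast
  show im: "\<gamma> u \<in> topspace (mtop X)" if "u \<in> {0..1}" for u
    using continuous_map_image_subset_topspace[OF c] that by auto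
  have cu: "compactin unitT (topspace unitT)" by (simp add: compactin_subtopology)
  show "\<gamma> \<in> mspace (cfunspace unitT d)"
    unfolding compactin_mspace_cfunspace[OF cu] using im c assms by (auto simp: mspace_d d paths_iff)
  show "restrict \<gamma> {0..1} = \<gamma>" using assms by (simp add: paths_iff extensional_restrict)
qed

lemma topspace_pathsT: "topspace pathsT = paths"
proof -
  interpret C: Metric_space "mspace (cfunspace unitT d)" "mdist (cfunspace unitT d)"
    by (rule Metric_space_mspace_mdist)
  have "topspace (mtopology_of (cfunspace unitT d)) = mspace (cfunspace unitT d)"
    unfolding mtopology_of_def by (rule C.topspace_mtopology)
  then show ?thesis unfolding path_space_def topspace_subtopology using pathsD(6) by blast
qed

lemma openin_pathsT:
  "openin pathsT U \<longleftrightarrow> U \<subseteq> paths \<and>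
     (\<forall>\<gamma>\<in>U. \<exists>\<epsilon>>0. \<forall>\<eta>\<in>paths. (\<forall>u\<in>{0..1}. mdist d (\<eta> u) (\<gamma> u) < \<epsilon>) \<longrightarrow> \<eta> \<in> U)"
proof
  interpret C: Metric_space "mspace (cfunspace unitT d)" "mdist (cfunspace unitT d)"
    by (rule Metric_space_mspace_mdist)
  have C: "mtopology_of (cfunspace unitT d) = C.mtopology" by (simp add: mtopology_of_def)
  assume U: "openin pathsT U"
  then obtain U' where U': "openin C.mtopology U'" "U = U' \<inter> paths"
    unfolding path_space_def C openin_subtopology by blast
  have "\<exists>\<epsilon>>0. \<forall>\<eta>\<in>paths. (\<forall>u\<in>{0..1}. mdist d (\<eta> u) (\<gamma> u) < \<epsilon>) \<longrightarrow> \<eta> \<in> U" if \<gamma>: "\<gamma> \<in> U" for \<gamma>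
  proof -
    obtain \<epsilon> where \<epsilon>: "\<epsilon> > 0" "C.mball \<gamma> \<epsilon> \<subseteq> U'" using U' \<gamma> C.openin_mtopology by blast
    \<comment> \<open>Pointwise strict bounds give only a weak bound on the supremum, hence the
      half.\<close>
    have "\<eta> \<in> U" if \<eta>: "\<eta> \<in> paths" "\<forall>u\<in>{0..1}. mdist d (\<eta> u) (\<gamma> u) < \<epsilon> / 2" for \<eta>
    proof -
      have "mdist (cfunspace unitT d) \<eta> \<gamma> \<le> \<epsilon> / 2"
        by (rule mdist_cfunspace_le) (use \<epsilon> \<eta> in \<open>auto intro: less_imp_le\<close>)
      then have "mdist (cfunspace unitT d) \<eta> \<gamma> < \<epsilon>" using \<epsilon>(1) by linarith
      moreover have "\<gamma> \<in> paths" using \<gamma> U'(2) by blast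
      ultimately have "\<eta> \<in> C.mball \<gamma> \<epsilon>"
        unfolding C.in_mball C.commute[of \<gamma> \<eta>] using pathsD(6) \<eta>(1) by (intro conjI) blast+
      then show ?thesis using \<epsilon>(2) \<eta>(1) U'(2) by blast
    qed
    then show ?thesis using \<epsilon>(1) by (intro exI[of _ "\<epsilon> / 2"]) auto
  qed
  then show "U \<subseteq> paths \<and> (\<forall>\<gamma>\<in>U. \<exists>\<epsilon>>0. \<forall>\<eta>\<in>paths. (\<forall>u\<in>{0..1}. mdist d (\<eta> u) (\<gamma> u) < \<epsilon>) \<longrightarrow> \<eta> \<in> U)"
    using U'(2) by blast
next
  interpret C: Metric_space "mspace (cfunspace unitT d)" "mdist (cfunspace unitT d)"
    by (rule Metric_space_mspace_mdist)
  have C: "mtopology_of (cfunspace unitT d) = C.mtopology" by (simp add: mtopology_of_def)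
  assume U: "U \<subseteq> paths \<and> (\<forall>\<gamma>\<in>U. \<exists>\<epsilon>>0. \<forall>\<eta>\<in>paths. (\<forall>u\<in>{0..1}. mdist d (\<eta> u) (\<gamma> u) < \<epsilon>) \<longrightarrow> \<eta> \<in> U)"
  show "openin pathsT U"
  proof (subst openin_subopen, rule ballI)
    fix \<gamma> assume \<gamma>: "\<gamma> \<in> U"
    obtain \<epsilon> where \<epsilon>: "\<epsilon> > 0" "\<And>\<eta>. \<eta> \<in> paths \<Longrightarrow> \<forall>u\<in>{0..1}. mdist d (\<eta> u) (\<gamma> u) < \<epsilon> \<Longrightarrow> \<eta> \<in> U"
      using U \<gamma> by blast
    have \<gamma>p: "\<gamma> \<in> paths" using U \<gamma> by blast
    have "openin pathsT (C.mball \<gamma> \<epsilon> \<inter> paths)"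
      unfolding path_space_def C openin_subtopology using C.openin_mball by blast
    moreover have "\<gamma> \<in> C.mball \<gamma> \<epsilon> \<inter> paths" 
      unfolding Int_iff C.centre_in_mball_iff by (intro conjI \<gamma>p pathsD(6)[OF \<gamma>p] \<epsilon>(1))
    moreover have "C.mball \<gamma> \<epsilon> \<inter> paths \<subseteq> U"
    proof
      fix \<eta> assume \<eta>: "\<eta> \<in> C.mball \<gamma> \<epsilon> \<inter> paths"
      have cu: "compactin unitT (topspace unitT)" by (simp add: compactin_subtopology)
      have lt: "mdist (cfunspace unitT d) \<eta> \<gamma> < \<epsilon>" 
        using \<eta> unfolding Int_iff C.in_mball C.commute[of \<gamma> \<eta>] by (elim conjE)
      have "mdist d (\<eta> u) (\<gamma> u) < \<epsilon>" if "u \<in> {0..1}" for u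
        by (rule cfunspace_mdist_lt[OF cu _ _ lt]) (use pathsD(6) \<gamma>p \<eta> that in auto)
      then show "\<eta> \<in> U" using \<epsilon>(2) \<eta> by blast
    qed
    ultimately show "\<exists>T. openin pathsT T \<and> \<gamma> \<in> T \<and> T \<subseteq> U" by blast
  qed
qed

text \<open>Currying for uniform convergence, by the tube lemma over the compact parameter
  interval.\<close>

lemma continuous_map_into_pathsT:
  assumes g: "continuous_map (prod_topology Z unitT) (mtop X) g"
    and im: "\<And>z. z \<in> topspace Z \<Longrightarrow> restrict (\<lambda>u. g (z, u)) {0..1} \<in> paths"
  shows "continuous_map Z pathsT (\<lambda>z. restrict (\<lambda>u. g (z, u)) {0..1})"
  unfolding continuous_map
proof (intro conjI allI impI)
  let ?h = "\<lambda>z. restrict (\<lambda>u. g (z, u)) {0..1}"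
  show "?h ` topspace Z \<subseteq> topspace pathsT" using im topspace_pathsT by auto
  fix U assume U: "openin pathsT U"
  interpret Md: Metric_space "mspace d" "mdist d" by simp
  have top: "Md.mtopology = mtop X" using d by (simp add: mtopology_of_def)
  show "openin Z {z \<in> topspace Z. ?h z \<in> U}"
  proof (subst openin_subopen, rule ballI)
    fix z0 assume "z0 \<in> {z \<in> topspace Z. ?h z \<in> U}"
    then have z0: "z0 \<in> topspace Z" "?h z0 \<in> U" by auto
    obtain \<epsilon> where \<epsilon>: "\<epsilon> > 0" "\<And>\<eta>. \<eta> \<in> paths \<Longrightarrow> \<forall>u\<in>{0..1}. mdist d (\<eta> u) (?h z0 u) < \<epsilon> \<Longrightarrow> \<eta> \<in> U"
      using U z0(2) openin_pathsT[of U] by blast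
    let ?Z = "prod_topology Z unitT"
    have g0: "continuous_map ?Z (mtop X) (\<lambda>q. g (z0, snd q))"
    proof -
      have "continuous_map ?Z ?Z (\<lambda>q. (z0, snd q))"
        unfolding continuous_map_pairwise o_def using z0 continuous_map_snd[of Z unitT] by simp
      from continuous_map_compose[OF this g] show ?thesis by (simp add: o_def)
    qed
    \<comment> \<open>The parameters at which the path of z and the path of z0 lie in a common ball
      of radius \<epsilon> / 2; the set is open and contains the whole line over z0.\<close>
    define W where "W = (\<Union>p\<in>mspace d. {q \<in> topspace ?Z. g q \<in> Md.mball p (\<epsilon> / 2)} \<inter>
        {q \<in> topspace ?Z. g (z0, snd q) \<in> Md.mball p (\<epsilon> / 2)})"
    have W: "openin ?Z W"
      unfolding W_def using Md.openin_mball top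
      by (intro openin_Union[of "_ ` _"] openin_Int ballI openin_continuous_map_preimage[OF g]
          openin_continuous_map_preimage[OF g0] | clarify)+ auto
    have C: "compactin unitT {0..1}" by (simp add: compactin_subtopology)
    have sub: "{z0} \<times> {0..1} \<subseteq> W"
    proof clarify
      fix u :: real assume u: "u \<in> {0..1}"
      have "g (z0, u) \<in> mspace d"
        using continuous_map_image_subset_topspace[OF g] z0(1) u by (auto simp: mspace_d)
      then show "(z0, u) \<in> W" unfolding W_def using z0(1) u \<epsilon>(1)
        by (intro UN_I[of "g (z0, u)"]) (auto simp: Md.in_mball)
    qed
    obtain A V where A: "openin Z A" "z0 \<in> A" "{0..1} \<subseteq> V" "A \<times> V \<subseteq> W"
      using tube_lemma_right[OF W C z0(1) sub] by blast
    have "A \<subseteq> {z \<in> topspace Z. ?h z \<in> U}"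
    proof
      fix z assume z: "z \<in> A"
      have zZ: "z \<in> topspace Z" using z A(1) openin_subset by blast
      have "mdist d (?h z u) (?h z0 u) < \<epsilon>" if u: "u \<in> {0..1}" for u
      proof -
        have "(z, u) \<in> W" using A z u by blast
        then obtain p where "g (z, u) \<in> Md.mball p (\<epsilon> / 2)" "g (z0, u) \<in> Md.mball p (\<epsilon> / 2)"
          by (auto simp: W_def)
        then have m: "mdist d p (g (z, u)) < \<epsilon> / 2" "mdist d p (g (z0, u)) < \<epsilon> / 2"
          "p \<in> mspace d" "g (z, u) \<in> mspace d" "g (z0, u) \<in> mspace d" by (auto simp: Md.in_mball)
        have "mdist d (g (z, u)) (g (z0, u)) \<le> mdist d (g (z, u)) p + mdist d p (g (z0, u))"
          by (rule Md.triangle) (use m in auto)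
        then show ?thesis using m(1,2) u by (simp add: Md.commute)
      qed
      then show "z \<in> {z \<in> topspace Z. ?h z \<in> U}" using \<epsilon>(2)[OF im[OF zZ]] zZ by blast
    qed
    with A(1,2) show "\<exists>T. openin Z T \<and> z0 \<in> T \<and> T \<subseteq> {z \<in> topspace Z. ?h z \<in> U}" by blast
  qed
qed

lemma evaluation_continuous:
  assumes u: "u \<in> {0..1}"
  shows "continuous_map pathsT (mtop X) (\<lambda>\<gamma>. \<gamma> u)"
  unfolding continuous_map
proof (intro conjI allI impI)
  show "(\<lambda>\<gamma>. \<gamma> u) ` topspace pathsT \<subseteq> topspace (mtop X)" using pathsD(5) u topspace_pathsT by auto
  fix V assume V: "openin (mtop X) V"
  show "openin pathsT {\<gamma> \<in> topspace pathsT. \<gamma> u \<in> V}"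
    unfolding openin_pathsT
  proof (intro conjI ballI)
    show "{\<gamma> \<in> topspace pathsT. \<gamma> u \<in> V} \<subseteq> paths" using topspace_pathsT by auto
    fix \<gamma> assume "\<gamma> \<in> {\<gamma> \<in> topspace pathsT. \<gamma> u \<in> V}"
    then have \<gamma>: "\<gamma> \<in> paths" "\<gamma> u \<in> V" using topspace_pathsT by auto
    have "{u..u} \<subseteq> {0..1}" using u by auto
    then obtain \<epsilon> where \<epsilon>: "\<epsilon> > 0" "\<And>v x. v \<in> {u..u} \<Longrightarrow> x \<in> topspace (mtop X) \<Longrightarrow> mdist d x (\<gamma> v) < \<epsilon> \<Longrightarrow> x \<in> V"
      using compact_path_tube[OF pathsD(4)[OF \<gamma>(1)] _ V, of u u] \<gamma>(2) by auto
    then show "\<exists>\<epsilon>>0. \<forall>\<eta>\<in>paths. (\<forall>u\<in>{0..1}. mdist d (\<eta> u) (\<gamma> u) < \<epsilon>) \<longrightarrow> \<eta> \<in> {\<gamma> \<in> topspace pathsT. \<gamma> u \<in> V}"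
      using topspace_pathsT u pathsD(5) by (intro exI[of _ \<epsilon>]) auto
  qed
qed

lemma leaf_homotopic_leaf_hom: "leaf_homotopic X F \<gamma> \<gamma>' \<longleftrightarrow> leaf_hom {0, 1} \<gamma> \<gamma>'"
  by (simp add: leaf_homotopic_iff leaf_hom_def)

lemma cls_eq_iff:
  assumes "\<gamma> \<in> paths" "\<gamma>' \<in> paths"
  shows "cls \<gamma> = cls \<gamma>' \<longleftrightarrow> leaf_hom {0, 1} \<gamma> \<gamma>'"
proof
  assume "cls \<gamma> = cls \<gamma>'"
  moreover have "\<gamma>' \<in> cls \<gamma>'"
    using assms(2) leaf_hom_refl[OF pathsD(1)[OF assms(2)]] by (simp add: path_class_def leaf_homotopic_leaf_hom)
  ultimately have "\<gamma>' \<in> cls \<gamma>" by simp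
  then show "leaf_hom {0, 1} \<gamma> \<gamma>'" by (simp add: path_class_def leaf_homotopic_leaf_hom)
next
  assume "leaf_hom {0, 1} \<gamma> \<gamma>'"
  then show "cls \<gamma> = cls \<gamma>'"
    using leaf_hom_trans leaf_hom_sym unfolding path_class_def leaf_homotopic_leaf_hom by blast
qed

lemma class_ends:
  assumes "\<gamma> \<in> paths"
  shows "class_start (cls \<gamma>) = \<gamma> 0" "class_end (cls \<gamma>) = \<gamma> 1"
proof -
  have "\<gamma> \<in> cls \<gamma>"
    using assms leaf_hom_refl[OF pathsD(1)[OF assms]] by (simp add: path_class_def leaf_homotopic_leaf_hom)
  then have "(SOME \<gamma>'. \<gamma>' \<in> cls \<gamma>) \<in> cls \<gamma>" by (rule someI[of "\<lambda>\<gamma>'. \<gamma>' \<in> cls \<gamma>"])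
  then have "leaf_hom {0, 1} \<gamma> (SOME \<gamma>'. \<gamma>' \<in> cls \<gamma>)" by (simp add: path_class_def leaf_homotopic_leaf_hom)
  then show "class_start (cls \<gamma>) = \<gamma> 0" "class_end (cls \<gamma>) = \<gamma> 1"
    using leaf_hom_eq_on by (auto simp: class_start_def class_end_def)
qed

lemma classT_quotient: "quotient_map pathsT classT cls"
  by (rule quotient_map_quotient_topology)

lemma topspace_classT: "topspace classT = cls ` paths"
  by (simp add: topspace_quotient_topology topspace_pathsT)

lemma class_end_continuous: "continuous_map classT (mtop X) class_end"
proof (rule continuous_compose_quotient_map[OF classT_quotient])
  show "continuous_map pathsT (mtop X) (class_end \<circ> cls)"
    by (rule continuous_map_eq[OF evaluation_continuous[of 1]]) (simp_all add: topspace_pathsT class_ends)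
qed

lemma class_start_continuous: "continuous_map classT (subtopology (mtop X) D) class_start"
proof (rule continuous_compose_quotient_map[OF classT_quotient])
  have "continuous_map pathsT (mtop X) (class_start \<circ> cls)"
    by (rule continuous_map_eq[OF evaluation_continuous[of 0]]) (simp_all add: topspace_pathsT class_ends)
  then show "continuous_map pathsT (subtopology (mtop X) D) (class_start \<circ> cls)"
    using pathsD(2) by (auto simp: continuous_map_in_subtopology topspace_pathsT class_ends)
qed


section \<open>Local sections of the end point map\<close>

text \<open>What remains of a transport when only classes matter. The clause on U says that every
  path near \<open>\<gamma>\<close> is equivalent to the section at its own end point; this makes
  the end point a local coordinate.\<close>

definition section_at :: "(real \<Rightarrow> 'a) \<Rightarrow> 'a set \<Rightarrow> ('a \<Rightarrow> real \<Rightarrow> 'a) \<Rightarrow> bool" where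
  "section_at \<gamma> V g \<longleftrightarrow> openin (mtop X) V \<and> \<gamma> 1 \<in> V \<and> continuous_map (subtopology (mtop X) V) pathsT g \<and>
     (\<forall>w\<in>V. g w 1 = w) \<and> g (\<gamma> 1) = \<gamma> \<and>
     (\<exists>U. openin pathsT U \<and> \<gamma> \<in> U \<and> (\<forall>\<eta>\<in>U. \<eta> 1 \<in> V \<and> cls \<eta> = cls (g (\<eta> 1)))) \<and>
     (\<forall>w\<in>V. submersive_at X (\<lambda>w. t (g w 0)) w)"

lemma section_atD:
  assumes "section_at \<gamma> V g"
  shows "openin (mtop X) V" "\<gamma> 1 \<in> V" "continuous_map (subtopology (mtop X) V) pathsT g"
    "\<And>w. w \<in> V \<Longrightarrow> g w 1 = w" "g (\<gamma> 1) = \<gamma>" "\<And>w. w \<in> V \<Longrightarrow> g w \<in> paths"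
    "\<And>w. w \<in> V \<Longrightarrow> submersive_at X (\<lambda>w. t (g w 0)) w"
    "\<exists>U. openin pathsT U \<and> \<gamma> \<in> U \<and> (\<forall>\<eta>\<in>U. \<eta> 1 \<in> V \<and> cls \<eta> = cls (g (\<eta> 1)))"
proof -
  show *: "openin (mtop X) V" "\<gamma> 1 \<in> V" "continuous_map (subtopology (mtop X) V) pathsT g"
    "\<And>w. w \<in> V \<Longrightarrow> g w 1 = w" "g (\<gamma> 1) = \<gamma>" "\<And>w. w \<in> V \<Longrightarrow> submersive_at X (\<lambda>w. t (g w 0)) w"
    "\<exists>U. openin pathsT U \<and> \<gamma> \<in> U \<and> (\<forall>\<eta>\<in>U. \<eta> 1 \<in> V \<and> cls \<eta> = cls (g (\<eta> 1)))"
    using assms unfolding section_at_def by (elim conjE; blast)+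
  show "g w \<in> paths" if "w \<in> V" for w
    using continuous_map_image_subset_topspace[OF *(3)] openin_subset[OF *(1)] that topspace_pathsT by auto
qed

lemma pathsT_ball:
  assumes "\<gamma> \<in> paths" "\<epsilon> > 0"
  obtains U where "openin pathsT U" "\<gamma> \<in> U" "\<And>\<eta> u. \<eta> \<in> U \<Longrightarrow> u \<in> {0..1} \<Longrightarrow> mdist d (\<eta> u) (\<gamma> u) < \<epsilon>"
proof -
  interpret C: Metric_space "mspace (cfunspace unitT d)" "mdist (cfunspace unitT d)"
    by (rule Metric_space_mspace_mdist)
  have C: "mtopology_of (cfunspace unitT d) = C.mtopology" by (simp add: mtopology_of_def)
  show ?thesis
  proof (rule that[of "C.mball \<gamma> \<epsilon> \<inter> paths"])
    show "openin pathsT (C.mball \<gamma> \<epsilon> \<inter> paths)"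
      unfolding path_space_def C openin_subtopology using C.openin_mball by blast
    show "\<gamma> \<in> C.mball \<gamma> \<epsilon> \<inter> paths"
      unfolding Int_iff C.centre_in_mball_iff by (intro conjI assms pathsD(6)[OF assms(1)])
    fix \<eta> and u :: real assume \<eta>: "\<eta> \<in> C.mball \<gamma> \<epsilon> \<inter> paths" and u: "u \<in> {0..1}"
    have cu: "compactin unitT (topspace unitT)" by (simp add: compactin_subtopology)
    have lt: "mdist (cfunspace unitT d) \<eta> \<gamma> < \<epsilon>"
      using \<eta> unfolding Int_iff C.in_mball C.commute[of \<gamma> \<eta>] by (elim conjE)
    show "mdist d (\<eta> u) (\<gamma> u) < \<epsilon>"
      by (rule cfunspace_mdist_lt[OF cu _ _ lt]) (use pathsD(6) assms(1) \<eta> u in auto)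
  qed
qed

text \<open>Transport to time 1, where the relative set shrinks to {0, 1} and the homotopies become
  those of the covering domain.\<close>

lemma section_exists:
  assumes \<gamma>: "\<gamma> \<in> paths"
  obtains V g where "section_at \<gamma> V g"
proof -
  obtain V G where tr: "transport \<gamma> 1 V G" using transport_exists[OF pathsD(1,2)[OF \<gamma>]] by blast
  note T = transportD[OF tr]
  define g where "g w = restrict (\<lambda>u. G (w, u)) {0..1}" for w
  have gp: "g w \<in> paths" if w: "w \<in> V" for w
    unfolding g_def
  proof (rule restrict_paths)
    have "w \<in> topspace (subtopology leafT V)" using w T(3,4) openin_subset topspace_leafT by fastforce
    then have "continuous_map unitT (prod_topology (subtopology leafT V) unitT) (\<lambda>u. (w, u))"
      by (simp add: continuous_map_pairwise o_def)
    from continuous_map_compose[OF this T(7)] show "pathin leafT (\<lambda>u. G (w, u))" by (simp add: pathin_def o_def)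
    show "G (w, 0) \<in> D" using T(8)[OF w] .
  qed
  have "continuous_map (subtopology (mtop X) V) pathsT (\<lambda>w. restrict (\<lambda>u. G (w, u)) {0..1})"
    by (rule continuous_map_into_pathsT[OF T(6)]) (use gp in \<open>simp add: g_def\<close>)
  then have gc: "continuous_map (subtopology (mtop X) V) pathsT g" by (simp add: g_def[abs_def])
  obtain \<epsilon> where \<epsilon>: "\<epsilon> > 0" "\<And>\<eta>. pathin leafT \<eta> \<Longrightarrow> \<eta> 0 \<in> D \<Longrightarrow> (\<And>u. u \<in> {0..1} \<Longrightarrow> mdist d (\<eta> u) (\<gamma> u) < \<epsilon>) \<Longrightarrow>
        \<eta> 1 \<in> V \<and> leaf_hom (insert 0 {1..1}) (\<lambda>u. \<eta> (min u 1)) (\<lambda>u. G (\<eta> 1, u))"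
    using T(12) by blast
  obtain U where U: "openin pathsT U" "\<gamma> \<in> U" "\<And>\<eta> u. \<eta> \<in> U \<Longrightarrow> u \<in> {0..1} \<Longrightarrow> mdist d (\<eta> u) (\<gamma> u) < \<epsilon>"
    by (rule pathsT_ball[OF \<gamma> \<epsilon>(1)]) (rule that)
  have U': "\<eta> 1 \<in> V \<and> cls \<eta> = cls (g (\<eta> 1))" if \<eta>: "\<eta> \<in> U" for \<eta>
  proof -
    have \<eta>p: "\<eta> \<in> paths" using openin_subset[OF U(1)] \<eta> topspace_pathsT by blast
    have h: "\<eta> 1 \<in> V" "leaf_hom (insert 0 {1..1}) (\<lambda>u. \<eta> (min u 1)) (\<lambda>u. G (\<eta> 1, u))"
      using \<epsilon>(2)[OF pathsD(1,2)[OF \<eta>p] U(3)[OF \<eta>]] by auto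
    have "leaf_hom {0, 1} \<eta> (g (\<eta> 1))"
      by (rule leaf_hom_cong[OF _ h(2), simplified]) (auto simp: g_def min_def)
    then show ?thesis using h(1) cls_eq_iff[OF \<eta>p gp[OF h(1)]] by blast
  qed
  have "g (\<gamma> 1) = \<gamma>"
  proof -
    have "g (\<gamma> 1) = restrict \<gamma> {0..1}" unfolding g_def using T(10) by (intro restrict_ext) auto
    then show ?thesis using pathsD(7)[OF \<gamma>] by simp
  qed
  moreover have "g w 1 = w" if "w \<in> V" for w using T(9)[OF that, of 1] by (simp add: g_def)
  moreover have "submersive_at X (\<lambda>w. t (g w 0)) w" if "w \<in> V" for w using T(11)[OF that] by (simp add: g_def)
  ultimately have "section_at \<gamma> V g" unfolding section_at_def using T(3,5) gc U(1,2) U' by blast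
  then show ?thesis by (rule that)
qed

text \<open>Equality of the germs at x of the sections, read in the space of classes; the paths
  themselves may differ.\<close>

definition sections_agree :: "'a \<Rightarrow> 'a set \<Rightarrow> ('a \<Rightarrow> real \<Rightarrow> 'a) \<Rightarrow> 'a set \<Rightarrow> ('a \<Rightarrow> real \<Rightarrow> 'a) \<Rightarrow> bool" where
  "sections_agree x V g V' g' \<longleftrightarrow>
     (\<exists>Q. openin (mtop X) Q \<and> x \<in> Q \<and> (\<forall>w\<in>Q. w \<in> V \<and> w \<in> V' \<and> cls (g w) = cls (g' w)))"

lemma sections_agree_sym: "sections_agree x V g V' g' \<Longrightarrow> sections_agree x V' g' V g"
  unfolding sections_agree_def by metis

lemma sections_agree_trans:
  assumes "sections_agree x V g V' g'" "sections_agree x V' g' V'' g''"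
  shows "sections_agree x V g V'' g''"
proof -
  obtain O1 O2 where "openin (mtop X) O1" "x \<in> O1" "\<forall>w\<in>O1. w \<in> V \<and> w \<in> V' \<and> cls (g w) = cls (g' w)"
    "openin (mtop X) O2" "x \<in> O2" "\<forall>w\<in>O2. w \<in> V' \<and> w \<in> V'' \<and> cls (g' w) = cls (g'' w)"
    using assms unfolding sections_agree_def by blast
  then show ?thesis unfolding sections_agree_def
    by (intro exI[of _ "O1 \<inter> O2"]) auto
qed

text \<open>Near \<open>\<gamma>' 1\<close> the paths g' w still lie in U by continuity, so they are
  equivalent to the value of g at their end point, which is w.\<close>

lemma sections_agree_near:
  assumes \<gamma>: "section_at \<gamma> V g" and U: "\<forall>\<eta>\<in>U. \<eta> 1 \<in> V \<and> cls \<eta> = cls (g (\<eta> 1))" "openin pathsT U"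
    and \<gamma>': "section_at \<gamma>' V' g'" "\<gamma>' \<in> U"
  shows "sections_agree (\<gamma>' 1) V g V' g'"
proof -
  note S' = section_atD[OF \<gamma>'(1)]
  have "openin (subtopology (mtop X) V') {w \<in> topspace (subtopology (mtop X) V'). g' w \<in> U}"
    by (rule openin_continuous_map_preimage[OF S'(3) U(2)])
  then have "openin (mtop X) {w \<in> topspace (subtopology (mtop X) V'). g' w \<in> U}"
    using S'(1) openin_trans_full by blast
  moreover have "\<gamma>' 1 \<in> {w \<in> topspace (subtopology (mtop X) V'). g' w \<in> U}"
    using S'(2,5) \<gamma>'(2) openin_subset[OF S'(1)] by auto
  moreover have "w \<in> V \<and> w \<in> V' \<and> cls (g w) = cls (g' w)"
    if w: "w \<in> {w \<in> topspace (subtopology (mtop X) V'). g' w \<in> U}" for w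
  proof -
    have "w \<in> V'" "g' w \<in> U" using w by auto
    then show ?thesis using U(1) S'(4) by fastforce
  qed
  ultimately show ?thesis unfolding sections_agree_def by blast
qed

text \<open>All stages K s of the homotopy end at the same point, so their sections have germs
  there. Neighbouring stages have equal germs, and the unit interval is connected.\<close>

lemma sections_agree_class:
  assumes \<gamma>: "\<gamma> \<in> paths" "section_at \<gamma> V g" and \<gamma>': "\<gamma>' \<in> paths" "section_at \<gamma>' V' g'"
    and eq: "cls \<gamma> = cls \<gamma>'"
  shows "sections_agree (\<gamma> 1) V g V' g'"
proof -
  have "leaf_hom {0, 1} \<gamma> \<gamma>'" using cls_eq_iff \<gamma> \<gamma>' eq by blast
  then obtain h where h: "continuous_map (prod_topology unitT unitT) leafT h" "\<And>u. h (0, u) = \<gamma> u"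
    "\<And>u. h (1, u) = \<gamma>' u" "\<And>\<tau> u. \<tau> \<in> {0..1} \<Longrightarrow> u \<in> {0, 1} \<Longrightarrow> h (\<tau>, u) = \<gamma> u"
    by (rule leaf_homE) (rule that)
  define K where "K s = restrict (\<lambda>u. h (s, u)) {0..1}" for s
  have Kp: "K s \<in> paths" if s: "s \<in> {0..1}" for s
    unfolding K_def
  proof (rule restrict_paths)
    have "continuous_map unitT (prod_topology unitT unitT) (\<lambda>u. (s, u))"
      using s by (auto simp: continuous_map_pairwise o_def intro!: continuous_intros)
    from continuous_map_compose[OF this h(1)] show "pathin leafT (\<lambda>u. h (s, u))" by (simp add: pathin_def o_def)
    show "h (s, 0) \<in> D" using h(4)[OF s, of 0] pathsD(2)[OF \<gamma>(1)] by simp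
  qed
  have K0: "K 0 = \<gamma>" using pathsD(7)[OF \<gamma>(1)] by (simp add: K_def h(2))
  have K1: "K 1 = \<gamma>'" using pathsD(7)[OF \<gamma>'(1)] by (simp add: K_def h(3))
  have Kend: "K s 1 = \<gamma> 1" if "s \<in> {0..1}" for s using h(4)[OF that, of 1] by (simp add: K_def)
  have "continuous_map unitT pathsT (\<lambda>s. restrict (\<lambda>u. h (s, u)) {0..1})"
    by (rule continuous_map_into_pathsT[OF leafT_continuous_imp_continuous[OF h(1)]]) (use Kp in \<open>simp add: K_def\<close>)
  then have Kc: "continuous_map unitT pathsT K" by (simp add: K_def[abs_def])
  have "\<forall>s\<in>{0..1}. \<exists>P. section_at (K s) (fst P) (snd P)"
    using section_exists[OF Kp] by (metis fst_conv snd_conv)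
  then obtain S where S: "\<And>s. s \<in> {0..1} \<Longrightarrow> section_at (K s) (fst (S s)) (snd (S s))" by metis
  define R where "R s s' = sections_agree (\<gamma> 1) (fst (S s)) (snd (S s)) (fst (S s')) (snd (S s'))" for s s'
  have "R 0 1"
  proof (rule connected_equivalence_relation[of "{0..1::real}" 0 1 R])
    show "R x y \<Longrightarrow> R y x" for x y unfolding R_def by (rule sections_agree_sym)
    show "R x y \<Longrightarrow> R y z \<Longrightarrow> R x z" for x y z unfolding R_def by (rule sections_agree_trans)
    fix s :: real assume s: "s \<in> {0..1}"
    obtain U where U: "openin pathsT U" "K s \<in> U" "\<forall>\<eta>\<in>U. \<eta> 1 \<in> fst (S s) \<and> cls \<eta> = cls (snd (S s) (\<eta> 1))"
      using section_atD(8)[OF S[OF s]] by blast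
    have "openin unitT {s' \<in> topspace unitT. K s' \<in> U}"
      by (rule openin_continuous_map_preimage[OF Kc U(1)])
    moreover have "s \<in> {s' \<in> topspace unitT. K s' \<in> U}" using s U(2) by simp
    moreover have "R s s'" if s': "s' \<in> {s' \<in> topspace unitT. K s' \<in> U}" for s'
    proof -
      have s'1: "s' \<in> {0..1}" "K s' \<in> U" using s' by auto
      show ?thesis
        using sections_agree_near[OF S[OF s] U(3,1) S[OF s'1(1)] s'1(2)] Kend[OF s'1(1)] by (simp add: R_def)
    qed
    ultimately show "\<exists>T. openin unitT T \<and> s \<in> T \<and> (\<forall>x\<in>T. R s x)" by blast
  qed auto
  \<comment> \<open>The section chosen at stage 0 passes through \<open>\<gamma>\<close> but need
    not be g; the two are compared directly, and likewise at stage 1.\<close>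
  moreover have "sections_agree (\<gamma> 1) V g (fst (S 0)) (snd (S 0))"
  proof -
    have S0: "section_at \<gamma> (fst (S 0)) (snd (S 0))" using S[of 0] K0 by simp
    obtain U where "openin pathsT U" "\<gamma> \<in> U" "\<forall>\<eta>\<in>U. \<eta> 1 \<in> V \<and> cls \<eta> = cls (g (\<eta> 1))"
      using section_atD(8)[OF \<gamma>(2)] by blast
    then show ?thesis using sections_agree_near[OF \<gamma>(2) _ _ S0] by blast
  qed
  moreover have "sections_agree (\<gamma> 1) (fst (S 1)) (snd (S 1)) V' g'"
  proof -
    have S1: "section_at \<gamma>' (fst (S 1)) (snd (S 1))" using S[of 1] K1 by simp
    obtain U where "openin pathsT U" "\<gamma>' \<in> U" "\<forall>\<eta>\<in>U. \<eta> 1 \<in> fst (S 1) \<and> cls \<eta> = cls (snd (S 1) (\<eta> 1))"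
      using section_atD(8)[OF S1] by blast
    then show ?thesis using sections_agree_near[OF S1 _ _ \<gamma>'(2)] Kend[of 1] K1 by simp
  qed
  ultimately show ?thesis unfolding R_def using sections_agree_trans by blast
qed

text \<open>Openness in the quotient concerns all representatives of a class, including those far
  from g w as paths. Such a representative has the germ of section of every homotopic path, in
  particular that of g w, so paths near it have classes in the image.\<close>

lemma section_image_open:
  assumes \<gamma>: "section_at \<gamma> V g" and A: "openin (mtop X) A" "A \<subseteq> V"
  shows "openin classT ((\<lambda>w. cls (g w)) ` A)"
  unfolding openin_quotient_topology topspace_pathsT
proof
  note S = section_atD[OF \<gamma>]
  show "(\<lambda>w. cls (g w)) ` A \<subseteq> cls ` paths" using S(6) A(2) by blast
  show "openin pathsT {\<eta> \<in> paths. cls \<eta> \<in> (\<lambda>w. cls (g w)) ` A}"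
  proof (subst openin_subopen, rule ballI)
    fix \<eta> assume "\<eta> \<in> {\<eta> \<in> paths. cls \<eta> \<in> (\<lambda>w. cls (g w)) ` A}"
    then obtain w where \<eta>: "\<eta> \<in> paths" and w: "w \<in> A" "cls \<eta> = cls (g w)" by blast
    have wV: "w \<in> V" using w A by blast
    have gw: "g w \<in> paths" using S(6)[OF wV] .
    have \<eta>1: "\<eta> 1 = w"
      using class_ends(2)[OF \<eta>] class_ends(2)[OF gw] w(2) S(4)[OF wV] by simp
    \<comment> \<open>The comparison goes from a section through \<open>\<eta>\<close> to one
      through g w, which is homotopic to \<open>\<eta>\<close>, and from there to g, whose values
      near w are close to g w.\<close>
    obtain V1 g1 where S1: "section_at \<eta> V1 g1" using section_exists[OF \<eta>] by blast
    obtain V2 g2 where S2: "section_at (g w) V2 g2" using section_exists[OF gw] by blast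
    have ag1: "sections_agree w V1 g1 V2 g2"
      using sections_agree_class[OF \<eta> S1 gw S2 w(2)] \<eta>1 by simp
    obtain U2 where U2: "openin pathsT U2" "g w \<in> U2" "\<forall>\<eta>\<in>U2. \<eta> 1 \<in> V2 \<and> cls \<eta> = cls (g2 (\<eta> 1))"
      using section_atD(8)[OF S2] by blast
    have ag2: "sections_agree w V2 g2 V g"
    proof -
      have "openin (subtopology (mtop X) V) {w \<in> topspace (subtopology (mtop X) V). g w \<in> U2}"
        by (rule openin_continuous_map_preimage[OF S(3) U2(1)])
      then have "openin (mtop X) {w \<in> topspace (subtopology (mtop X) V). g w \<in> U2}"
        using S(1) openin_trans_full by blast
      moreover have "w \<in> {w \<in> topspace (subtopology (mtop X) V). g w \<in> U2}"
        using wV U2(2) openin_subset[OF S(1)] by auto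
      moreover have "v \<in> V2 \<and> v \<in> V \<and> cls (g2 v) = cls (g v)"
        if v: "v \<in> {w \<in> topspace (subtopology (mtop X) V). g w \<in> U2}" for v
      proof -
        have "v \<in> V" "g v \<in> U2" using v by auto
        then show ?thesis using U2(3) S(4) by fastforce
      qed
      ultimately show ?thesis unfolding sections_agree_def by blast
    qed
    from sections_agree_trans[OF ag1 ag2] obtain Q where
      Q: "openin (mtop X) Q" "w \<in> Q" "\<And>v. v \<in> Q \<Longrightarrow> v \<in> V1 \<and> v \<in> V \<and> cls (g1 v) = cls (g v)"
      unfolding sections_agree_def by blast
    obtain U1 where U1: "openin pathsT U1" "\<eta> \<in> U1" "\<forall>\<eta>\<in>U1. \<eta> 1 \<in> V1 \<and> cls \<eta> = cls (g1 (\<eta> 1))"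
      using section_atD(8)[OF S1] by blast
    have "openin pathsT (U1 \<inter> {\<kappa> \<in> topspace pathsT. \<kappa> 1 \<in> Q \<inter> A})"
      using U1(1) openin_continuous_map_preimage[OF evaluation_continuous[of 1] openin_Int[OF Q(1) A(1)]] by (simp add: openin_Int)
    moreover have "\<eta> \<in> U1 \<inter> {\<kappa> \<in> topspace pathsT. \<kappa> 1 \<in> Q \<inter> A}"
      using U1(2) \<eta> \<eta>1 Q(2) w(1) topspace_pathsT by simp
    moreover have "U1 \<inter> {\<kappa> \<in> topspace pathsT. \<kappa> 1 \<in> Q \<inter> A} \<subseteq> {\<eta> \<in> paths. cls \<eta> \<in> (\<lambda>w. cls (g w)) ` A}"
    proof
      fix \<kappa> assume \<kappa>: "\<kappa> \<in> U1 \<inter> {\<kappa> \<in> topspace pathsT. \<kappa> 1 \<in> Q \<inter> A}"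
      then have "cls \<kappa> = cls (g1 (\<kappa> 1))" using U1(3) by blast
      also have "\<dots> = cls (g (\<kappa> 1))" using Q(3) \<kappa> by blast
      finally show "\<kappa> \<in> {\<eta> \<in> paths. cls \<eta> \<in> (\<lambda>w. cls (g w)) ` A}" using \<kappa> topspace_pathsT by blast
    qed
    ultimately show "\<exists>T. openin pathsT T \<and> \<eta> \<in> T \<and> T \<subseteq> {\<eta> \<in> paths. cls \<eta> \<in> (\<lambda>w. cls (g w)) ` A}" by blast
  qed
qed

lemma section_class:
  assumes "section_at \<gamma> V g" "w \<in> V"
  shows "class_end (cls (g w)) = w" "class_start (cls (g w)) = g w 0"
  using class_ends[OF section_atD(6)[OF assms]] section_atD(4)[OF assms] by simp_all

text \<open>The image of a section is open and \<open>class_end\<close> inverts the section on it,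
  which gives local injectivity; the map is open because sections are continuous into the
  quotient.\<close>

lemma etale_class_end: "etale classT class_end X"
  unfolding etale_def
proof (intro conjI ballI)
  show "continuous_map classT (mtop X) class_end" by (rule class_end_continuous)
  show "open_map classT (mtop X) class_end"
    unfolding open_map_def
  proof (intro allI impI)
    fix A assume A: "openin classT A"
    show "openin (mtop X) (class_end ` A)"
    proof (subst openin_subopen, rule ballI)
      fix x assume "x \<in> class_end ` A"
      then obtain \<gamma> where \<gamma>: "\<gamma> \<in> paths" "cls \<gamma> \<in> A" "x = class_end (cls \<gamma>)"
        using openin_subset[OF A] topspace_classT by auto
      obtain V g where Sg: "section_at \<gamma> V g" using section_exists[OF \<gamma>(1)] by blast
      note S = section_atD[OF Sg]
      have "continuous_map (subtopology (mtop X) V) classT (cls \<circ> g)"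
        by (rule continuous_map_compose[OF S(3) quotient_imp_continuous_map[OF classT_quotient]])
      from openin_continuous_map_preimage[OF this A]
      have op: "openin (mtop X) {w \<in> topspace (subtopology (mtop X) V). (cls \<circ> g) w \<in> A}"
        using S(1) openin_trans_full by blast
      moreover have "x \<in> {w \<in> topspace (subtopology (mtop X) V). (cls \<circ> g) w \<in> A}"
        using \<gamma> class_ends(2)[OF \<gamma>(1)] S(2,5) openin_subset[OF S(1)] by auto
      moreover have "{w \<in> topspace (subtopology (mtop X) V). (cls \<circ> g) w \<in> A} \<subseteq> class_end ` A"
      proof
        fix w assume "w \<in> {w \<in> topspace (subtopology (mtop X) V). (cls \<circ> g) w \<in> A}"
        then have w: "w \<in> V" "cls (g w) \<in> A" by auto
        then show "w \<in> class_end ` A" using section_class(1)[OF Sg w(1)] by (metis imageI)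
      qed
      ultimately show "\<exists>T. openin (mtop X) T \<and> x \<in> T \<and> T \<subseteq> class_end ` A" by blast
    qed
  qed
  fix c assume "c \<in> topspace classT"
  then obtain \<gamma> where \<gamma>: "\<gamma> \<in> paths" "c = cls \<gamma>" using topspace_classT by auto
  obtain V g where Sg: "section_at \<gamma> V g" using section_exists[OF \<gamma>(1)] by blast
  note S = section_atD[OF Sg]
  have "inj_on class_end ((\<lambda>w. cls (g w)) ` V)"
    by (rule inj_onI) (use section_class(1)[OF Sg] in auto)
  moreover have "c \<in> (\<lambda>w. cls (g w)) ` V" using S(2,5) \<gamma>(2) by (metis imageI)
  ultimately show "\<exists>W. openin classT W \<and> c \<in> W \<and> inj_on class_end W"
    using section_image_open[OF Sg S(1) subset_refl] by blast
qed

lemma class_start_submersive: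
  assumes "c \<in> topspace classT"
  shows "\<exists>N q. openin classT N \<and> c \<in> N \<and> (\<forall>y\<in>N. (t \<circ> class_start) y = q (class_end y)) \<and> submersive_at X q (class_end c)"
proof -
  obtain \<gamma> where \<gamma>: "\<gamma> \<in> paths" "c = cls \<gamma>" using assms topspace_classT by auto
  obtain V g where Sg: "section_at \<gamma> V g" using section_exists[OF \<gamma>(1)] by blast
  note S = section_atD[OF Sg]
  have "c \<in> (\<lambda>w. cls (g w)) ` V" using S(2,5) \<gamma>(2) by (metis imageI)
  moreover have "\<forall>y\<in>(\<lambda>w. cls (g w)) ` V. (t \<circ> class_start) y = t (g (class_end y) 0)"
    using section_class[OF Sg] by auto
  moreover have "submersive_at X (\<lambda>w. t (g w 0)) (class_end c)"
    using S(7)[OF S(2)] class_ends(2)[OF \<gamma>(1)] \<gamma>(2) by simp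
  ultimately show ?thesis using section_image_open[OF Sg S(1) subset_refl]
    by (intro exI[of _ "(\<lambda>w. cls (g w)) ` V"] exI[of _ "\<lambda>w. t (g w 0)"]) blast
qed


text \<open>Paths with the same code, a list of points of a finite net, are uniformly close; there are only
  countably many codes.\<close>

lemma path_codes:
  assumes e: "e > 0"
  obtains code :: "(real \<Rightarrow> 'a) \<Rightarrow> nat \<times> 'a list" where "countable (code ` paths)"
    "\<And>\<gamma> \<eta> u. \<gamma> \<in> paths \<Longrightarrow> \<eta> \<in> paths \<Longrightarrow> code \<gamma> = code \<eta> \<Longrightarrow> u \<in> {0..1} \<Longrightarrow> mdist d (\<gamma> u) (\<eta> u) < e"
proof -
  interpret Md: Metric_space "mspace d" "mdist d" by simp
  have top: "Md.mtopology = mtop X" using d by (simp add: mtopology_of_def)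
  have "Md.mtotally_bounded (mspace d)"
    using cpt top Md.compact_space_eq_mcomplete_mtotally_bounded by metis
  then have "\<exists>K. finite K \<and> K \<subseteq> mspace d \<and> mspace d \<subseteq> (\<Union>x\<in>K. Md.mball x (e / 2))"
    using e unfolding Md.mtotally_bounded_def by simp
  then obtain N where N: "finite N" "N \<subseteq> mspace d" "mspace d \<subseteq> (\<Union>x\<in>N. Md.mball x (e / 2))" by blast
  \<comment> \<open>A number k of subintervals and k + 1 net points, one for each node j / k. The
    interval of radius 1 / k about the node just below u contains u, so one node serves all paths
    with the same code.\<close>
  define is_code where "is_code \<gamma> c \<longleftrightarrow> fst c > 0 \<and> snd c \<in> lists N \<and> length (snd c) = Suc (fst c) \<and>
      (\<forall>j\<le>fst c. \<forall>u\<in>{0..1}. \<bar>u - real j / real (fst c)\<bar> \<le> 1 / real (fst c) \<longrightarrow> \<gamma> u \<in> Md.mball (snd c ! j) (e / 2))"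
    for \<gamma> :: "real \<Rightarrow> 'a" and c :: "nat \<times> 'a list"
  have ex: "\<exists>c. is_code \<gamma> c" if \<gamma>: "\<gamma> \<in> paths" for \<gamma>
  proof -
    have "\<exists>O'. open O' \<and> {u \<in> topspace unitT. \<gamma> u \<in> Md.mball p (e / 2)} = {0..1} \<inter> O'" for p
      using openin_continuous_map_preimage[OF pathsD(4)[OF \<gamma>], of "Md.mball p (e / 2)"] Md.openin_mball top
      unfolding openin_open by metis
    then obtain O' where O': "\<And>p. open (O' p)" "\<And>p. {u \<in> topspace unitT. \<gamma> u \<in> Md.mball p (e / 2)} = {0..1} \<inter> O' p"
      by metis
    have cov: "{0..1} \<subseteq> \<Union>(O' ` N)"
    proof
      fix u :: real assume u: "u \<in> {0..1}"
      then have "\<gamma> u \<in> mspace d" using pathsD(5)[OF \<gamma>] mspace_d by simp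
      then obtain p where "p \<in> N" "\<gamma> u \<in> Md.mball p (e / 2)" using N(3) by blast
      then have "u \<in> {u \<in> topspace unitT. \<gamma> u \<in> Md.mball p (e / 2)}" using u by simp
      then show "u \<in> \<Union>(O' ` N)" using O'(2) \<open>p \<in> N\<close> by blast
    qed
    obtain \<delta> where \<delta>: "\<delta> > 0" "\<And>x. x \<in> {0..1} \<Longrightarrow> \<exists>G\<in>O' ` N. ball x \<delta> \<subseteq> G"
      using Heine_Borel_lemma[OF compact_Icc cov] O'(1) by (metis (no_types, lifting) imageE)
    obtain k where k: "0 < k" "1 / real k < \<delta>"
      using reals_Archimedean[OF \<delta>(1)] by (metis inverse_eq_divide zero_less_Suc)
    have "\<exists>p\<in>N. \<forall>u\<in>{0..1}. \<bar>u - real j / real k\<bar> \<le> 1 / real k \<longrightarrow> \<gamma> u \<in> Md.mball p (e / 2)" if j: "j \<le> k" for j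
    proof -
      have "real j / real k \<in> {0..1}" using j k by (simp add: divide_le_eq)
      then obtain p where p: "p \<in> N" "ball (real j / real k) \<delta> \<subseteq> O' p" using \<delta>(2) by blast
      have "\<gamma> u \<in> Md.mball p (e / 2)" if u: "u \<in> {0..1}" "\<bar>u - real j / real k\<bar> \<le> 1 / real k" for u
      proof -
        have "u \<in> ball (real j / real k) \<delta>" using u k by (simp add: dist_real_def abs_minus_commute)
        then have "u \<in> {0..1} \<inter> O' p" using p u by blast
        then show ?thesis using O'(2)[of p] by blast
      qed
      with p(1) show ?thesis by blast
    qed
    then obtain l where l: "\<And>j. j \<le> k \<Longrightarrow> l j \<in> N \<and> (\<forall>u\<in>{0..1}. \<bar>u - real j / real k\<bar> \<le> 1 / real k \<longrightarrow> \<gamma> u \<in> Md.mball (l j) (e / 2))"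
      by metis
    have "is_code \<gamma> (k, map l [0..<Suc k])"
      unfolding is_code_def
    proof (intro conjI)
      show "snd (k, map l [0..<Suc k]) \<in> lists N" using l by auto
      show "\<forall>j\<le>fst (k, map l [0..<Suc k]). \<forall>u\<in>{0..1}. \<bar>u - real j / real (fst (k, map l [0..<Suc k]))\<bar>
          \<le> 1 / real (fst (k, map l [0..<Suc k])) \<longrightarrow> \<gamma> u \<in> Md.mball (snd (k, map l [0..<Suc k]) ! j) (e / 2)"
      proof (intro allI impI)
        fix j assume j: "j \<le> fst (k, map l [0..<Suc k])"
        have "snd (k, map l [0..<Suc k]) ! j = l j" using j nth_map_upt[of j "Suc k" 0 l] by simp
        then show "\<forall>u\<in>{0..1}. \<bar>u - real j / real (fst (k, map l [0..<Suc k]))\<bar>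
          \<le> 1 / real (fst (k, map l [0..<Suc k])) \<longrightarrow> \<gamma> u \<in> Md.mball (snd (k, map l [0..<Suc k]) ! j) (e / 2)"
          using l[of j] j by simp
      qed
    qed (use k in auto)
    then show ?thesis ..
  qed
  define code where "code \<gamma> = (SOME c. is_code \<gamma> c)" for \<gamma>
  have code: "is_code \<gamma> (code \<gamma>)" if "\<gamma> \<in> paths" for \<gamma>
    unfolding code_def using someI_ex[OF ex[OF that]] .
  show ?thesis
  proof (rule that[of code])
    have "code ` paths \<subseteq> UNIV \<times> lists N"
    proof
      fix c assume "c \<in> code ` paths"
      then obtain \<gamma> where \<gamma>: "\<gamma> \<in> paths" "c = code \<gamma>" by blast
      have "snd (code \<gamma>) \<in> lists N" using code[OF \<gamma>(1)] unfolding is_code_def by (elim conjE)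
      then show "c \<in> UNIV \<times> lists N" by (simp add: \<gamma>(2) mem_Times_iff)
    qed
    moreover have "countable ((UNIV :: nat set) \<times> lists N)"
      by (intro countable_SIGMA countable_lists countableI_type countable_finite[OF N(1)])
    ultimately show "countable (code ` paths)" by (rule countable_subset)
    fix \<gamma> \<eta> and u :: real assume p: "\<gamma> \<in> paths" "\<eta> \<in> paths" "code \<gamma> = code \<eta>" and u: "u \<in> {0..1}"
    define k where "k = fst (code \<gamma>)"
    have k: "k > 0" using code[OF p(1)] by (simp add: is_code_def k_def)
    define j where "j = nat \<lfloor>u * real k\<rfloor>"
    have uk: "0 \<le> u * real k" using u by simp
    have j1: "real j \<le> u * real k" "u * real k \<le> real j + 1"
      using uk by (auto simp: j_def le_nat_floor of_nat_nat)
    have "u * real k \<le> real k" using u mult_right_mono[of u 1 "real k"] by simp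
    then have jk: "j \<le> k" using j1(1) by linarith
    have "\<bar>u - real j / real k\<bar> \<le> 1 / real k"
    proof -
      have "u - real j / real k = (u * real k - real j) / real k" using k by (simp add: field_simps)
      moreover have "\<bar>u * real k - real j\<bar> \<le> 1" using j1 by linarith
      ultimately show ?thesis using k by (simp add: abs_divide divide_right_mono)
    qed
    then have "\<gamma> u \<in> Md.mball (snd (code \<gamma>) ! j) (e / 2)" "\<eta> u \<in> Md.mball (snd (code \<gamma>) ! j) (e / 2)"
      using code[OF p(1)] code[OF p(2)] p(3) u jk unfolding is_code_def k_def[symmetric] by auto
    then have m: "mdist d (snd (code \<gamma>) ! j) (\<gamma> u) < e / 2" "mdist d (snd (code \<gamma>) ! j) (\<eta> u) < e / 2"
      "snd (code \<gamma>) ! j \<in> mspace d" "\<gamma> u \<in> mspace d" "\<eta> u \<in> mspace d" by (auto simp: Md.in_mball)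
    have "mdist d (\<gamma> u) (\<eta> u) \<le> mdist d (\<gamma> u) (snd (code \<gamma>) ! j) + mdist d (snd (code \<gamma>) ! j) (\<eta> u)"
      by (rule Md.triangle) (use m in auto)
    then show "mdist d (\<gamma> u) (\<eta> u) < e" using m(1,2) by (simp add: Md.commute)
  qed
qed

text \<open>Sheets of the end point map are homeomorphic to open sets of X and so second countable;
  countably many suffice. At a fine enough scale, all paths with the code of \<open>\<gamma>\<close>
  have their classes in one sheet, and each scale has countably many codes.\<close>

lemma second_countable_classT: "second_countable classT"
proof -
  have "\<forall>n. \<exists>code :: (real \<Rightarrow> 'a) \<Rightarrow> nat \<times> 'a list. countable (code ` paths) \<and>
      (\<forall>\<gamma>\<in>paths. \<forall>\<eta>\<in>paths. code \<gamma> = code \<eta> \<longrightarrow> (\<forall>u\<in>{0..1}. mdist d (\<gamma> u) (\<eta> u) < inverse (real (Suc n))))"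
  proof
    fix n
    show "\<exists>code :: (real \<Rightarrow> 'a) \<Rightarrow> nat \<times> 'a list. countable (code ` paths) \<and>
      (\<forall>\<gamma>\<in>paths. \<forall>\<eta>\<in>paths. code \<gamma> = code \<eta> \<longrightarrow> (\<forall>u\<in>{0..1}. mdist d (\<gamma> u) (\<eta> u) < inverse (real (Suc n))))"
      by (rule path_codes[of "inverse (real (Suc n))"]) (simp, blast)
  qed
  then obtain code :: "nat \<Rightarrow> (real \<Rightarrow> 'a) \<Rightarrow> nat \<times> 'a list" where code: "\<And>n. countable (code n ` paths)"
    "\<And>n \<gamma> \<eta> u. \<gamma> \<in> paths \<Longrightarrow> \<eta> \<in> paths \<Longrightarrow> code n \<gamma> = code n \<eta> \<Longrightarrow> u \<in> {0..1} \<Longrightarrow> mdist d (\<gamma> u) (\<eta> u) < inverse (real (Suc n))"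
    by metis
  define sheet where "sheet W \<longleftrightarrow> openin classT W \<and> second_countable (subtopology classT W)" for W
  have sheets: "\<exists>W. sheet W \<and> cls \<gamma> \<in> W" if \<gamma>: "\<gamma> \<in> paths" for \<gamma>
  proof -
    have "cls \<gamma> \<in> topspace classT" using \<gamma> topspace_classT by blast
    then obtain W where W: "openin classT W" "cls \<gamma> \<in> W" "inj_on class_end W"
      using etale_class_end by (auto simp: etale_def)
    have "second_countable (mtop X)" using X by (simp add: complex_manifold_def)
    then have "second_countable (subtopology classT W)"
      using homeomorphic_space_second_countability[OF homeomorphic_map_imp_homeomorphic_space[OF etale_homeomorphic(2)[OF etale_class_end W(1,3)]]]
        second_countable_subtopology by blast
    then show ?thesis using W by (auto simp: sheet_def)
  qed
  define good where "good n z W \<longleftrightarrow> sheet W \<and> (\<forall>\<eta>\<in>paths. code n \<eta> = z \<longrightarrow> cls \<eta> \<in> W)" for n z W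
  have ex: "\<exists>n W. good n (code n \<gamma>) W" if \<gamma>: "\<gamma> \<in> paths" for \<gamma>
  proof -
    obtain W where W: "sheet W" "cls \<gamma> \<in> W" using sheets[OF \<gamma>] by blast
    have "openin pathsT {\<eta> \<in> topspace pathsT. cls \<eta> \<in> W}"
      using openin_continuous_map_preimage[OF quotient_imp_continuous_map[OF classT_quotient]] W(1) by (simp add: sheet_def)
    then obtain \<epsilon> where \<epsilon>: "\<epsilon> > 0" "\<And>\<eta>. \<eta> \<in> paths \<Longrightarrow> \<forall>u\<in>{0..1}. mdist d (\<eta> u) (\<gamma> u) < \<epsilon> \<Longrightarrow> cls \<eta> \<in> W"
      using W(2) \<gamma> topspace_pathsT unfolding openin_pathsT by blast
    obtain n where n: "inverse (real (Suc n)) < \<epsilon>" using reals_Archimedean[OF \<epsilon>(1)] by blast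
    have "cls \<eta> \<in> W" if "\<eta> \<in> paths" "code n \<eta> = code n \<gamma>" for \<eta>
      using \<epsilon>(2)[OF that(1)] code(2)[OF that(1) \<gamma> that(2)] n by (meson less_trans)
    then show ?thesis using W(1) by (auto simp: good_def)
  qed
  \<comment> \<open>The codes, with their scale, whose paths all have their classes in a common
    sheet; one sheet is chosen for each.\<close>
  define J where "J = {(n, z). z \<in> code n ` paths \<and> (\<exists>W. good n z W)}"
  define W where "W = (\<lambda>(n, z). SOME W. good n z W)"
  have W: "good n z (W (n, z))" if "(n, z) \<in> J" for n z
    using that someI_ex[of "good n z"] by (auto simp: W_def J_def)
  show ?thesis
  proof (rule second_countable_countable_cover[of "W ` J"])
    have "J \<subseteq> (SIGMA n:UNIV. code n ` paths)" by (auto simp: J_def)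
    then have "countable J" using code(1) countable_subset countable_SIGMA by (metis countableI_type)
    then show "countable (W ` J)" by simp
    show "openin classT V" "second_countable (subtopology classT V)" if "V \<in> W ` J" for V
      using that W by (auto simp: good_def sheet_def)
    show "topspace classT \<subseteq> \<Union> (W ` J)"
    proof
      fix c assume "c \<in> topspace classT"
      then obtain \<gamma> where \<gamma>: "\<gamma> \<in> paths" "c = cls \<gamma>" using topspace_classT by auto
      obtain n W' where "good n (code n \<gamma>) W'" using ex[OF \<gamma>(1)] by blast
      then have "(n, code n \<gamma>) \<in> J" using \<gamma>(1) by (auto simp: J_def)
      moreover from W[OF this] have "c \<in> W (n, code n \<gamma>)" using \<gamma> by (simp add: good_def)
      ultimately show "c \<in> \<Union> (W ` J)" by blast
    qed
  qed
qed

section \<open>Connectedness of the domain and of its fibres\<close>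

definition const_path :: "'a \<Rightarrow> real \<Rightarrow> 'a" where
  "const_path z = restrict (\<lambda>u. z) {0..1}"

lemma const_path_in:
  assumes "z \<in> D" shows "const_path z \<in> paths"
  unfolding const_path_def
  by (rule restrict_paths) (use assms D_sub in \<open>auto simp: pathin_def\<close>)

text \<open>The truncations of \<open>\<gamma>\<close> at time s form an arc in the fibre from the
  constant path to \<open>\<gamma>\<close>.\<close>

lemma truncation_connects:
  assumes \<gamma>: "\<gamma> \<in> paths"
  shows "\<exists>C. connectedin classT C \<and> cls \<gamma> \<in> C \<and> cls (const_path (\<gamma> 0)) \<in> C \<and> (\<forall>c\<in>C. class_start c = \<gamma> 0)"
proof -
  define g where "g s = restrict (\<lambda>u. \<gamma> (min u s)) {0..1}" for s
  have clip: "continuous_map (prod_topology unitT unitT) unitT (\<lambda>p. min (snd p) (fst p))"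
    by (auto simp: continuous_map_in_subtopology intro!: continuous_intros)
  have gp: "g s \<in> paths" if s: "s \<in> {0..1}" for s
    unfolding g_def
  proof (rule restrict_paths)
    have "continuous_map unitT unitT (\<lambda>u. min u s)"
      using s by (auto simp: continuous_map_in_subtopology intro!: continuous_intros)
    from continuous_map_compose[OF this pathsD(3)[OF \<gamma>]] show "pathin leafT (\<lambda>u. \<gamma> (min u s))" by (simp add: pathin_def o_def)
    show "\<gamma> (min 0 s) \<in> D" using s pathsD(2)[OF \<gamma>] by (simp add: min_def)
  qed
  have gc: "continuous_map unitT pathsT g"
  proof -
    have "continuous_map (prod_topology unitT unitT) (mtop X) (\<lambda>p. \<gamma> (min (snd p) (fst p)))"
      using continuous_map_compose[OF clip pathsD(4)[OF \<gamma>]] by (simp add: o_def)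
    from continuous_map_into_pathsT[OF this] show ?thesis using gp by (simp add: g_def[abs_def])
  qed
  have "connectedin unitT {0..1}" by (simp add: connectedin_subtopology connectedin_iff_connected)
  from connectedin_continuous_map_image[OF continuous_map_compose[OF gc quotient_imp_continuous_map[OF classT_quotient]] this]
  have "connectedin classT ((cls \<circ> g) ` {0..1})" .
  moreover have "g 1 = \<gamma>"
  proof -
    have "g 1 = restrict \<gamma> {0..1}" unfolding g_def by (rule restrict_ext) (simp add: min_def)
    then show ?thesis using pathsD(7)[OF \<gamma>] by simp
  qed
  then have "cls \<gamma> \<in> (cls \<circ> g) ` {0..1}" by (intro image_eqI[of _ _ 1]) auto
  moreover have "g 0 = const_path (\<gamma> 0)" unfolding g_def const_path_def by (rule restrict_ext) (simp add: min_absorb2)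
  then have "cls (const_path (\<gamma> 0)) \<in> (cls \<circ> g) ` {0..1}" by (intro image_eqI[of _ _ 0]) auto
  moreover have "class_start c = \<gamma> 0" if "c \<in> (cls \<circ> g) ` {0..1}" for c
    using that class_ends(1)[OF gp] by (auto simp: g_def min_def)
  ultimately show ?thesis by blast
qed

lemma fiber_connected:
  assumes z: "z \<in> D"
  shows "connectedin classT {c \<in> topspace classT. class_start c = z}"
proof -
  define \<C> where "\<C> = {C. connectedin classT C \<and> cls (const_path z) \<in> C \<and> (\<forall>c\<in>C. class_start c = z)}"
  have cz: "class_start (cls (const_path z)) = z" "cls (const_path z) \<in> topspace classT"
    using class_ends(1)[OF const_path_in[OF z]] const_path_in[OF z] topspace_classT by (auto simp: const_path_def)
  have "{c \<in> topspace classT. class_start c = z} = \<Union>\<C>"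
  proof
    show "{c \<in> topspace classT. class_start c = z} \<subseteq> \<Union>\<C>"
    proof clarify
      fix c assume "c \<in> topspace classT" "z = class_start c"
      then obtain \<gamma> where \<gamma>: "\<gamma> \<in> paths" "c = cls \<gamma>" "\<gamma> 0 = z" using topspace_classT class_ends(1) by auto
      then show "c \<in> \<Union>\<C>" using truncation_connects[OF \<gamma>(1)] by (auto simp: \<C>_def)
    qed
    show "\<Union>\<C> \<subseteq> {c \<in> topspace classT. class_start c = z}"
      unfolding \<C>_def using connectedin_subset_topspace by blast
  qed
  moreover have "connectedin classT (\<Union>\<C>)"
  proof (rule connectedin_Union)
    have "{cls (const_path z)} \<in> \<C>" using cz by (simp add: \<C>_def connectedin_sing)
    then show "\<Inter>\<C> \<noteq> {}" by (auto simp: \<C>_def)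
  qed (simp add: \<C>_def)
  ultimately show ?thesis by simp
qed

text \<open>The constant paths are a continuous image of D, hence connected, and every class is
  joined to one of them inside its fibre.\<close>

lemma connected_classT: "connected_space classT"
proof -
  have "continuous_map (subtopology (mtop X) D) pathsT const_path"
  proof -
    have "continuous_map (prod_topology (subtopology (mtop X) D) unitT) (mtop X) fst"
      using continuous_map_fst continuous_map_into_fulltopology by blast
    from continuous_map_into_pathsT[OF this] show ?thesis
      using const_path_in D_sub by (auto simp: const_path_def[abs_def])
  qed
  from continuous_map_compose[OF this quotient_imp_continuous_map[OF classT_quotient]]
  have c: "continuous_map (subtopology (mtop X) D) classT (cls \<circ> const_path)" .
  have "connectedin (top_of_set (ball (0::complex) r)) (ball 0 r)"
    by (simp add: connectedin_subtopology connectedin_iff_connected convex_connected)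
  from connectedin_continuous_map_image[OF homeomorphic_imp_continuous_map[OF disc_coordinateD(5)] this]
  have "connectedin (subtopology (mtop X) D) (inv_into D t ` ball 0 r)" .
  moreover have "inv_into D t ` ball 0 r = D"
    using homeomorphic_imp_surjective_map[OF disc_coordinateD(5)] D_sub by auto
  ultimately have S0: "connectedin classT ((cls \<circ> const_path) ` D)"
    using connectedin_continuous_map_image[OF c] by simp
  define \<C> where "\<C> = {C. connectedin classT C \<and> (cls \<circ> const_path) ` D \<subseteq> C}"
  have "topspace classT \<subseteq> \<Union>\<C>"
  proof
    fix c assume "c \<in> topspace classT"
    then obtain \<gamma> where \<gamma>: "\<gamma> \<in> paths" "c = cls \<gamma>" using topspace_classT by auto
    obtain C where C: "connectedin classT C" "c \<in> C" "cls (const_path (\<gamma> 0)) \<in> C"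
      using truncation_connects[OF \<gamma>(1)] \<gamma>(2) by blast
    have "cls (const_path (\<gamma> 0)) \<in> (cls \<circ> const_path) ` D" using pathsD(2)[OF \<gamma>(1)] by simp
    then have "connectedin classT (C \<union> (cls \<circ> const_path) ` D)"
      using connectedin_Un[OF C(1) S0] C(3) by blast
    then show "c \<in> \<Union>\<C>" using C(2) by (auto simp: \<C>_def)
  qed
  moreover have "connectedin classT (\<Union>\<C>)"
  proof (rule connectedin_Union)
    show "\<Inter>\<C> \<noteq> {}" using mD by (auto simp: \<C>_def)
  qed (simp add: \<C>_def)
  ultimately have "connectedin classT (topspace classT)"
    using connectedin_subset_topspace by (metis subset_antisym)
  then show ?thesis by (simp add: connectedin_topspace)
qed

end

subsection \<open>Lifting the holonomy\<close>

text \<open>The restriction is there because elements of the path space are extensional functions on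
  the unit interval.\<close>

definition path_cat :: "(real \<Rightarrow> 'a) \<Rightarrow> (real \<Rightarrow> 'a) \<Rightarrow> real \<Rightarrow> 'a" where
  "path_cat \<delta> \<kappa> = restrict (\<lambda>u. if u \<le> 1/2 then \<delta> (2 * u) else \<kappa> (2 * u - 1)) {0..1}"

lemma path_cat_family_continuous:
  assumes a: "continuous_map (prod_topology Z unitT) Y (\<lambda>p. a (fst p) (snd p))"
    and b: "continuous_map (prod_topology Z unitT) Y (\<lambda>p. b (fst p) (snd p))"
    and eq: "\<And>z. z \<in> topspace Z \<Longrightarrow> a z 1 = b z 0"
  shows "continuous_map (prod_topology Z unitT) Y
    (\<lambda>p. if snd p \<le> 1/2 then a (fst p) (2 * snd p) else b (fst p) (2 * snd p - 1))"
proof -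
  let ?Z = "prod_topology Z unitT"
  have s: "continuous_map ?Z unitT snd" by (rule continuous_map_snd)
  \<comment> \<open>Clipping the arguments makes both branches total on the product; on its own half
    each clipped branch is the intended one.\<close>
  have cl: "continuous_map unitT unitT (\<lambda>u. min 1 (2 * u))" "continuous_map unitT unitT (\<lambda>u. max 0 (2 * u - 1))"
    by (auto simp: continuous_map_in_subtopology intro!: continuous_intros)
  have "continuous_map ?Z ?Z (\<lambda>p. (fst p, min 1 (2 * snd p)))" "continuous_map ?Z ?Z (\<lambda>p. (fst p, max 0 (2 * snd p - 1)))"
    using continuous_map_compose[OF s cl(1)] continuous_map_compose[OF s cl(2)] continuous_map_fst[of Z unitT]
    by (simp_all add: continuous_map_paired o_def)
  from continuous_map_compose[OF this(1) a] continuous_map_compose[OF this(2) b]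
  have c: "continuous_map ?Z Y (\<lambda>p. a (fst p) (min 1 (2 * snd p)))" "continuous_map ?Z Y (\<lambda>p. b (fst p) (max 0 (2 * snd p - 1)))"
    by (simp_all add: o_def)
  have "continuous_map ?Z Y (\<lambda>p. if snd p \<le> 1/2 then a (fst p) (min 1 (2 * snd p)) else b (fst p) (max 0 (2 * snd p - 1)))"
  proof (rule continuous_map_cases_le)
    show "continuous_map ?Z euclideanreal snd" using s continuous_map_into_fulltopology by blast
    show "a (fst p) (min 1 (2 * snd p)) = b (fst p) (max 0 (2 * snd p - 1))" if "p \<in> topspace ?Z" "snd p = 1/2" for p
      using eq[of "fst p"] that by (auto simp: mem_Times_iff)
  qed (use c in \<open>auto intro: continuous_map_from_subtopology\<close>)
  then show ?thesis by (rule continuous_map_eq) auto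
qed

context foliated_surface
begin

lemma pathin_path_cat:
  assumes "pathin leafT \<delta>" "pathin leafT \<kappa>" "\<delta> 1 = \<kappa> 0"
  shows "pathin leafT (path_cat \<delta> \<kappa>)"
proof -
  let ?Z = "prod_topology unitT unitT"
  have "continuous_map ?Z leafT (\<lambda>p. \<delta> (snd p))" "continuous_map ?Z leafT (\<lambda>p. \<kappa> (snd p))"
    using continuous_map_compose[OF continuous_map_snd[of unitT unitT] assms(1)[unfolded pathin_def]]
      continuous_map_compose[OF continuous_map_snd[of unitT unitT] assms(2)[unfolded pathin_def]]
    by (simp_all add: o_def)
  then have c: "continuous_map ?Z leafT (\<lambda>p. if snd p \<le> 1/2 then \<delta> (2 * snd p) else \<kappa> (2 * snd p - 1))"
    by (rule path_cat_family_continuous[of unitT leafT "\<lambda>_. \<delta>" "\<lambda>_. \<kappa>"]) (rule assms(3))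
  have "continuous_map unitT ?Z (\<lambda>u. (0, u))"
    by (auto simp: continuous_map_pairwise o_def intro!: continuous_intros)
  from continuous_map_compose[OF this c]
  have "continuous_map unitT leafT (\<lambda>u. if u \<le> 1/2 then \<delta> (2 * u) else \<kappa> (2 * u - 1))"
    by (simp add: o_def cong: if_cong)
  then show ?thesis unfolding pathin_def by (rule continuous_map_eq) (simp add: path_cat_def)
qed

lemma leaf_hom_path_cat:
  assumes \<delta>: "pathin leafT \<delta>" "\<delta> 1 = \<kappa> 0" and hom: "leaf_hom {0, 1} \<kappa> \<kappa>'"
  shows "leaf_hom {0, 1} (path_cat \<delta> \<kappa>) (path_cat \<delta> \<kappa>')"
proof -
  obtain h where h: "continuous_map (prod_topology unitT unitT) leafT h" "\<And>u. h (0, u) = \<kappa> u"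
    "\<And>u. h (1, u) = \<kappa>' u" "\<And>\<tau> u. \<tau> \<in> {0..1} \<Longrightarrow> u \<in> {0, 1} \<Longrightarrow> h (\<tau>, u) = \<kappa> u"
    by (rule leaf_homE[OF hom]) (rule that)
  let ?Z = "prod_topology unitT unitT"
  have d: "continuous_map ?Z leafT (\<lambda>p. \<delta> (snd p))"
    using continuous_map_compose[OF continuous_map_snd[of unitT unitT] \<delta>(1)[unfolded pathin_def]] by (simp add: o_def)
  have "continuous_map ?Z leafT (\<lambda>p. if snd p \<le> 1/2 then \<delta> (2 * snd p) else h (fst p, 2 * snd p - 1))"
    by (rule path_cat_family_continuous[of unitT leafT "\<lambda>_. \<delta>" "\<lambda>\<tau> u. h (\<tau>, u)"])
      (use d h(1) h(4)[of _ 0] \<delta>(2) in auto)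
  then show ?thesis
    by (rule leaf_homI[rotated]) (use h in \<open>auto simp: path_cat_def\<close>)
qed

text \<open>Two traversals of the same path k are homotopic by interpolating the parameters in a
  convex domain. The domain is left general so that a path run back and forth can be
  contracted.\<close>

lemma leaf_hom_reparametrization:
  assumes k: "continuous_map (top_of_set S) leafT k" and S: "convex S"
    and q: "continuous_on {0..1} q1" "continuous_on {0..1} q2" "q1 ` {0..1} \<subseteq> S" "q2 ` {0..1} \<subseteq> S"
    and eq: "q1 0 = q2 0" "q1 1 = q2 (1::real)"
  shows "leaf_hom {0, 1} (\<lambda>u. k (q1 u)) (\<lambda>u. k (q2 u :: real))"
proof -
  have "continuous_map (prod_topology unitT unitT) (top_of_set S) (\<lambda>p. (1 - fst p) * q1 (snd p) + fst p * q2 (snd p))"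
  proof -
    have "continuous_on ({0..1} \<times> {0..1}) (\<lambda>p::real \<times> real. (1 - fst p) * q1 (snd p) + fst p * q2 (snd p))"
      by (intro continuous_intros continuous_on_compose2[OF q(1)] continuous_on_compose2[OF q(2)]) auto
    moreover have "(1 - x) * q1 u + x * q2 u \<in> S" if "x \<in> {0..1}" "u \<in> {0..1}" for x u
    proof -
      have "q1 u \<in> S" "q2 u \<in> S" using q(3,4) that(2) by blast+
      from convexD_alt[OF S this, of x] show ?thesis using that(1) by simp
    qed
    ultimately show ?thesis by (auto simp: continuous_map_in_subtopology)
  qed
  from continuous_map_compose[OF this k]
  have "continuous_map (prod_topology unitT unitT) leafT (\<lambda>p. k ((1 - fst p) * q1 (snd p) + fst p * q2 (snd p)))"
    by (simp add: o_def)
  then show ?thesis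
    by (rule leaf_homI[rotated]) (use eq in \<open>auto simp: algebra_simps\<close>)
qed

end

section \<open>The self-map of the domain induced by the holonomy\<close>

locale holonomy_disc = foliated_disc +
  fixes \<alpha> :: complex and h :: "'a \<Rightarrow> 'a" and \<gamma>\<^sub>0 :: "real \<Rightarrow> 'a"
  assumes hol: "holonomy_along X F D m \<gamma>\<^sub>0 D h" and lin: "\<And>z. z \<in> D \<Longrightarrow> t (h z) = \<alpha> * t z" and \<alpha>0: "\<alpha> \<noteq> 0"
begin

lemma hD: "z \<in> D \<Longrightarrow> h z \<in> D"
  using hol by (auto simp: holonomy_along_def)

lemma h_inj: "inj_on h D"
proof (rule inj_onI)
  fix z z' assume z: "z \<in> D" "z' \<in> D" "h z = h z'"
  then have "\<alpha> * t z = \<alpha> * t z'" using lin by metis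
  then have "t z = t z'" using \<alpha>0 by simp
  then show "z = z'" using disc_coordinateD(2) z by (auto simp: bij_betw_def inj_on_def)
qed

definition \<Gamma> :: "real \<times> 'a \<Rightarrow> 'a" where
  "\<Gamma> = (SOME \<Gamma>. continuous_map (prod_topology unitT (subtopology (mtop X) D)) (mtop X) \<Gamma> \<and>
     (\<forall>z\<in>D. leaf_path X F (\<lambda>s. \<Gamma> (s, z)) \<and> \<Gamma> (0, z) = z \<and> \<Gamma> (1, z) = h z))"

lemma \<Gamma>:
  "continuous_map (prod_topology unitT (subtopology (mtop X) D)) (mtop X) \<Gamma>"
  "\<And>z. z \<in> D \<Longrightarrow> pathin leafT (\<lambda>s. \<Gamma> (s, z))" "\<And>z. z \<in> D \<Longrightarrow> \<Gamma> (0, z) = z" "\<And>z. z \<in> D \<Longrightarrow> \<Gamma> (1, z) = h z"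
proof -
  have "\<exists>\<Gamma>. continuous_map (prod_topology unitT (subtopology (mtop X) D)) (mtop X) \<Gamma> \<and>
     (\<forall>z\<in>D. leaf_path X F (\<lambda>s. \<Gamma> (s, z)) \<and> \<Gamma> (0, z) = z \<and> \<Gamma> (1, z) = h z)"
    using hol unfolding holonomy_along_def by blast
  from someI_ex[OF this, folded \<Gamma>_def]
  show "continuous_map (prod_topology unitT (subtopology (mtop X) D)) (mtop X) \<Gamma>"
    "\<And>z. z \<in> D \<Longrightarrow> pathin leafT (\<lambda>s. \<Gamma> (s, z))" "\<And>z. z \<in> D \<Longrightarrow> \<Gamma> (0, z) = z" "\<And>z. z \<in> D \<Longrightarrow> \<Gamma> (1, z) = h z"
    by (auto simp: leaf_path_iff)
qed

text \<open>Joint continuity, and not only that at a fixed time, is needed to concatenate a whole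
  family of paths continuously.\<close>

lemma joint_evaluation_continuous:
  "continuous_map (prod_topology pathsT unitT) (mtop X) (\<lambda>p. fst p (snd p))"
  unfolding continuous_map
proof (intro conjI allI impI)
  let ?Z = "prod_topology pathsT unitT"
  show "(\<lambda>p. fst p (snd p)) ` topspace ?Z \<subseteq> topspace (mtop X)" using pathsD(5) topspace_pathsT by auto
  fix V assume V: "openin (mtop X) V"
  show "openin ?Z {p \<in> topspace ?Z. fst p (snd p) \<in> V}"
  proof (subst openin_subopen, rule ballI)
    fix p assume "p \<in> {p \<in> topspace ?Z. fst p (snd p) \<in> V}"
    then obtain \<gamma> u where p: "p = (\<gamma>, u)" "\<gamma> \<in> paths" "u \<in> {0..1}" "\<gamma> u \<in> V" using topspace_pathsT by (cases p) auto
    have "openin unitT {v \<in> topspace unitT. \<gamma> v \<in> V}"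
      by (rule openin_continuous_map_preimage[OF pathsD(4)[OF p(2)] V])
    moreover have "u \<in> {v \<in> topspace unitT. \<gamma> v \<in> V}" using p by simp
    ultimately obtain e where e: "e > 0" "ball u e \<inter> {0..1} \<subseteq> {v \<in> topspace unitT. \<gamma> v \<in> V}"
      unfolding openin_contains_ball by blast
    \<comment> \<open>A closed interval around u inside the ball of radius e, so that compactness
      gives a tube around that piece of path.\<close>
    define l where "l = max 0 (u - e/2)" define r' where "r' = min 1 (u + e/2)"
    have lr: "{l..r'} \<subseteq> {0..1}" by (auto simp: l_def r'_def)
    have im: "\<gamma> ` {l..r'} \<subseteq> V"
    proof clarify
      fix v assume v: "v \<in> {l..r'}"
      then have "v \<in> ball u e \<inter> {0..1}" using e(1) by (auto simp: l_def r'_def dist_real_def)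
      then show "\<gamma> v \<in> V" using e(2) by blast
    qed
    obtain \<epsilon> where \<epsilon>: "\<epsilon> > 0" "\<And>u x. u \<in> {l..r'} \<Longrightarrow> x \<in> topspace (mtop X) \<Longrightarrow> mdist d x (\<gamma> u) < \<epsilon> \<Longrightarrow> x \<in> V"
      by (rule compact_path_tube[OF pathsD(4)[OF p(2)] lr V im]) (rule that)
    obtain U where U: "openin pathsT U" "\<gamma> \<in> U" "\<And>\<eta> u. \<eta> \<in> U \<Longrightarrow> u \<in> {0..1} \<Longrightarrow> mdist d (\<eta> u) (\<gamma> u) < \<epsilon>"
      by (rule pathsT_ball[OF p(2) \<epsilon>(1)]) (rule that)
    have "openin unitT ({0..1} \<inter> ball u (e/2))" by (simp add: openin_open_Int)
    then have "openin ?Z (U \<times> ({0..1} \<inter> ball u (e/2)))" using U(1) by (simp add: openin_prod_Times_iff)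
    moreover have "p \<in> U \<times> ({0..1} \<inter> ball u (e/2))" using p U(2) e(1) by simp
    moreover have "U \<times> ({0..1} \<inter> ball u (e/2)) \<subseteq> {p \<in> topspace ?Z. fst p (snd p) \<in> V}"
    proof clarify
      fix \<eta> v assume \<eta>: "\<eta> \<in> U" and v: "v \<in> {0..1}" "v \<in> ball u (e/2)"
      have \<eta>p: "\<eta> \<in> paths" using openin_subset[OF U(1)] \<eta> topspace_pathsT by blast
      have "v \<in> {l..r'}" using v by (auto simp: l_def r'_def dist_real_def abs_if split: if_splits)
      then have "\<eta> v \<in> V" using \<epsilon>(2) pathsD(5)[OF \<eta>p v(1)] U(3)[OF \<eta> v(1)] by blast
      then show "(\<eta>, v) \<in> topspace ?Z \<and> fst (\<eta>, v) (snd (\<eta>, v)) \<in> V" using \<eta>p v topspace_pathsT by simp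
    qed
    ultimately show "\<exists>T. openin ?Z T \<and> p \<in> T \<and> T \<subseteq> {p \<in> topspace ?Z. fst p (snd p) \<in> V}" by blast
  qed
qed

definition lift_path :: "(real \<Rightarrow> 'a) \<Rightarrow> real \<Rightarrow> 'a" where
  "lift_path \<gamma> = path_cat (\<lambda>u. \<Gamma> (1 - u, \<gamma> 0)) \<gamma>"

lemma reverse_path: "pathin leafT \<delta> \<Longrightarrow> pathin leafT (\<lambda>u. \<delta> (1 - u))"
proof -
  assume "pathin leafT \<delta>"
  moreover have "continuous_map unitT unitT (\<lambda>u. 1 - u)"
    by (auto simp: continuous_map_in_subtopology intro!: continuous_intros)
  ultimately show "pathin leafT (\<lambda>u. \<delta> (1 - u))"
    using continuous_map_compose[of unitT unitT _ leafT \<delta>] by (simp add: pathin_def o_def)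
qed

lemma lift_path:
  assumes "\<gamma> \<in> paths"
  shows "lift_path \<gamma> \<in> paths" "lift_path \<gamma> 0 = h (\<gamma> 0)" "lift_path \<gamma> 1 = \<gamma> 1"
proof -
  note p = pathsD[OF assms]
  show 0: "lift_path \<gamma> 0 = h (\<gamma> 0)" and "lift_path \<gamma> 1 = \<gamma> 1"
    using \<Gamma>(4)[OF p(2)] by (simp_all add: lift_path_def path_cat_def)
  have "pathin leafT (lift_path \<gamma>)"
    unfolding lift_path_def
    by (rule pathin_path_cat[OF reverse_path[OF \<Gamma>(2)[OF p(2)]] p(1)]) (use \<Gamma>(3)[OF p(2)] in simp)
  then show "lift_path \<gamma> \<in> paths" using 0 hD[OF p(2)] by (simp add: paths_iff) (simp add: lift_path_def path_cat_def)
qed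

lemma lift_path_continuous: "continuous_map pathsT pathsT lift_path"
proof -
  let ?Z = "prod_topology pathsT unitT"
  have "continuous_map ?Z (prod_topology unitT (subtopology (mtop X) D)) (\<lambda>p. (1 - snd p, fst p 0))"
  proof -
    have "continuous_map unitT unitT (\<lambda>u. 1 - u)"
      by (auto simp: continuous_map_in_subtopology intro!: continuous_intros)
    from continuous_map_compose[OF continuous_map_snd this]
    have "continuous_map ?Z unitT (\<lambda>p. 1 - snd p)" by (simp add: o_def)
    moreover have "continuous_map pathsT (subtopology (mtop X) D) (\<lambda>\<gamma>. \<gamma> 0)"
      using evaluation_continuous[of 0] pathsD(2) by (auto simp: continuous_map_in_subtopology topspace_pathsT)
    from continuous_map_compose[OF continuous_map_fst this]
    have "continuous_map ?Z (subtopology (mtop X) D) (\<lambda>p. fst p 0)" by (simp add: o_def)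
    ultimately show ?thesis by (simp add: continuous_map_paired)
  qed
  from continuous_map_compose[OF this \<Gamma>(1)]
  have a: "continuous_map ?Z (mtop X) (\<lambda>p. \<Gamma> (1 - snd p, fst p 0))" by (simp add: o_def)
  have "continuous_map ?Z (mtop X) (\<lambda>p. if snd p \<le> 1/2 then \<Gamma> (1 - 2 * snd p, fst p 0) else fst p (2 * snd p - 1))"
    by (rule path_cat_family_continuous[of pathsT "mtop X" "\<lambda>\<gamma> u. \<Gamma> (1 - u, \<gamma> 0)" "\<lambda>\<gamma>. \<gamma>"])
      (use a joint_evaluation_continuous \<Gamma>(3) pathsD(2) in \<open>auto simp: topspace_pathsT\<close>)
  from continuous_map_into_pathsT[OF this] lift_path(1)
  show ?thesis by (simp add: lift_path_def[abs_def] path_cat_def topspace_pathsT cong: if_cong)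
qed

text \<open>Prefixing the same path preserves homotopy. Conversely equal lifts start at the same h
  z, h is injective on D, and prefixing \<open>\<Gamma>\<close> once more cancels its
  reversal.\<close>

lemma lift_path_hom:
  assumes "\<gamma> \<in> paths" "\<gamma>' \<in> paths"
  shows "cls (lift_path \<gamma>) = cls (lift_path \<gamma>') \<longleftrightarrow> cls \<gamma> = cls \<gamma>'"
proof
  note p = pathsD[OF assms(1)] and p' = pathsD[OF assms(2)] and L = lift_path[OF assms(1)] and L' = lift_path[OF assms(2)]
  assume "cls \<gamma> = cls \<gamma>'"
  then have hom: "leaf_hom {0, 1} \<gamma> \<gamma>'" using cls_eq_iff assms by blast
  then have 0: "\<gamma>' 0 = \<gamma> 0" using leaf_hom_eq_on by blast
  have "leaf_hom {0, 1} (lift_path \<gamma>) (lift_path \<gamma>')"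
    unfolding lift_path_def 0
    by (rule leaf_hom_path_cat[OF reverse_path[OF \<Gamma>(2)[OF p(2)]] _ hom]) (use \<Gamma>(3)[OF p(2)] in simp)
  then show "cls (lift_path \<gamma>) = cls (lift_path \<gamma>')" using cls_eq_iff L L' by blast
next
  note p = pathsD[OF assms(1)] and p' = pathsD[OF assms(2)] and L = lift_path[OF assms(1)] and L' = lift_path[OF assms(2)]
  assume "cls (lift_path \<gamma>) = cls (lift_path \<gamma>')"
  then have hom: "leaf_hom {0, 1} (lift_path \<gamma>) (lift_path \<gamma>')" using cls_eq_iff L L' by blast
  then have "lift_path \<gamma>' 0 = lift_path \<gamma> 0" using leaf_hom_eq_on by blast
  then have 0: "\<gamma>' 0 = \<gamma> 0" using inj_onD[OF h_inj] L L' p(2) p'(2) by metis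
  let ?\<delta> = "\<lambda>u. \<Gamma> (u, \<gamma> 0)"
  have hom2: "leaf_hom {0, 1} (path_cat ?\<delta> (lift_path \<gamma>)) (path_cat ?\<delta> (lift_path \<gamma>'))"
    by (rule leaf_hom_path_cat[OF \<Gamma>(2)[OF p(2)] _ hom]) (use \<Gamma>(4)[OF p(2)] L in simp)
  have retract: "leaf_hom {0, 1} (path_cat ?\<delta> (lift_path \<eta>)) \<eta>" if \<eta>: "\<eta> \<in> paths" and z: "\<eta> 0 = \<gamma> 0" for \<eta>
  proof -
    \<comment> \<open>On [-1, 1] this path comes back from h z to z along the reversed
      \<open>\<Gamma>\<close> and then follows \<open>\<eta>\<close>; both sides of the cancellation
      are traversals of it.\<close>
    define k where "k v = (if v \<le> 0 then \<Gamma> (- v, \<gamma> 0) else \<eta> v)" for v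
    let ?S = "{-1..1::real}"
    have k: "continuous_map (top_of_set ?S) leafT k"
      unfolding k_def[abs_def]
    proof (rule continuous_map_cases_le)
      have "continuous_map (subtopology (top_of_set ?S) {x \<in> topspace (top_of_set ?S). x \<le> 0}) unitT (\<lambda>v. - v)"
        by (auto simp: continuous_map_in_subtopology subtopology_subtopology intro!: continuous_intros)
      from continuous_map_compose[OF this, of leafT ?\<delta>]
      show "continuous_map (subtopology (top_of_set ?S) {x \<in> topspace (top_of_set ?S). x \<le> 0}) leafT (\<lambda>v. \<Gamma> (- v, \<gamma> 0))"
        using \<Gamma>(2)[OF p(2)] by (simp add: pathin_def o_def)
      have "continuous_map (subtopology (top_of_set ?S) {x \<in> topspace (top_of_set ?S). 0 \<le> x}) unitT (\<lambda>v. v)"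
        by (auto simp: continuous_map_in_subtopology subtopology_subtopology intro!: continuous_intros)
      from continuous_map_compose[OF this pathsD(3)[OF \<eta>]]
      show "continuous_map (subtopology (top_of_set ?S) {x \<in> topspace (top_of_set ?S). 0 \<le> x}) leafT \<eta>"
        by (simp add: o_def)
      show "\<Gamma> (- x, \<gamma> 0) = \<eta> x" if "x = 0" for x using that z \<Gamma>(3)[OF p(2)] by simp
    qed (auto intro!: continuous_intros)
    \<comment> \<open>The triple concatenation in terms of k: out to -1 at speed 2 during the first
      half, then up to 1 at speed 4. The two lines cross at u = 1/2.\<close>
    define q1 where "q1 u = max (- 2 * u) (4 * u - 3)" for u :: real
    have "leaf_hom {0, 1} (\<lambda>u. k (q1 u)) (\<lambda>u. k u)"
    proof (rule leaf_hom_reparametrization[OF k])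
      show "continuous_on {0..1} q1"
        unfolding q1_def[abs_def] by (intro continuous_intros)
    qed (auto simp: q1_def)
    then show ?thesis
    proof (rule leaf_hom_cong[rotated])
      show "path_cat ?\<delta> (lift_path \<eta>) u = k (q1 u)" if "u \<in> {0..1}" for u
        using that z by (auto simp: path_cat_def lift_path_def k_def q1_def)
      show "\<eta> u = k u" if "u \<in> {0..1}" for u using that z \<Gamma>(3)[OF p(2)] by (auto simp: k_def)
    qed auto
  qed
  have "leaf_hom {0, 1} \<gamma> \<gamma>'"
    using leaf_hom_trans[OF leaf_hom_trans[OF leaf_hom_sym[OF retract[OF assms(1) refl]] hom2] retract[OF assms(2) 0]] .
  then show "cls \<gamma> = cls \<gamma>'" using cls_eq_iff assms by blast
qed

definition lift_class :: "(real \<Rightarrow> 'a) set \<Rightarrow> (real \<Rightarrow> 'a) set" where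
  "lift_class c = cls (lift_path (SOME \<gamma>. \<gamma> \<in> c))"

lemma lift_class_cls:
  assumes \<gamma>: "\<gamma> \<in> paths"
  shows "lift_class (cls \<gamma>) = cls (lift_path \<gamma>)"
proof -
  have "\<gamma> \<in> cls \<gamma>"
    using \<gamma> leaf_hom_refl[OF pathsD(1)[OF \<gamma>]] by (simp add: path_class_def leaf_homotopic_leaf_hom)
  then have s: "(SOME \<gamma>'. \<gamma>' \<in> cls \<gamma>) \<in> cls \<gamma>" by (rule someI[of "\<lambda>\<gamma>'. \<gamma>' \<in> cls \<gamma>"])
  then have "(SOME \<gamma>'. \<gamma>' \<in> cls \<gamma>) \<in> paths" "leaf_hom {0, 1} \<gamma> (SOME \<gamma>'. \<gamma>' \<in> cls \<gamma>)"
    by (simp_all add: path_class_def leaf_homotopic_leaf_hom)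
  then show ?thesis unfolding lift_class_def using lift_path_hom[OF \<gamma>] cls_eq_iff[OF \<gamma>] by metis
qed

lemma lift_class:
  "continuous_map classT classT lift_class" "inj_on lift_class (topspace classT)"
  "\<And>c. c \<in> topspace classT \<Longrightarrow> class_end (lift_class c) = class_end c"
  "\<And>c. c \<in> topspace classT \<Longrightarrow> t (class_start (lift_class c)) = \<alpha> * t (class_start c)"
proof -
  show "continuous_map classT classT lift_class"
  proof (rule continuous_compose_quotient_map[OF classT_quotient])
    show "continuous_map pathsT classT (lift_class \<circ> cls)"
      by (rule continuous_map_eq[OF continuous_map_compose[OF lift_path_continuous quotient_imp_continuous_map[OF classT_quotient]]])
        (simp add: topspace_pathsT lift_class_cls)
  qed
  show "inj_on lift_class (topspace classT)"
    by (rule inj_onI) (auto simp: topspace_classT lift_class_cls lift_path_hom)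
  show "class_end (lift_class c) = class_end c" "t (class_start (lift_class c)) = \<alpha> * t (class_start c)"
    if "c \<in> topspace classT" for c
    using that lift_path class_ends lin pathsD(2) by (auto simp: topspace_classT lift_class_cls)
qed

end

subsection \<open>The direct limit\<close>

text \<open>A map over M is determined near a point by the sheet W of the image point: the image of
  a small set is the part of W lying over an open set of M.\<close>

lemma etale_map_open:
  assumes et: "etale T p M" and e: "continuous_map T T e" and pe: "\<And>x. x \<in> topspace T \<Longrightarrow> p (e x) = p x"
  shows "open_map T T e"
  unfolding open_map_def
proof (intro allI impI)
  fix A assume A: "openin T A"
  show "openin T (e ` A)"
  proof (subst openin_subopen, rule ballI)
    fix y assume "y \<in> e ` A"
    then obtain x where x: "x \<in> A" "y = e x" by blast
    have xT: "x \<in> topspace T" using x A openin_subset by blast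
    then have "y \<in> topspace T" using continuous_map_image_subset_topspace[OF e] x by blast
    then obtain W where W: "openin T W" "y \<in> W" "inj_on p W" using et by (auto simp: etale_def)
    \<comment> \<open>Restricting to points sent into W is what allows a point of W over p A' to be
      recognised as an image.\<close>
    define A' where "A' = A \<inter> {x \<in> topspace T. e x \<in> W}"
    have A': "openin T A'" unfolding A'_def using A openin_continuous_map_preimage[OF e W(1)] by (rule openin_Int)
    then have "openin (mtop M) (p ` A')" using et by (auto simp: etale_def open_map_def)
    then have "openin T {z \<in> topspace T. p z \<in> p ` A'}"
      using et openin_continuous_map_preimage by (auto simp: etale_def)
    then have "openin T (W \<inter> {z \<in> topspace T. p z \<in> p ` A'})" using W(1) by (rule openin_Int[rotated])
    moreover have "y \<in> W \<inter> {z \<in> topspace T. p z \<in> p ` A'}"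
      using W(2) \<open>y \<in> topspace T\<close> x xT pe[OF xT] by (auto simp: A'_def)
    moreover have "W \<inter> {z \<in> topspace T. p z \<in> p ` A'} \<subseteq> e ` A"
    proof
      fix z assume z: "z \<in> W \<inter> {z \<in> topspace T. p z \<in> p ` A'}"
      then obtain a where a: "a \<in> A'" "p z = p a" by blast
      then have "p (e a) = p z" "e a \<in> W" using pe by (auto simp: A'_def)
      then have "e a = z" using inj_onD[OF W(3)] z by blast
      then show "z \<in> e ` A" using a(1) by (auto simp: A'_def)
    qed
    ultimately show "\<exists>U. openin T U \<and> y \<in> U \<and> U \<subseteq> e ` A" by blast
  qed
qed

lemma submersive_at_divide:
  assumes "submersive_at M q x" "k \<noteq> 0"
  shows "submersive_at M (\<lambda>w. q w / k) x"
proof -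
  obtain B \<psi> L where B: "compatible_chart M B \<psi>" "x \<in> B"
    and L: "((q \<circ> inv_into B \<psi>) has_derivative L) (at (\<psi> x))" "\<And>c v. L (c *\<^sub>C v) = c *\<^sub>C L v" "surj L"
    using assms(1) by (auto simp: submersive_at_def)
  have "((\<lambda>w. q w / k) \<circ> inv_into B \<psi> has_derivative (\<lambda>h. L h / k)) (at (\<psi> x))"
    using bounded_linear.has_derivative[OF bounded_linear_divide L(1), of k] by (simp add: o_def)
  moreover have "surj (\<lambda>h. L h / k)"
  proof (rule surjI[of _ "\<lambda>z. inv L (z * k)"])
    show "L (inv L (z * k)) / k = z" for z using surj_f_inv_f[OF L(3)] assms(2) by simp
  qed
  ultimately show ?thesis
    unfolding submersive_at_def using B L(2)
    by (intro exI[of _ B] exI[of _ \<psi>] exI[of _ "\<lambda>h. L h / k"]) (simp add: scaleC_complex_def)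
qed

text \<open>The direct limit of \<open>T \<rightarrow> T \<rightarrow> T \<rightarrow> \<dots>\<close> along an injective self-map \<^term>\<open>e\<close> over \<^term>\<open>p\<close>: the pair
  \<^term>\<open>(c, n)\<close> stands for the point \<open>e\<^sup>-\<^sup>n c\<close>.\<close>

locale telescope =
  fixes M :: "('a, 'e::complex_normed) cmfd" and T :: "'b topology" and p :: "'b \<Rightarrow> 'a" and e :: "'b \<Rightarrow> 'b"
  assumes M: "complex_manifold M" and et: "etale T p M" and T2: "Hausdorff_space T" and sc: "second_countable T"
    and e: "continuous_map T T e" and inj: "inj_on e (topspace T)"
    and pe: "\<And>x. x \<in> topspace T \<Longrightarrow> p (e x) = p x"
begin

lemma e_in: "c \<in> topspace T \<Longrightarrow> e c \<in> topspace T"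
  using continuous_map_image_subset_topspace[OF e] by blast

lemma iter_in: "c \<in> topspace T \<Longrightarrow> (e ^^ n) c \<in> topspace T"
  by (induction n) (auto intro: e_in)

lemma iter_inj: "c \<in> topspace T \<Longrightarrow> c' \<in> topspace T \<Longrightarrow> (e ^^ n) c = (e ^^ n) c' \<Longrightarrow> c = c'"
proof (induction n)
  case (Suc n)
  then have "(e ^^ n) c = (e ^^ n) c'" using inj_onD[OF inj] iter_in by (metis comp_apply funpow.simps(2))
  then show ?case using Suc by blast
qed simp

lemma iter_continuous: "continuous_map T T (e ^^ n)"
proof (induction n)
  case (Suc n)
  then show ?case using continuous_map_compose[OF Suc e] by (simp add: o_def)
qed (simp add: id_def)

lemma iter_p: "c \<in> topspace T \<Longrightarrow> p ((e ^^ n) c) = p c"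
  by (induction n) (auto simp: pe iter_in)

lemma iter_add: "(e ^^ n) ((e ^^ k) c) = (e ^^ (n + k)) c"
  by (simp add: funpow_add)

lemma iter_swap: "(e ^^ n) ((e ^^ k) c) = (e ^^ k) ((e ^^ n) c)"
  by (simp add: iter_add add.commute)

lemma open_e: "openin T A \<Longrightarrow> openin T (e ` A)"
  using etale_map_open[OF et e pe] by (simp add: open_map_def)

lemma open_iter: "openin T A \<Longrightarrow> openin T ((e ^^ n) ` A)"
proof (induction n)
  case (Suc n)
  then show ?case using open_e[of "(e ^^ n) ` A"] by (simp add: image_comp)
qed simp

text \<open>The class of the pair (c, n) in the direct limit, as the set of pairs equivalent to it.
  Since e is injective, cross-multiplied iterates decide equivalence, without passing to a still
  later stage.\<close>

definition lim_pt :: "nat \<Rightarrow> 'b \<Rightarrow> ('b \<times> nat) set" where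
  "lim_pt n c = {(c', n'). c' \<in> topspace T \<and> (e ^^ n') c = (e ^^ n) c'}"

lemma lim_pt_eq_iff:
  assumes "c \<in> topspace T" "c' \<in> topspace T"
  shows "lim_pt n c = lim_pt n' c' \<longleftrightarrow> (e ^^ n') c = (e ^^ n) c'"
proof
  assume "lim_pt n c = lim_pt n' c'"
  moreover have "(c', n') \<in> lim_pt n' c'" using assms by (simp add: lim_pt_def)
  ultimately have "(c', n') \<in> lim_pt n c" by simp
  then show "(e ^^ n') c = (e ^^ n) c'" by (simp add: lim_pt_def)
next
  have sub: "lim_pt n c \<subseteq> lim_pt n' c'"
    if c: "c \<in> topspace T" "c' \<in> topspace T" and eq: "(e ^^ n') c = (e ^^ n) c'" for c c' n n'
  proof
    fix z assume z: "z \<in> lim_pt n c"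
    obtain x k where x: "z = (x, k)" "x \<in> topspace T" "(e ^^ k) c = (e ^^ n) x" using z by (auto simp: lim_pt_def)
    have "(e ^^ n) ((e ^^ k) c') = (e ^^ k) ((e ^^ n') c)" using eq iter_swap by metis
    also have "\<dots> = (e ^^ n') ((e ^^ n) x)" using x(3) iter_swap by metis
    also have "\<dots> = (e ^^ n) ((e ^^ n') x)" by (rule iter_swap)
    \<comment> \<open>Transitivity is where injectivity is spent: the common factor
      \<open>e ^^ n\<close> is cancelled.\<close>
    finally have "(e ^^ k) c' = (e ^^ n') x" using iter_inj iter_in c(2) x(2) by blast
    then show "z \<in> lim_pt n' c'" using x by (simp add: lim_pt_def)
  qed
  assume "(e ^^ n') c = (e ^^ n) c'"
  then show "lim_pt n c = lim_pt n' c'" using sub assms by (metis subset_antisym)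
qed

lemma lim_pt_shift: "c \<in> topspace T \<Longrightarrow> lim_pt (n + k) ((e ^^ k) c) = lim_pt n c"
  by (subst lim_pt_eq_iff) (auto simp: iter_in iter_add)

lemma lim_pt_Suc: "c \<in> topspace T \<Longrightarrow> lim_pt (Suc n) (e c) = lim_pt n c"
  using lim_pt_shift[of c n 1] by simp

lemma lim_pt_inj: "inj_on (lim_pt n) (topspace T)"
  by (rule inj_onI) (use lim_pt_eq_iff iter_inj in blast)

definition limW :: "('b \<times> nat) set set" where "limW = (\<Union>n. lim_pt n ` topspace T)"

definition limT :: "('b \<times> nat) set topology" where
  "limT = topology (\<lambda>U. U \<subseteq> limW \<and> (\<forall>n. openin T {c \<in> topspace T. lim_pt n c \<in> U}))"

lemma openin_limT: "openin limT U \<longleftrightarrow> U \<subseteq> limW \<and> (\<forall>n. openin T {c \<in> topspace T. lim_pt n c \<in> U})"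
proof -
  have "istopology (\<lambda>U. U \<subseteq> limW \<and> (\<forall>n. openin T {c \<in> topspace T. lim_pt n c \<in> U}))"
    unfolding istopology_def
  proof (intro conjI allI impI)
    fix S S' assume *: "S \<subseteq> limW \<and> (\<forall>n. openin T {c \<in> topspace T. lim_pt n c \<in> S})"
      "S' \<subseteq> limW \<and> (\<forall>n. openin T {c \<in> topspace T. lim_pt n c \<in> S'})"
    show "S \<inter> S' \<subseteq> limW" using * by blast
    fix n
    have "{c \<in> topspace T. lim_pt n c \<in> S \<inter> S'} = {c \<in> topspace T. lim_pt n c \<in> S} \<inter> {c \<in> topspace T. lim_pt n c \<in> S'}"
      by blast
    then show "openin T {c \<in> topspace T. lim_pt n c \<in> S \<inter> S'}" using * by auto
  next
    fix \<K> assume *: "\<forall>K\<in>\<K>. K \<subseteq> limW \<and> (\<forall>n. openin T {c \<in> topspace T. lim_pt n c \<in> K})"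
    show "\<Union>\<K> \<subseteq> limW" using * by blast
    fix n
    have "{c \<in> topspace T. lim_pt n c \<in> \<Union>\<K>} = (\<Union>K\<in>\<K>. {c \<in> topspace T. lim_pt n c \<in> K})" by blast
    then show "openin T {c \<in> topspace T. lim_pt n c \<in> \<Union>\<K>}" using * by auto
  qed
  then show ?thesis by (simp add: limT_def)
qed

text \<open>Seen from stage k, the image of A is the preimage under \<open>e ^^ n\<close> of
  \<open>e ^^ k\<close> applied to A, and e is open. So each stage is an open copy of T.\<close>

lemma lim_pt_open:
  assumes A: "openin T A" shows "openin limT (lim_pt n ` A)"
  unfolding openin_limT
proof (intro conjI allI)
  have AT: "A \<subseteq> topspace T" using openin_subset[OF A] .
  then show "lim_pt n ` A \<subseteq> limW" by (auto simp: limW_def)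
  fix k
  have "{c \<in> topspace T. lim_pt k c \<in> lim_pt n ` A} = {c \<in> topspace T. (e ^^ n) c \<in> (e ^^ k) ` A}"
    using AT lim_pt_eq_iff by (auto simp: image_iff subset_iff)
  then show "openin T {c \<in> topspace T. lim_pt k c \<in> lim_pt n ` A}"
    using openin_continuous_map_preimage[OF iter_continuous open_iter[OF A]] by simp
qed

lemma topspace_limT: "topspace limT = limW"
proof
  show "topspace limT \<subseteq> limW" using openin_limT by (metis openin_topspace)
  show "limW \<subseteq> topspace limT"
    unfolding limW_def using openin_subset[OF lim_pt_open[OF openin_topspace]] by blast
qed

lemma limWE:
  assumes "x \<in> topspace limT"
  obtains n c where "c \<in> topspace T" "x = lim_pt n c"
  using assms by (auto simp: topspace_limT limW_def)

lemma lim_pt_in: "c \<in> topspace T \<Longrightarrow> lim_pt n c \<in> topspace limT"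
  by (auto simp: topspace_limT limW_def)

text \<open>Two points are compared at the sum of their stages; separation properties can then be
  read off in a single copy of T.\<close>

lemma limT_common:
  assumes "x \<in> topspace limT" "y \<in> topspace limT"
  obtains n c c' where "c \<in> topspace T" "c' \<in> topspace T" "x = lim_pt n c" "y = lim_pt n c'"
proof -
  obtain n c where x: "c \<in> topspace T" "x = lim_pt n c" using limWE[OF assms(1)] by blast
  obtain k c' where y: "c' \<in> topspace T" "y = lim_pt k c'" using limWE[OF assms(2)] by blast
  have "x = lim_pt (n + k) ((e ^^ k) c)" "y = lim_pt (n + k) ((e ^^ n) c')"
    using lim_pt_shift x y by (metis, metis add.commute)
  then show ?thesis using that iter_in x(1) y(1) by blast
qed

lemma lim_pt_continuous: "continuous_map T limT (lim_pt n)"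
  unfolding continuous_map
proof (intro conjI allI impI)
  show "lim_pt n ` topspace T \<subseteq> topspace limT" using lim_pt_in by blast
  show "openin T {c \<in> topspace T. lim_pt n c \<in> U}" if "openin limT U" for U
    using that unfolding openin_limT by blast
qed

lemma continuous_map_limT:
  assumes "\<And>n. continuous_map T Y (f \<circ> lim_pt n)"
  shows "continuous_map limT Y f"
  unfolding continuous_map
proof (intro conjI allI impI)
  show "f ` topspace limT \<subseteq> topspace Y"
    using continuous_map_image_subset_topspace[OF assms] by (auto elim!: limWE)
  fix U assume U: "openin Y U"
  have "{c \<in> topspace T. lim_pt n c \<in> {x \<in> topspace limT. f x \<in> U}} = {c \<in> topspace T. (f \<circ> lim_pt n) c \<in> U}" for n
    using lim_pt_in by auto
  then show "openin limT {x \<in> topspace limT. f x \<in> U}"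
    unfolding openin_limT using openin_continuous_map_preimage[OF assms U] by (auto simp: topspace_limT)
qed

lemma lim_pt_homeomorphic: "homeomorphic_map T (subtopology limT (lim_pt n ` topspace T)) (lim_pt n)"
proof (rule bijective_open_imp_homeomorphic_map)
  show "continuous_map T (subtopology limT (lim_pt n ` topspace T)) (lim_pt n)"
    using lim_pt_continuous by (auto simp: continuous_map_in_subtopology)
  show "open_map T (subtopology limT (lim_pt n ` topspace T)) (lim_pt n)"
    unfolding open_map_def
  proof (intro allI impI)
    fix A assume A: "openin T A"
    then have "lim_pt n ` A \<subseteq> lim_pt n ` topspace T" using openin_subset by blast
    then show "openin (subtopology limT (lim_pt n ` topspace T)) (lim_pt n ` A)"
      using lim_pt_open[OF A] openin_subtopology_Int2 by (metis inf.absorb_iff2 openin_subtopology inf.orderE)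
  qed
  show "lim_pt n ` topspace T = topspace (subtopology limT (lim_pt n ` topspace T))"
    using lim_pt_in by auto
qed (rule lim_pt_inj)

definition descend :: "('b \<Rightarrow> nat \<Rightarrow> 'c) \<Rightarrow> ('b \<times> nat) set \<Rightarrow> 'c" where
  "descend f x = (let z = SOME z. z \<in> x in f (fst z) (snd z))"

lemma descend_lim_pt:
  assumes c: "c \<in> topspace T"
    and f: "\<And>c c' n n'. c \<in> topspace T \<Longrightarrow> c' \<in> topspace T \<Longrightarrow> (e ^^ n') c = (e ^^ n) c' \<Longrightarrow> f c n = f c' n'"
  shows "descend f (lim_pt n c) = f c n"
proof -
  have "(c, n) \<in> lim_pt n c" using c by (simp add: lim_pt_def)
  then have "(SOME z. z \<in> lim_pt n c) \<in> lim_pt n c" by (rule someI[of "\<lambda>z. z \<in> lim_pt n c"])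
  then obtain c' n' where z: "(SOME z. z \<in> lim_pt n c) = (c', n')" "c' \<in> topspace T" "(e ^^ n') c = (e ^^ n) c'"
    by (auto simp: lim_pt_def)
  show ?thesis using f[OF c z(2,3)] by (simp add: descend_def z(1))
qed

definition lim_p :: "('b \<times> nat) set \<Rightarrow> 'a" where "lim_p = descend (\<lambda>c n. p c)"

definition lim_e :: "('b \<times> nat) set \<Rightarrow> ('b \<times> nat) set" where "lim_e = descend (\<lambda>c n. lim_pt n (e c))"

text \<open>Raising the stage inverts e, because e c at stage n + 1 is the same point as c at stage
  n.\<close>

definition lim_e_inv :: "('b \<times> nat) set \<Rightarrow> ('b \<times> nat) set" where "lim_e_inv = descend (\<lambda>c n. lim_pt (Suc n) c)"

lemma lim_p: "c \<in> topspace T \<Longrightarrow> lim_p (lim_pt n c) = p c"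
  unfolding lim_p_def by (rule descend_lim_pt) (metis iter_p)+

lemma lim_e: "c \<in> topspace T \<Longrightarrow> lim_e (lim_pt n c) = lim_pt n (e c)"
  unfolding lim_e_def
proof (rule descend_lim_pt)
  fix c c' n n' assume "c \<in> topspace T" "c' \<in> topspace T" "(e ^^ n') c = (e ^^ n) c'"
  then show "lim_pt n (e c) = lim_pt n' (e c')"
    using lim_pt_eq_iff[OF e_in e_in] iter_swap[of _ 1] by simp
qed

lemma lim_e_inv: "c \<in> topspace T \<Longrightarrow> lim_e_inv (lim_pt n c) = lim_pt (Suc n) c"
  unfolding lim_e_inv_def by (rule descend_lim_pt) (auto simp: lim_pt_eq_iff)

lemma etale_lim: "etale limT lim_p M"
  unfolding etale_def
proof (intro conjI ballI)
  have cp: "continuous_map T (mtop M) p" and op: "open_map T (mtop M) p" using et by (auto simp: etale_def)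
  show "continuous_map limT (mtop M) lim_p"
    by (rule continuous_map_limT, rule continuous_map_eq[OF cp]) (simp add: lim_p)
  show "open_map limT (mtop M) lim_p"
    unfolding open_map_def
  proof (intro allI impI)
    fix U assume U: "openin limT U"
    have "lim_p ` U = (\<Union>n. p ` {c \<in> topspace T. lim_pt n c \<in> U})"
    proof
      show "lim_p ` U \<subseteq> (\<Union>n. p ` {c \<in> topspace T. lim_pt n c \<in> U})"
      proof clarify
        fix x assume x: "x \<in> U"
        obtain n c where c: "c \<in> topspace T" "x = lim_pt n c" using limWE openin_subset[OF U] x by blast
        then show "lim_p x \<in> (\<Union>n. p ` {c \<in> topspace T. lim_pt n c \<in> U})" using x lim_p by auto
      qed
      show "(\<Union>n. p ` {c \<in> topspace T. lim_pt n c \<in> U}) \<subseteq> lim_p ` U" using lim_p by (metis (mono_tags, lifting) UN_least image_subsetI imageI mem_Collect_eq)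
    qed
    then show "openin (mtop M) (lim_p ` U)"
      using U op unfolding openin_limT open_map_def by auto
  qed
  fix x assume "x \<in> topspace limT"
  then obtain n c where c: "c \<in> topspace T" "x = lim_pt n c" by (rule limWE)
  obtain W where W: "openin T W" "c \<in> W" "inj_on p W" using et c by (auto simp: etale_def)
  have "inj_on lim_p (lim_pt n ` W)"
    using W(3) lim_p openin_subset[OF W(1)] by (auto simp: inj_on_def subset_iff)
  then show "\<exists>W. openin limT W \<and> x \<in> W \<and> inj_on lim_p W" using lim_pt_open[OF W(1)] W(2) c(2) by blast
qed

text \<open>Distinct points in a common stage are separated in T, and the stage map is open and
  injective.\<close>

lemma Hausdorff_limT: "Hausdorff_space limT"
  unfolding Hausdorff_space_def
proof (intro allI impI)
  fix x y assume xy: "x \<in> topspace limT \<and> y \<in> topspace limT \<and> x \<noteq> y"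
  then obtain n c c' where c: "c \<in> topspace T" "c' \<in> topspace T" "x = lim_pt n c" "y = lim_pt n c'"
    using limT_common by metis
  then have "c \<noteq> c'" using xy by blast
  then obtain A B where AB: "openin T A" "openin T B" "c \<in> A" "c' \<in> B" "disjnt A B"
    using T2 c unfolding Hausdorff_space_def by blast
  have "disjnt (lim_pt n ` A) (lim_pt n ` B)"
    using AB(5) inj_on_image_Int[OF lim_pt_inj openin_subset[OF AB(1)] openin_subset[OF AB(2)], of n]
    by (auto simp: disjnt_def)
  then show "\<exists>U V. openin limT U \<and> openin limT V \<and> x \<in> U \<and> y \<in> V \<and> disjnt U V"
    using lim_pt_open AB c by blast
qed

lemma second_countable_limT: "second_countable limT"
proof (rule second_countable_countable_cover[of "range (\<lambda>n. lim_pt n ` topspace T)"])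
  show "second_countable (subtopology limT V)" if "V \<in> range (\<lambda>n. lim_pt n ` topspace T)" for V
    using that sc homeomorphic_space_second_countability[OF homeomorphic_map_imp_homeomorphic_space[OF lim_pt_homeomorphic]] by auto
qed (auto simp: lim_pt_open topspace_limT limW_def)

text \<open>All stages contain the stage-0 point of c0, represented in stage n by its n-th
  iterate.\<close>

lemma connected_limT:
  assumes T: "connected_space T" and c0: "c0 \<in> topspace T" shows "connected_space limT"
proof -
  have "connectedin limT (\<Union>(range (\<lambda>n. lim_pt n ` topspace T)))"
  proof (rule connectedin_Union)
    show "connectedin limT S" if "S \<in> range (\<lambda>n. lim_pt n ` topspace T)" for S
      using that T connectedin_continuous_map_image[OF lim_pt_continuous] connectedin_topspace by blast
    have "lim_pt 0 c0 \<in> lim_pt n ` topspace T" for n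
      using lim_pt_shift[OF c0, of 0 n] iter_in[OF c0, of n] by (metis add_0 imageI)
    then show "\<Inter>(range (\<lambda>n. lim_pt n ` topspace T)) \<noteq> {}" by blast
  qed
  then show ?thesis using topspace_limT limW_def connectedin_topspace by metis
qed

lemma lim_e_homeomorphic: "homeomorphic_map limT limT lim_e"
proof -
  have "homeomorphic_maps limT limT lim_e lim_e_inv"
    unfolding homeomorphic_maps_def
  proof (intro conjI ballI)
    show "continuous_map limT limT lim_e"
    proof (rule continuous_map_limT)
      show "continuous_map T limT (lim_e \<circ> lim_pt n)" for n
        by (rule continuous_map_eq[OF continuous_map_compose[OF e lim_pt_continuous]]) (simp add: lim_e)
    qed
    show "continuous_map limT limT lim_e_inv"
    proof (rule continuous_map_limT)
      show "continuous_map T limT (lim_e_inv \<circ> lim_pt n)" for n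
        by (rule continuous_map_eq[OF lim_pt_continuous]) (simp add: lim_e_inv)
    qed
    fix x assume "x \<in> topspace limT"
    then obtain n c where "c \<in> topspace T" "x = lim_pt n c" by (rule limWE)
    then show "lim_e_inv (lim_e x) = x" "lim_e (lim_e_inv x) = x"
      by (simp_all add: lim_e lim_e_inv lim_pt_Suc e_in)
  qed
  then show ?thesis using homeomorphic_map_maps by blast
qed

lemma lim_p_lim_e: "x \<in> topspace limT \<Longrightarrow> lim_p (lim_e x) = lim_p x"
  by (auto elim!: limWE simp: lim_e lim_p e_in pe)

end

section \<open>The projection of the limit onto the plane\<close>

locale foliated_telescope = telescope M T p e
  for M :: "('a, 'e::complex_normed) cmfd" and T :: "'b topology" and p :: "'b \<Rightarrow> 'a" and e :: "'b \<Rightarrow> 'b" +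
  fixes \<pi> :: "'b \<Rightarrow> complex" and \<alpha> :: complex and r :: real
  assumes \<pi>c: "continuous_map T euclidean \<pi>"
    and \<pi>s: "\<And>c. c \<in> topspace T \<Longrightarrow> \<exists>N q. openin T N \<and> c \<in> N \<and> (\<forall>y\<in>N. \<pi> y = q (p y)) \<and> submersive_at M q (p c)"
    and \<pi>e: "\<And>c. c \<in> topspace T \<Longrightarrow> \<pi> (e c) = \<alpha> * \<pi> c"
    and \<alpha>: "\<alpha> \<noteq> 0" "cmod \<alpha> < 1" and r: "r > 0"
    and im: "\<pi> ` topspace T = ball 0 r"
    and fibers: "\<And>s. s \<in> ball 0 r \<Longrightarrow> connectedin T {c \<in> topspace T. \<pi> c = s}"
begin

definition lim_\<pi> :: "('b \<times> nat) set \<Rightarrow> complex" where "lim_\<pi> = descend (\<lambda>c n. \<pi> c / \<alpha> ^ n)"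

lemma \<pi>_iter: "c \<in> topspace T \<Longrightarrow> \<pi> ((e ^^ n) c) = \<alpha> ^ n * \<pi> c"
  by (induction n) (auto simp: \<pi>e iter_in)

lemma lim_\<pi>: "c \<in> topspace T \<Longrightarrow> lim_\<pi> (lim_pt n c) = \<pi> c / \<alpha> ^ n"
  unfolding lim_\<pi>_def
proof (rule descend_lim_pt)
  fix c c' n n' assume c: "c \<in> topspace T" "c' \<in> topspace T" "(e ^^ n') c = (e ^^ n) c'"
  then have "\<alpha> ^ n' * \<pi> c = \<alpha> ^ n * \<pi> c'" using \<pi>_iter by metis
  then show "\<pi> c / \<alpha> ^ n = \<pi> c' / \<alpha> ^ n'" using \<alpha>(1) by (simp add: field_simps)
qed

lemma lim_\<pi>_lim_e: "x \<in> topspace limT \<Longrightarrow> lim_\<pi> (lim_e x) = \<alpha> * lim_\<pi> x"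
  by (auto elim!: limWE simp: lim_e lim_\<pi> e_in \<pi>e)

lemma eventually_in_disc:
  obtains N where "\<And>n. n \<ge> N \<Longrightarrow> \<alpha> ^ n * s \<in> ball 0 r"
proof -
  have "(\<lambda>n. \<alpha> ^ n * s) \<longlonglongrightarrow> 0 * s"
    using \<alpha>(2) by (intro tendsto_intros LIMSEQ_power_zero)
  then have "\<forall>\<^sub>F n in sequentially. \<alpha> ^ n * s \<in> ball 0 r"
    using r by (intro topological_tendstoD) auto
  then show ?thesis using that by (auto simp: eventually_sequentially)
qed

lemma lim_\<pi>_surj: "lim_\<pi> ` topspace limT = UNIV"
proof -
  have "s \<in> lim_\<pi> ` topspace limT" for s
  proof -
    obtain N where "\<And>n. n \<ge> N \<Longrightarrow> \<alpha> ^ n * s \<in> ball 0 r" by (rule eventually_in_disc[of s]) (rule that)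
    then obtain c where c: "c \<in> topspace T" "\<pi> c = \<alpha> ^ N * s" using im by (metis imageE order_refl)
    then have "lim_\<pi> (lim_pt N c) = s" using \<alpha>(1) by (simp add: lim_\<pi>)
    then show ?thesis using lim_pt_in[OF c(1)] by blast
  qed
  then show ?thesis by blast
qed

lemma lim_\<pi>_submersive:
  assumes "x \<in> topspace limT"
  shows "\<exists>N q. openin limT N \<and> x \<in> N \<and> (\<forall>y\<in>N. lim_\<pi> y = q (lim_p y)) \<and> submersive_at M q (lim_p x)"
proof -
  obtain n c where c: "c \<in> topspace T" "x = lim_pt n c" using limWE[OF assms] by blast
  obtain N q where N: "openin T N" "c \<in> N" "\<And>y. y \<in> N \<Longrightarrow> \<pi> y = q (p y)" "submersive_at M q (p c)"
    using \<pi>s[OF c(1)] by blast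
  have "\<alpha> ^ n \<noteq> 0" using \<alpha> by simp
  from submersive_at_divide[OF N(4) this] have "submersive_at M (\<lambda>w. q w / \<alpha> ^ n) (lim_p x)"
    by (simp add: c lim_p)
  moreover have "\<forall>y\<in>lim_pt n ` N. lim_\<pi> y = q (lim_p y) / \<alpha> ^ n"
    using N(3) openin_subset[OF N(1)] by (auto simp: lim_\<pi> lim_p subset_iff)
  ultimately show ?thesis using lim_pt_open[OF N(1)] N(2) c(2)
    by (intro exI[of _ "lim_pt n ` N"] exI[of _ "\<lambda>w. q w / \<alpha> ^ n"]) blast
qed

lemma lim_\<pi>_continuous: "continuous_map limT euclidean lim_\<pi>"
proof (rule continuous_map_limT)
  fix n
  have "continuous_map T euclidean (\<lambda>c. \<pi> c / \<alpha> ^ n)"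
    using continuous_map_compose[OF \<pi>c, of euclidean "\<lambda>z. z / \<alpha> ^ n"] \<alpha>(1)
    by (simp add: o_def continuous_intros)
  then show "continuous_map T euclidean (lim_\<pi> \<circ> lim_pt n)"
    by (rule continuous_map_eq) (simp add: lim_\<pi>)
qed

text \<open>The fibre over s is the union of the images of the fibres over
  \<open>\<alpha> ^ n * s\<close>, taken only for n so large that these values lie in the disc. The
  images are connected and all contain one point, the image of a point chosen at stage N.\<close>

lemma lim_\<pi>_fiber: "connectedin limT {x \<in> topspace limT. lim_\<pi> x = s}"
proof -
  obtain N where N: "\<And>n. n \<ge> N \<Longrightarrow> \<alpha> ^ n * s \<in> ball 0 r" by (rule eventually_in_disc[of s]) (rule that)
  define C where "C n = lim_pt n ` {c \<in> topspace T. \<pi> c = \<alpha> ^ n * s}" for n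
  have "connectedin limT (\<Union>(C ` {N..}))"
  proof (rule connectedin_Union)
    show "connectedin limT S" if "S \<in> C ` {N..}" for S
      using that connectedin_continuous_map_image[OF lim_pt_continuous fibers[OF N]] by (auto simp: C_def)
    obtain c where c: "c \<in> topspace T" "\<pi> c = \<alpha> ^ N * s" using N im by (metis imageE order_refl)
    have "lim_pt N c \<in> C n" if n: "n \<ge> N" for n
    proof -
      obtain k where k: "n = N + k" using n le_Suc_ex by blast
      have "lim_pt N c = lim_pt n ((e ^^ k) c)" using lim_pt_shift[OF c(1)] k by simp
      moreover have "\<pi> ((e ^^ k) c) = \<alpha> ^ n * s" using \<pi>_iter[OF c(1)] c(2) k by (simp add: power_add)
      ultimately show ?thesis using iter_in[OF c(1)] by (auto simp: C_def)
    qed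
    then show "\<Inter>(C ` {N..}) \<noteq> {}" by blast
  qed
  moreover have "\<Union>(C ` {N..}) = {x \<in> topspace limT. lim_\<pi> x = s}"
  proof
    show "\<Union>(C ` {N..}) \<subseteq> {x \<in> topspace limT. lim_\<pi> x = s}"
      using \<alpha>(1) lim_pt_in by (auto simp: C_def lim_\<pi>)
    show "{x \<in> topspace limT. lim_\<pi> x = s} \<subseteq> \<Union>(C ` {N..})"
    proof clarify
      fix x assume x: "x \<in> topspace limT" "s = lim_\<pi> x"
      obtain n c where c: "c \<in> topspace T" "x = lim_pt n c" using limWE[OF x(1)] by blast
      have "x = lim_pt (n + N) ((e ^^ N) c)" using lim_pt_shift[OF c(1)] c(2) by simp
      moreover have "\<pi> ((e ^^ N) c) = \<alpha> ^ (n + N) * s"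
        using \<pi>_iter[OF c(1)] c x(2) \<alpha>(1) by (simp add: lim_\<pi> power_add)
      ultimately have "x \<in> C (n + N)" using iter_in[OF c(1)] x(2) by (auto simp: C_def)
      then show "x \<in> \<Union>(C ` {N..})" using x(2) by auto
    qed
  qed
  ultimately show ?thesis by simp
qed

end

section \<open>Assembling the foliated domain over the plane\<close>

lemma open_submfd_open_mfd: "open_submfd (open_mfd UNIV) S = open_mfd S"
  by (auto simp: open_submfd_def open_mfd_def)

lemma foliated_domain_pullback:
  assumes M: "complex_manifold M" and et: "etale T p M" and "Hausdorff_space T" "second_countable T" "connected_space T"
    and Q: "open Q" and c: "continuous_map T euclidean \<pi>" and im: "\<pi> ` topspace T = Q"
    and loc: "\<And>x. x \<in> topspace T \<Longrightarrow> \<exists>N q. openin T N \<and> x \<in> N \<and> (\<forall>y\<in>N. \<pi> y = q (p y)) \<and> submersive_at M q (p x)"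
    and fib: "\<And>s. s \<in> Q \<Longrightarrow> connectedin T {x \<in> topspace T. \<pi> x = s}"
  shows "foliated_domain (pullback_mfd T p M) \<pi> (open_mfd Q)"
proof -
  have "continuous_map T (top_of_set Q) \<pi>" using c im by (auto simp: continuous_map_in_subtopology)
  then have "holo_submersion (pullback_mfd T p M) (open_mfd Q) \<pi>"
    by (intro holo_submersion_pullback[OF M et _ _ _ loc]) (simp_all add: open_mfd_def)
  then show ?thesis
    unfolding foliated_domain_def
    using complex_manifold_pullback[OF M et assms(3,4)] complex_manifold_open_mfd[OF Q] assms(5) im fib
    by (simp add: open_mfd_def)
qed

theorem theorem2:
  fixes X :: "'x csurface" and F :: "'x fol" and d :: "'x metric"
    and D :: "'x set" and m :: 'x and t :: "'x \<Rightarrow> complex" and r :: real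
    and \<alpha> :: complex and a :: "('x \<Rightarrow> 'x) set"
    and P :: "(real \<Rightarrow> 'x) set csurface"
  assumes "complex_manifold X" and "compact_space (mtop X)" and "foliation X F"
    and "mtopology_of d = mtop X"
    and "poincare_disc X F D" and "m \<in> D"
    and "disc_coordinate X D m r t"
    and "a \<in> holonomy_group X F D m" and "hyperbolic_germ D t m a"
    and "0 < cmod \<alpha>" and "cmod \<alpha> < 1"
    and "linear_in_coordinate X F D m t \<alpha> a"
    and "P = poincare_domain X F d D"
    and "Hausdorff_space (mtop P)"
    and "rothstein P class_start"
  shows "\<exists>(W :: ((real \<Rightarrow> 'x) set \<times> nat) set csurface) \<pi> p \<iota> \<alpha>'.
     foliated_domain W \<pi> (open_mfd UNIV) \<and>
     foliated_subdomain P (t \<circ> class_start) (ball 0 r) W \<pi> (open_mfd UNIV) \<iota> \<and>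
     locally_biholomorphic W X p \<and> (\<forall>x\<in>topspace (mtop P). p (\<iota> x) = class_end x) \<and>
     biholomorphism W W \<alpha>' \<and>
     (\<forall>x\<in>topspace (mtop W). \<pi> (\<alpha>' x) = \<alpha> * \<pi> x \<and> p (\<alpha>' x) = p x)"
proof -
  obtain h \<gamma>\<^sub>0 where h: "holonomy_along X F D m \<gamma>\<^sub>0 D h" "\<And>z. z \<in> D \<Longrightarrow> t (h z) = \<alpha> * t z"
    using assms(12) unfolding linear_in_coordinate_def by blast
  interpret holonomy_disc X F d D m t r \<alpha> h \<gamma>\<^sub>0
    by unfold_locales (use assms h in auto)
  have P: "P = pullback_mfd classT class_end X" using assms(13) by (simp add: poincare_domain_def)
  have H: "Hausdorff_space classT" using assms(14) by (simp add: P)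
  let ?\<pi> = "t \<circ> class_start"
  have \<pi>c: "continuous_map classT euclidean ?\<pi>"
    using continuous_map_compose[OF class_start_continuous coordinate_continuous] continuous_map_into_fulltopology by blast
  have startD: "class_start c \<in> D" if "c \<in> topspace classT" for c
    using that class_ends(1) pathsD(2) topspace_classT by auto
  have im: "?\<pi> ` topspace classT = ball 0 r"
  proof
    show "?\<pi> ` topspace classT \<subseteq> ball 0 r" using startD disc_coordinateD(6) by auto
    show "ball 0 r \<subseteq> ?\<pi> ` topspace classT"
    proof
      fix s :: complex assume s: "s \<in> ball 0 r"
      let ?z = "inv_into D t s"
      have z: "?z \<in> D" "t ?z = s" using disc_coordinateD(7)[OF s] by auto
      have "s = ?\<pi> (cls (const_path ?z))"
        using class_ends(1)[OF const_path_in[OF z(1)]] z(2) by (simp add: const_path_def)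
      moreover have "cls (const_path ?z) \<in> topspace classT" using const_path_in[OF z(1)] topspace_classT by blast
      ultimately show "s \<in> ?\<pi> ` topspace classT" by (rule image_eqI)
    qed
  qed
  have fib: "connectedin classT {c \<in> topspace classT. ?\<pi> c = s}" if s: "s \<in> ball 0 r" for s
  proof -
    have z: "inv_into D t s \<in> D" "t (inv_into D t s) = s" using disc_coordinateD(7)[OF s] by auto
    have "t (class_start c) = s \<longleftrightarrow> class_start c = inv_into D t s" if "c \<in> topspace classT" for c
      using disc_coordinateD(6)[OF startD[OF that]] z(2) by auto
    then have "{c \<in> topspace classT. ?\<pi> c = s} = {c \<in> topspace classT. class_start c = inv_into D t s}" by auto
    then show ?thesis using fiber_connected[OF z(1)] by simp
  qed
  \<comment> \<open>The limit is taken along the lifted holonomy; the multiplier of the start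
    coordinate is the linearized holonomy, and r is the radius of the coordinate disc.\<close>
  interpret L: foliated_telescope X classT class_end lift_class ?\<pi> \<alpha> r
  proof unfold_locales
    show "\<alpha> \<noteq> 0" "cmod \<alpha> < 1" "r > 0" using assms(11) \<alpha>0 disc_coordinateD(1) by auto
  qed (use X etale_class_end H second_countable_classT lift_class \<pi>c class_start_submersive im fib in auto)
  define W where "W = pullback_mfd L.limT L.lim_p X"
  have W: "mtop W = L.limT" by (simp add: W_def)
  obtain c\<^sub>0 where c\<^sub>0: "c\<^sub>0 \<in> topspace classT" using im disc_coordinateD(1) by (metis centre_in_ball imageE)
  have fW: "foliated_domain W L.lim_\<pi> (open_mfd UNIV)"
    unfolding W_def
    by (rule foliated_domain_pullback[OF X L.etale_lim L.Hausdorff_limT L.second_countable_limT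
          L.connected_limT[OF connected_classT c\<^sub>0] open_UNIV L.lim_\<pi>_continuous L.lim_\<pi>_surj
          L.lim_\<pi>_submersive L.lim_\<pi>_fiber])
  have fP: "foliated_domain P ?\<pi> (open_mfd (ball 0 r))"
    unfolding P
    by (rule foliated_domain_pullback[OF X etale_class_end H second_countable_classT connected_classT
          open_ball \<pi>c im class_start_submersive fib])
  \<comment> \<open>Stage 0 is the original domain; there the power of \<alpha> is 1, so both
    projections of the limit restrict to the given ones.\<close>
  let ?S = "L.lim_pt 0 ` topspace classT"
  have S: "openin L.limT ?S" by (rule L.lim_pt_open[OF openin_topspace])
  have \<iota>: "biholomorphism P (open_submfd W ?S) (L.lim_pt 0)"
    unfolding P W_def
    by (rule biholomorphism_over[OF X etale_class_end etale_subtopology[OF L.etale_lim S] L.lim_pt_homeomorphic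
          _ _ _ _ charts_open_submfd_pullback[OF L.etale_lim S]])
      (auto simp: L.lim_p open_submfd_def)
  have sub: "foliated_subdomain P ?\<pi> (ball 0 r) W L.lim_\<pi> (open_mfd UNIV) (L.lim_pt 0)"
    unfolding foliated_subdomain_def open_submfd_open_mfd
    using fP fW \<iota> S by (simp add: W P open_mfd_def L.lim_\<pi>)
  have "locally_biholomorphic W X L.lim_p"
    unfolding W_def by (rule locally_biholomorphic_pullback[OF X L.etale_lim])
  moreover have "biholomorphism W W L.lim_e"
    unfolding W_def
    by (rule biholomorphism_over[OF X L.etale_lim L.etale_lim L.lim_e_homeomorphic L.lim_p_lim_e]) auto
  ultimately show ?thesis
    using fW sub
    by (intro exI[of _ W] exI[of _ L.lim_\<pi>] exI[of _ L.lim_p] exI[of _ "L.lim_pt 0"] exI[of _ L.lim_e])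
      (simp add: W P L.lim_p L.lim_p_lim_e L.lim_\<pi>_lim_e)
qed

end
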